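(* Let $n\ge 2$ be an integer, let $1<p<q<p^*$, where $p^*=\frac{np}{n-p}$ if $p<n$ and $p^*=\infty$ if $p\ge n$, and let $a>p-n$. Let $p'=\frac{p}{p-1}$ be the conjugate exponent to $p$. If $$\frac{1}{n-1}\left(\frac{n-p+a}{p}\right)^2>\frac{1}{q-p}-\frac{1}{q+p'},$$ then no minimizer for $S_p(a,q)$ is radial. That is, there is no radially symmetric function $u\in\mathcal D^{1,p}(\mathbb R^n;|x|^a dx)\setminus\{0\}$ such that $$\int_{\mathbb R^n}|x|^a|\nabla u|^p\,dx = S_p(a,q)\left(\int_{\mathbb R^n}|x|^{-b_a}|u|^q\,dx\right)^{p/q}.$$
   Context: For $a>p-n$ set $b_a=n-q\,\frac{n-p+a}{p}$. The space $\mathcal D^{1,p}(\mathbb R^n;|x|^a dx)$ consists of the real-valued functions (up to a.e. equality) $u\in L^p(\mathbb R^n;|x|^{a-p}dx)$ with $\int_{\mathbb R^n}|x|^a|\nabla u|^p\,dx<\infty$, where $\nabla u$ is the weak gradient on $\mathbb R^n\setminus\{0\}$. The best constant in the Caffarelli-Kohn-Nirenberg inequality is $$S_p(a,q)=\inf_{u\in\mathcal D^{1,p}(\mathbb R^n;|x|^a dx),\ u\ne 0}\frac{\int_{\mathbb R^n}|x|^a|\nabla u|^p\,dx}{\left(\int_{\mathbb R^n}|x|^{-b_a}|u|^q\,dx\right)^{p/q}}.$$ A minimizer (extremal) for $S_p(a,q)$ is a function $u\in\mathcal D^{1,p}(\mathbb R^n;|x|^a dx)\setminus\{0\}$ attaining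 this infimum. A function is radial (radially symmetric) if it coincides a.e. with a function of $|x|$ only. *)

theory Defs
  imports "HOL-Analysis.Analysis"
begin

text \<open>
  The ambient space is \<open>real ^ 'n\<close>, of dimension \<open>CARD('n)\<close>. Elements of Lebesgue and Sobolev spaces
  are represented by functions, so that \<open>u \<noteq> 0\<close> means that \<open>u\<close> is not almost everywhere zero. The
  weights \<open>norm x powr a\<close> take the value 0 at the origin, for every \<open>a\<close>; this is a null set.
\<close>

definition partial_deriv :: "'n::finite \<Rightarrow> (real ^ 'n \<Rightarrow> real) \<Rightarrow> real ^ 'n \<Rightarrow> real" where
  "partial_deriv i f x = frechet_derivative f (at x) (axis i 1)"

primrec k_times_cont_diff :: "nat \<Rightarrow> (real ^ 'n::finite \<Rightarrow> real) \<Rightarrow> bool" where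
  "k_times_cont_diff 0 f \<longleftrightarrow> continuous_on UNIV f"
| "k_times_cont_diff (Suc k) f \<longleftrightarrow>
     (\<forall>x. f differentiable (at x)) \<and> (\<forall>i. k_times_cont_diff k (partial_deriv i f))"

text \<open>
  Smooth functions with compact support in the complement of the origin, extended by zero.
\<close>
definition test_fun :: "(real ^ 'n::finite \<Rightarrow> real) \<Rightarrow> bool" where
  "test_fun \<phi> \<longleftrightarrow> (\<forall>k. k_times_cont_diff k \<phi>) \<and>
     compact (closure {x. \<phi> x \<noteq> 0}) \<and> 0 \<notin> closure {x. \<phi> x \<noteq> 0}"

definition loc_integrable_off_0 ::
    "(real ^ 'n::finite \<Rightarrow> 'b::euclidean_space) \<Rightarrow> bool" where
  "loc_integrable_off_0 f \<longleftrightarrow> (\<forall>K. compact K \<and> 0 \<notin> K \<longrightarrow> f absolutely_integrable_on K)"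

definition has_weak_gradient ::
    "(real ^ 'n::finite \<Rightarrow> real) \<Rightarrow> (real ^ 'n \<Rightarrow> real ^ 'n) \<Rightarrow> bool" where
  "has_weak_gradient u v \<longleftrightarrow> loc_integrable_off_0 u \<and> loc_integrable_off_0 v \<and>
     (\<forall>\<phi> i. test_fun \<phi> \<longrightarrow>
        (LINT x|lebesgue. u x * partial_deriv i \<phi> x) = - (LINT x|lebesgue. v x $ i * \<phi> x))"

text \<open>
  A weak gradient is unique up to almost everywhere equality, so the choice of the
  representative is irrelevant for the integrals below.
\<close>
definition weak_gradient :: "(real ^ 'n::finite \<Rightarrow> real) \<Rightarrow> real ^ 'n \<Rightarrow> real ^ 'n" where
  "weak_gradient u = (SOME v. has_weak_gradient u v)"

definition D1p :: "real \<Rightarrow> real \<Rightarrow> (real ^ 'n::finite \<Rightarrow> real) set" where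
  "D1p p a = {u. u \<in> borel_measurable lebesgue \<and>
     integrable lebesgue (\<lambda>x. norm x powr (a - p) * \<bar>u x\<bar> powr p) \<and>
     (\<exists>v. has_weak_gradient u v) \<and>
     integrable lebesgue (\<lambda>x. norm x powr a * norm (weak_gradient u x) powr p)}"

definition ae_zero :: "(real ^ 'n::finite \<Rightarrow> real) \<Rightarrow> bool" where
  "ae_zero u \<longleftrightarrow> (AE x in lebesgue. u x = 0)"

definition grad_energy :: "real \<Rightarrow> real \<Rightarrow> (real ^ 'n::finite \<Rightarrow> real) \<Rightarrow> real" where
  "grad_energy p a u = (LINT x|lebesgue. norm x powr a * norm (weak_gradient u x) powr p)"

definition b_exponent :: "real \<Rightarrow> real \<Rightarrow> real \<Rightarrow> real \<Rightarrow> real" where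
  "b_exponent n p a q = n - q * ((n - p + a) / p)"

definition q_integral :: "real \<Rightarrow> real \<Rightarrow> real \<Rightarrow> (real ^ 'n::finite \<Rightarrow> real) \<Rightarrow> real" where
  "q_integral p a q u =
     (LINT x|lebesgue. norm x powr (- b_exponent (real CARD('n)) p a q) * \<bar>u x\<bar> powr q)"

text \<open>
  For the exponents considered, the Caffarelli-Kohn-Nirenberg inequality makes \<open>q_integral p a q u\<close>
  the integral of an integrable function for every \<open>u\<close> in \<open>D1p p a\<close>. If that integral were infinite,
  the Bochner integral and hence the quotient below would be 0, in accordance with the
  convention \<open>t / \<infinity> = 0\<close>. The type argument carries the dimension.
\<close>
definition CKN_const :: "'n::finite itself \<Rightarrow> real \<Rightarrow> real \<Rightarrow> real \<Rightarrow> real" where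
  "CKN_const _ p a q =
     (INF u \<in> {u :: real ^ 'n \<Rightarrow> real. u \<in> D1p p a \<and> \<not> ae_zero u}.
        grad_energy p a u / q_integral p a q u powr (p / q))"

definition CKN_minimizer :: "real \<Rightarrow> real \<Rightarrow> real \<Rightarrow> (real ^ 'n::finite \<Rightarrow> real) \<Rightarrow> bool" where
  "CKN_minimizer p a q u \<longleftrightarrow> u \<in> D1p p a \<and> \<not> ae_zero u \<and>
     grad_energy p a u = CKN_const TYPE('n) p a q * q_integral p a q u powr (p / q)"

definition radial :: "(real ^ 'n::finite \<Rightarrow> real) \<Rightarrow> bool" where
  "radial u \<longleftrightarrow> (\<exists>f. AE x in lebesgue. u x = f (norm x))"

definition critical_exponent :: "real \<Rightarrow> real \<Rightarrow> ereal" where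
  "critical_exponent n p = (if p < n then ereal (n * p / (n - p)) else \<infinity>)"

end

theory Submission
  imports Defs "HOL-Real_Asymp.Real_Asymp"
begin

text \<open>
  Put \<open>g = (n - p + a) / p\<close>, \<open>s = ln |x|\<close> and \<open>u = |x| powr (- g) * W\<close>. For radial \<open>u\<close> the quotient becomes
  the one-dimensional quotient of \<open>\<integral> |W' - g W| powr p ds\<close> and \<open>(\<integral> |W| powr q ds) powr (p / q)\<close>, which
  is minimized by an explicit profile \<open>w\<close> (Bliss): transport the mass \<open>|W| powr q ds\<close> to \<open>w powr q ds\<close>,
  apply Young's inequality to \<open>|W' - g W| powr p\<close> with the momentum of \<open>w\<close> at the transported point,
  integrate by parts, and minimize the remaining integrand pointwise. The explicit profile is
  unstable: perturb it to \<open>w (1 + \<epsilon> \<mu> x\<^sub>i / |x|)\<close>, where \<open>w \<mu>\<close> is a cut-off of the ground state of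
  the second variation, which is also explicit. The second variation is negative exactly under the
  assumed inequality, so \<open>S\<^sub>p(a, q)\<close> is strictly smaller than the quotient of every radial function.
\<close>

section \<open>Test functions\<close>

text \<open>The lower bound for radial functions, \<open>(c * Q0) powr (1 - p / q)\<close> with
  \<open>c\<close> the area of the unit sphere, holds for all of them at once, so radial minimizers
  need not be classified. The obstacle is regularity: \<open>u\<close> has only a weak gradient,
  about whose direction and symmetry nothing is known at first. Therefore \<open>W'\<close> is
  replaced by a function \<open>K\<close> on the whole space whose means over spheres are the
  derivative of \<open>W\<close>, and the axis variable \<open>ln |x|\<close> is reached through the
  image of a measure. The number \<open>n - 1\<close> arises from
  \<open>y = x\<^sub>i / |x|\<close>: over a sphere \<open>y\<^sup>2\<close> has mean
  \<open>1 / n\<close> and \<open>1 - y\<^sup>2\<close> has mean \<open>(n - 1) / n\<close>, so the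
  angular part of the second variation has weight \<open>n - 1\<close> relative to the radial part.
  It competes with \<open>threshold\<close>, which equals
  \<open>g\<^sup>2 (q - p) (q + p') / (p + p')\<close>; this is the assumed inequality. The ground
  state has to be cut off because its quotient by \<open>t = (g w - w') / w\<close> is unbounded at
  minus infinity. With compact support all Taylor expansions in \<epsilon> are uniform in
  \<open>s\<close>.\<close>

definition flat_exp :: "nat \<Rightarrow> real \<Rightarrow> real" where
  "flat_exp k y = (if y > 0 then (1 / y) ^ k * exp (- (1 / y)) else 0)"

lemma flat_exp_pos: "y > 0 \<Longrightarrow> flat_exp k y > 0"
  by (simp add: flat_exp_def)

text \<open>The powers of \<open>1 / y\<close> in the definition close the family under
  differentiation, so that one formula controls derivatives of every order. At \<open>y = 0\<close>
  the exponential beats every power from the right, and the function is constant on the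
  left.\<close>

lemma flat_exp_has_derivative:
  "(flat_exp k has_real_derivative (flat_exp (k + 2) y - real k * flat_exp (k + 1) y)) (at y)"
proof -
  consider "y > 0" | "y < 0" | "y = 0" by linarith
  then show ?thesis
  proof cases
    case 1
    have "((\<lambda>y. (1 / y) ^ k * exp (- (1 / y))) has_real_derivative
      (flat_exp (k + 2) y - real k * flat_exp (k + 1) y)) (at y)"
      using 1
    proof (cases k)
      case (Suc j)
      have "real k * ((1 / y) ^ (k - 1) * (- 1 / y\<^sup>2)) * exp (- (1 / y)) + (1 / y) ^ k * (exp (- (1 / y)) * (1 / y\<^sup>2))
        = flat_exp (k + 2) y - real k * flat_exp (k + 1) y"
        using 1 by (simp add: flat_exp_def Suc power2_eq_square algebra_simps)
      moreover have "((\<lambda>y. 1 / y) has_real_derivative - 1 / y\<^sup>2) (at y)"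
        using 1 by (auto intro!: derivative_eq_intros simp: power2_eq_square)
      ultimately show ?thesis
        by (intro DERIV_cong[OF DERIV_mult[OF DERIV_power[of "\<lambda>y. 1 / y"] DERIV_fun_exp[OF DERIV_minus]]])
          (auto simp: mult_ac)
    qed (auto intro!: derivative_eq_intros simp: flat_exp_def field_simps power2_eq_square)
    then show ?thesis
      by (rule has_field_derivative_transform_within_open[where S = "{0<..}"])
        (use 1 in \<open>auto simp: flat_exp_def\<close>)
  next
    case 2
    have "((\<lambda>y. 0) has_real_derivative 0) (at y)" by simp
    then have "(flat_exp k has_real_derivative 0) (at y)"
      by (rule has_field_derivative_transform_within_open[where S = "{..<0}"])
        (use 2 in \<open>auto simp: flat_exp_def\<close>)
    then show ?thesis using 2 by (simp add: flat_exp_def)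
  next
    case 3
    have "((\<lambda>h::real. (1 / h) ^ k * exp (- (1 / h)) / h) \<longlongrightarrow> 0) (at_right 0)"
      by real_asymp
    then have r: "((\<lambda>h. flat_exp k h / h) \<longlongrightarrow> 0) (at_right 0)"
      by (rule Lim_transform_eventually) (auto simp: flat_exp_def eventually_at_filter)
    have l: "((\<lambda>h. flat_exp k h / h) \<longlongrightarrow> 0) (at_left 0)"
      by (rule Lim_transform_eventually[OF tendsto_const])
        (auto simp: flat_exp_def eventually_at_filter)
    have "((\<lambda>h. flat_exp k h / h) \<longlongrightarrow> 0) (at 0)"
      using l r by (simp add: filterlim_split_at)
    then show ?thesis using 3
      by (simp add: DERIV_def flat_exp_def)
  qed
qed

text \<open>
  The class is closed under partial derivatives, so smoothness of its members needs no Leibniz or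
  chain rule for higher derivatives.
\<close>

inductive smooth_class :: "(real ^ 'n::finite \<Rightarrow> real) \<Rightarrow> bool" where
  smooth_linear: "bounded_linear f \<Longrightarrow> smooth_class f"
| smooth_const: "smooth_class (\<lambda>x. c)"
| smooth_add: "smooth_class f \<Longrightarrow> smooth_class g \<Longrightarrow> smooth_class (\<lambda>x. f x + g x)"
| smooth_mult: "smooth_class f \<Longrightarrow> smooth_class g \<Longrightarrow> smooth_class (\<lambda>x. f x * g x)"
| smooth_flat: "smooth_class (\<lambda>x. flat_exp k (c + d * (x \<bullet> x)))"

text \<open>Differentiability and the return of all directional derivatives to the class are proved
  together, so that an induction on the order gives smoothness of every order. Fixed directions
  \<open>e\<close> suffice, since partial derivatives are the values of \<open>D x\<close> at basis
  vectors.\<close>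

lemma smooth_class_step:
  assumes "smooth_class f"
  shows "\<exists>D. (\<forall>x. (f has_derivative D x) (at x)) \<and> (\<forall>e. smooth_class (\<lambda>x. D x e))"
  using assms
proof induction
  case (smooth_linear f)
  then show ?case
    by (intro exI[of _ "\<lambda>x. f"]) (auto intro: bounded_linear_imp_has_derivative smooth_class.intros)
next
  case (smooth_const c)
  then show ?case
    by (intro exI[of _ "\<lambda>x h. 0"]) (auto intro: smooth_class.intros)
next
  case (smooth_add f g)
  then obtain D1 D2 where "\<forall>x. (f has_derivative D1 x) (at x)" "\<forall>e. smooth_class (\<lambda>x. D1 x e)"
    "\<forall>x. (g has_derivative D2 x) (at x)" "\<forall>e. smooth_class (\<lambda>x. D2 x e)" by blast
  then show ?case
    by (intro exI[of _ "\<lambda>x h. D1 x h + D2 x h"])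
      (auto intro!: derivative_eq_intros intro: smooth_class.intros)
next
  case (smooth_mult f g)
  then obtain D1 D2 where D: "\<forall>x. (f has_derivative D1 x) (at x)" "\<forall>e. smooth_class (\<lambda>x. D1 x e)"
    "\<forall>x. (g has_derivative D2 x) (at x)" "\<forall>e. smooth_class (\<lambda>x. D2 x e)" by blast
  have "((\<lambda>x. f x * g x) has_derivative (\<lambda>h. f x * D2 x h + D1 x h * g x)) (at x)" for x
    using D by (intro has_derivative_mult) auto
  with D smooth_mult.hyps show ?case
    by (intro exI[of _ "\<lambda>x h. f x * D2 x h + D1 x h * g x"] conjI allI smooth_class.smooth_add
        smooth_class.smooth_mult) auto
next
  case (smooth_flat k c d)
  let ?D = "\<lambda>x h. (flat_exp (k + 2) (c + d * (x \<bullet> x)) + (- real k) * flat_exp (k + 1) (c + d * (x \<bullet> x)))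
     * ((2 * d) * (x \<bullet> h))"
  have "((\<lambda>x. flat_exp k (c + d * (x \<bullet> x))) has_derivative ?D x) (at x)" for x
  proof -
    have 1: "((\<lambda>x. c + d * (x \<bullet> x)) has_derivative (\<lambda>h. (2 * d) * (x \<bullet> h))) (at x)"
      by (auto intro!: derivative_eq_intros simp: inner_commute algebra_simps)
    have 2: "(flat_exp k has_derivative
      (\<lambda>h. (flat_exp (k + 2) (c + d * (x \<bullet> x)) + (- real k) * flat_exp (k + 1) (c + d * (x \<bullet> x))) * h))
      (at (c + d * (x \<bullet> x)))"
      using flat_exp_has_derivative[of k "c + d * (x \<bullet> x)"]
      by (simp add: has_field_derivative_def)
    show ?thesis using has_derivative_compose[OF 1 2] by simp
  qed
  moreover have "smooth_class (\<lambda>x. ?D x e)" for e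
    by (intro smooth_class.smooth_mult smooth_class.smooth_add smooth_class.smooth_const
      smooth_class.smooth_flat smooth_class.smooth_linear bounded_linear_inner_left)
  ultimately show ?case by (intro exI[of _ ?D]) blast
qed

lemma smooth_class_differentiable: "smooth_class f \<Longrightarrow> f differentiable (at x)"
  using smooth_class_step[of f] unfolding differentiable_def by blast

lemma smooth_class_partial:
  assumes "smooth_class f" shows "smooth_class (partial_deriv i f)"
proof -
  obtain D where "\<forall>x. (f has_derivative D x) (at x)" and D: "\<forall>e. smooth_class (\<lambda>x. D x e)"
    using smooth_class_step[OF assms] by blast
  then have "partial_deriv i f = (\<lambda>x. D x (axis i 1))"
    by (metis partial_deriv_def frechet_derivative_at ext)
  with D show ?thesis by simp
qed

lemma smooth_class_k_times: "smooth_class f \<Longrightarrow> k_times_cont_diff k f"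
proof (induction k arbitrary: f)
  case 0
  then show ?case
    by (auto intro!: continuous_at_imp_continuous_on differentiable_imp_continuous_within
        smooth_class_differentiable)
next
  case (Suc k)
  then show ?case by (auto intro: smooth_class_partial smooth_class_differentiable)
qed

section \<open>Polynomials cut off to annuli around the origin\<close>

definition annulus :: "real \<Rightarrow> real \<Rightarrow> 'a::euclidean_space set" where
  "annulus A B = {x. A \<le> norm x \<and> norm x \<le> B}"

lemma compact_annulus: "compact (annulus A B)"
proof -
  have "annulus A B = cball 0 B \<inter> - ball 0 A"
    by (auto simp: annulus_def)
  then show ?thesis
    by (metis closed_Compl compact_Int_closed compact_cball open_ball)
qed

lemma zero_notin_annulus: "0 < A \<Longrightarrow> 0 \<notin> annulus A B"
  by (simp add: annulus_def)

text \<open>Written with \<open>x \<bullet> x\<close> instead of the norm, so that it belongs to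
  \<open>smooth_class\<close> and is a function of \<open>x \<bullet> x\<close> alone; the radial
  test fields use the second fact through \<open>flat_bump\<close>.\<close>

definition bump :: "real \<Rightarrow> real \<Rightarrow> 'a::euclidean_space \<Rightarrow> real" where
  "bump A B x = flat_exp 0 (x \<bullet> x - A\<^sup>2) * flat_exp 0 (B\<^sup>2 - x \<bullet> x)"

lemma bump_eq_0: "0 \<le> A \<Longrightarrow> 0 \<le> B \<Longrightarrow> x \<notin> annulus A B \<Longrightarrow> bump A B x = 0"
  by (auto simp: bump_def flat_exp_def annulus_def power2_norm_eq_inner[symmetric]
      dest!: power2_less_imp_less)

lemma bump_pos: "0 \<le> A \<Longrightarrow> A < norm x \<Longrightarrow> norm x < B \<Longrightarrow> bump A B x > 0"
  unfolding bump_def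
  by (intro mult_pos_pos flat_exp_pos)
    (simp_all add: power2_norm_eq_inner[symmetric] power_strict_mono)

lemma smooth_bump: "smooth_class (bump A B)"
proof -
  have eq: "bump A B = (\<lambda>x::real^'n. flat_exp 0 (- (A\<^sup>2) + 1 * (x \<bullet> x)) * flat_exp 0 (B\<^sup>2 + (- 1) * (x \<bullet> x)))"
    by (auto simp: bump_def fun_eq_iff)
  show ?thesis unfolding eq by (intro smooth_class.smooth_mult smooth_class.smooth_flat)
qed

lemma smooth_real_polynomial: "real_polynomial_function P \<Longrightarrow> smooth_class P"
  by (induction rule: real_polynomial_function.induct) (auto intro: smooth_class.intros)

lemma real_polynomial_inner_self: "real_polynomial_function (\<lambda>x::real^'n::finite. x \<bullet> x)"
proof -
  have eq: "(\<lambda>x::real^'n. x \<bullet> x) = (\<lambda>x. \<Sum>i\<in>UNIV. x $ i * x $ i)"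
    by (simp add: inner_vec_def)
  show ?thesis unfolding eq
    by (intro real_polynomial_function_sum real_polynomial_function.intros(4)
      real_polynomial_function.intros(1) bounded_linear_vec_nth) auto
qed

text \<open>These are the test functions from which all information about a given weak gradient is
  extracted: on an annulus polynomials are dense in the continuous functions.\<close>

lemma test_fun_bump:
  assumes "0 < A" "0 < B" "real_polynomial_function P"
  shows "test_fun (\<lambda>x::real^'n::finite. P x * bump A B x)"
proof -
  let ?f = "\<lambda>x::real^'n. P x * bump A B x"
  have sub: "closure {x. ?f x \<noteq> 0} \<subseteq> annulus A B"
  proof (rule closure_minimal)
    show "{x. ?f x \<noteq> 0} \<subseteq> annulus A B" using bump_eq_0[of A B] assms by force
    show "closed (annulus A B :: (real^'n) set)" by (simp add: compact_annulus compact_imp_closed)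
  qed
  have "smooth_class ?f"
    using assms by (intro smooth_class.smooth_mult smooth_real_polynomial smooth_bump)
  moreover have "compact (annulus A B \<inter> closure {x. ?f x \<noteq> 0})"
    by (intro compact_Int_closed compact_annulus closed_closure)
  then have "compact (closure {x. ?f x \<noteq> 0})"
    using sub by (simp only: Int_absorb1)
  ultimately show ?thesis
    using sub zero_notin_annulus[OF \<open>0 < A\<close>, of B]
    unfolding test_fun_def
    by (intro conjI allI smooth_class_k_times) (assumption | blast)+
qed

section \<open>Weak gradients\<close>

text \<open>
  The function \<open>f\<close> need not be measurable. Compact sets \<open>K\<close> inside \<open>{x. f (\<pi> x) > 0}\<close> may be replaced by
  \<open>\<pi> -` \<pi> ` K\<close>, whose indicator is a limit of functions \<open>\<eta> \<circ> \<pi>\<close>. Both \<open>\<pi> = id\<close> and \<open>\<pi> = norm\<close> are needed.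
\<close>

lemma AE_nonpos_if_orthogonal:
  fixes z :: "'a::euclidean_space \<Rightarrow> real" and \<pi> :: "'a \<Rightarrow> 'b::metric_space"
  assumes int: "integrable lebesgue z" and cont: "continuous_on UNIV \<pi>"
    and z: "AE x in lebesgue. z x = f (\<pi> x)"
    and orth: "\<And>\<eta>. continuous_on UNIV \<eta> \<Longrightarrow> (\<And>y. 0 \<le> \<eta> y \<and> \<eta> y \<le> 1) \<Longrightarrow>
      (LINT x|lebesgue. z x * \<eta> (\<pi> x)) = 0"
  shows "AE x in lebesgue. z x \<le> 0"
proof -
  define Z where "Z = {x. f (\<pi> x) > 0}"
  have zm[measurable]: "z \<in> borel_measurable lebesgue" using int by auto
  have \<pi>m[measurable]: "\<pi> \<in> borel_measurable lebesgue"
    using borel_measurable_continuous_onI[OF cont] by (simp add: measurable_completion)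
  \<comment> \<open>\<open>Z\<close> is defined through the arbitrary function \<open>f\<close>. It
    agrees almost everywhere with the measurable set where \<open>z\<close> is positive, and
    Lebesgue measure is complete.\<close>
  have Zm: "Z \<in> sets lebesgue"
  proof -
    have "{x\<in>space lebesgue. 0 < z x} \<in> sets lebesgue" by measurable
    then have "Measurable.pred lebesgue (\<lambda>x. z x > 0)" by measurable
    moreover have "AE x in lebesgue. (x \<in> {x. z x > 0}) = (x \<in> Z)"
      using z by eventually_elim (auto simp: Z_def)
    moreover have "{x. z x > 0} \<in> sets lebesgue"
      using \<open>{x\<in>space lebesgue. 0 < z x} \<in> sets lebesgue\<close> by simp
    ultimately show ?thesis
      using completion.in_sets_AE[of "{x. z x > 0}" Z lborel] by auto
  qed
  have null: "K \<in> null_sets lebesgue" if K: "compact K" "K \<subseteq> Z" for K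
  proof (cases "K = {}")
    case False
    define L where "L = \<pi> -` (\<pi> ` K)"
    have cK: "closed (\<pi> ` K)"
      using compact_continuous_image[OF continuous_on_subset[OF cont] K(1)] compact_imp_closed by blast
    have Lm[measurable]: "L \<in> sets lebesgue"
      unfolding L_def using closed_vimage[OF cK cont] by (simp add: borel_closed)
    define \<eta> where "\<eta> k y = max 0 (1 - real k * infdist y (\<pi> ` K))" for k y
    have \<eta>: "continuous_on UNIV (\<eta> k)" "0 \<le> \<eta> k y \<and> \<eta> k y \<le> 1" for k y
      unfolding \<eta>_def by (auto intro!: continuous_intros simp: infdist_nonneg)
    have [measurable]: "(\<lambda>x. \<eta> k (\<pi> x)) \<in> borel_measurable lebesgue" for k
      using measurable_compose[OF \<pi>m borel_measurable_continuous_onI[OF \<eta>(1)]] .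
    have lim: "(\<lambda>k. z x * \<eta> k (\<pi> x)) \<longlonglongrightarrow> z x * indicator L x" for x
    proof (cases "x \<in> L")
      case True
      then have "infdist (\<pi> x) (\<pi> ` K) = 0" by (auto simp: L_def)
      then show ?thesis using True by (simp add: \<eta>_def)
    next
      case F: False
      then have d: "infdist (\<pi> x) (\<pi> ` K) > 0"
        using in_closed_iff_infdist_zero[OF cK, of "\<pi> x"] False infdist_nonneg[of "\<pi> x" "\<pi> ` K"]
        by (auto simp: L_def less_le)
      obtain N :: nat where N: "real N * infdist (\<pi> x) (\<pi> ` K) > 1"
        using d reals_Archimedean3 by blast
      have "\<eta> k (\<pi> x) = 0" if "k \<ge> N" for k
      proof -
        have "real k * infdist (\<pi> x) (\<pi> ` K) \<ge> real N * infdist (\<pi> x) (\<pi> ` K)"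
          using that d by (intro mult_right_mono) auto
        with N show ?thesis by (simp add: \<eta>_def)
      qed
      then have "\<forall>\<^sub>F k in sequentially. z x * \<eta> k (\<pi> x) = z x * indicator L x"
        using F by (auto simp: eventually_sequentially)
      then show ?thesis by (simp add: tendsto_eventually)
    qed
    have "(\<lambda>k. LINT x|lebesgue. z x * \<eta> k (\<pi> x)) \<longlonglongrightarrow> (LINT x|lebesgue. z x * indicator L x)"
    proof (rule integral_dominated_convergence[where w = "\<lambda>x. \<bar>z x\<bar>"])
      show "AE x in lebesgue. norm (z x * \<eta> k (\<pi> x)) \<le> \<bar>z x\<bar>" for k
        using \<eta>(2)[of k] by (auto simp: abs_mult intro!: mult_left_le)
    qed (use int lim in auto)
    then have 0: "(LINT x|lebesgue. z x * indicator L x) = 0"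
      using orth[OF \<eta>] by (simp add: LIMSEQ_const_iff)
    \<comment> \<open>On \<open>L\<close> the value of \<pi> is also attained at a point of
      \<open>K\<close>, hence lies where \<open>f\<close> is positive; here the representation of
      \<open>z\<close> through \<pi> enters.\<close>
    have pos: "AE x in lebesgue. x \<in> L \<longrightarrow> z x > 0"
      using z by eventually_elim (use K(2) in \<open>auto simp: L_def Z_def\<close>)
    have "integrable lebesgue (\<lambda>x. z x * indicator L x)"
      using integrable_mult_indicator[OF Lm int] by (simp add: mult.commute)
    then have "AE x in lebesgue. z x * indicator L x = 0"
      using 0 pos by (subst (asm) integral_nonneg_eq_0_iff_AE)
        (auto simp: indicator_def intro!: eventually_mono[OF pos])
    with pos have "AE x in lebesgue. x \<notin> L" by eventually_elim (auto simp: indicator_def)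
    then have "AE x in lebesgue. x \<notin> K" by eventually_elim (auto simp: L_def)
    moreover have "K \<in> sets lebesgue" using K(1) by (simp add: borel_compact)
    ultimately show ?thesis by (simp add: AE_iff_null_sets)
  qed simp
  \<comment> \<open>Up to a null set \<open>Z\<close> is a countable union of compact sets, so the
    case of a compact \<open>K\<close> suffices.\<close>
  obtain C T where C: "fsigma C" "T \<in> null_sets lebesgue" "C \<union> T = Z"
    using lebesgue_set_almost_fsigma[OF Zm] by metis
  then obtain F :: "nat \<Rightarrow> 'a set" where F: "range F \<subseteq> Collect compact" "C = \<Union>(F ` UNIV)"
    using fsigma_Union_compact by metis
  have "F i \<in> null_sets lebesgue" for i
    using F C null[of "F i"] by blast
  then have "C \<in> null_sets lebesgue" unfolding F(2) by (intro null_sets_UN') auto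
  then have "Z \<in> null_sets lebesgue" using C by (metis null_sets.Un)
  then have "AE x in lebesgue. x \<notin> Z" by (simp add: AE_not_in)
  with z show ?thesis by eventually_elim (auto simp: Z_def not_less)
qed

lemma AE_zero_if_orthogonal:
  fixes z :: "'a::euclidean_space \<Rightarrow> real" and \<pi> :: "'a \<Rightarrow> 'b::metric_space"
  assumes int: "integrable lebesgue z" and cont: "continuous_on UNIV \<pi>"
    and z: "AE x in lebesgue. z x = f (\<pi> x)"
    and orth: "\<And>\<eta>. continuous_on UNIV \<eta> \<Longrightarrow> (\<And>y. 0 \<le> \<eta> y \<and> \<eta> y \<le> 1) \<Longrightarrow>
      (LINT x|lebesgue. z x * \<eta> (\<pi> x)) = 0"
  shows "AE x in lebesgue. z x = 0"
proof -
  have "AE x in lebesgue. z x \<le> 0"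
    by (rule AE_nonpos_if_orthogonal[OF assms])
  moreover have "AE x in lebesgue. - z x \<le> 0"
  proof (rule AE_nonpos_if_orthogonal[where \<pi> = \<pi> and f = "\<lambda>y. - f y"])
    show "AE x in lebesgue. - z x = - f (\<pi> x)" using z by eventually_elim simp
  qed (use int cont orth in auto)
  ultimately show ?thesis by eventually_elim simp
qed

section \<open>Integration by parts against functions of compact support\<close>

lemma integrable_continuous_compact_support:
  fixes F :: "'a::euclidean_space \<Rightarrow> real"
  assumes cont: "continuous_on UNIV F" and supp: "\<And>x. norm x > R \<Longrightarrow> F x = 0"
  shows "integrable lborel F" "integrable lebesgue F"
proof -
  have "integrable lborel (\<lambda>x. indicator (cball 0 R) x *\<^sub>R F x)"
    by (rule borel_integrable_compact[OF compact_cball continuous_on_subset[OF cont]]) auto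
  also have "(\<lambda>x. indicator (cball 0 R) x *\<^sub>R F x) = F"
    using supp by (force simp: indicator_def fun_eq_iff)
  finally show "integrable lborel F" .
  then show "integrable lebesgue F" by (simp add: integrable_completion)
qed

text \<open>By translation invariance every difference quotient of \<open>F\<close> in direction
  \<open>b\<close> has integral 0. The quotients converge to \<open>D x b\<close>; by the mean value
  theorem they are bounded on a fixed ball, and they vanish outside it, so dominated convergence
  applies.\<close>

lemma integral_directional_derivative_eq_0:
  fixes F :: "'a::euclidean_space \<Rightarrow> real"
  assumes D: "\<And>x. (F has_derivative D x) (at x)"
    and cont: "continuous_on UNIV (\<lambda>x. D x b)"
    and supp: "\<And>x. norm x > R \<Longrightarrow> F x = 0"
  shows "(LINT x|lebesgue. D x b) = 0"
proof -
  have contF: "continuous_on UNIV F"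
    using D by (meson continuous_at_imp_continuous_on has_derivative_continuous)
  then have Fm[measurable]: "F \<in> borel_measurable borel" by (rule borel_measurable_continuous_onI)
  have Dm[measurable]: "(\<lambda>x. D x b) \<in> borel_measurable borel"
    using cont by (rule borel_measurable_continuous_onI)
  define h where "h k = 1 / real (Suc k)" for k
  have h: "0 < h k" "h k \<le> 1" for k by (auto simp: h_def)
  \<comment> \<open>Beyond radius \<open>S\<close> both \<open>x\<close> and its translate by
    \<open>h k\<close> times \<open>b\<close> have norm above \<open>R\<close>, because
    \<open>h k \<le> 1\<close>.\<close>
  define S where "S = \<bar>R\<bar> + norm b + 1"
  obtain M where M: "\<And>x. x \<in> cball 0 (S + norm b) \<Longrightarrow> \<bar>D x b\<bar> \<le> M"
  proof -
    have "compact ((\<lambda>x. D x b) ` cball 0 (S + norm b))"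
      by (intro compact_continuous_image continuous_on_subset[OF cont]) auto
    then obtain a where "\<forall>x\<in>cball 0 (S + norm b). \<bar>D x b\<bar> \<le> a"
      by (auto dest!: compact_imp_bounded simp: bounded_iff)
    then show ?thesis using that by blast
  qed
  have intF: "integrable lborel F"
    using contF supp by (rule integrable_continuous_compact_support)
  have shift: "integrable lborel (\<lambda>x. F (x + c))" "(LINT x|lborel. F (x + c)) = (LINT x|lborel. F x)" for c
  proof -
    have "integrable (distr lborel borel ((+) c)) F" using intF by (simp add: lborel_distr_plus)
    then show "integrable lborel (\<lambda>x. F (x + c))"
      by (subst (asm) integrable_distr_eq) (auto simp: add.commute)
    have "(LINT x|distr lborel borel ((+) c). F x) = (LINT x|lborel. F (c + x))"
      by (subst integral_distr) auto
    then show "(LINT x|lborel. F (x + c)) = (LINT x|lborel. F x)"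
      by (simp add: lborel_distr_plus add.commute)
  qed
  define s where "s k x = (F (x + h k *\<^sub>R b) - F x) / h k" for k x
  have s0: "(LINT x|lborel. s k x) = 0" for k
    using intF shift by (simp add: s_def)
  have lim: "(\<lambda>k. s k x) \<longlonglongrightarrow> D x b" for x
  proof -
    have "((\<lambda>t. F (x + t *\<^sub>R b)) has_derivative (\<lambda>t. D x (t *\<^sub>R b))) (at 0)"
      by (rule has_derivative_compose[where g = F, of "\<lambda>t. x + t *\<^sub>R b" "\<lambda>t. t *\<^sub>R b"])
        (auto intro!: derivative_eq_intros D)
    moreover have "linear (D x)" using D has_derivative_linear by blast
    ultimately have "((\<lambda>t. F (x + t *\<^sub>R b)) has_real_derivative D x b) (at 0)"
      by (simp add: has_field_derivative_def linear_scale mult_commute_abs)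
    then have "((\<lambda>t. (F (x + t *\<^sub>R b) - F x) / t) \<longlongrightarrow> D x b) (at 0)"
      by (simp add: DERIV_def)
    moreover have "h \<longlonglongrightarrow> 0"
      unfolding h_def[abs_def] by (rule LIMSEQ_Suc[OF lim_1_over_n])
    then have "filterlim h (at 0) sequentially"
      unfolding filterlim_at by (intro conjI always_eventually allI) (use h(1) in \<open>auto simp: less_imp_neq[symmetric]\<close>)
    ultimately show ?thesis unfolding s_def by (rule filterlim_compose)
  qed
  have bd: "\<bar>s k x\<bar> \<le> M * indicator (cball 0 S) x" for k x
  proof (cases "norm x \<le> S")
    case True
    have "\<exists>y. norm y \<le> S + norm b \<and> s k x = D y b"
    proof -
      have der: "((\<lambda>t. F (x + t *\<^sub>R b)) has_real_derivative D (x + t *\<^sub>R b) b) (at t)" for t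
      proof -
        have "((\<lambda>t. F (x + t *\<^sub>R b)) has_derivative (\<lambda>u. D (x + t *\<^sub>R b) (u *\<^sub>R b))) (at t)"
          by (rule has_derivative_compose[where g = F, of "\<lambda>t. x + t *\<^sub>R b" "\<lambda>t. t *\<^sub>R b"])
            (auto intro!: derivative_eq_intros D)
        moreover have "linear (D (x + t *\<^sub>R b))" using D has_derivative_linear by blast
        ultimately show ?thesis
          by (simp add: has_field_derivative_def linear_scale mult_commute_abs)
      qed
      obtain t where t: "0 < t" "t < h k" "F (x + h k *\<^sub>R b) - F (x + 0 *\<^sub>R b) = (h k - 0) * D (x + t *\<^sub>R b) b"
        using MVT2[of 0 "h k" "\<lambda>t. F (x + t *\<^sub>R b)" "\<lambda>t. D (x + t *\<^sub>R b) b"] der h by blast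
      have "norm (x + t *\<^sub>R b) \<le> norm x + t * norm b"
        using t by (metis abs_of_pos norm_scaleR norm_triangle_ineq)
      also have "t * norm b \<le> 1 * norm b" using t h[of k] by (intro mult_right_mono) auto
      finally have "norm (x + t *\<^sub>R b) \<le> S + norm b" using True by simp
      moreover have "s k x = D (x + t *\<^sub>R b) b" using t(3) h(1)[of k] by (simp add: s_def)
      ultimately show ?thesis by blast
    qed
    then show ?thesis using M True by auto
  next
    case False
    have "norm x \<le> norm (x + h k *\<^sub>R b) + norm (h k *\<^sub>R b)"
      by (metis add_diff_cancel_right' norm_triangle_ineq4)
    moreover have "norm (h k *\<^sub>R b) \<le> norm b" using h[of k] by (simp add: mult_left_le_one_le)
    moreover have "norm x > \<bar>R\<bar> + norm b + 1" using False by (simp add: S_def)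
    moreover have "norm b \<ge> 0" by simp
    ultimately have "norm (x + h k *\<^sub>R b) > R" "norm x > R" by linarith+
    then show ?thesis using supp False by (simp add: s_def)
  qed
  have "(\<lambda>k. LINT x|lborel. s k x) \<longlonglongrightarrow> (LINT x|lborel. D x b)"
  proof (rule integral_dominated_convergence[where w = "\<lambda>x. M * indicator (cball 0 S) x"])
    show "integrable lborel (\<lambda>x::'a. M * indicat_real (cball 0 S) x)"
    proof (intro integrable_mult_right integrable_real_indicator)
      show "emeasure lborel (cball (0::'a) S) < \<infinity>" by (rule emeasure_lborel_cball_finite)
    qed simp
    show "s k \<in> borel_measurable lborel" for k
      unfolding s_def by measurable
  qed (use lim bd in auto)
  then have "(LINT x|lborel. D x b) = 0" by (simp add: s0 LIMSEQ_const_iff)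
  then show ?thesis by (simp add: integral_completion)
qed

lemma integrable_loc_integrable_mult:
  fixes f :: "real^'n::finite \<Rightarrow> real"
  assumes f: "loc_integrable_off_0 f" and m: "\<phi> \<in> borel_measurable lebesgue"
    and K: "compact K" "0 \<notin> K"
    and bd: "\<And>x. x \<in> K \<Longrightarrow> \<bar>\<phi> x\<bar> \<le> (B::real)" and out: "\<And>x. x \<notin> K \<Longrightarrow> \<phi> x = 0"
  shows "integrable lebesgue (\<lambda>x. f x * \<phi> x)"
proof -
  have i: "integrable lebesgue (\<lambda>x. indicator K x *\<^sub>R f x)"
    using f K unfolding loc_integrable_off_0_def set_integrable_def by blast
  have eq: "(\<lambda>x. f x * \<phi> x) = (\<lambda>x. (indicator K x *\<^sub>R f x) * \<phi> x)"
    using out by (auto simp: indicator_def fun_eq_iff)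
  have "integrable lebesgue (\<lambda>x. (indicator K x *\<^sub>R f x) * \<phi> x)"
  proof (rule Bochner_Integration.integrable_bound[OF integrable_mult_right[OF i, of "\<bar>B\<bar>"]])
    show "(\<lambda>x. indicator K x *\<^sub>R f x * \<phi> x) \<in> borel_measurable lebesgue"
      using i m by (intro borel_measurable_times) auto
    show "AE x in lebesgue. norm (indicator K x *\<^sub>R f x * \<phi> x) \<le> norm (\<bar>B\<bar> * indicator K x *\<^sub>R f x)"
    proof (intro always_eventually allI)
      fix x
      have "\<bar>f x\<bar> * \<bar>\<phi> x\<bar> \<le> \<bar>B\<bar> * \<bar>f x\<bar>" if "x \<in> K"
        using bd[OF that] by (metis abs_ge_self abs_ge_zero mult.commute mult_right_mono order_trans)
      then show "norm (indicator K x *\<^sub>R f x * \<phi> x) \<le> norm (\<bar>B\<bar> * indicator K x *\<^sub>R f x)"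
        by (auto simp: indicator_def abs_mult)
    qed
  qed
  then show ?thesis by (simp only: eq)
qed

lemma integrable_loc_integrable_continuous_mult:
  fixes f h :: "real^'n::finite \<Rightarrow> real"
  assumes f: "loc_integrable_off_0 f" and h: "continuous_on UNIV h"
    and A: "0 < A" and out: "\<And>x. x \<notin> annulus A B \<Longrightarrow> h x = 0"
  shows "integrable lebesgue (\<lambda>x. f x * h x)"
proof -
  have "bounded (h ` annulus A B)"
    by (intro compact_imp_bounded compact_continuous_image compact_annulus continuous_on_subset[OF h]) auto
  then obtain C where C: "\<And>x. x \<in> annulus A B \<Longrightarrow> \<bar>h x\<bar> \<le> C" by (force simp: bounded_iff)
  have "h \<in> borel_measurable lebesgue"
    by (rule measurable_completion) (simp add: borel_measurable_continuous_onI[OF h])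
  from integrable_loc_integrable_mult[OF f this compact_annulus zero_notin_annulus[OF A] C out]
  show ?thesis .
qed

lemma loc_integrable_off_0_component:
  fixes v :: "real^'n::finite \<Rightarrow> real^'n"
  assumes "loc_integrable_off_0 v"
  shows "loc_integrable_off_0 (\<lambda>x. v x $ i)"
  unfolding loc_integrable_off_0_def
proof (intro allI impI)
  fix K :: "(real^'n) set" assume "compact K \<and> 0 \<notin> K"
  then have "v absolutely_integrable_on K" using assms by (simp add: loc_integrable_off_0_def)
  from absolutely_integrable_component[OF this, of "axis i 1"]
  show "(\<lambda>x. v x $ i) absolutely_integrable_on K" by (simp add: inner_axis)
qed

lemma nonpos_if_le_epsilon_mult:
  fixes x C :: real
  assumes "\<And>e. e > 0 \<Longrightarrow> x \<le> e * C"
  shows "x \<le> 0"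
proof (rule ccontr)
  assume x: "\<not> x \<le> 0"
  have "x \<le> x / (2 * (\<bar>C\<bar> + 1)) * C" using x by (intro assms divide_pos_pos) auto
  also have "\<dots> \<le> x / (2 * (\<bar>C\<bar> + 1)) * (\<bar>C\<bar> + 1)" using x by (intro mult_left_mono) auto
  also have "\<dots> = x / 2" by (simp add: field_simps)
  finally show False using x by simp
qed

lemma continuous_bump: "continuous_on UNIV (bump A B :: real^'n::finite \<Rightarrow> real)"
  by (auto intro!: continuous_at_imp_continuous_on differentiable_imp_continuous_within
        smooth_class_differentiable smooth_bump)

text \<open>Makes the arbitrary choice in \<open>weak_gradient\<close> harmless. The difference of
  two gradients, times a bump, is orthogonal to all polynomials, by Stone-Weierstrass to all
  continuous functions, and therefore vanishes where the bump is positive.\<close>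

lemma weak_gradient_unique:
  fixes u :: "real^'n::finite \<Rightarrow> real"
  assumes v: "has_weak_gradient u v" and w: "has_weak_gradient u w"
  shows "AE x in lebesgue. v x = w x"
proof -
  have comp: "AE x in lebesgue. A < norm x \<and> norm x < B \<longrightarrow> v x $ i = w x $ i"
    if AB: "0 < A" "A < B" for A B i
  proof -
    let ?b = "bump A B :: real^'n \<Rightarrow> real"
    let ?K = "annulus A B :: (real^'n) set"
    define z where "z x = (v x $ i - w x $ i) * ?b x" for x
    have int: "integrable lebesgue (\<lambda>x. V x $ i * (P x * ?b x))"
      if V: "loc_integrable_off_0 V" and P: "continuous_on UNIV P" for V P
      using AB
      by (intro integrable_loc_integrable_continuous_mult[where A = A and B = B] loc_integrable_off_0_component V
          continuous_on_mult P continuous_bump) (auto simp: bump_eq_0)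
    have loc: "loc_integrable_off_0 v" "loc_integrable_off_0 w"
      using v w by (auto simp: has_weak_gradient_def)
    have zi: "integrable lebesgue (\<lambda>x. z x * P x)" if "continuous_on UNIV P" for P
      using Bochner_Integration.integrable_diff[OF int[OF loc(1) that] int[OF loc(2) that]]
      by (simp add: z_def algebra_simps)
    have z1: "integrable lebesgue z" using zi[of "\<lambda>x. 1"] by simp
    have poly: "(LINT x|lebesgue. z x * P x) = 0" if P: "real_polynomial_function P" for P
    proof -
      have cP: "continuous_on UNIV P"
        using P by (simp add: continuous_on_polymonial_function real_polynomial_function_eq)
      have "test_fun (\<lambda>x. P x * ?b x)" using AB P by (intro test_fun_bump) auto
      then have "(LINT x|lebesgue. u x * partial_deriv i (\<lambda>x. P x * ?b x) x)
        = - (LINT x|lebesgue. V x $ i * (P x * ?b x))" if "has_weak_gradient u V" for V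
        using that by (simp add: has_weak_gradient_def)
      from this[OF v] this[OF w]
      have "(LINT x|lebesgue. v x $ i * (P x * ?b x)) = (LINT x|lebesgue. w x $ i * (P x * ?b x))"
        by simp
      then show ?thesis
        using Bochner_Integration.integral_diff[OF int[OF loc(1) cP] int[OF loc(2) cP]]
        by (simp add: z_def algebra_simps)
    qed
    have "AE x in lebesgue. z x = 0"
    proof (rule AE_zero_if_orthogonal[OF z1, of id z])
      fix \<eta> :: "real^'n \<Rightarrow> real" assume \<eta>: "continuous_on UNIV \<eta>"
      have "\<bar>LINT x|lebesgue. z x * \<eta> x\<bar> \<le> e * (LINT x|lebesgue. \<bar>z x\<bar>)" if e: "e > 0" for e
      proof -
        obtain P where P: "real_polynomial_function P" "\<And>x. x \<in> ?K \<Longrightarrow> \<bar>\<eta> x - P x\<bar> < e"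
          using Stone_Weierstrass_real_polynomial_function[OF compact_annulus continuous_on_subset[OF \<eta> subset_UNIV] e]
          by blast
        have cP: "continuous_on UNIV P"
          using P by (simp add: continuous_on_polymonial_function real_polynomial_function_eq)
        have "(LINT x|lebesgue. z x * \<eta> x) = (LINT x|lebesgue. z x * \<eta> x - z x * P x)"
          using zi[OF \<eta>] zi[OF cP] poly[OF P(1)] by simp
        also have "\<bar>\<dots>\<bar> \<le> (LINT x|lebesgue. \<bar>z x * \<eta> x - z x * P x\<bar>)"
          by (rule integral_abs_bound)
        also have "\<dots> \<le> (LINT x|lebesgue. e * \<bar>z x\<bar>)"
        proof (rule integral_mono)
          show "\<bar>z x * \<eta> x - z x * P x\<bar> \<le> e * \<bar>z x\<bar>" for x
          proof (cases "x \<in> ?K")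
            case True
            then have "\<bar>z x\<bar> * \<bar>\<eta> x - P x\<bar> \<le> \<bar>z x\<bar> * e" using P(2) by (intro mult_left_mono) (auto intro: less_imp_le)
            then show ?thesis by (simp add: abs_mult[symmetric] algebra_simps)
          next
            case False then show ?thesis using AB by (simp add: z_def bump_eq_0)
          qed
        qed (use zi[OF \<eta>] zi[OF cP] z1 in auto)
        finally show ?thesis by simp
      qed
      then have "\<bar>LINT x|lebesgue. z x * \<eta> x\<bar> \<le> 0"
        by (rule nonpos_if_le_epsilon_mult)
      then show "(LINT x|lebesgue. z x * \<eta> (id x)) = 0" by simp
    qed auto
    then show ?thesis
    proof eventually_elim
      case (elim x)
      then show ?case using bump_pos[of A x B] AB by (auto simp: z_def)
    qed
  qed
  \<comment> \<open>The outer radius carries \<open>+ 1\<close> so that it exceeds the inner one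
    already for \<open>k = 0\<close>, as \<open>comp\<close> requires. The annuli exhaust the
    complement of the origin.\<close>
  have "AE x in lebesgue. \<forall>k::nat. \<forall>i. 1 / real (Suc k) < norm x \<and> norm x < real (Suc k) + 1 \<longrightarrow> v x $ i = w x $ i"
    unfolding AE_all_countable
  proof (intro allI AE_finite_allI comp)
    fix k :: nat
    have "1 / real (Suc k) \<le> 1" by simp
    then show "1 / real (Suc k) < real (Suc k) + 1" by linarith
  qed auto
  moreover have "AE x in lebesgue. x \<noteq> (0::real^'n)"
    by (rule AE_completion) (auto intro: AE_lborel_singleton)
  ultimately show ?thesis
  proof eventually_elim
    case (elim x)
    then have "norm x > 0" by simp
    then obtain k1 :: nat where "1 / real (Suc k1) < norm x" using nat_approx_posE by blast
    moreover obtain k2 :: nat where "norm x < real k2" using reals_Archimedean2 by blast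
    moreover have "1 / real (Suc (max k1 k2)) \<le> 1 / real (Suc k1)" by (intro divide_left_mono) auto
    ultimately have "1 / real (Suc (max k1 k2)) < norm x" "norm x < real (Suc (max k1 k2)) + 1" by linarith+
    then show ?case using elim(1) by (auto simp: vec_eq_iff)
  qed
qed


section \<open>Logarithmic cylinder coordinates\<close>

text \<open>Serves two purposes: with \<open>P = 0\<close> it differentiates the components of a
  radial vector field, and in full it differentiates the trial functions, which are radial plus a
  radial multiple of one coordinate.\<close>

lemma has_derivative_log_radial:
  fixes x e :: "'a::euclidean_space"
  assumes P: "\<And>s. (P has_real_derivative P' s) (at s)"
    and R: "\<And>s. (R has_real_derivative R' s) (at s)" and x: "x \<noteq> 0"
  shows "((\<lambda>x. P (ln (norm x)) + R (ln (norm x)) * (x \<bullet> e)) has_derivative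
    (\<lambda>h. (P' (ln (norm x)) + R' (ln (norm x)) * (x \<bullet> e)) / (norm x)\<^sup>2 * (x \<bullet> h)
      + R (ln (norm x)) * (e \<bullet> h))) (at x)"
proof -
  have ln: "((\<lambda>x. ln (norm x)) has_derivative (\<lambda>h. (x \<bullet> h) / (norm x)\<^sup>2)) (at x)"
  proof -
    have n: "(norm has_derivative (\<lambda>h. sgn x \<bullet> h)) (at x)"
      using GDERIV_norm[OF x] by (simp add: gderiv_def inner_commute)
    have l: "(ln has_derivative (\<lambda>h. h / norm x)) (at (norm x))"
      using DERIV_ln[of "norm x"] x
      by (auto simp: has_field_derivative_def inverse_eq_divide elim!: has_derivative_eq_rhs)
    show ?thesis
      by (rule has_derivative_eq_rhs[OF has_derivative_compose[OF n l]])
        (simp add: sgn_div_norm power2_eq_square fun_eq_iff divide_inverse)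
  qed
  have 1: "((\<lambda>x. P (ln (norm x))) has_derivative (\<lambda>h. P' (ln (norm x)) * ((x \<bullet> h) / (norm x)\<^sup>2))) (at x)"
    using has_derivative_compose[OF ln P[unfolded has_field_derivative_def]] .
  have 2: "((\<lambda>x. R (ln (norm x))) has_derivative (\<lambda>h. R' (ln (norm x)) * ((x \<bullet> h) / (norm x)\<^sup>2))) (at x)"
    using has_derivative_compose[OF ln R[unfolded has_field_derivative_def]] .
  have 3: "((\<lambda>x. x \<bullet> e) has_derivative (\<lambda>h. e \<bullet> h)) (at x)"
    by (auto intro!: derivative_eq_intros simp: inner_commute)
  show ?thesis
    by (rule has_derivative_eq_rhs[OF has_derivative_add[OF 1 has_derivative_mult[OF 2 3]]])
      (simp add: fun_eq_iff add_divide_distrib algebra_simps)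
qed

lemma bounded_compact_support:
  fixes f :: "real \<Rightarrow> real"
  assumes f: "continuous_on UNIV f" and supp: "\<And>s. \<bar>s\<bar> > L \<Longrightarrow> f s = 0"
  obtains B where "B \<ge> 0" "\<And>s. \<bar>f s\<bar> \<le> B"
proof -
  have "bounded (f ` {-L..L})" by (intro compact_imp_bounded compact_continuous_image continuous_on_subset[OF f]) auto
  then obtain B where B: "\<forall>s\<in>{-L..L}. \<bar>f s\<bar> \<le> B" by (auto simp: bounded_iff)
  have "\<bar>f s\<bar> \<le> max B 0" for s
  proof (cases "\<bar>s\<bar> > L")
    case False
    then have "s \<in> {-L..L}" by auto
    then have "\<bar>f s\<bar> \<le> B" using B by blast
    then show ?thesis by simp
  qed (simp add: supp)
  then show ?thesis using that[of "max B 0"] by simp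
qed

lemma continuous_on_extend_by_0:
  fixes g :: "'a::euclidean_space \<Rightarrow> 'b::real_normed_vector"
  assumes c: "continuous_on (- {0}) g" and r: "r > 0" and z: "\<And>x. norm x < r \<Longrightarrow> g x = 0"
  shows "continuous_on UNIV g"
proof -
  have "continuous_on (ball 0 r) g"
    using z by (intro continuous_on_eq[OF continuous_on_const[of _ 0]]) auto
  then have "continuous_on (- {0} \<union> ball 0 r) g"
    using c by (intro continuous_on_open_Un) auto
  moreover have "- {0} \<union> ball 0 r = (UNIV :: 'a set)" using r by auto
  ultimately show ?thesis by simp
qed

lemma ln_norm_less_if: "norm x < exp (- L) \<Longrightarrow> x \<noteq> 0 \<Longrightarrow> \<bar>ln (norm x)\<bar> > L"
proof -
  assume a: "norm x < exp (- L)" "x \<noteq> 0"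
  then have "ln (norm x) < - L" using ln_less_cancel_iff[of "norm x" "exp (- L)"] by simp
  then show ?thesis by linarith
qed

lemma ln_norm_greater_if:
  assumes "norm x > exp L" shows "\<bar>ln (norm x)\<bar> > L"
proof -
  have "norm x > 0" using assms exp_gt_zero[of L] by linarith
  then have "ln (norm x) > L" using ln_less_cancel_iff[of "exp L" "norm x"] assms by simp
  then show ?thesis by linarith
qed

text \<open>The field \<open>R (ln |x|) x\<close> with \<open>R s = exp (- n s) F s\<close> has
  divergence \<open>R' + n R\<close> at \<open>ln |x|\<close>; the exponential is chosen to cancel
  the \<open>n\<close> that comes from the divergence of \<open>x\<close>. Each component is
  continuously differentiable with compact support off the origin, so its partial derivatives
  integrate to 0.\<close>

lemma integral_log_radial_deriv_eq_0:
  fixes F :: "real \<Rightarrow> real"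
  assumes F: "\<And>s. (F has_real_derivative F' s) (at s)" and F': "continuous_on UNIV F'"
    and supp: "\<And>s. \<bar>s\<bar> > L \<Longrightarrow> F s = 0"
  shows "(LINT x|lebesgue. F' (ln (norm x)) * norm (x::'a::euclidean_space) powr - real DIM('a)) = 0"
proof -
  let ?n = "real DIM('a)"
  have supp': "F' s = 0" if "\<bar>s\<bar> > L" for s
  proof -
    have o: "open {s. \<bar>s\<bar> > L}" by (intro open_Collect_less continuous_intros)
    have "((\<lambda>s. 0) has_real_derivative F' s) (at s)"
      by (rule has_field_derivative_transform_within_open[OF F o]) (use that supp in auto)
    then show ?thesis by (metis DERIV_const DERIV_unique)
  qed
  define R where "R s = exp (- ?n * s) * F s" for s
  define R' where "R' s = exp (- ?n * s) * (F' s - ?n * F s)" for s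
  have R: "(R has_real_derivative R' s) (at s)" for s
    unfolding R_def R'_def by (auto intro!: derivative_eq_intros F simp: algebra_simps)
  have contF: "continuous_on UNIV F" using F by (meson DERIV_isCont continuous_at_imp_continuous_on)
  have contR: "continuous_on UNIV R" "continuous_on UNIV R'"
    unfolding R_def R'_def by (intro continuous_intros contF F')+
  define D where "D e x h = (if x = 0 then 0 else R' (ln (norm x)) * (x \<bullet> e) / (norm x)\<^sup>2 * (x \<bullet> h)
      + R (ln (norm x)) * (e \<bullet> h))" for e x h :: 'a
  have der: "((\<lambda>x. if x = 0 then 0 else R (ln (norm x)) * (x \<bullet> e)) has_derivative D e x) (at x)" for e x :: 'a
  proof (cases "x = 0")
    case True
    have "((\<lambda>x. 0) has_derivative D e x) (at x)" using True by (simp add: D_def[abs_def])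
    then show ?thesis
    proof (rule has_derivative_transform_within_open[OF _ open_ball[of 0 "exp (- L)"]])
      fix y :: 'a assume "y \<in> ball 0 (exp (- L))"
      then show "0 = (if y = 0 then 0 else R (ln (norm y)) * (y \<bullet> e))"
        using ln_norm_less_if[of y L] supp by (auto simp: R_def)
    qed (use True in auto)
  next
    case False
    have "((\<lambda>x. 0 + R (ln (norm x)) * (x \<bullet> e)) has_derivative D e x) (at x)"
      using has_derivative_log_radial[where P = "\<lambda>s. 0" and P' = "\<lambda>s. 0", OF _ R False, of e] False
      by (simp add: D_def[abs_def])
    then show ?thesis
      by (rule has_derivative_transform_within_open[OF _ open_Compl[OF closed_singleton[of 0]]])
        (use False in auto)
  qed
  have cont: "continuous_on UNIV (\<lambda>x. D e x h)" for e h
  proof (rule continuous_on_extend_by_0[where r = "exp (- L)"])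
    have "continuous_on (- {0}) (\<lambda>x. R' (ln (norm x)) * (x \<bullet> e) / (norm x)\<^sup>2 * (x \<bullet> h) + R (ln (norm x)) * (e \<bullet> h))"
      by (intro continuous_intros continuous_on_compose2[OF contR(1)] continuous_on_compose2[OF contR(2)]) auto
    then show "continuous_on (- {0}) (\<lambda>x. D e x h)"
      by (rule continuous_on_eq) (auto simp: D_def)
    show "D e x h = 0" if "norm x < exp (- L)" for x
      using ln_norm_less_if[OF that] supp supp' by (auto simp: D_def R_def R'_def)
  qed simp
  have Dz: "D e x h = 0" if "norm x > exp L" for e x h
    using ln_norm_greater_if[OF that] supp supp' by (auto simp: D_def R_def R'_def)
  have "(LINT x|lebesgue. D e x e) = 0" for e
  proof (rule integral_directional_derivative_eq_0[OF der cont])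
    show "(if x = 0 then 0 else R (ln (norm x)) * (x \<bullet> e)) = 0" if "norm x > exp L" for x :: 'a
      using ln_norm_greater_if[OF that] supp by (auto simp: R_def)
  qed
  then have "0 = (\<Sum>e\<in>Basis. LINT x|lebesgue. D e x e)" by simp
  also have "\<dots> = (LINT x|lebesgue. (\<Sum>e\<in>Basis. D e x e))"
    by (rule Bochner_Integration.integral_sum[symmetric])
      (rule integrable_continuous_compact_support(2)[OF cont Dz])
  also have "\<dots> = (LINT x|lebesgue. F' (ln (norm x)) * norm (x::'a) powr - ?n)"
  proof (intro Bochner_Integration.integral_cong refl)
    fix x :: 'a
    show "(\<Sum>e\<in>Basis. D e x e) = F' (ln (norm x)) * norm x powr - ?n"
    proof (cases "x = 0")
      case False
      have n2: "(\<Sum>e\<in>Basis. (x \<bullet> e) * (x \<bullet> e)) = (norm x)\<^sup>2"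
        by (simp add: power2_norm_eq_inner euclidean_inner[of x x])
      have "(\<Sum>e\<in>Basis. D e x e) = (\<Sum>e\<in>Basis. R' (ln (norm x)) / (norm x)\<^sup>2 * ((x \<bullet> e) * (x \<bullet> e)) + R (ln (norm x)))"
        using False by (intro sum.cong) (auto simp: D_def)
      also have "\<dots> = R' (ln (norm x)) + ?n * R (ln (norm x))"
        using False by (simp only: sum.distrib sum_distrib_left[symmetric] n2) simp
      also have "\<dots> = F' (ln (norm x)) * norm x powr - ?n"
        using False by (simp add: R_def R'_def powr_def algebra_simps)
      finally show ?thesis .
    qed (simp add: D_def)
  qed
  finally show ?thesis by simp
qed

lemma has_derivative_antiderivative:
  fixes f :: "real \<Rightarrow> real"
  assumes "continuous_on UNIV f"
  obtains F where "\<And>s. (F has_real_derivative f s) (at s)"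
proof -
  define F where "F s = (if s \<ge> 0 then integral {0..s} f else - integral {s..0} f)" for s
  have "(F has_real_derivative f s) (at s)" for s
  proof -
    define c where "c = - \<bar>s\<bar> - 1"
    have int: "f integrable_on {a..b}" for a b
      using assms by (intro integrable_continuous_interval) (auto intro: continuous_on_subset)
    have d: "((\<lambda>u. integral {c..u} f) has_real_derivative f s) (at s within {c..\<bar>s\<bar> + 1})"
      using assms by (intro integral_has_real_derivative) (auto simp: c_def intro: continuous_on_subset)
    have "((\<lambda>u. integral {c..u} f) has_real_derivative f s) (at s)"
      using d at_within_interior[of s "{c..\<bar>s\<bar> + 1}"] by (simp add: c_def interior_atLeastAtMost_real abs_if split: if_splits)
    then have "((\<lambda>u. integral {c..u} f - integral {c..0} f) has_real_derivative f s) (at s)"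
      by (auto intro!: derivative_eq_intros)
    then show ?thesis
    proof (rule has_field_derivative_transform_within_open[where S = "{c<..}"])
      fix u assume u: "u \<in> {c<..}"
      show "integral {c..u} f - integral {c..0} f = F u"
      proof (cases "u \<ge> 0")
        case True
        then have "integral {c..0} f + integral {0..u} f = integral {c..u} f"
          by (intro Henstock_Kurzweil_Integration.integral_combine int) (auto simp: c_def)
        with True show ?thesis by (simp add: F_def)
      next
        case False
        then have "integral {c..u} f + integral {u..0} f = integral {c..0} f"
          using u by (intro Henstock_Kurzweil_Integration.integral_combine int) auto
        with False show ?thesis by (simp add: F_def)
      qed
    qed (auto simp: c_def)
  qed
  then show ?thesis using that by blast
qed

lemma integral_deriv_compact_support:
  fixes F :: "real \<Rightarrow> real"
  assumes F: "\<And>s. (F has_real_derivative f s) (at s)" and f: "continuous_on UNIV f"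
    and supp: "\<And>s. \<bar>s\<bar> > L \<Longrightarrow> f s = 0" and L: "L \<ge> 0"
  shows "(LINT s|lborel. f s) = F L - F (- L)"
proof -
  have "(LINT s|lborel. f s) = (LINT s|lborel. f s * indicator {- L..L} s)"
    using supp by (intro Bochner_Integration.integral_cong refl) (force simp: indicator_def)
  also have "\<dots> = F L - F (- L)"
    using f L by (intro integral_FTC_Icc_real F) (auto intro: continuous_on_interior)
  finally show ?thesis .
qed

text \<open>A primitive is constant on each side of the support, and the vanishing integral makes
  the two constants equal.\<close>

lemma compact_antiderivative:
  fixes f :: "real \<Rightarrow> real"
  assumes f: "continuous_on UNIV f" and supp: "\<And>s. \<bar>s\<bar> > L \<Longrightarrow> f s = 0"
    and L: "L \<ge> 0" and 0: "(LINT s|lborel. f s) = 0"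
  obtains F where "\<And>s. (F has_real_derivative f s) (at s)" "\<And>s. \<bar>s\<bar> > L \<Longrightarrow> F s = 0"
proof -
  obtain G where G: "\<And>s. (G has_real_derivative f s) (at s)"
    using has_derivative_antiderivative[OF f] by blast
  have e: "G L = G (- L)" using integral_deriv_compact_support[OF G f supp L] 0 by simp
  have "G s = G L" if "\<bar>s\<bar> > L" for s
  proof (cases "s > L")
    case True
    then obtain z where "L < z" "G s - G L = (s - L) * f z"
      using MVT2[of L s G f] G by blast
    then show ?thesis using supp[of z] by simp
  next
    case False
    then have "s < - L" using that by auto
    then obtain z where "z < - L" "G (- L) - G s = (- L - s) * f z"
      using MVT2[of s "- L" G f] G by blast
    then show ?thesis using supp[of z] e by simp
  qed
  moreover have "((\<lambda>s. G s - G L) has_real_derivative f s) (at s)" for s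
    by (auto intro!: derivative_eq_intros G)
  ultimately show ?thesis using that[of "\<lambda>s. G s - G L"] by simp
qed

section \<open>The image of \<open>|x| powr (- n) dx\<close> under \<open>ln |x|\<close>\<close>

lemma log_radial_measurable[measurable]: "(\<lambda>x::'a::euclidean_space. ln (norm x)) \<in> borel_measurable borel"
  by measurable

text \<open>A fixed continuous density of compact support; \<open>4 / 3\<close> is the integral of
  \<open>1 - s\<^sup>2\<close> over \<open>[-1, 1]\<close>. Subtracting a multiple of it turns a
  continuous function of compact support into one of integral 0, which is the derivative of a
  function of compact support.\<close>

definition parabola :: "real \<Rightarrow> real" where "parabola s = max 0 (3 / 4 * (1 - s\<^sup>2))"

lemma continuous_parabola: "continuous_on UNIV parabola"
  unfolding parabola_def by (intro continuous_intros)

lemma parabola_simps: "parabola s \<ge> 0" "\<bar>s\<bar> > 1 \<Longrightarrow> parabola s = 0" "\<bar>s\<bar> < 1 \<Longrightarrow> parabola s > 0"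
  using abs_square_le_1[of s] abs_square_less_1[of s] by (auto simp: parabola_def max_def)

lemma integral_parabola: "integrable lborel parabola" "(LINT s|lborel. parabola s) = 1"
proof -
  show "integrable lborel parabola"
    by (rule integrable_continuous_compact_support[OF continuous_parabola, of 1]) (auto simp: parabola_simps)
  have "(LINT s|lborel. parabola s) = (LINT s|lborel. (3 / 4 * (1 - s\<^sup>2)) * indicator {-1..1} s)"
  proof (intro Bochner_Integration.integral_cong refl)
    fix s :: real
    show "parabola s = 3 / 4 * (1 - s\<^sup>2) * indicator {-1..1} s"
      using abs_square_le_1[of s] by (auto simp: parabola_def indicator_def abs_le_iff max_def)
  qed
  also have "\<dots> = 3 / 4 * (1 - 1 ^ 3 / 3) - 3 / 4 * (- 1 - (- 1) ^ 3 / 3)"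
    by (rule integral_FTC_Icc_real[where F = "\<lambda>s. 3 / 4 * (s - s ^ 3 / 3)"])
      (auto intro!: derivative_eq_intros continuous_intros simp: power2_eq_square)
  finally show "(LINT s|lborel. parabola s) = 1" by simp
qed

lemma log_radial_integrable:
  fixes F :: "real \<Rightarrow> real"
  assumes F: "continuous_on UNIV F" and supp: "\<And>s. \<bar>s\<bar> > L \<Longrightarrow> F s = 0"
  shows "integrable lebesgue (\<lambda>x::'a::euclidean_space. F (ln (norm x)) * norm x powr d)"
proof -
  define f where "f x = (if x = 0 then 0 else F (ln (norm x)) * norm x powr d)" for x :: 'a
  have "continuous_on UNIV f"
  proof (rule continuous_on_extend_by_0[where r = "exp (- L)"])
    have "continuous_on (- {0}) (\<lambda>x::'a. F (ln (norm x)) * norm x powr d)"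
      by (intro continuous_intros continuous_on_compose2[OF F]) auto
    then show "continuous_on (- {0}) f" by (rule continuous_on_eq) (auto simp: f_def)
    show "f x = 0" if "norm x < exp (- L)" for x
      using ln_norm_less_if[OF that] supp by (auto simp: f_def)
  qed simp
  moreover have "f x = 0" if "norm x > exp L" for x
    using ln_norm_greater_if[OF that] supp by (auto simp: f_def)
  ultimately have "integrable lebesgue f" by (rule integrable_continuous_compact_support)
  moreover have "f = (\<lambda>x. F (ln (norm x)) * norm x powr d)" by (auto simp: f_def fun_eq_iff)
  ultimately show ?thesis by simp
qed

text \<open>
  This is the area of the unit sphere, since \<open>parabola\<close> has integral 1. The divergence theorem applied to
  \<open>|x| powr (- n) F(ln |x|) x\<close> replaces polar coordinates.
\<close>

definition sphere_const :: "'a::euclidean_space itself \<Rightarrow> real" where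
  "sphere_const _ = (LINT x|lebesgue. parabola (ln (norm (x::'a))) * norm x powr - real DIM('a))"

lemma sphere_const_pos: "sphere_const TYPE('a::euclidean_space) > 0"
proof -
  let ?f = "\<lambda>x::'a. parabola (ln (norm x)) * norm x powr - real DIM('a)"
  have int: "integrable lebesgue ?f"
    by (rule log_radial_integrable[OF continuous_parabola, of 1]) (auto simp: parabola_simps)
  have "sphere_const TYPE('a) \<ge> 0"
    unfolding sphere_const_def by (intro integral_nonneg_AE) (auto simp: parabola_simps)
  moreover have "sphere_const TYPE('a) \<noteq> 0"
  proof
    assume "sphere_const TYPE('a) = 0"
    then have ae: "AE x in lebesgue. ?f x = 0"
      unfolding sphere_const_def using int
      by (subst (asm) integral_nonneg_eq_0_iff_AE) (auto simp: parabola_simps)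
    define S where "S = {x::'a. exp (-1/2) < norm x \<and> norm x < exp (1/2)}"
    have "?f x > 0" if "x \<in> S" for x
    proof -
      have x: "norm x > 0" using that exp_gt_zero[of "-1/2 :: real"] unfolding S_def mem_Collect_eq by linarith
      have "ln (exp (-1/2)) < ln (norm x)" "ln (norm x) < ln (exp (1/2))"
        using that x by (subst ln_less_cancel_iff; auto simp: S_def)+
      then show ?thesis using x by (auto intro!: mult_pos_pos parabola_simps(3))
    qed
    note pos = this
    have "AE x in lebesgue. x \<notin> S"
      using ae by eventually_elim (use pos in fastforce)
    moreover have "open S" unfolding S_def by (intro open_Collect_conj open_Collect_less continuous_intros)
    ultimately have "negligible S"
      by (simp add: negligible_iff_null_sets AE_iff_null_sets borel_open)
    moreover obtain b :: 'a where "b \<in> Basis" using nonempty_Basis by blast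
    then have "b \<in> S" by (auto simp: S_def)
    ultimately show False using open_not_negligible[OF \<open>open S\<close>] by blast
  qed
  ultimately show ?thesis by linarith
qed

text \<open>Subtract the multiple \<open>I\<close> of \<open>parabola\<close> that has the same
  integral. The remainder is the derivative of a function of compact support and contributes 0,
  while \<open>parabola\<close> itself contributes \<open>sphere_const\<close> by
  definition.\<close>

lemma integral_log_radial_continuous:
  fixes F :: "real \<Rightarrow> real"
  assumes F: "continuous_on UNIV F" and supp: "\<And>s. \<bar>s\<bar> > L \<Longrightarrow> F s = 0"
  shows "(LINT x|lebesgue. F (ln (norm x)) * norm (x::'a::euclidean_space) powr - real DIM('a))
    = sphere_const TYPE('a) * (LINT s|lborel. F s)"
proof -
  define I where "I = (LINT s|lborel. F s)"
  define M where "M = max 1 \<bar>L\<bar>"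
  define f where "f s = F s - I * parabola s" for s
  have f: "continuous_on UNIV f" unfolding f_def by (intro continuous_intros F continuous_parabola)
  have fs: "f s = 0" if "\<bar>s\<bar> > M" for s using that supp by (auto simp: f_def M_def parabola_simps)
  have iF: "integrable lborel F"
    by (rule integrable_continuous_compact_support[OF F, of L]) (use supp in auto)
  have "(LINT s|lborel. f s) = 0"
    using iF integral_parabola by (simp add: f_def I_def)
  then obtain G where "\<And>s. (G has_real_derivative f s) (at s)" "\<And>s. \<bar>s\<bar> > M \<Longrightarrow> G s = 0"
    using compact_antiderivative[OF f, of M] fs by (metis M_def max.cobounded1 order_trans zero_le_one)
  from integral_log_radial_deriv_eq_0[OF this(1) f this(2)]
  have "(LINT x|lebesgue. f (ln (norm x)) * norm (x::'a) powr - real DIM('a)) = 0" .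
  moreover have "integrable lebesgue (\<lambda>x. F (ln (norm x)) * norm (x::'a) powr - real DIM('a))"
    by (rule log_radial_integrable[OF F supp])
  moreover have "integrable lebesgue (\<lambda>x. parabola (ln (norm x)) * norm (x::'a) powr - real DIM('a))"
    by (rule log_radial_integrable[OF continuous_parabola, of 1]) (auto simp: parabola_simps)
  ultimately show ?thesis
    by (simp add: f_def left_diff_distrib sphere_const_def I_def mult.assoc)
qed

text \<open>The product of \<open>ds\<close>, where \<open>s = ln |x|\<close>, with the normalized
  surface measure of the sphere. Dividing by \<open>sphere_const\<close> makes the image under
  \<open>ln |x|\<close> exactly Lebesgue measure.\<close>

definition cyl_measure :: "'a::euclidean_space measure" where
  "cyl_measure = density lebesgue (\<lambda>x. ennreal (norm x powr - real DIM('a) / sphere_const TYPE('a)))"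

lemma space_cyl_measure[simp]: "space cyl_measure = UNIV"
  and sets_cyl_measure[measurable_cong, simp]: "sets (cyl_measure :: 'a::euclidean_space measure) = sets lebesgue"
  by (auto simp: cyl_measure_def)

lemma measurable_lebesgue_if_borel: "f \<in> borel_measurable borel \<Longrightarrow> f \<in> borel_measurable (lebesgue :: 'a::euclidean_space measure)"
  by (rule measurable_completion) simp

lemma cyl_weight_measurable[measurable]:
  "(\<lambda>x::'a::euclidean_space. norm x powr d) \<in> borel_measurable lebesgue"
  "(\<lambda>x::'a::euclidean_space. ln (norm x)) \<in> borel_measurable lebesgue"
  by (rule measurable_lebesgue_if_borel, measurable)+

lemma integrable_cyl_measure_iff:
  fixes f :: "'a::euclidean_space \<Rightarrow> real"
  assumes [measurable]: "f \<in> borel_measurable lebesgue"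
  shows "integrable cyl_measure f \<longleftrightarrow> integrable lebesgue (\<lambda>x. norm x powr - real DIM('a) * f x)"
proof -
  let ?c = "sphere_const TYPE('a)"
  have c: "?c > 0" by (rule sphere_const_pos)
  have "integrable cyl_measure f \<longleftrightarrow> integrable lebesgue (\<lambda>x. (norm x powr - real DIM('a) / ?c) *\<^sub>R f x)"
    unfolding cyl_measure_def using c by (intro integrable_density) (auto intro!: always_eventually)
  also have "\<dots> \<longleftrightarrow> integrable lebesgue (\<lambda>x. (norm x powr - real DIM('a) * f x) / ?c)"
    by (simp add: field_simps)
  also have "\<dots> \<longleftrightarrow> integrable lebesgue (\<lambda>x. norm x powr - real DIM('a) * f x)"
    using c integrable_mult_right_iff[of lebesgue "\<lambda>x. norm x powr - real DIM('a) * f x" "1 / ?c"] by simp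
  finally show ?thesis .
qed

lemma integral_cyl_measure:
  fixes f :: "'a::euclidean_space \<Rightarrow> real"
  assumes [measurable]: "f \<in> borel_measurable lebesgue"
  shows "(LINT x|lebesgue. norm x powr - real DIM('a) * f x) = sphere_const TYPE('a) * (LINT x|cyl_measure. f x)"
proof -
  let ?c = "sphere_const TYPE('a)"
  have c: "?c > 0" by (rule sphere_const_pos)
  have "(LINT x|cyl_measure. f x) = (LINT x|lebesgue. (norm x powr - real DIM('a) / ?c) *\<^sub>R f x)"
    unfolding cyl_measure_def using c by (intro integral_density) (auto intro!: always_eventually)
  also have "\<dots> = (LINT x|lebesgue. (norm x powr - real DIM('a) * f x) / ?c)"
    by (simp add: field_simps)
  also have "\<dots> = (LINT x|lebesgue. norm x powr - real DIM('a) * f x) / ?c" by simp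
  finally show ?thesis using c by simp
qed

lemma AE_cyl_measure: "AE x in lebesgue. P x \<Longrightarrow> AE x in (cyl_measure :: 'a::euclidean_space measure). P x"
  unfolding cyl_measure_def by (subst AE_density) (auto elim!: eventually_mono)

lemma AE_lebesgue_neq_0: "AE x in lebesgue. x \<noteq> (0::'a::euclidean_space)"
  by (rule AE_completion) (auto intro: AE_lborel_singleton)

text \<open>A measure on the line that is finite on bounded intervals is determined by open
  intervals. The trapezoids \<open>f k\<close> increase to the indicator of such an interval, and
  for continuous functions of compact support the equality is
  \<open>integral_log_radial_continuous\<close>.\<close>

lemma distr_cyl_measure:
  "distr (cyl_measure :: 'a::euclidean_space measure) borel (\<lambda>x. ln (norm x)) = lborel" (is "?N = _")
proof (rule lborel_eqI[symmetric])
  fix l u :: real assume lu: "\<And>b. b \<in> Basis \<Longrightarrow> l \<bullet> b \<le> u \<bullet> b"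
  define f where "f k s = max 0 (min 1 (real k * min (s - l) (u - s)))" for k :: nat and s
  define M where "M = max \<bar>l\<bar> \<bar>u\<bar>"
  have f: "continuous_on UNIV (f k)" for k unfolding f_def by (intro continuous_intros)
  have f0: "0 \<le> f k s" for k s by (simp add: f_def)
  have fs: "f k s = 0" if "\<bar>s\<bar> > M" for k s
  proof -
    have "min (s - l) (u - s) \<le> 0" using that by (auto simp: M_def)
    then have "real k * min (s - l) (u - s) \<le> 0" by (simp add: mult_nonneg_nonpos)
    then show ?thesis by (simp add: f_def)
  qed
  have [measurable]: "f k \<in> borel_measurable borel" for k
    using f by (rule borel_measurable_continuous_onI)
  have inc: "incseq f"
  proof (intro monoI le_funI)
    fix j k :: nat and s assume jk: "j \<le> k"
    show "f j s \<le> f k s"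
    proof (cases "min (s - l) (u - s) \<ge> 0")
      case True
      then have "real j * min (s - l) (u - s) \<le> real k * min (s - l) (u - s)"
        using jk by (intro mult_right_mono) auto
      then show ?thesis by (auto simp: f_def)
    next
      case False
      then have "min (s - l) (u - s) \<le> 0" by linarith
      then have "real j * min (s - l) (u - s) \<le> 0" by (intro mult_nonneg_nonpos) auto
      then show ?thesis by (simp add: f_def)
    qed
  qed
  have sup: "(SUP k. ennreal (f k s)) = indicator {l<..<u} s" for s
  proof (rule LIMSEQ_unique[OF LIMSEQ_SUP])
    show "incseq (\<lambda>k. ennreal (f k s))"
      using inc by (auto simp: incseq_def le_fun_def ennreal_leI)
    have "\<forall>\<^sub>F k in sequentially. ennreal (f k s) = indicator {l<..<u} s"
    proof (cases "l < s \<and> s < u")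
      case True
      then have d: "min (s - l) (u - s) > 0" by simp
      then obtain N :: nat where N: "real N * min (s - l) (u - s) > 1" using reals_Archimedean3 by blast
      have "f k s = 1" if "k \<ge> N" for k
      proof -
        have "real N * min (s - l) (u - s) \<le> real k * min (s - l) (u - s)"
          using that d by (intro mult_right_mono) auto
        with N have "real k * min (s - l) (u - s) > 1" by linarith
        then show ?thesis by (simp add: f_def)
      qed
      then show ?thesis using True by (auto simp: eventually_sequentially)
    next
      case False
      then have "min (s - l) (u - s) \<le> 0" by auto
      then have "real k * min (s - l) (u - s) \<le> 0" for k by (intro mult_nonneg_nonpos) auto
      then have "f k s = 0" for k unfolding f_def by (intro max_absorb1 min.coboundedI2)
      then show ?thesis using False by auto
    qed
    then show "(\<lambda>k. ennreal (f k s)) \<longlonglongrightarrow> indicator {l<..<u} s" by (rule tendsto_eventually)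
  qed
  have eq: "(\<integral>\<^sup>+s. ennreal (f k s) \<partial>?N) = (\<integral>\<^sup>+s. ennreal (f k s) \<partial>lborel)" for k
  proof -
    have i: "integrable lebesgue (\<lambda>x::'a. norm x powr - real DIM('a) * f k (ln (norm x)))"
      by (subst mult.commute) (rule log_radial_integrable[OF f fs])
    have m[measurable]: "(\<lambda>x::'a. f k (ln (norm x))) \<in> borel_measurable lebesgue" by measurable
    have i': "integrable cyl_measure (\<lambda>x::'a. f k (ln (norm x)))"
      using i by (simp add: integrable_cyl_measure_iff[OF m])
    have "(\<integral>\<^sup>+s. ennreal (f k s) \<partial>?N) = (\<integral>\<^sup>+x. ennreal (f k (ln (norm (x::'a)))) \<partial>cyl_measure)"
      by (subst nn_integral_distr) auto
    also have "\<dots> = ennreal (LINT x|cyl_measure. f k (ln (norm (x::'a))))"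
      using i' f0 by (intro nn_integral_eq_integral) auto
    also have "(LINT x|cyl_measure. f k (ln (norm (x::'a)))) = (LINT s|lborel. f k s)"
      using integral_cyl_measure[OF m] integral_log_radial_continuous[OF f fs, where 'a = 'a]
        sphere_const_pos[where 'a = 'a] by (simp add: mult.commute)
    also have "ennreal \<dots> = (\<integral>\<^sup>+s. ennreal (f k s) \<partial>lborel)"
      using f0 by (intro nn_integral_eq_integral[symmetric] integrable_continuous_compact_support(1)[OF f, of M]) (auto simp: fs)
    finally show ?thesis .
  qed
  have "emeasure ?N (box l u) = (\<integral>\<^sup>+s. indicator {l<..<u} s \<partial>?N)" by (simp add: box_real)
  also have "\<dots> = (\<integral>\<^sup>+s. (SUP k. ennreal (f k s)) \<partial>?N)" by (simp add: sup)
  also have "\<dots> = (SUP k. \<integral>\<^sup>+s. ennreal (f k s) \<partial>?N)"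
    using inc by (intro nn_integral_monotone_convergence_SUP) (auto simp: incseq_def le_fun_def ennreal_leI)
  also have "\<dots> = (SUP k. \<integral>\<^sup>+s. ennreal (f k s) \<partial>lborel)" by (simp add: eq)
  also have "\<dots> = (\<integral>\<^sup>+s. (SUP k. ennreal (f k s)) \<partial>lborel)"
    using inc by (intro nn_integral_monotone_convergence_SUP[symmetric]) (auto simp: incseq_def le_fun_def ennreal_leI)
  also have "\<dots> = emeasure lborel {l<..<u}" by (simp add: sup)
  also have "\<dots> = (\<Prod>b\<in>Basis. (u - l) \<bullet> b)" using lu by simp
  finally show "emeasure ?N (box l u) = (\<Prod>b\<in>Basis. (u - l) \<bullet> b)" .
qed simp

section \<open>A chain rule for primitives along a fibration\<close>

text \<open>Telescoping over a subdivision into equal steps shorter than \<delta>.\<close>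

lemma abs_diff_le_if_locally:
  fixes e m :: "real \<Rightarrow> real"
  assumes loc: "\<And>a b. \<alpha> \<le> a \<Longrightarrow> a \<le> b \<Longrightarrow> b \<le> \<beta> \<Longrightarrow> b - a < \<delta> \<Longrightarrow> \<bar>e b - e a\<bar> \<le> m b - m a"
    and \<delta>: "\<delta> > 0" and le: "\<alpha> \<le> \<beta>"
  shows "\<bar>e \<beta> - e \<alpha>\<bar> \<le> m \<beta> - m \<alpha>"
proof -
  obtain N :: nat where N: "(\<beta> - \<alpha>) / \<delta> < real N" using reals_Archimedean2 by blast
  have N0: "real N > 0" using N le \<delta> by (smt (verit) divide_nonneg_pos)
  define x where "x i = \<alpha> + real i * ((\<beta> - \<alpha>) / real N)" for i
  have st: "(\<beta> - \<alpha>) / real N < \<delta>" using N N0 \<delta> by (simp add: field_simps)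
  have "\<bar>e (x i) - e \<alpha>\<bar> \<le> m (x i) - m \<alpha>" if "i \<le> N" for i
    using that
  proof (induction i)
    case 0 then show ?case by (simp add: x_def)
  next
    case (Suc i)
    have "real (Suc i) * ((\<beta> - \<alpha>) / real N) \<le> real N * ((\<beta> - \<alpha>) / real N)"
      using Suc.prems le by (intro mult_right_mono) auto
    then have "x (Suc i) \<le> \<beta>" using N0 by (simp add: x_def)
    moreover have d: "x (Suc i) - x i = (\<beta> - \<alpha>) / real N" by (simp add: x_def distrib_right add_divide_distrib)
    moreover have "0 \<le> (\<beta> - \<alpha>) / real N" using le N0 by simp
    moreover have "\<alpha> \<le> x i" using le N0 by (simp add: x_def)
    ultimately have "\<bar>e (x (Suc i)) - e (x i)\<bar> \<le> m (x (Suc i)) - m (x i)"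
      using st by (intro loc) auto
    with Suc show ?case by linarith
  qed
  from this[of N] show ?thesis using N0 by (simp add: x_def)
qed

text \<open>Keeps of the cylinder only its projection to the axis. The fibres stand for spheres, but
  no measure on a single fibre is ever formed.\<close>

locale line_fibration =
  fixes M :: "'x measure" and l :: "'x \<Rightarrow> real"
  assumes l_measurable[measurable]: "l \<in> borel_measurable M"
    and distr_l: "distr M borel l = lborel"
begin

lemma integral_fibration:
  fixes F :: "real \<Rightarrow> real"
  assumes [measurable]: "F \<in> borel_measurable borel"
  shows "(LINT x|M. F (l x)) = (LINT s|lborel. F s)"
  unfolding distr_l[symmetric] by (rule integral_distr[symmetric]) auto

lemma integrable_fibration:
  fixes F :: "real \<Rightarrow> real"
  assumes [measurable]: "F \<in> borel_measurable borel"
  shows "integrable M (\<lambda>x. F (l x)) \<longleftrightarrow> integrable lborel F"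
  unfolding distr_l[symmetric] by (rule integrable_distr_eq[symmetric]) auto

lemma integral_interval:
  assumes "a \<le> b"
  shows "integrable M (\<lambda>x. indicat_real {a<..b} (l x))" "(LINT x|M. indicat_real {a<..b} (l x)) = b - a"
proof -
  have "integrable lborel (indicat_real {a<..b})"
    by (rule integrable_real_indicator) (use assms in auto)
  then show "integrable M (\<lambda>x. indicat_real {a<..b} (l x))" by (subst integrable_fibration) auto
  show "(LINT x|M. indicat_real {a<..b} (l x)) = b - a"
    using assms by (subst integral_fibration) auto
qed

end

lemma indicator_Ioc_split:
  fixes a b c x :: real
  assumes "a \<le> b" "b \<le> c"
  shows "indicat_real {a<..c} x = indicator {a<..b} x + indicator {b<..c} x"
  using assms by (auto simp: indicator_def)

text \<open>\<open>W_diff\<close> expresses in integrated form that the derivative of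
  \<open>W\<close> at \<open>s\<close> is the mean of \<open>K\<close> over the fibre
  \<open>l x = s\<close>. In this form neither fibre measures nor pointwise differentiability of
  \<open>W\<close> occur.\<close>

locale fibre_primitive = line_fibration +
  fixes K :: "'x \<Rightarrow> real" and W :: "real \<Rightarrow> real"
  assumes K_measurable[measurable]: "K \<in> borel_measurable M"
    and K_integrable: "\<And>a b. integrable M (\<lambda>x. indicator {a<..b} (l x) * K x)"
    and W_diff: "\<And>a b. a \<le> b \<Longrightarrow> W b - W a = (LINT x|M. indicator {a<..b} (l x) * K x)"
    and W_cont: "continuous_on UNIV W"
begin

lemma integrable_indicator_bounded_mult:
  assumes "continuous_on UNIV (g :: real \<Rightarrow> real)" and H: "integrable M (\<lambda>x. indicator {a<..b} (l x) * H x)"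
    and [measurable]: "H \<in> borel_measurable M"
  shows "integrable M (\<lambda>x. indicator {a<..b} (l x) * (g (l x) * H x))"
proof -
  have "compact (g ` {a..b})"
    by (intro compact_continuous_image continuous_on_subset[OF assms(1)]) auto
  then obtain B where "\<forall>s\<in>{a..b}. \<bar>g s\<bar> \<le> B"
    by (auto dest!: compact_imp_bounded simp: bounded_iff)
  then have B: "\<And>s. s \<in> {a..b} \<Longrightarrow> \<bar>g s\<bar> \<le> B" by blast
  have [measurable]: "g \<in> borel_measurable borel" using assms(1) by (rule borel_measurable_continuous_onI)
  show ?thesis
  proof (rule Bochner_Integration.integrable_bound[OF integrable_mult_right[OF H, of B]])
    show "AE x in M. norm (indicator {a<..b} (l x) * (g (l x) * H x)) \<le> norm (B * (indicator {a<..b} (l x) * H x))"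
    proof (intro always_eventually allI)
      fix x
      show "norm (indicator {a<..b} (l x) * (g (l x) * H x)) \<le> norm (B * (indicator {a<..b} (l x) * H x))"
        using B[of "l x"] by (auto simp: indicator_def abs_mult intro!: mult_right_mono)
    qed
  qed measurable
qed

lemma integrable_product_deriv:
  assumes "continuous_on UNIV (\<theta>0 :: real \<Rightarrow> real)" "continuous_on UNIV (\<theta>1 :: real \<Rightarrow> real)"
  shows "integrable M (\<lambda>x. indicator {a<..b} (l x) * (\<theta>0 (l x) + \<theta>1 (l x) * K x))"
proof -
  have "integrable M (\<lambda>x. indicator {a<..b} (l x) * (1::real))"
  proof (cases "a \<le> b")
    case True then show ?thesis using integral_interval(1)[OF True] by simp
  qed simp
  from integrable_indicator_bounded_mult[OF assms(1) this]
    integrable_indicator_bounded_mult[OF assms(2) K_integrable]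
  have "integrable M (\<lambda>x. indicator {a<..b} (l x) * (\<theta>0 (l x) * 1) + indicator {a<..b} (l x) * (\<theta>1 (l x) * K x))"
    by (intro Bochner_Integration.integrable_add) auto
  then show ?thesis by (simp add: distrib_left)
qed

text \<open>
  \<open>K\<close> need not be constant on the fibres of \<open>l\<close>; it plays the role of the derivative of \<open>W\<close>, which
  is only absolutely continuous. On short intervals the mean value theorem gives the identity up
  to a small multiple of the integral of \<open>1 + |K|\<close>.
\<close>

lemma chain_rule:
  assumes \<theta>: "\<And>s. (\<theta> has_real_derivative \<theta>' s) (at s)" "continuous_on UNIV \<theta>'"
    and \<Psi>: "\<And>y. (\<Psi> has_real_derivative \<Psi>' y) (at y)" "continuous_on UNIV \<Psi>'"
    and le: "\<alpha> \<le> \<beta>"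
  shows "\<theta> \<beta> * \<Psi> (W \<beta>) - \<theta> \<alpha> * \<Psi> (W \<alpha>) = (LINT x|M. indicator {\<alpha><..\<beta>} (l x) *
     (\<theta>' (l x) * \<Psi> (W (l x)) + \<theta> (l x) * \<Psi>' (W (l x)) * K x))"
proof -
  have c\<theta>: "continuous_on UNIV \<theta>" using \<theta>(1) by (meson DERIV_isCont continuous_at_imp_continuous_on)
  have c\<Psi>: "continuous_on UNIV \<Psi>" using \<Psi>(1) by (meson DERIV_isCont continuous_at_imp_continuous_on)
  have cA: "continuous_on UNIV (\<lambda>s. \<theta>' s * \<Psi> (W s))"
    by (intro continuous_intros \<theta>(2) continuous_on_compose2[OF c\<Psi> W_cont]) auto
  have cB: "continuous_on UNIV (\<lambda>s. \<theta> s * \<Psi>' (W s))"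
    by (intro continuous_intros c\<theta> continuous_on_compose2[OF \<Psi>(2) W_cont]) auto
  define g where "g x = \<theta>' (l x) * \<Psi> (W (l x)) + \<theta> (l x) * \<Psi>' (W (l x)) * K x" for x
  have gi: "integrable M (\<lambda>x. indicator {a<..b} (l x) * g x)" for a b
    unfolding g_def by (rule integrable_product_deriv[OF cA cB])
  \<comment> \<open>The local error is measured by increments of \<open>m\<close>: the summand 1
    pays for the term with \<theta>', and \<open>|K|\<close> pays for the term with \<Psi>'.\<close>
  define m where "m s = (LINT x|M. indicator {\<alpha><..s} (l x) * (1 + \<bar>K x\<bar>))" for s
  have mi: "integrable M (\<lambda>x. indicator {a<..b} (l x) * (1 + \<bar>K x\<bar>))" for a b
  proof -
    have "integrable M (\<lambda>x. indicator {a<..b} (l x) * (1 + 0 * K x) + \<bar>indicator {a<..b} (l x) * K x\<bar>)"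
      using integrable_product_deriv[of "\<lambda>s. 1" "\<lambda>s. 0" a b] K_integrable[of a b]
      by (intro Bochner_Integration.integrable_add integrable_abs) auto
    then show ?thesis by (simp add: distrib_left abs_mult)
  qed
  define e where "e s = \<theta> s * \<Psi> (W s) - (LINT x|M. indicator {\<alpha><..s} (l x) * g x)" for s
  have split: "(LINT x|M. indicator {\<alpha><..b} (l x) * H x) - (LINT x|M. indicator {\<alpha><..a} (l x) * H x)
     = (LINT x|M. indicator {a<..b} (l x) * H x)"
    if "\<And>a b. integrable M (\<lambda>x. indicator {a<..b} (l x) * H x)" "\<alpha> \<le> a" "a \<le> b" for H :: "'x \<Rightarrow> real" and a b
  proof -
    have "(LINT x|M. indicator {\<alpha><..b} (l x) * H x) =
      (LINT x|M. indicator {\<alpha><..a} (l x) * H x + indicator {a<..b} (l x) * H x)"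
      using that by (intro Bochner_Integration.integral_cong) (auto simp: indicator_Ioc_split[of \<alpha> a b] distrib_right)
    also have "\<dots> = (LINT x|M. indicator {\<alpha><..a} (l x) * H x) + (LINT x|M. indicator {a<..b} (l x) * H x)"
      by (intro Bochner_Integration.integral_add that)
    finally show ?thesis by simp
  qed
  have key: "\<bar>e \<beta> - e \<alpha>\<bar> \<le> \<epsilon> * (m \<beta> - m \<alpha>)" if \<epsilon>: "\<epsilon> > 0" for \<epsilon>
  proof -
    \<comment> \<open>Uniform continuity in two independent variables, because the two factors of
      each product will be evaluated at different points of a short interval.\<close>
    have "uniformly_continuous_on ({\<alpha>..\<beta>} \<times> {\<alpha>..\<beta>}) (\<lambda>(s, t). \<theta>' s * \<Psi> (W t))"
      unfolding case_prod_beta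
      by (intro compact_uniformly_continuous continuous_intros compact_Times continuous_on_compose2[OF \<theta>(2)]
         continuous_on_compose2[OF c\<Psi>] continuous_on_compose2[OF W_cont]) auto
    then obtain d1 where d1: "d1 > 0" "\<And>s t s' t'. s \<in> {\<alpha>..\<beta>} \<Longrightarrow> t \<in> {\<alpha>..\<beta>} \<Longrightarrow> s' \<in> {\<alpha>..\<beta>} \<Longrightarrow> t' \<in> {\<alpha>..\<beta>}
       \<Longrightarrow> dist (s', t') (s, t) < d1 \<Longrightarrow> \<bar>\<theta>' s' * \<Psi> (W t') - \<theta>' s * \<Psi> (W t)\<bar> < \<epsilon>"
      using \<epsilon> unfolding uniformly_continuous_on_def
      by (force simp: dist_real_def)
    have "uniformly_continuous_on ({\<alpha>..\<beta>} \<times> {\<alpha>..\<beta>}) (\<lambda>(s, t). \<theta> s * \<Psi>' (W t))"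
      unfolding case_prod_beta
      by (intro compact_uniformly_continuous continuous_intros compact_Times continuous_on_compose2[OF c\<theta>]
         continuous_on_compose2[OF \<Psi>(2)] continuous_on_compose2[OF W_cont]) auto
    then obtain d2 where d2: "d2 > 0" "\<And>s t s' t'. s \<in> {\<alpha>..\<beta>} \<Longrightarrow> t \<in> {\<alpha>..\<beta>} \<Longrightarrow> s' \<in> {\<alpha>..\<beta>} \<Longrightarrow> t' \<in> {\<alpha>..\<beta>}
       \<Longrightarrow> dist (s', t') (s, t) < d2 \<Longrightarrow> \<bar>\<theta> s' * \<Psi>' (W t') - \<theta> s * \<Psi>' (W t)\<bar> < \<epsilon>"
      using \<epsilon> unfolding uniformly_continuous_on_def
      by (force simp: dist_real_def)
    \<comment> \<open>Halved because the distance of two pairs is estimated by the sum of the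
      coordinate distances, which is at most \<open>2 * (b - a)\<close>.\<close>
    define \<delta> where "\<delta> = min d1 d2 / 2"
    have \<delta>: "\<delta> > 0" using d1 d2 by (simp add: \<delta>_def)
    have "\<bar>e \<beta> - e \<alpha>\<bar> \<le> \<epsilon> * m \<beta> - \<epsilon> * m \<alpha>"
    proof (rule abs_diff_le_if_locally[OF _ \<delta> le])
      fix a b assume ab: "\<alpha> \<le> a" "a \<le> b" "b \<le> \<beta>" "b - a < \<delta>"
      obtain \<xi> where \<xi>: "a \<le> \<xi>" "\<xi> \<le> b" "\<theta> b - \<theta> a = (b - a) * \<theta>' \<xi>"
      proof (cases "a = b")
        case True then show ?thesis using that[of a] by simp
      next
        case False then show ?thesis using MVT2[of a b \<theta> \<theta>'] \<theta>(1) ab that by (metis less_eq_real_def)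
      qed
      \<comment> \<open>The mean value theorem for \<Psi> gives a point \<open>y\<close> between two
        values of \<open>W\<close>. As \<open>W\<close> is only continuous, the intermediate value
        theorem is what places \<open>y\<close> at \<open>W c\<close> with \<open>c\<close> in the
        interval.\<close>
      obtain c where c: "a \<le> c" "c \<le> b" "\<Psi> (W b) - \<Psi> (W a) = (W b - W a) * \<Psi>' (W c)"
      proof -
        consider "W a = W b" | "W a < W b" | "W b < W a" by linarith
        then show ?thesis
        proof cases
          case 1 then show ?thesis using that[of a] ab by simp
        next
          case 2
          then obtain y where y: "W a < y" "y < W b" "\<Psi> (W b) - \<Psi> (W a) = (W b - W a) * \<Psi>' y"
            using MVT2[of "W a" "W b" \<Psi> \<Psi>'] \<Psi>(1) by blast
          then obtain c where "a \<le> c" "c \<le> b" "W c = y"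
            using IVT'[of W a y b] ab continuous_on_subset[OF W_cont] by (metis less_imp_le subset_UNIV)
          then show ?thesis using y that by blast
        next
          case 3
          then obtain y where y: "W b < y" "y < W a" "\<Psi> (W a) - \<Psi> (W b) = (W a - W b) * \<Psi>' y"
            using MVT2[of "W b" "W a" \<Psi> \<Psi>'] \<Psi>(1) by blast
          then obtain c where "a \<le> c" "c \<le> b" "W c = y"
            using IVT2'[of W b y a] ab continuous_on_subset[OF W_cont] by (metis less_imp_le subset_UNIV)
          then show ?thesis using y that[of c] by (simp add: algebra_simps)
        qed
      qed
      let ?A = "\<theta>' \<xi> * \<Psi> (W b)" and ?B = "\<theta> a * \<Psi>' (W c)"
      have ii: "integrable M (\<lambda>x. indicator {a<..b} (l x) * (?A + ?B * K x))"
        by (rule integrable_product_deriv) auto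
      have "\<theta> b * \<Psi> (W b) - \<theta> a * \<Psi> (W a) = (\<theta> b - \<theta> a) * \<Psi> (W b) + \<theta> a * (\<Psi> (W b) - \<Psi> (W a))"
        by (simp add: algebra_simps)
      also have "\<dots> = ?A * (b - a) + ?B * (W b - W a)" unfolding \<xi>(3) c(3) by (simp add: algebra_simps)
      also have "\<dots> = ?A * (LINT x|M. indicator {a<..b} (l x)) + ?B * (LINT x|M. indicator {a<..b} (l x) * K x)"
        using W_diff[OF ab(2)] integral_interval(2)[OF ab(2)] by simp
      also have "\<dots> = (LINT x|M. ?A * indicator {a<..b} (l x) + ?B * (indicator {a<..b} (l x) * K x))"
        using integral_interval(1)[OF ab(2)] K_integrable[of a b]
        by (subst Bochner_Integration.integral_add) auto
      also have "\<dots> = (LINT x|M. indicator {a<..b} (l x) * (?A + ?B * K x))"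
        by (intro Bochner_Integration.integral_cong) (auto simp: algebra_simps)
      finally have "e b - e a = (LINT x|M. indicator {a<..b} (l x) * (?A + ?B * K x)) - (LINT x|M. indicator {a<..b} (l x) * g x)"
        using split[OF gi ab(1,2)] by (simp add: e_def)
      also have "\<dots> = (LINT x|M. indicator {a<..b} (l x) * (?A + ?B * K x) - indicator {a<..b} (l x) * g x)"
        by (intro Bochner_Integration.integral_diff[symmetric] ii gi)
      finally have "\<bar>e b - e a\<bar> \<le> (LINT x|M. \<bar>indicator {a<..b} (l x) * (?A + ?B * K x) - indicator {a<..b} (l x) * g x\<bar>)"
        by (simp only: integral_abs_bound)
      also have "\<dots> \<le> (LINT x|M. \<epsilon> * (indicator {a<..b} (l x) * (1 + \<bar>K x\<bar>)))"
      proof (rule integral_mono)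
        fix x
        show "\<bar>indicator {a<..b} (l x) * (?A + ?B * K x) - indicator {a<..b} (l x) * g x\<bar>
          \<le> \<epsilon> * (indicator {a<..b} (l x) * (1 + \<bar>K x\<bar>))"
        proof (cases "l x \<in> {a<..b}")
          case True
          have dd: "dist (s', t') (l x, l x) < min d1 d2" if "s' \<in> {a..b}" "t' \<in> {a..b}" for s' t'
          proof -
            have "dist (s', t') (l x, l x) \<le> dist s' (l x) + dist t' (l x)"
              unfolding dist_Pair_Pair by (rule sqrt_sum_squares_le_sum) auto
            also have "\<dots> \<le> 2 * (b - a)" using that True by (auto simp: dist_real_def)
            also have "\<dots> < min d1 d2" using ab(4) by (simp add: \<delta>_def)
            finally show ?thesis .
          qed
          have 1: "\<bar>?A - \<theta>' (l x) * \<Psi> (W (l x))\<bar> < \<epsilon>"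
            using True ab \<xi> dd[of \<xi> b] by (intro d1(2)) auto
          have "\<bar>?B - \<theta> (l x) * \<Psi>' (W (l x))\<bar> < \<epsilon>"
            using True ab c dd[of a c] by (intro d2(2)) auto
          then have 2: "\<bar>(?B - \<theta> (l x) * \<Psi>' (W (l x))) * K x\<bar> \<le> \<epsilon> * \<bar>K x\<bar>"
            unfolding abs_mult by (intro mult_right_mono) auto
          have "?A + ?B * K x - g x = (?A - \<theta>' (l x) * \<Psi> (W (l x))) + (?B - \<theta> (l x) * \<Psi>' (W (l x))) * K x"
            by (simp add: g_def algebra_simps)
          then have "\<bar>?A + ?B * K x - g x\<bar> \<le> \<epsilon> + \<epsilon> * \<bar>K x\<bar>" using 1 2 by linarith
          then show ?thesis using True by (simp add: distrib_left)
        qed simp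
      qed (use ii gi mi in \<open>auto intro!: integrable_abs\<close>)
      also have "\<dots> = \<epsilon> * m b - \<epsilon> * m a"
        using split[OF mi ab(1,2)] by (simp add: m_def right_diff_distrib[symmetric])
      finally show "\<bar>e b - e a\<bar> \<le> \<epsilon> * m b - \<epsilon> * m a" .
    qed
    then show ?thesis by (simp add: right_diff_distrib)
  qed
  have "\<bar>e \<beta> - e \<alpha>\<bar> \<le> 0" using key by (rule nonpos_if_le_epsilon_mult)
  then show ?thesis by (simp add: e_def g_def)
qed

end

section \<open>Powers of absolute values\<close>

lemma abs_powr_has_derivative:
  fixes p :: real
  assumes "p > 1"
  shows "((\<lambda>y. \<bar>y\<bar> powr p) has_real_derivative p * (\<bar>y\<bar> powr (p - 1) * sgn y)) (at y)"
proof -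
  consider "y > 0" | "y < 0" | "y = 0" by linarith
  then show ?thesis
  proof cases
    case 1
    have "((\<lambda>y. y powr p) has_real_derivative p * (\<bar>y\<bar> powr (p - 1) * sgn y)) (at y)"
      using 1 by (auto intro!: derivative_eq_intros)
    then show ?thesis
      by (rule has_field_derivative_transform_within_open[where S = "{0<..}"]) (use 1 in auto)
  next
    case 2
    have "((\<lambda>y. (- y) powr p) has_real_derivative p * (\<bar>y\<bar> powr (p - 1) * sgn y)) (at y)"
      using 2 by (auto intro!: derivative_eq_intros)
    then show ?thesis
      by (rule has_field_derivative_transform_within_open[where S = "{..<0}"]) (use 2 in auto)
  next
    case 3
    have "((\<lambda>h. \<bar>h\<bar> powr p / h) \<longlongrightarrow> 0) (at (0::real))"
    proof (rule Lim_null_comparison)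
      show "\<forall>\<^sub>F h in at (0::real). norm (\<bar>h\<bar> powr p / h) \<le> \<bar>h\<bar> powr (p - 1)"
        unfolding eventually_at_filter
        by (intro always_eventually) (auto simp: abs_divide powr_diff)
      have "((\<lambda>h. \<bar>h\<bar> powr (p - 1)) \<longlongrightarrow> \<bar>0::real\<bar> powr (p - 1)) (at 0)"
        using assms by (intro tendsto_powr' tendsto_intros) auto
      then show "((\<lambda>h::real. \<bar>h\<bar> powr (p - 1)) \<longlongrightarrow> 0) (at 0)" by simp
    qed
    then show ?thesis using 3 by (simp add: DERIV_def)
  qed
qed

lemma continuous_abs_powr:
  fixes r :: real
  assumes "r > 0"
  shows "continuous_on UNIV (\<lambda>y. \<bar>y::real\<bar> powr r)"
  using assms by (intro continuous_on_powr' continuous_intros) auto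

lemma continuous_abs_powr_sgn:
  fixes r :: real
  assumes "r > 0"
  shows "continuous_on UNIV (\<lambda>y. \<bar>y::real\<bar> powr r * sgn y)"
proof (rule continuous_at_imp_continuous_on, rule ballI)
  fix y :: real
  show "isCont (\<lambda>y. \<bar>y\<bar> powr r * sgn y) y"
  proof (cases "y = 0")
    case True
    have "((\<lambda>h. \<bar>h\<bar> powr r * sgn h) \<longlongrightarrow> 0) (at (0::real))"
    proof (rule Lim_null_comparison)
      show "\<forall>\<^sub>F h in at (0::real). norm (\<bar>h\<bar> powr r * sgn h) \<le> \<bar>h\<bar> powr r"
        by (intro always_eventually) (auto simp: abs_mult abs_sgn_eq)
      have "((\<lambda>h. \<bar>h\<bar> powr r) \<longlongrightarrow> \<bar>0::real\<bar> powr r) (at 0)"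
        using assms by (intro tendsto_powr' tendsto_intros) auto
      then show "((\<lambda>h::real. \<bar>h\<bar> powr r) \<longlongrightarrow> 0) (at 0)" by simp
    qed
    then show ?thesis using True by (simp add: isCont_def)
  next
    case False
    then show ?thesis by (intro continuous_intros) auto
  qed
qed

section \<open>The extremal profile and its second variation\<close>

text \<open>Derivatives are recorded as the function times its logarithmic derivative, which is
  multiplied by the exponent under powers and adds up under products. The profile and its ground
  state are differentiated in this form.\<close>

lemma has_derivative_powr_log:
  fixes f :: "real \<Rightarrow> real"
  assumes "(f has_real_derivative f s * a) (at s)" "f s > 0"
  shows "((\<lambda>s. f s powr r) has_real_derivative f s powr r * (r * a)) (at s)"
  using assms by (auto intro!: derivative_eq_intros simp: powr_diff)

lemma has_derivative_mult_log:
  fixes f h :: "real \<Rightarrow> real"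
  assumes "(f has_real_derivative f s * a) (at s)" "(h has_real_derivative h s * b) (at s)"
  shows "((\<lambda>s. f s * h s) has_real_derivative (f s * h s) * (a + b)) (at s)"
  by (rule DERIV_cong[OF DERIV_mult[OF assms]]) (simp add: algebra_simps)

lemma integrable_exp_abs:
  fixes \<kappa> :: real
  assumes "\<kappa> > 0"
  shows "integrable lborel (\<lambda>s. exp (- \<kappa> * \<bar>s\<bar>))"
proof -
  define f where "f s = exp (- \<kappa> * s) * indicat_real {0..} s" for s
  have lim: "((\<lambda>s. - exp (- \<kappa> * s) / \<kappa>) \<longlongrightarrow> 0) at_top"
    using assms by real_asymp
  have "(\<integral>\<^sup>+s. ennreal (exp (- \<kappa> * s)) * indicator {0..} s \<partial>lborel) = ennreal (0 - (- exp (- \<kappa> * 0) / \<kappa>))"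
    using assms by (intro nn_integral_FTC_atLeast[OF _ _ _ lim])
      (auto intro!: derivative_eq_intros simp: field_simps)
  moreover have "ennreal (exp (- \<kappa> * s)) * indicator {0..} s = ennreal (norm (f s))" for s
    by (auto simp: f_def indicator_def)
  moreover have "f \<in> borel_measurable lborel"
    unfolding f_def[abs_def] by measurable
  ultimately have f: "integrable lborel f"
    by (intro integrableI_bounded) (auto simp: f_def)
  then have "integrable lborel (\<lambda>s. f (0 + (-1) * s))"
    by (intro lborel_integrable_real_affine) auto
  with f have "integrable lborel (\<lambda>s. f s + f (- s))" by simp
  then show ?thesis
    by (rule Bochner_Integration.integrable_bound) (auto simp: f_def indicator_def)
qed

lemma integral_deriv_line_eq_0:
  fixes F f :: "real \<Rightarrow> real"
  assumes F: "\<And>s. (F has_real_derivative f s) (at s)" and f: "continuous_on UNIV f" "integrable lborel f"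
    and lim: "(\<lambda>k. F (real k)) \<longlonglongrightarrow> 0" "(\<lambda>k. F (- real k)) \<longlonglongrightarrow> 0"
  shows "(LINT s|lborel. f s) = 0"
proof -
  have "(\<lambda>k. LINT s|lborel. f s * indicator {- real k..real k} s) \<longlonglongrightarrow> (LINT s|lborel. f s)"
  proof (rule integral_dominated_convergence[where w = "\<lambda>s. \<bar>f s\<bar>"])
    show "AE s in lborel. (\<lambda>k. f s * indicat_real {- real k..real k} s) \<longlonglongrightarrow> f s"
    proof (intro always_eventually allI)
      fix s
      obtain N :: nat where "\<bar>s\<bar> < real N" using reals_Archimedean2 by blast
      then have "\<forall>\<^sub>F k in sequentially. f s * indicat_real {- real k..real k} s = f s"
        unfolding eventually_sequentially by (intro exI[of _ N]) (auto simp: indicator_def)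
      then show "(\<lambda>k. f s * indicat_real {- real k..real k} s) \<longlonglongrightarrow> f s" by (rule tendsto_eventually)
    qed
  qed (use f in \<open>auto simp: indicator_def\<close>)
  moreover have "(LINT s|lborel. f s * indicator {- real k..real k} s) = F (real k) - F (- real k)" for k
    by (intro integral_FTC_Icc_real F) (use f in \<open>auto intro: continuous_on_interior\<close>)
  moreover have "(\<lambda>k. F (real k) - F (- real k)) \<longlonglongrightarrow> 0 - 0" by (intro tendsto_diff lim)
  ultimately show ?thesis by (simp add: LIMSEQ_unique)
qed

section \<open>Cut-off functions of class \<open>C\<^sup>1\<close>\<close>

definition cutoff :: "real \<Rightarrow> real \<Rightarrow> real" where "cutoff R s = (max 0 (1 - (s / R)\<^sup>2))\<^sup>2"
definition cutoff' :: "real \<Rightarrow> real \<Rightarrow> real" where "cutoff' R s = 2 * max 0 (1 - (s / R)\<^sup>2) * (- (2 * s / R\<^sup>2))"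

lemma max_0_square_deriv: "((\<lambda>y::real. (max 0 y)\<^sup>2) has_real_derivative 2 * max 0 y) (at y)"
proof -
  consider "y > 0" | "y < 0" | "y = 0" by linarith
  then show ?thesis
  proof cases
    case 1
    have "((\<lambda>y. y\<^sup>2) has_real_derivative 2 * max 0 y) (at y)" using 1 by (auto intro!: derivative_eq_intros)
    then show ?thesis
      by (rule has_field_derivative_transform_within_open[where S = "{0<..}"]) (use 1 in auto)
  next
    case 2
    have "((\<lambda>y. 0) has_real_derivative 2 * max 0 y) (at y)" using 2 by auto
    then show ?thesis
      by (rule has_field_derivative_transform_within_open[where S = "{..<0}"]) (use 2 in auto)
  next
    case 3
    have "((\<lambda>h::real. (max 0 h)\<^sup>2 / h) \<longlongrightarrow> 0) (at 0)"
    proof (rule Lim_null_comparison)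
      show "\<forall>\<^sub>F h in at (0::real). norm ((max 0 h)\<^sup>2 / h) \<le> \<bar>h\<bar>"
        by (intro always_eventually) (auto simp: max_def power2_eq_square)
      show "((\<lambda>h::real. \<bar>h\<bar>) \<longlongrightarrow> 0) (at 0)" by (intro tendsto_eq_intros) auto
    qed
    then show ?thesis using 3 by (simp add: DERIV_def)
  qed
qed

lemma cutoff_deriv: "R > 0 \<Longrightarrow> (cutoff R has_real_derivative cutoff' R s) (at s)"
proof -
  assume "R > 0"
  then have "((\<lambda>s. 1 - (s / R)\<^sup>2) has_real_derivative - (2 * s / R\<^sup>2)) (at s)"
    by (auto intro!: derivative_eq_intros simp: power2_eq_square)
  from DERIV_chain2[OF max_0_square_deriv this] show ?thesis
    by (simp add: cutoff_def[abs_def] cutoff'_def)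
qed

lemma continuous_cutoff: "R > 0 \<Longrightarrow> continuous_on A (cutoff R)" "R > 0 \<Longrightarrow> continuous_on A (cutoff' R)"
  unfolding cutoff_def cutoff'_def by (intro continuous_intros; simp)+

lemma cutoff_support: "R > 0 \<Longrightarrow> \<bar>s\<bar> > R \<Longrightarrow> cutoff R s = 0 \<and> cutoff' R s = 0"
proof -
  assume R: "R > 0" "\<bar>s\<bar> > R"
  then have "\<bar>s / R\<bar> > 1" by simp
  then have "(s / R)\<^sup>2 > 1" using abs_square_le_1[of "s / R"] by linarith
  then show ?thesis by (simp add: cutoff_def cutoff'_def)
qed

text \<open>The decay in \<open>R\<close> makes the cost of cutting off the ground state arbitrarily
  small.\<close>

lemma cutoff'_bound: "R > 0 \<Longrightarrow> (cutoff' R s)\<^sup>2 \<le> 16 / R\<^sup>2"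
proof -
  assume R: "R > 0"
  have "\<bar>cutoff' R s\<bar> \<le> 4 / R"
  proof (cases "\<bar>s\<bar> > R")
    case False
    have "\<bar>cutoff' R s\<bar> = 2 * max 0 (1 - (s / R)\<^sup>2) * (2 * \<bar>s\<bar> / R\<^sup>2)"
      by (simp add: cutoff'_def abs_mult)
    also have "\<dots> \<le> 2 * 1 * (2 * R / R\<^sup>2)" using False R by (intro mult_mono divide_right_mono) auto
    finally show ?thesis using R by (simp add: power2_eq_square)
  qed (use R cutoff_support in auto)
  then have "\<bar>cutoff' R s\<bar>\<^sup>2 \<le> (4 / R)\<^sup>2" by (rule power_mono) auto
  then show ?thesis by (simp add: power_divide)
qed

text \<open>Keeps the gain of the cut-off ground state bounded below independently of
  \<open>R\<close>.\<close>

lemma cutoff_mono: "R \<ge> 1 \<Longrightarrow> (cutoff 1 s)\<^sup>2 \<le> (cutoff R s)\<^sup>2"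
proof -
  assume R: "R \<ge> 1"
  then have R2: "1 \<le> R\<^sup>2" by (simp add: one_le_power)
  then have "s\<^sup>2 * 1 \<le> s\<^sup>2 * R\<^sup>2" by (rule mult_left_mono) simp
  then have "(s / R)\<^sup>2 \<le> s\<^sup>2" using R2 by (simp add: power_divide divide_le_eq)
  then show ?thesis unfolding cutoff_def by (intro power_mono max.mono) auto
qed

lemma integral_pos_continuous:
  fixes f :: "real \<Rightarrow> real"
  assumes "continuous_on UNIV f" "integrable lborel f" "\<And>s. f s \<ge> 0" "f a > 0"
  shows "(LINT s|lborel. f s) > 0"
proof -
  have "(LINT s|lborel. f s) \<ge> 0" using assms by (intro integral_nonneg_AE) auto
  moreover have "(LINT s|lborel. f s) \<noteq> 0"
  proof
    assume "(LINT s|lborel. f s) = 0"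
    then have ae: "AE s in lborel. f s = 0" using assms by (subst (asm) integral_nonneg_eq_0_iff_AE) auto
    have o: "open {s. f s > 0}" by (intro open_Collect_less continuous_intros assms)
    from ae have "AE s in lborel. s \<notin> {s. f s > 0}" by eventually_elim auto
    then have "AE s in lebesgue. s \<notin> {s. f s > 0}" by (rule AE_completion)
    then have "negligible {s. f s > 0}"
      using o by (simp add: negligible_iff_null_sets AE_iff_null_sets borel_open)
    then show False using open_not_negligible[OF o] assms(4) by blast
  qed
  ultimately show ?thesis by linarith
qed

text \<open>The algebraic core of \<open>profile_identity\<close>: the common factor
  \<open>B s\<close> is removed and \<open>G = T / p\<close>, so that every term is polynomial. Here
  \<open>e\<close> and \<open>e'\<close> are the values of the cut-off and of its derivative,
  \<open>(p - 1) G\<close> is \<open>g\<close>, and the coefficient of the last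
  \<open>e\<^sup>2\<close> is \<open>threshold - N\<close>.\<close>

lemma profile_polynomial:
  fixes p e' e k t N G :: real
  shows "(p - 1) * (e' + e * (k * G - (k + 1) * t))\<^sup>2 + N * e\<^sup>2 - (p * (k + 1) - 1) * ((k + 1) * (p - 1) * (t * (p * G - t)) * e\<^sup>2)
    = 2 * e * e' * ((p - 1) * (k * G - (k + 1) * t)) + e\<^sup>2 * ((p - 1) * ((p * ((p - 1) * G - t)
        + (p - 2) * (k * (p * G - t)) + 2 * (k * (G - t))) * (k * G - (k + 1) * t)
        - ((k + 1) * (t * (k * (p * G - t)))))) + (p - 1) * e'\<^sup>2
      - (((p - 1) * G)\<^sup>2 * k * ((k + 1) * (p - 1) + 1) - N) * e\<^sup>2"
  by algebra

text \<open>
  The Euler--Lagrange equation has the conserved Hamiltonian \<open>g w z - z powr p' / p' - w powr q / q\<close>, with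
  \<open>z = (g w - w') powr (p - 1)\<close>. On its zero level \<open>t = (g w - w') / w\<close> solves the logistic equation
  \<open>t' = k t (T - t)\<close>, and \<open>w\<close> is a function of \<open>t\<close>.
\<close>

locale bliss_profile =
  fixes p q g :: real
  assumes p: "1 < p" and pq: "p < q" and g: "0 < g"
begin

text \<open>With \<open>z = (t w) powr (p - 1)\<close> the zero level, divided by
  \<open>w powr p\<close>, reads
  \<open>w powr (q - p) = q t powr (p - 1) (g - (p - 1) t / p)\<close>. Its zero in \<open>t\<close>
  is \<open>T\<close>, and solving for \<open>w\<close> gives the formula below. The choice
  \<open>t 0 = T / 2\<close> fixes the translation.\<close>

definition k where "k = (q - p) / p"
definition T where "T = p * g / (p - 1)"
definition t where "t s = T / (1 + exp (- (k * T) * s))"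
definition w where "w s = ((q * (p - 1) / p) * (t s powr (p - 1) * (T - t s))) powr (1 / (q - p))"

lemma k_pos: "k > 0" and T_pos: "T > 0" using p pq g by (auto simp: k_def T_def)

lemma q_eq: "q = p * (k + 1)" and T_eq: "(p - 1) * T = p * g"
  using p by (auto simp: k_def T_def field_simps)

lemma q_ratio: "q * (p - 1) / p = (k + 1) * (p - 1)"
  using p by (simp add: k_def field_simps)

lemma t_pos: "0 < t s" and t_less: "t s < T" and t_compl: "T - t s = T / (1 + exp (k * T * s))"
proof -
  have 1: "1 + exp x > 0" for x :: real by (simp add: add_pos_pos)
  show "0 < t s" using T_pos 1 by (simp add: t_def)
  show "t s < T" using T_pos 1 by (simp add: t_def divide_less_eq)
  have "exp (k * T * s) * exp (- (k * T) * s) = 1" by (simp add: exp_minus_inverse)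
  then show "T - t s = T / (1 + exp (k * T * s))"
    using 1[of "- (k * T) * s"] 1[of "k * T * s"] by (simp add: t_def field_simps)
qed

lemma t_deriv: "(t has_real_derivative t s * (k * (T - t s))) (at s)"
proof -
  have 1: "1 + exp x > 0" for x :: real by (simp add: add_pos_pos)
  have "(t has_real_derivative T * (k * T * exp (- (k * T) * s)) / (1 + exp (- (k * T) * s))\<^sup>2) (at s)"
    unfolding t_def[abs_def] using 1[of "- (k * T) * s"]
    by (auto intro!: derivative_eq_intros simp: power2_eq_square)
  moreover have "T - t s = T * exp (- (k * T) * s) / (1 + exp (- (k * T) * s))"
    using 1[of "- (k * T) * s"] by (simp add: t_def field_simps)
  moreover have "T * (k * T * E) / (1 + E)\<^sup>2 = T / (1 + E) * (k * (T * E / (1 + E)))" for E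
    by (simp add: power2_eq_square)
  ultimately show ?thesis by (simp only: t_def)
qed

lemma compl_deriv: "((\<lambda>s. T - t s) has_real_derivative (T - t s) * (- k * t s)) (at s)"
  by (rule DERIV_cong[OF DERIV_diff[OF DERIV_const t_deriv]]) (simp add: algebra_simps)

lemma continuous_t: "continuous_on A t"
  using t_deriv by (meson DERIV_isCont continuous_at_imp_continuous_on)

lemma w_pos: "w s > 0"
  using p pq t_pos[of s] t_less[of s] by (simp add: w_def)

lemma w_powr: "w s powr (q - p) = (q * (p - 1) / p) * (t s powr (p - 1) * (T - t s))"
  using p pq t_pos[of s] t_less[of s] by (simp add: w_def powr_powr)

text \<open>Equivalently \<open>g w - w' = t w\<close>, so \<open>t w\<close> is the quantity whose
  \<open>p\<close>-th power the energy of the profile integrates.\<close>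

lemma w_deriv: "(w has_real_derivative w s * (g - t s)) (at s)"
proof -
  have c: "((\<lambda>s. q * (p - 1) / p) has_real_derivative (q * (p - 1) / p) * 0) (at s)" by simp
  have tp: "((\<lambda>s. t s powr (p - 1)) has_real_derivative t s powr (p - 1) * ((p - 1) * (k * (T - t s)))) (at s)"
    by (rule has_derivative_powr_log[OF t_deriv t_pos])
  have pos: "(q * (p - 1) / p) * (t s powr (p - 1) * (T - t s)) > 0"
    using p pq t_pos[of s] t_less[of s] by simp
  \<comment> \<open>This forces the constants: the bracket is \<open>k ((p - 1) T - p t)\<close>,
    and it has to be \<open>(q - p) (g - t)\<close>.\<close>
  have e: "1 / (q - p) * (0 + ((p - 1) * (k * (T - t s)) + - k * t s)) = g - t s"
  proof -
    have "(p - 1) * (k * (T - t s)) + - k * t s = k * ((p - 1) * T - p * t s)" by (simp add: algebra_simps)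
    also have "\<dots> = (q - p) * (g - t s)" unfolding T_eq using p by (simp add: k_def field_simps)
    finally show ?thesis using pq by simp
  qed
  have "(w has_real_derivative w s * (1 / (q - p) * (0 + ((p - 1) * (k * (T - t s)) + - k * t s)))) (at s)"
    unfolding w_def[abs_def]
    by (rule has_derivative_powr_log[OF has_derivative_mult_log[OF c has_derivative_mult_log[OF tp compl_deriv]] pos])
  then show ?thesis by (simp only: e)
qed

lemma continuous_w: "continuous_on A w"
  using w_deriv by (meson DERIV_isCont continuous_at_imp_continuous_on)

lemma w_exp_bound:
  obtains C \<kappa> where "C > 0" "\<kappa> > 0" "\<And>s. w s \<le> C * exp (- \<kappa> * \<bar>s\<bar>)"
proof -
  let ?c = "q * (p - 1) / p"
  \<comment> \<open>For \<open>s \<ge> 0\<close> the factor \<open>T - t\<close> decays at rate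
    \<open>k T\<close>, for \<open>s < 0\<close> the factor \<open>t powr (p - 1)\<close> decays at
    rate \<open>k T (p - 1)\<close>; \<open>a\<close> is the slower of the two.\<close>
  define a where "a = k * T * min 1 (p - 1)"
  have a: "a > 0" using k_pos T_pos p by (simp add: a_def)
  have c: "?c > 0" using p pq by simp
  have bd: "t s powr (p - 1) * (T - t s) \<le> T powr p * exp (- a * \<bar>s\<bar>)" for s
  proof -
    have Tp: "T powr (p - 1) * T = T powr p" using T_pos by (simp add: powr_diff)
    show ?thesis
    proof (cases "s \<ge> 0")
      case True
      have "T - t s \<le> T / exp (k * T * s)"
        unfolding t_compl using T_pos by (intro divide_left_mono) (auto simp: add_pos_pos)
      also have "\<dots> = T * exp (- (k * T * s))" by (simp add: exp_minus divide_inverse)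
      also have "\<dots> \<le> T * exp (- a * \<bar>s\<bar>)"
      proof -
        have "(k * T * s) * min 1 (p - 1) \<le> (k * T * s) * 1"
          using True T_pos k_pos by (intro mult_left_mono) auto
        then show ?thesis using True T_pos by (simp add: a_def mult_ac)
      qed
      finally have "t s powr (p - 1) * (T - t s) \<le> T powr (p - 1) * (T * exp (- a * \<bar>s\<bar>))"
        using t_pos[of s] t_less[of s] p by (intro mult_mono powr_mono2) auto
      then show ?thesis using Tp by (simp add: mult.assoc[symmetric])
    next
      case False
      have "t s \<le> T / exp (- (k * T) * s)"
        unfolding t_def using T_pos by (intro divide_left_mono) (auto simp: add_pos_pos)
      also have "\<dots> = T * exp (k * T * s)" by (simp add: exp_minus divide_inverse)
      finally have "t s powr (p - 1) \<le> (T * exp (k * T * s)) powr (p - 1)"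
        using t_pos[of s] p by (intro powr_mono2) auto
      also have "\<dots> = T powr (p - 1) * exp ((k * T * s) * (p - 1))"
        using T_pos by (simp add: powr_mult exp_powr_real)
      also have "\<dots> \<le> T powr (p - 1) * exp (- a * \<bar>s\<bar>)"
      proof -
        have "(k * T) * (- s) * min 1 (p - 1) \<le> (k * T) * (- s) * (p - 1)"
          using False T_pos k_pos by (intro mult_left_mono) (auto intro!: mult_nonneg_nonpos)
        moreover have "(k * T * s) * (p - 1) = - ((k * T) * (- s) * (p - 1))" by simp
        moreover have "- a * \<bar>s\<bar> = - ((k * T) * (- s) * min 1 (p - 1))" using False by (simp add: a_def)
        ultimately have "(k * T * s) * (p - 1) \<le> - a * \<bar>s\<bar>" by linarith
        then show ?thesis by (intro mult_left_mono) auto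
      qed
      finally have "t s powr (p - 1) * (T - t s) \<le> (T powr (p - 1) * exp (- a * \<bar>s\<bar>)) * T"
        using t_pos[of s] t_less[of s] by (intro mult_mono) auto
      also have "\<dots> = T powr p * exp (- a * \<bar>s\<bar>)" by (simp only: Tp[symmetric] mult_ac)
      finally show ?thesis .
    qed
  qed
  have "w s \<le> (?c * T powr p) powr (1 / (q - p)) * exp (- (a / (q - p)) * \<bar>s\<bar>)" for s
  proof -
    have "w s \<le> (?c * (T powr p * exp (- a * \<bar>s\<bar>))) powr (1 / (q - p))"
      unfolding w_def using p pq t_pos[of s] t_less[of s]
      by (intro powr_mono2 mult_left_mono bd) (auto intro!: divide_nonneg_pos mult_nonneg_nonneg)
    also have "\<dots> = (?c * T powr p) powr (1 / (q - p)) * exp ((- a * \<bar>s\<bar>) * (1 / (q - p)))"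
    proof -
      have aux: "(C * (X * exp y)) powr r = (C * X) powr r * exp (y * r)" if "C > 0" "X > 0" for C X y r :: real
        using that by (simp add: powr_mult exp_powr_real)
      show ?thesis by (rule aux[OF c]) (use T_pos in simp)
    qed
    also have "(- a * \<bar>s\<bar>) * (1 / (q - p)) = - (a / (q - p)) * \<bar>s\<bar>" by simp
    finally show ?thesis .
  qed
  moreover have "(?c * T powr p) powr (1 / (q - p)) > 0" using p pq T_pos by simp
  moreover have "a / (q - p) > 0" using a pq by simp
  ultimately show ?thesis using that by blast
qed

lemma w_powr_bound:
  assumes "r > 0"
  obtains C \<kappa> where "C > 0" "\<kappa> > 0" "\<And>s. w s powr r \<le> C * exp (- \<kappa> * \<bar>s\<bar>)"
proof -
  obtain C \<kappa> where C: "C > 0" "\<kappa> > 0" "\<And>s. w s \<le> C * exp (- \<kappa> * \<bar>s\<bar>)" using w_exp_bound by blast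
  have "w s powr r \<le> C powr r * exp (- (\<kappa> * r) * \<bar>s\<bar>)" for s
  proof -
    have "w s powr r \<le> (C * exp (- \<kappa> * \<bar>s\<bar>)) powr r"
      using assms C(3) w_pos[of s] by (intro powr_mono2) auto
    also have "\<dots> = C powr r * exp (- (\<kappa> * r) * \<bar>s\<bar>)"
      using C by (simp add: powr_mult exp_powr_real mult_ac)
    finally show ?thesis .
  qed
  moreover have "C powr r > 0" "\<kappa> * r > 0" using C assms by auto
  ultimately show ?thesis using that by blast
qed

lemma continuous_w_powr: "continuous_on A (\<lambda>s. w s powr r)"
  using w_pos by (intro continuous_intros continuous_w) (metis less_irrefl)

lemma continuous_t_powr: "continuous_on A (\<lambda>s. t s powr r)"
  using t_pos by (intro continuous_intros continuous_t) (metis less_irrefl)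

lemma integrable_w_powr_mult:
  fixes b :: "real \<Rightarrow> real"
  assumes r: "r > 0" and b: "continuous_on UNIV b" "\<And>s. \<bar>b s\<bar> \<le> B"
  shows "integrable lborel (\<lambda>s. w s powr r * b s)"
proof -
  obtain C \<kappa> where C: "C > 0" "\<kappa> > 0" "\<And>s. w s powr r \<le> C * exp (- \<kappa> * \<bar>s\<bar>)"
    using w_powr_bound[OF r] by blast
  show ?thesis
  proof (rule Bochner_Integration.integrable_bound[OF integrable_mult_right[OF integrable_exp_abs[OF C(2)], of "B * C"]])
    show "(\<lambda>s. w s powr r * b s) \<in> borel_measurable lborel"
      using borel_measurable_continuous_onI[OF continuous_on_mult[OF continuous_w_powr b(1)]] by simp
    show "AE s in lborel. norm (w s powr r * b s) \<le> norm (B * C * exp (- \<kappa> * \<bar>s\<bar>))"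
    proof (intro always_eventually allI)
      fix s
      have B: "B \<ge> 0" using b(2)[of s] by linarith
      have "w s powr r * \<bar>b s\<bar> \<le> (C * exp (- \<kappa> * \<bar>s\<bar>)) * B" by (intro mult_mono C(3) b(2)) (use C in auto)
      then show "norm (w s powr r * b s) \<le> norm (B * C * exp (- \<kappa> * \<bar>s\<bar>))"
        using C B by (simp add: abs_mult mult_ac)
    qed
  qed
qed

lemma integrable_w_powr: "r > 0 \<Longrightarrow> integrable lborel (\<lambda>s. w s powr r)"
  using integrable_w_powr_mult[of r "\<lambda>s. 1" 1] by simp

definition Q0 where "Q0 = (LINT s|lborel. w s powr q)"

lemma Q0_pos: "Q0 > 0"
  unfolding Q0_def using w_pos[of 0] p pq
  by (intro integral_pos_continuous[where a = 0] continuous_w_powr integrable_w_powr) auto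

lemma w_powr_q: "w s powr q = w s powr p * ((q * (p - 1) / p) * (t s powr (p - 1) * (T - t s)))"
  using w_powr[of s] powr_add[of "w s" p "q - p"] by simp

lemma t_powr_bounded: "r \<ge> 0 \<Longrightarrow> \<bar>t s powr r\<bar> \<le> T powr r"
  using t_pos[of s] t_less[of s] by (simp add: powr_mono2)

text \<open>The Euler-Lagrange equation tested with \<open>w\<close>: the function
  \<open>t powr (p - 1) * w powr p\<close> has derivative \<open>w powr q - (t w) powr p\<close> and
  vanishes at both ends. Hence the one-dimensional quotient of \<open>w\<close> is
  \<open>Q0 powr (1 - p / q)\<close>.\<close>

lemma energy_eq: "(LINT s|lborel. (t s * w s) powr p) = Q0"
proof -
  have tw: "(t s * w s) powr p = w s powr p * t s powr p" for s
    using t_pos[of s] w_pos[of s] by (simp add: powr_mult)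
  have i1: "integrable lborel (\<lambda>s. (t s * w s) powr p)"
    unfolding tw using p t_powr_bounded
    by (intro integrable_w_powr_mult[where B = "T powr p"] continuous_t_powr) auto
  have i2: "integrable lborel (\<lambda>s. w s powr q)" using p pq by (intro integrable_w_powr) auto
  define V where "V s = t s powr (p - 1) * w s powr p" for s
  have "(LINT s|lborel. w s powr q - (t s * w s) powr p) = 0"
  proof (rule integral_deriv_line_eq_0)
    show "(V has_real_derivative w s powr q - (t s * w s) powr p) (at s)" for s
    proof -
      have "(V has_real_derivative V s * ((p - 1) * (k * (T - t s)) + p * (g - t s))) (at s)"
        unfolding V_def[abs_def]
        by (intro has_derivative_mult_log has_derivative_powr_log t_deriv t_pos w_deriv w_pos)
      moreover have "t s powr p = t s powr (p - 1) * t s" using t_pos[of s] by (simp add: powr_diff)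
      then have "w s powr q - (t s * w s) powr p = V s * ((q * (p - 1) / p) * (T - t s) - t s)"
        unfolding tw w_powr_q V_def by (simp add: algebra_simps)
      moreover have "(q * (p - 1) / p) * (T - t s) - t s = (p - 1) * (k * (T - t s)) + p * (g - t s)"
        unfolding q_ratio using T_eq by (simp add: algebra_simps)
      ultimately show ?thesis by simp
    qed
    show "continuous_on UNIV (\<lambda>s. w s powr q - (t s * w s) powr p)"
      unfolding tw by (intro continuous_intros continuous_w_powr continuous_t_powr)
    obtain C \<kappa> where C: "C > 0" "\<kappa> > 0" "\<And>s. w s powr p \<le> C * exp (- \<kappa> * \<bar>s\<bar>)"
      using w_powr_bound[of p] p by auto
    have Vb: "\<bar>V s\<bar> \<le> T powr (p - 1) * C * exp (- \<kappa> * \<bar>s\<bar>)" for s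
    proof -
      have "t s powr (p - 1) * w s powr p \<le> T powr (p - 1) * (C * exp (- \<kappa> * \<bar>s\<bar>))"
        using p t_pos[of s] t_less[of s] C by (intro mult_mono powr_mono2) auto
      then show ?thesis by (simp add: V_def abs_mult mult.assoc)
    qed
    have lim: "(\<lambda>k::nat. T powr (p - 1) * C * exp (- \<kappa> * \<bar>real k\<bar>)) \<longlonglongrightarrow> 0"
      using C(2) by real_asymp
    show "(\<lambda>k. V (real k)) \<longlonglongrightarrow> 0"
    proof (rule Lim_null_comparison[OF always_eventually lim], intro allI)
      show "norm (V (real j)) \<le> T powr (p - 1) * C * exp (- \<kappa> * \<bar>real j\<bar>)" for j
        using Vb[of "real j"] by simp
    qed
    show "(\<lambda>k. V (- real k)) \<longlonglongrightarrow> 0"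
    proof (rule Lim_null_comparison[OF always_eventually lim], intro allI)
      show "norm (V (- real j)) \<le> T powr (p - 1) * C * exp (- \<kappa> * \<bar>real j\<bar>)" for j
        using Vb[of "- real j"] by simp
    qed
  qed (use i1 i2 in auto)
  then show ?thesis using i1 i2 by (simp add: Q0_def)
qed

text \<open>
  \<open>w m\<close> is the ground state of the second variation, with eigenvalue \<open>- threshold\<close> with respect to
  the weight \<open>(t w) powr (p - 2)\<close>.
\<close>

definition m where "m s = t s powr (1 / p) * (T - t s) powr (1 - 1 / p)"
text \<open>The square of the ground state \<open>w m\<close> times the weight
  \<open>(t w) powr (p - 2)\<close>.\<close>

definition B where "B s = w s powr p * (t s powr (p - 2) * (m s)\<^sup>2)"
text \<open>This is \<open>((w m)' - g w m) / (w m)\<close>: the logarithmic derivative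
  \<open>k (T / p - t)\<close> of \<open>m\<close> minus \<open>t\<close>.\<close>

definition slope where "slope s = k * T / p - (k + 1) * t s"
text \<open>Equal to \<open>g\<^sup>2 (q - p) (q + p') / (p + p')\<close> for the conjugate exponent
  \<open>p'\<close>.\<close>

definition threshold where "threshold = g\<^sup>2 * k * ((k + 1) * (p - 1) + 1)"

lemma m_pos: "m s > 0" using t_pos[of s] t_less[of s] by (simp add: m_def)

lemma m_deriv: "(m has_real_derivative m s * (k * (T / p - t s))) (at s)"
proof -
  have "(m has_real_derivative m s * (1 / p * (k * (T - t s)) + (1 - 1 / p) * (- k * t s))) (at s)"
    unfolding m_def[abs_def] using t_less[of s]
    by (intro has_derivative_mult_log has_derivative_powr_log t_deriv t_pos compl_deriv) auto
  moreover have "1 / p * (k * (T - t s)) + (1 - 1 / p) * (- k * t s) = k * (T / p - t s)"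
    by (simp add: algebra_simps)
  ultimately show ?thesis by simp
qed

lemma continuous_m: "continuous_on A m"
  using m_deriv by (meson DERIV_isCont continuous_at_imp_continuous_on)

lemma B_pos: "B s > 0" using w_pos[of s] t_pos[of s] m_pos[of s] by (simp add: B_def)

lemma continuous_B: "continuous_on A B"
  unfolding B_def by (intro continuous_intros continuous_w_powr continuous_t_powr continuous_m)

text \<open>For \<open>p < 2\<close> the factor \<open>t powr (p - 2)\<close> blows up at minus
  infinity. The factor \<open>t powr (2 / p)\<close> contained in \<open>m\<^sup>2\<close>
  compensates it, because \<open>p - 2 + 2 / p = ((p - 1)\<^sup>2 + 1) / p\<close> is
  positive.\<close>

lemma integrable_B: "integrable lborel B"
  unfolding B_def[abs_def]
proof (rule integrable_w_powr_mult)
  show "continuous_on UNIV (\<lambda>s. t s powr (p - 2) * (m s)\<^sup>2)"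
    by (intro continuous_intros continuous_t_powr continuous_m)
  show "\<bar>t s powr (p - 2) * (m s)\<^sup>2\<bar> \<le> T powr (p - 2 + 2 / p) * T powr (2 - 2 / p)" for s
  proof -
    have "(m s)\<^sup>2 = t s powr (2 / p) * (T - t s) powr (2 - 2 / p)"
      using t_pos[of s] t_less[of s]
      by (simp add: m_def power_mult_distrib powr_realpow[symmetric] powr_powr left_diff_distrib)
    then have "t s powr (p - 2) * (m s)\<^sup>2 = t s powr (p - 2 + 2 / p) * (T - t s) powr (2 - 2 / p)"
      by (simp add: powr_add mult.assoc)
    moreover have "p - 2 + 2 / p \<ge> 0"
    proof -
      have "p * (p - 2 + 2 / p) = (p - 1)\<^sup>2 + 1" using p by (simp add: field_simps power2_eq_square)
      then have "p * (p - 2 + 2 / p) > 0" by (simp add: add_nonneg_pos)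
      then show ?thesis using p by (simp add: zero_less_mult_iff)
    qed
    moreover have "2 - 2 / p \<ge> 0" using p by (simp add: field_simps)
    ultimately show ?thesis
      using t_pos[of s] t_less[of s] by (simp add: mult_mono powr_mono2)
  qed
qed (use p in auto)

text \<open>Jacobi's substitution: for a direction written as a cut-off times the ground state the
  potential disappears. With \<open>Z = (p - 1) B slope\<close> the first bracket is the derivative
  of \<open>\<eta>\<^sup>2 Z\<close> and integrates to 0, so only the cost of the cut-off and the
  gain \<open>threshold - N\<close> remain.\<close>

lemma profile_identity:
  fixes \<eta> \<eta>' N :: real
  shows "(p - 1) * B s * (\<eta>' + \<eta> * slope s)\<^sup>2 + N * B s * \<eta>\<^sup>2 - (q - 1) * (w s powr q * (\<eta> * m s)\<^sup>2)
    = (2 * \<eta> * \<eta>' * ((p - 1) * (B s * slope s)) + \<eta>\<^sup>2 * ((p - 1) * (B s * (p * (g - t s) + (p - 2) * (k * (T - t s)) + 2 * (k * (T / p - t s))) * slope s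
        - B s * ((k + 1) * (t s * (k * (T - t s)))))))
      + (p - 1) * (B s * \<eta>'\<^sup>2) - (threshold - N) * (B s * \<eta>\<^sup>2)"
proof -
  define G where "G = T / p"
  have TG: "T = p * G" using p by (simp add: G_def)
  have "p * g = p * ((p - 1) * G)" using T_eq by (simp add: TG algebra_simps)
  then have gG: "g = (p - 1) * G" using p by simp
  have sl: "slope s = k * G - (k + 1) * t s" using p by (simp add: slope_def TG)
  have "t s powr (p - 1) = t s powr (p - 2) * t s" using t_pos[of s] powr_add[of "t s" "p - 2" 1] by simp
  moreover note q_ratio
  ultimately have wq: "w s powr q * (\<eta> * m s)\<^sup>2 = B s * ((k + 1) * (p - 1) * (t s * (T - t s)) * \<eta>\<^sup>2)"
    unfolding w_powr_q B_def by (simp add: power_mult_distrib mult_ac)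
  have gT: "(p - 1) * G = g" "p * G = T" "k * G - (k + 1) * t s = slope s"     by (simp only: gG[symmetric], simp only: TG, simp only: sl)
  have "(p - 1) * (\<eta>' + \<eta> * slope s)\<^sup>2 + N * \<eta>\<^sup>2 - (p * (k + 1) - 1) * ((k + 1) * (p - 1) * (t s * (T - t s)) * \<eta>\<^sup>2)
    = 2 * \<eta> * \<eta>' * ((p - 1) * slope s) + \<eta>\<^sup>2 * ((p - 1) * ((p * (g - t s) + (p - 2) * (k * (T - t s)) + 2 * (k * (G - t s))) * slope s
        - ((k + 1) * (t s * (k * (T - t s)))))) + (p - 1) * \<eta>'\<^sup>2 - (threshold - N) * \<eta>\<^sup>2"
    unfolding threshold_def by (rule profile_polynomial[where G = G, of p \<eta>' \<eta> k "t s" N, unfolded gT])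
  then have "B s * ((p - 1) * (\<eta>' + \<eta> * slope s)\<^sup>2 + N * \<eta>\<^sup>2 - (p * (k + 1) - 1) * ((k + 1) * (p - 1) * (t s * (T - t s)) * \<eta>\<^sup>2))
    = B s * (2 * \<eta> * \<eta>' * ((p - 1) * slope s) + \<eta>\<^sup>2 * ((p - 1) * ((p * (g - t s) + (p - 2) * (k * (T - t s)) + 2 * (k * (T / p - t s))) * slope s
        - ((k + 1) * (t s * (k * (T - t s)))))) + (p - 1) * \<eta>'\<^sup>2 - (threshold - N) * \<eta>\<^sup>2)"
    by (simp only: G_def)
  then show ?thesis unfolding wq q_eq[symmetric] by (simp add: algebra_simps)
qed

text \<open>Meant for \<open>N = n - 1\<close>. After integration of \<open>profile_identity\<close>
  the sign is decided by the integral of \<open>B \<eta>'\<^sup>2\<close>, which is of order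
  \<open>1 / R\<^sup>2\<close>, against that of \<open>B \<eta>\<^sup>2\<close>, which is bounded
  below.\<close>

lemma unstable_direction:
  assumes N: "N < threshold"
  obtains \<mu> \<mu>' L where "\<And>s. (\<mu> has_real_derivative \<mu>' s) (at s)" "continuous_on UNIV \<mu>'" 
    "\<And>s. \<bar>s\<bar> > L \<Longrightarrow> \<mu> s = 0 \<and> \<mu>' s = 0"
    "(LINT s|lborel. (t s * w s) powr p * ((p - 1) * (\<mu> s - \<mu>' s / t s)\<^sup>2 + N * (\<mu> s / t s)\<^sup>2))
      < (q - 1) * (LINT s|lborel. w s powr q * (\<mu> s)\<^sup>2)"
proof -
  define c1 where "c1 = (LINT s|lborel. B s * (cutoff 1 s)\<^sup>2)"
  define IB where "IB = (LINT s|lborel. B s)"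
  have cs: "integrable lborel f" if "continuous_on UNIV f" "\<And>s. \<bar>s\<bar> > R \<Longrightarrow> f s = 0" for f :: "real \<Rightarrow> real" and R
    by (rule integrable_continuous_compact_support[OF that(1), of R]) (use that in auto)
  have iB: "integrable lborel (\<lambda>s. B s * (cutoff R s)\<^sup>2)" "integrable lborel (\<lambda>s. B s * (cutoff' R s)\<^sup>2)" if "R > 0" for R
    using that cutoff_support by (intro cs[of _ R] continuous_intros continuous_B continuous_cutoff; auto)+
  have c1: "c1 > 0" unfolding c1_def
  proof (rule integral_pos_continuous[where a = 0])
    show "continuous_on UNIV (\<lambda>s. B s * (cutoff 1 s)\<^sup>2)"
      by (intro continuous_intros continuous_B continuous_cutoff) simp
    show "B s * (cutoff 1 s)\<^sup>2 \<ge> 0" for s using B_pos[of s] by simp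
    show "B 0 * (cutoff 1 0)\<^sup>2 > 0" using B_pos[of 0] by (simp add: cutoff_def)
  qed (rule iB, simp)
  have IB: "IB \<ge> 0" unfolding IB_def using B_pos by (intro integral_nonneg_AE) (auto intro: less_imp_le)
  \<comment> \<open>Solved from \<open>16 (p - 1) IB / R < (threshold - N) c1\<close>. The summand 1
    gives the strict inequality and also \<open>R \<ge> 1\<close>, which \<open>cutoff_mono\<close>
    requires.\<close>
  define R where "R = 1 + 16 * (p - 1) * IB / ((threshold - N) * c1)"
  have R: "R \<ge> 1" using p N c1 IB by (simp add: R_def)
  have R2: "16 * (p - 1) * IB < R * ((threshold - N) * c1)"
  proof -
    have "R * ((threshold - N) * c1) = (threshold - N) * c1 + 16 * (p - 1) * IB"
      unfolding R_def distrib_right using N c1 by simp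
    then show ?thesis using N c1 by simp
  qed
  define \<eta> where "\<eta> = cutoff R"
  define \<eta>' where "\<eta>' = cutoff' R"
  have \<eta>: "(\<eta> has_real_derivative \<eta>' s) (at s)" "\<bar>s\<bar> > R \<Longrightarrow> \<eta> s = 0 \<and> \<eta>' s = 0" for s
    unfolding \<eta>_def \<eta>'_def using R by (auto intro!: cutoff_deriv simp: cutoff_support)
  have c\<eta>: "continuous_on UNIV \<eta>" "continuous_on UNIV \<eta>'"
    unfolding \<eta>_def \<eta>'_def using R by (intro continuous_cutoff; simp)+
  define Z where "Z s = (p - 1) * (B s * slope s)" for s
  define b where "b s = p * (g - t s) + (p - 2) * (k * (T - t s)) + 2 * (k * (T / p - t s))" for s
  define Z' where "Z' s = (p - 1) * (B s * b s * slope s - B s * ((k + 1) * (t s * (k * (T - t s)))))" for s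
  have Z: "(Z has_real_derivative Z' s) (at s)" for s
  proof -
    have m2: "((\<lambda>s. (m s)\<^sup>2) has_real_derivative (m s)\<^sup>2 * (2 * (k * (T / p - t s)))) (at s)"
      by (auto intro!: derivative_eq_intros m_deriv simp: power2_eq_square)
    have "(B has_real_derivative B s * (p * (g - t s) + ((p - 2) * (k * (T - t s)) + 2 * (k * (T / p - t s))))) (at s)"
      unfolding B_def[abs_def]
      by (intro has_derivative_mult_log has_derivative_powr_log t_deriv t_pos w_deriv w_pos m2)
    then have "(B has_real_derivative B s * b s) (at s)" by (simp add: b_def add.assoc)
    moreover have "(slope has_real_derivative - ((k + 1) * (t s * (k * (T - t s))))) (at s)"
      unfolding slope_def[abs_def] by (auto intro!: derivative_eq_intros t_deriv)
    ultimately show ?thesis unfolding Z_def[abs_def] Z'_def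
      by (auto intro!: derivative_eq_intros simp: algebra_simps)
  qed
  have cZ: "continuous_on UNIV Z" "continuous_on UNIV Z'" "continuous_on UNIV slope"
    unfolding Z_def Z'_def b_def slope_def using p by (intro continuous_intros continuous_B continuous_t; simp)+
  define D where "D s = 2 * \<eta> s * \<eta>' s * Z s + (\<eta> s)\<^sup>2 * Z' s" for s
  have cD: "continuous_on UNIV D" unfolding D_def by (intro continuous_intros c\<eta> cZ)
  have iD: "integrable lborel D" by (rule cs[of _ R, OF cD]) (simp add: D_def \<eta>(2))
  have D0: "(LINT s|lborel. D s) = 0"
  proof -
    have "((\<lambda>s. (\<eta> s)\<^sup>2 * Z s) has_real_derivative D s) (at s)" for s
      unfolding D_def by (auto intro!: derivative_eq_intros \<eta> Z simp: power2_eq_square)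
    \<comment> \<open>At \<open>R + 1\<close> rather than \<open>R\<close>, because the vanishing of
      \<eta> is recorded only for \<open>|s| > R\<close>.\<close>
    from integral_deriv_compact_support[OF this cD, of "R + 1"] show ?thesis
      using R \<eta>(2) by (simp add: D_def)
  qed
  define \<mu> where "\<mu> s = \<eta> s * m s" for s
  define \<mu>' where "\<mu>' s = m s * (\<eta>' s + \<eta> s * (k * (T / p - t s)))" for s
  have \<mu>: "(\<mu> has_real_derivative \<mu>' s) (at s)" for s
    unfolding \<mu>_def[abs_def] \<mu>'_def by (rule DERIV_cong[OF DERIV_mult[OF \<eta>(1) m_deriv]]) (simp add: algebra_simps)
  have c\<mu>: "continuous_on UNIV \<mu>" "continuous_on UNIV \<mu>'"
    unfolding \<mu>_def \<mu>'_def using p by (intro continuous_intros c\<eta> continuous_m continuous_t; simp)+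
  have supp: "\<mu> s = 0 \<and> \<mu>' s = 0" if "\<bar>s\<bar> > R" for s using \<eta>(2)[OF that] by (simp add: \<mu>_def \<mu>'_def)
  \<comment> \<open>Rests on \<open>\<mu> - \<mu>' / t = - m (\<eta>' + \<eta> slope) / t\<close>,
    which explains the form of \<open>slope\<close>.\<close>
  have quad: "(t s * w s) powr p * ((p - 1) * (\<mu> s - \<mu>' s / t s)\<^sup>2 + N * (\<mu> s / t s)\<^sup>2)
     = (p - 1) * B s * (\<eta>' s + \<eta> s * slope s)\<^sup>2 + N * B s * (\<eta> s)\<^sup>2" for s
  proof -
    have "\<mu> s - \<mu>' s / t s = - (m s * (\<eta>' s + \<eta> s * slope s)) / t s"
      using t_pos[of s] p by (simp add: \<mu>_def \<mu>'_def slope_def field_simps)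
    then have 1: "(\<mu> s - \<mu>' s / t s)\<^sup>2 = (m s)\<^sup>2 * (\<eta>' s + \<eta> s * slope s)\<^sup>2 / (t s)\<^sup>2"
      by (simp add: power_divide power_mult_distrib)
    have 2: "(\<mu> s / t s)\<^sup>2 = (m s)\<^sup>2 * (\<eta> s)\<^sup>2 / (t s)\<^sup>2" by (simp add: \<mu>_def power_divide power_mult_distrib)
    have 3: "(t s * w s) powr p = w s powr p * (t s powr (p - 2) * (t s)\<^sup>2)"
      using t_pos[of s] w_pos[of s] powr_add[of "t s" "p - 2" 2] by (simp add: powr_mult powr_numeral)
    show ?thesis unfolding 1 2 3 B_def using t_pos[of s] by (simp add: field_simps)
  qed
  have i1: "integrable lborel (\<lambda>s. (p - 1) * B s * (\<eta>' s + \<eta> s * slope s)\<^sup>2 + N * B s * (\<eta> s)\<^sup>2)"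
    by (rule cs[of _ R]) (auto intro!: continuous_intros continuous_B c\<eta> cZ simp: \<eta>(2))
  have i2: "integrable lborel (\<lambda>s. w s powr q * (\<mu> s)\<^sup>2)"
    by (rule cs[of _ R]) (auto intro!: continuous_intros continuous_w_powr c\<mu> simp: supp)
  have R0: "R > 0" using R by simp
  have ib1: "integrable lborel (\<lambda>s. B s * (\<eta>' s)\<^sup>2)" and ib2: "integrable lborel (\<lambda>s. B s * (\<eta> s)\<^sup>2)"
    using iB[OF R0] by (auto simp: \<eta>_def \<eta>'_def)
  have "(LINT s|lborel. (t s * w s) powr p * ((p - 1) * (\<mu> s - \<mu>' s / t s)\<^sup>2 + N * (\<mu> s / t s)\<^sup>2))
      - (q - 1) * (LINT s|lborel. w s powr q * (\<mu> s)\<^sup>2)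
    = (LINT s|lborel. ((p - 1) * B s * (\<eta>' s + \<eta> s * slope s)\<^sup>2 + N * B s * (\<eta> s)\<^sup>2) - (q - 1) * (w s powr q * (\<mu> s)\<^sup>2))"
    unfolding quad using i1 i2 by simp
  also have "\<dots> = (LINT s|lborel. D s + (p - 1) * (B s * (\<eta>' s)\<^sup>2) - (threshold - N) * (B s * (\<eta> s)\<^sup>2))"
    unfolding \<mu>_def profile_identity by (simp add: D_def Z_def Z'_def b_def)
  also have "\<dots> = (p - 1) * (LINT s|lborel. B s * (\<eta>' s)\<^sup>2) - (threshold - N) * (LINT s|lborel. B s * (\<eta> s)\<^sup>2)"
    using iD ib1 ib2 D0 by simp
  also have "\<dots> < 0"
  proof -
    have "(LINT s|lborel. B s * (\<eta>' s)\<^sup>2) \<le> (LINT s|lborel. B s * (16 / R\<^sup>2))"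
      using ib1 integrable_B B_pos R0 by (intro integral_mono mult_left_mono) (auto simp: \<eta>'_def cutoff'_bound less_imp_le)
    also have "\<dots> = 16 * IB / R\<^sup>2" by (simp add: IB_def)
    also have "\<dots> \<le> 16 * IB / R" using R IB by (intro divide_left_mono) (auto simp: power2_eq_square)
    finally have "(p - 1) * (LINT s|lborel. B s * (\<eta>' s)\<^sup>2) \<le> (p - 1) * (16 * IB / R)"
      using p by (intro mult_left_mono) auto
    also have "\<dots> < (threshold - N) * c1" using R2 R0 by (simp add: field_simps)
    also have "c1 \<le> (LINT s|lborel. B s * (\<eta> s)\<^sup>2)"
      unfolding c1_def \<eta>_def using iB[OF R0] iB[of 1] R
      by (intro integral_mono mult_left_mono cutoff_mono) (auto simp: less_imp_le[OF B_pos])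
    then have "(threshold - N) * c1 \<le> (threshold - N) * (LINT s|lborel. B s * (\<eta> s)\<^sup>2)"
      using N by (intro mult_left_mono) auto
    finally show ?thesis by simp
  qed
  finally show ?thesis using that[OF \<mu> c\<mu>(2) supp] by simp
qed

end

section \<open>The Bliss inequality\<close>

text \<open>A half-line has infinite measure, so an integrable function cannot stay above
  \<open>e\<close> on it. In this way boundary terms become small at suitable points, without
  pointwise decay.\<close>

lemma exists_small_value:
  fixes f :: "real \<Rightarrow> real"
  assumes int: "integrable lborel f" and nn: "\<And>s. f s \<ge> 0" and e: "e > 0"
  shows "\<exists>s\<ge>N. f s < e" "\<exists>s\<le>N. f s < e"
proof -
  have *: "\<exists>s\<in>A. f s < e" if A: "A \<in> sets lborel" "emeasure lborel A = \<infinity>" for A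
  proof (rule ccontr)
    assume "\<not> ?thesis"
    then have ge: "\<And>s. s \<in> A \<Longrightarrow> e \<le> f s" by force
    have "integrable lborel (\<lambda>s. e * indicat_real A s)"
      by (rule Bochner_Integration.integrable_bound[OF int])
        (use A ge e nn in \<open>auto simp: indicator_def\<close>)
    then have "integrable lborel (indicat_real A)" using e by simp
    then have "emeasure lborel A < \<infinity>" using A by (simp add: integrable_indicator_iff)
    with A show False by simp
  qed
  have inf: "emeasure lborel A = \<infinity>"
    if "A \<in> sets lborel" "\<And>j::nat. {c j..c j + real j} \<subseteq> A" for A and c :: "nat \<Rightarrow> real"
  proof (rule ccontr)
    assume "emeasure lborel A \<noteq> \<infinity>"
    then obtain j :: nat where j: "emeasure lborel A < of_nat j"
      using ennreal_Ex_less_of_nat by (auto simp: less_top)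
    have "of_nat j = emeasure lborel {c j..c j + real j}" by (simp add: ennreal_of_nat_eq_real_of_nat)
    also have "\<dots> \<le> emeasure lborel A" using that by (intro emeasure_mono)
    finally show False using j by simp
  qed
  show "\<exists>s\<ge>N. f s < e" using *[of "{N..}"] inf[of "{N..}" "\<lambda>j. N"] by auto
  show "\<exists>s\<le>N. f s < e" using *[of "{..N}"] inf[of "{..N}" "\<lambda>j. N - real j"] by auto
qed

section \<open>Monotone transport on the line\<close>

definition cdf_of :: "(real \<Rightarrow> real) \<Rightarrow> real \<Rightarrow> real" where
  "cdf_of f s = (LINT x|lborel. f x * indicator {..s} x)"

context
  fixes f :: "real \<Rightarrow> real"
  assumes cont: "continuous_on UNIV f" and int: "integrable lborel f" and pos: "\<And>s. f s > 0"
begin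

lemma cdf_of_integrable: "A \<in> sets borel \<Longrightarrow> integrable lborel (\<lambda>x. f x * indicator A x)"
  using integrable_mult_indicator[of A lborel f] int by (simp add: mult.commute)

lemma cdf_of_deriv: "(cdf_of f has_real_derivative f s) (at s)"
proof -
  obtain G where G: "\<And>s. (G has_real_derivative f s) (at s)" using has_derivative_antiderivative[OF cont] by blast
  have le: "cdf_of f b - cdf_of f a = G b - G a" if "a \<le> b" for a b
  proof -
    have "cdf_of f b = (LINT x|lborel. f x * indicator {..a} x + f x * indicator {a<..b} x)"
      unfolding cdf_of_def using that by (intro Bochner_Integration.integral_cong) (auto simp: indicator_def)
    also have "\<dots> = cdf_of f a + (LINT x|lborel. f x * indicator {a<..b} x)"
      unfolding cdf_of_def by (intro Bochner_Integration.integral_add cdf_of_integrable) auto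
    also have "(LINT x|lborel. f x * indicator {a<..b} x) = (LINT x|lborel. f x * indicator {a..b} x)"
    proof (rule integral_cong_AE)
      show "AE x in lborel. f x * indicat_real {a<..b} x = f x * indicat_real {a..b} x"
        using AE_lborel_singleton[of a] by eventually_elim (auto simp: indicator_def)
    qed (use cdf_of_integrable[of "{a<..b}"] cdf_of_integrable[of "{a..b}"] in auto)
    also have "\<dots> = G b - G a"
      by (intro integral_FTC_Icc_real that G) (use cont in \<open>auto intro: continuous_on_interior\<close>)
    finally show ?thesis by simp
  qed
  define C where "C = cdf_of f 0 - G 0"
  have "cdf_of f x = G x + C" for x
    using le[of 0 x] le[of x 0] by (cases "x \<ge> 0") (auto simp: C_def)
  then have eq: "cdf_of f = (\<lambda>x. G x + C)" by (rule ext)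
  show ?thesis unfolding eq by (auto intro!: derivative_eq_intros G)
qed

lemma cdf_of_strict_mono: "a < b \<Longrightarrow> cdf_of f a < cdf_of f b"
  using DERIV_pos_imp_increasing[of a b "cdf_of f"] cdf_of_deriv pos by blast

lemma cdf_of_bounds: "0 < cdf_of f s" "cdf_of f s < (LINT x|lborel. f x)"
proof -
  have nn: "0 \<le> cdf_of f s" for s unfolding cdf_of_def
    using pos by (intro integral_nonneg_AE) (auto simp: less_imp_le)
  have le: "cdf_of f s \<le> (LINT x|lborel. f x)" for s unfolding cdf_of_def
    using pos int cdf_of_integrable[of "{..s}"] by (intro integral_mono) (auto simp: indicator_def less_imp_le)
  show "0 < cdf_of f s" using nn[of "s - 1"] cdf_of_strict_mono[of "s - 1" s] by simp
  show "cdf_of f s < (LINT x|lborel. f x)" using le[of "s + 1"] cdf_of_strict_mono[of s "s + 1"] by simp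
qed

lemma cdf_of_surj:
  assumes "0 < y" "y < (LINT x|lborel. f x)"
  obtains s where "cdf_of f s = y"
proof -
  have "(\<lambda>k. cdf_of f (real k)) \<longlonglongrightarrow> (LINT x|lborel. f x)" unfolding cdf_of_def
  proof (rule integral_dominated_convergence[where w = f])
    show "AE x in lborel. (\<lambda>k. f x * indicat_real {..real k} x) \<longlonglongrightarrow> f x"
    proof (intro always_eventually allI)
      fix x
      obtain N :: nat where "x < real N" using reals_Archimedean2 by blast
      then have "\<forall>\<^sub>F k in sequentially. f x * indicat_real {..real k} x = f x"
        unfolding eventually_sequentially by (intro exI[of _ N]) (auto simp: indicator_def)
      then show "(\<lambda>k. f x * indicat_real {..real k} x) \<longlonglongrightarrow> f x" by (rule tendsto_eventually)
    qed
  qed (use int pos cdf_of_integrable in \<open>auto simp: indicator_def less_imp_le\<close>)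
  from order_tendstoD(1)[OF this assms(2)] obtain k1 where k1: "y < cdf_of f (real k1)"
    by (auto simp: eventually_sequentially)
  have "(\<lambda>k. cdf_of f (- real k)) \<longlonglongrightarrow> (LINT x|(lborel :: real measure). 0 :: real)" unfolding cdf_of_def
  proof (rule integral_dominated_convergence[where w = f and f = "\<lambda>_. 0"])
    show "AE x in lborel. (\<lambda>k. f x * indicat_real {..- real k} x) \<longlonglongrightarrow> 0"
    proof (intro always_eventually allI)
      fix x
      obtain N :: nat where "- x < real N" using reals_Archimedean2 by blast
      then have "\<forall>\<^sub>F k in sequentially. f x * indicat_real {..- real k} x = 0"
        unfolding eventually_sequentially by (intro exI[of _ N]) (auto simp: indicator_def)
      then show "(\<lambda>k. f x * indicat_real {..- real k} x) \<longlonglongrightarrow> 0" by (rule tendsto_eventually)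
    qed
  qed (use int pos cdf_of_integrable in \<open>auto simp: indicator_def less_imp_le\<close>)
  then have "\<forall>\<^sub>F k in sequentially. cdf_of f (- real k) < y" using assms(1) by (auto dest: order_tendstoD(2))
  then obtain k2 where k2: "cdf_of f (- real k2) < y" by (auto simp: eventually_sequentially)
  have "\<exists>s\<ge>- real k2. s \<le> real k1 \<and> cdf_of f s = y"
    by (rule IVT') (use k1 k2 cdf_of_deriv in \<open>auto intro!: continuous_at_imp_continuous_on DERIV_isCont\<close>)
  then show ?thesis using that by blast
qed

end

text \<open>The map is the distribution function of \<open>f\<close> followed by the inverse of that
  of \<open>f0\<close>. Positivity of \<open>f0\<close> makes the inverse differentiable, and equal
  total masses make the composition defined everywhere.\<close>

lemma monotone_transport:
  fixes f f0 :: "real \<Rightarrow> real"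
  assumes f: "continuous_on UNIV f" "integrable lborel f" "\<And>s. f s > 0"
    and f0: "continuous_on UNIV f0" "integrable lborel f0" "\<And>s. f0 s > 0"
    and eq: "(LINT x|lborel. f x) = (LINT x|lborel. f0 x)"
  obtains \<sigma> where "\<And>s. (\<sigma> has_real_derivative f s / f0 (\<sigma> s)) (at s)"
proof -
  note F = cdf_of_deriv[OF f] cdf_of_strict_mono[OF f] cdf_of_bounds[OF f] cdf_of_surj[OF f]
  note F0 = cdf_of_deriv[OF f0] cdf_of_strict_mono[OF f0] cdf_of_bounds[OF f0] cdf_of_surj[OF f0]
  have inj: "inj (cdf_of f0)" by (rule injI) (metis F0(2) less_irrefl linorder_neqE)
  define h where "h = inv (cdf_of f0)"
  have h: "h (cdf_of f0 z) = z" for z unfolding h_def using inj by simp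
  define \<sigma> where "\<sigma> s = h (cdf_of f s)" for s
  have "(\<sigma> has_real_derivative f s / f0 (\<sigma> s)) (at s)" for s
  proof -
    define y where "y = cdf_of f s"
    have y: "0 < y" "y < (LINT x|lborel. f0 x)" unfolding y_def using F(3,4) eq by auto
    obtain z where z: "cdf_of f0 z = y" using F0(5)[OF y] .
    have "isCont h (cdf_of f0 z)"
      by (rule isCont_inverse_function2[of "z - 1" z "z + 1"]) (use h F0(1) in \<open>auto intro: DERIV_isCont\<close>)
    then have hc: "isCont h y" by (simp add: z)
    have hi: "cdf_of f0 (h v) = v" if "0 < v" "v < (LINT x|lborel. f0 x)" for v
      using F0(5)[OF that] h by metis
    have "(h has_real_derivative inverse (f0 (h y))) (at y)"
      by (rule DERIV_inverse_function[OF F0(1) _ y hi hc]) (use f0(3)[of "h y"] in auto)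
    from DERIV_chain2[OF this[unfolded y_def] F(1)] show ?thesis
      by (simp add: \<sigma>_def[abs_def] divide_inverse mult.commute)
  qed
  then show ?thesis using that by blast
qed

lemma young_powr:
  fixes a b p :: real
  assumes "p > 1" "a \<ge> 0" "b \<ge> 0"
  shows "p * (a powr (p - 1) * b) \<le> (p - 1) * a powr p + b powr p"
proof (cases "a = 0 \<or> b = 0")
  case True
  then show ?thesis using assms by auto
next
  case False
  have "(a powr p) powr ((p - 1) / p) * (b powr p) powr (1 / p) \<le> (p - 1) / p * a powr p + 1 / p * b powr p"
    using assms False by (intro Youngs_inequality_0) (auto simp: field_simps)
  moreover have "(a powr p) powr ((p - 1) / p) * (b powr p) powr (1 / p) = a powr (p - 1) * b"
    using assms False by (simp add: powr_powr)
  ultimately show ?thesis using assms by (simp add: field_simps)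
qed

lemma abs_powr_mult_sgn: "\<bar>y\<bar> powr (p - 1) * sgn y * y = \<bar>y\<bar> powr p" for y p :: real
proof (cases "y = 0")
  case False
  then have "\<bar>y\<bar> powr p = \<bar>y\<bar> powr (p - 1) * \<bar>y\<bar>" by (simp add: powr_diff)
  then show ?thesis by (simp add: mult.assoc sgn_mult_self_eq abs_sgn mult.commute)
qed simp

context bliss_profile
begin

text \<open>The weights \<open>1 - p / q\<close> and \<open>p / q\<close> are chosen so that the
  powers of \<open>x\<close> cancel. This is the pointwise minimization over \<open>x\<close>, which
  will be the value of \<open>w\<close> at the transported point.\<close>

lemma weighted_am_gm:
  assumes "A \<ge> 0" "x > 0" "\<nu> > 0"
  shows "k * \<nu> * (A powr (q + p) * x powr - p) + x powr (q - p) * A powr p \<ge> (q / p) * (\<nu> powr (1 - p / q) * A powr q)"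
proof (cases "A = 0")
  case True
  then show ?thesis using p pq by simp
next
  case False
  then have A: "A > 0" using assms by simp
  let ?a = "\<nu> * (A powr (q + p) * x powr - p)" and ?b = "x powr (q - p) * A powr p"
  let ?\<alpha> = "1 - p / q" and ?\<beta> = "p / q"
  have "?a powr ?\<alpha> * ?b powr ?\<beta> \<le> ?\<alpha> * ?a + ?\<beta> * ?b"
    using A assms p pq by (intro Youngs_inequality_0) (auto simp: field_simps)
  moreover have "?a powr ?\<alpha> * ?b powr ?\<beta> = \<nu> powr ?\<alpha> * A powr q"
  proof -
    have "?a powr ?\<alpha> * ?b powr ?\<beta> = \<nu> powr ?\<alpha> * (A powr ((q + p) * ?\<alpha>) * A powr (p * ?\<beta>)) * (x powr (- p * ?\<alpha>) * x powr ((q - p) * ?\<beta>))"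
      using A assms by (simp add: powr_mult powr_powr)
    moreover have "(q + p) * ?\<alpha> + p * ?\<beta> = q" using p pq by (simp add: field_simps)
    moreover have "- p * ?\<alpha> + (q - p) * ?\<beta> = 0" using p pq by (simp add: field_simps)
    ultimately show ?thesis using A assms by (simp only: powr_add[symmetric]) simp
  qed
  ultimately have "(q / p) * (\<nu> powr ?\<alpha> * A powr q) \<le> (q / p) * (?\<alpha> * ?a + ?\<beta> * ?b)"
    using p pq by (intro mult_left_mono) auto
  also have "\<dots> = k * ?a + ?b"
  proof -
    have "q / p * ?\<alpha> = k" "q / p * ?\<beta> = 1" using p pq by (auto simp: k_def field_simps)
    then show ?thesis by (simp add: distrib_left mult.assoc[symmetric])
  qed
  finally show ?thesis by (simp add: mult.assoc)
qed

end

text \<open>\<open>K x - g * W (l x)\<close> is the counterpart of \<open>W' - g W\<close> before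
  averaging over the fibres. All estimates of the energy are made pointwise on \<open>M\<close>, so
  averages of \<open>K\<close> never have to be compared with averages of its powers.\<close>

locale bliss_setting = bliss_profile p q g + fibre_primitive M l K W
  for p q g :: real and M :: "'x measure" and l K W +
  assumes W_p: "integrable lborel (\<lambda>s. \<bar>W s\<bar> powr p)"
    and KW_p: "integrable M (\<lambda>x. \<bar>K x - g * W (l x)\<bar> powr p)"
begin

lemma Wl_measurable[measurable]: "W \<in> borel_measurable borel" "(\<lambda>x. W (l x)) \<in> borel_measurable M"
proof -
  show "W \<in> borel_measurable borel" using W_cont by (rule borel_measurable_continuous_onI)
  then show "(\<lambda>x. W (l x)) \<in> borel_measurable M" by measurable
qed

lemma W_p': "integrable M (\<lambda>x. \<bar>W (l x)\<bar> powr p)"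
  using W_p by (subst integrable_fibration) auto

text \<open>The derivative of \<open>|W| powr p\<close> is
  \<open>p |W| powr (p - 1) sgn W K\<close>. Splitting \<open>K\<close> into \<open>K - g W\<close>
  and \<open>g W\<close> and applying Young's inequality bounds it by the integrable
  \<open>?H\<close>; the integration starts at a point where \<open>|W|\<close> is below 1.\<close>

lemma W_powr_bounded:
  obtains C where "\<And>s. \<bar>W s\<bar> powr p \<le> C"
proof -
  let ?H = "\<lambda>x. (p - 1 + p * g) * \<bar>W (l x)\<bar> powr p + \<bar>K x - g * W (l x)\<bar> powr p"
  have Hi: "integrable M ?H" using W_p' KW_p by simp
  have "\<bar>W s\<bar> powr p \<le> 1 + (LINT x|M. ?H x)" for s
  proof -
    obtain a where a: "a \<le> s" "\<bar>W a\<bar> powr p < 1"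
      using exists_small_value(2)[OF W_p, of 1 s] by auto
    have "1 * \<bar>W s\<bar> powr p - 1 * \<bar>W a\<bar> powr p = (LINT x|M. indicator {a<..s} (l x) *
        (0 * \<bar>W (l x)\<bar> powr p + 1 * (p * (\<bar>W (l x)\<bar> powr (p - 1) * sgn (W (l x)))) * K x))"
      using p a by (intro chain_rule[OF _ _ abs_powr_has_derivative])
        (auto intro!: continuous_intros continuous_abs_powr_sgn)
    also have "\<dots> \<le> (LINT x|M. ?H x)"
    proof (rule integral_mono_AE)
      show "integrable M (\<lambda>x. indicator {a<..s} (l x) *
        (0 * \<bar>W (l x)\<bar> powr p + 1 * (p * (\<bar>W (l x)\<bar> powr (p - 1) * sgn (W (l x)))) * K x))"
        using p by (intro integrable_product_deriv[of "\<lambda>s. 0 * \<bar>W s\<bar> powr p" "\<lambda>s. 1 * (p * (\<bar>W s\<bar> powr (p - 1) * sgn (W s)))"])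
          (auto intro!: continuous_intros continuous_on_compose2[OF continuous_abs_powr_sgn W_cont])
      show "AE x in M. indicator {a<..s} (l x) *
        (0 * \<bar>W (l x)\<bar> powr p + 1 * (p * (\<bar>W (l x)\<bar> powr (p - 1) * sgn (W (l x)))) * K x) \<le> ?H x"
      proof (intro always_eventually allI)
        fix x
        let ?w = "W (l x)"
        have "p * (\<bar>?w\<bar> powr (p - 1) * sgn ?w) * K x
          = p * (\<bar>?w\<bar> powr (p - 1) * (sgn ?w * (K x - g * ?w))) + p * g * (\<bar>?w\<bar> powr (p - 1) * sgn ?w * ?w)"
          by (simp add: algebra_simps)
        also have "\<bar>?w\<bar> powr (p - 1) * sgn ?w * ?w = \<bar>?w\<bar> powr p" by (rule abs_powr_mult_sgn)
        also have "p * (\<bar>?w\<bar> powr (p - 1) * (sgn ?w * (K x - g * ?w))) \<le> p * (\<bar>?w\<bar> powr (p - 1) * \<bar>K x - g * ?w\<bar>)"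
          using p by (intro mult_left_mono) (auto simp: sgn_if)
        also have "\<dots> \<le> (p - 1) * \<bar>?w\<bar> powr p + \<bar>K x - g * ?w\<bar> powr p"
          using p by (intro young_powr) auto
        finally have "p * (\<bar>?w\<bar> powr (p - 1) * sgn ?w) * K x \<le> ?H x" by (simp add: algebra_simps)
        moreover have "?H x \<ge> 0" using p g by (intro add_nonneg_nonneg mult_nonneg_nonneg) auto
        ultimately show "indicator {a<..s} (l x) *
           (0 * \<bar>?w\<bar> powr p + 1 * (p * (\<bar>?w\<bar> powr (p - 1) * sgn ?w)) * K x) \<le> ?H x"
          by (auto simp: indicator_def)
      qed
    qed (rule Hi)
    finally show ?thesis using a by simp
  qed
  then show ?thesis using that by blast
qed

text \<open>Boundedness of \<open>W\<close> and \<open>q > p\<close> give a bound of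
  \<open>|W| powr q\<close> by a multiple of \<open>|W| powr p\<close>.\<close>

lemma W_q: "integrable lborel (\<lambda>s. \<bar>W s\<bar> powr q)"
proof -
  obtain C where C: "\<And>s. \<bar>W s\<bar> powr p \<le> C" using W_powr_bounded by blast
  have "\<bar>W s\<bar> powr q \<le> C powr ((q - p) / p) * \<bar>W s\<bar> powr p" for s
  proof -
    have "\<bar>W s\<bar> powr q = (\<bar>W s\<bar> powr p) powr ((q - p) / p) * \<bar>W s\<bar> powr p"
      using p pq by (simp add: powr_powr powr_add[symmetric])
    also have "\<dots> \<le> C powr ((q - p) / p) * \<bar>W s\<bar> powr p"
      using C p pq by (intro mult_right_mono powr_mono2) auto
    finally show ?thesis .
  qed
  then show ?thesis
    by (intro Bochner_Integration.integrable_bound[OF integrable_mult_right[OF W_p, of "C powr ((q - p) / p)"]])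
      auto
qed

definition QW where "QW = (LINT s|lborel. \<bar>W s\<bar> powr q)"
definition EW where "EW = (LINT x|M. \<bar>K x - g * W (l x)\<bar> powr p)"

text \<open>The added mass \<open>\<delta> * w powr q\<close> keeps the density positive where
  \<open>W\<close> vanishes, and \<nu> rescales the total to \<open>Q0\<close>, so that the
  transport to \<open>w powr q\<close> exists and is differentiable.\<close>

lemma transported_bound:
  assumes \<delta>: "\<delta> > 0"
  shows "(Q0 / (QW + \<delta> * Q0)) powr (1 - p / q) * QW \<le> EW"
proof -
  have QW0: "QW \<ge> 0" unfolding QW_def by (intro integral_nonneg_AE) auto
  define \<nu> where "\<nu> = Q0 / (QW + \<delta> * Q0)"
  have den: "QW + \<delta> * Q0 > 0" using QW0 \<delta> Q0_pos by (simp add: add_nonneg_pos)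
  have \<nu>: "\<nu> > 0" using den Q0_pos by (simp add: \<nu>_def)
  define \<rho> where "\<rho> s = \<nu> * (\<bar>W s\<bar> powr q + \<delta> * w s powr q)" for s
  have cWq: "continuous_on UNIV (\<lambda>s. \<bar>W s\<bar> powr q)"
    using p pq by (intro continuous_on_compose2[OF continuous_abs_powr W_cont]) auto
  have \<rho>: "continuous_on UNIV \<rho>" "integrable lborel \<rho>" "\<And>s. \<rho> s > 0"
  proof -
    show "continuous_on UNIV \<rho>" unfolding \<rho>_def by (intro continuous_intros cWq continuous_w_powr)
    have "integrable lborel (\<lambda>s. w s powr q)" using p pq by (intro integrable_w_powr) auto
    then show "integrable lborel \<rho>" unfolding \<rho>_def
      by (intro integrable_mult_right Bochner_Integration.integrable_add W_q)
    show "\<rho> s > 0" for s unfolding \<rho>_def using \<nu> \<delta> w_pos[of s]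
      by (intro mult_pos_pos add_nonneg_pos) auto
  qed
  have tot: "(LINT s|lborel. \<rho> s) = (LINT s|lborel. w s powr q)"
  proof -
    have "(LINT s|lborel. \<rho> s) = \<nu> * (QW + \<delta> * Q0)"
      unfolding \<rho>_def QW_def Q0_def using W_q integrable_w_powr[of q] p pq by simp
    then show ?thesis using den by (simp add: \<nu>_def Q0_def[symmetric])
  qed
  obtain \<sigma> where \<sigma>: "\<And>s. (\<sigma> has_real_derivative \<rho> s / w (\<sigma> s) powr q) (at s)"
  proof -
    have "w s powr q > 0" for s using w_pos[of s] by simp
    from monotone_transport[OF \<rho> continuous_w_powr integrable_w_powr this tot] show ?thesis
      using that p pq by auto
  qed
  have c\<sigma>: "continuous_on UNIV \<sigma>" using \<sigma> by (meson DERIV_isCont continuous_at_imp_continuous_on)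
  define \<tau> where "\<tau> s = t (\<sigma> s)" for s
  have \<tau>: "0 < \<tau> s" "\<tau> s < T" for s by (auto simp: \<tau>_def t_pos t_less)
  have c\<tau>: "continuous_on UNIV \<tau>" unfolding \<tau>_def by (intro continuous_on_compose2[OF continuous_t c\<sigma>]) auto
  \<comment> \<open>\<open>\<theta> |W| powr (p - 1)\<close> is the dual variable in Young's
    inequality: the momentum \<open>(t w) powr (p - 1)\<close> of the profile, with \<open>t\<close>
    taken at the transported point and \<open>w\<close> replaced by \<open>|W|\<close>.\<close>
  define \<theta> where "\<theta> s = \<tau> s powr (p - 1)" for s
  define \<theta>' where "\<theta>' s = (k * p / q) * (\<rho> s * w (\<sigma> s) powr - p)" for s
  have wt: "w (\<sigma> s) powr (q - p) = (q * (p - 1) / p) * (\<tau> s powr (p - 1) * (T - \<tau> s))" for s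
    unfolding \<tau>_def by (rule w_powr)
  have \<theta>: "(\<theta> has_real_derivative \<theta>' s) (at s)" for s
  proof -
    have "(\<tau> has_real_derivative \<tau> s * (k * (T - \<tau> s) * (\<rho> s / w (\<sigma> s) powr q))) (at s)"
      unfolding \<tau>_def[abs_def] by (rule DERIV_cong[OF DERIV_chain2[OF t_deriv \<sigma>]]) simp
    from has_derivative_powr_log[OF this \<tau>(1), of "p - 1"]
    have "(\<theta> has_real_derivative \<theta> s * ((p - 1) * (k * (T - \<tau> s) * (\<rho> s / w (\<sigma> s) powr q)))) (at s)"
      by (simp add: \<theta>_def[abs_def])
    moreover have "\<theta> s * ((p - 1) * (k * (T - \<tau> s) * (\<rho> s / w (\<sigma> s) powr q))) = \<theta>' s"
    proof -
      have "(p - 1) * (\<theta> s * (T - \<tau> s)) = (p / q) * w (\<sigma> s) powr (q - p)"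
        unfolding wt \<theta>_def using p pq by simp
      moreover have "\<theta> s * ((p - 1) * (k * (T - \<tau> s) * X)) = k * ((p - 1) * (\<theta> s * (T - \<tau> s))) * X" for X
        by (simp add: mult_ac)
      ultimately have "\<theta> s * ((p - 1) * (k * (T - \<tau> s) * (\<rho> s / w (\<sigma> s) powr q)))
        = k * ((p / q) * w (\<sigma> s) powr (q - p)) * (\<rho> s / w (\<sigma> s) powr q)"
        by simp
      also have "w (\<sigma> s) powr (q - p) = w (\<sigma> s) powr q * w (\<sigma> s) powr - p"
        by (simp add: powr_add[symmetric])
      finally show ?thesis using w_pos[of "\<sigma> s"] by (simp add: \<theta>'_def)
    qed
    ultimately show ?thesis by simp
  qed
  have c\<theta>': "continuous_on UNIV \<theta>'" unfolding \<theta>'_def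
    by (intro continuous_intros \<rho>(1) continuous_on_compose2[OF continuous_w_powr c\<sigma>]) auto
  have c\<theta>: "continuous_on UNIV \<theta>" using \<theta> by (meson DERIV_isCont continuous_at_imp_continuous_on)
  \<comment> \<open>What is left of Young's lower bound after \<open>\<theta> (|W| powr p)'\<close>
    has been integrated by parts; the relation \<open>p g = (p - 1) T\<close> collects the terms of
    order zero into \<open>T - \<tau>\<close>.\<close>
  define H where "H s = \<theta>' s * \<bar>W s\<bar> powr p + (p - 1) * (\<theta> s * (T - \<tau> s)) * \<bar>W s\<bar> powr p" for s
  \<comment> \<open>Of \<rho> only the part \<open>\<nu> |W| powr q\<close> is kept. Then
    \<open>weighted_am_gm\<close> with \<open>x = w (\<sigma> s)\<close> removes every trace of the
    transport map.\<close>
  have Hge: "H s \<ge> \<nu> powr (1 - p / q) * \<bar>W s\<bar> powr q" for s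
  proof -
    have 1: "(p - 1) * (\<theta> s * (T - \<tau> s)) = (p / q) * w (\<sigma> s) powr (q - p)"
      unfolding wt \<theta>_def using p pq by simp
    have "\<nu> * \<bar>W s\<bar> powr q \<le> \<rho> s" using \<nu> \<delta> by (simp add: \<rho>_def)
    then have "(k * p / q) * ((\<nu> * \<bar>W s\<bar> powr q) * w (\<sigma> s) powr - p) * \<bar>W s\<bar> powr p \<le> \<theta>' s * \<bar>W s\<bar> powr p"
      unfolding \<theta>'_def using k_pos p pq by (intro mult_right_mono mult_left_mono) auto
    moreover have "(k * p / q) * ((\<nu> * \<bar>W s\<bar> powr q) * w (\<sigma> s) powr - p) * \<bar>W s\<bar> powr p
        = (p / q) * (k * \<nu> * (\<bar>W s\<bar> powr (q + p) * w (\<sigma> s) powr - p))"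
      by (simp add: powr_add)
    ultimately have "H s \<ge> (p / q) * (k * \<nu> * (\<bar>W s\<bar> powr (q + p) * w (\<sigma> s) powr - p) + w (\<sigma> s) powr (q - p) * \<bar>W s\<bar> powr p)"
    proof -
      assume a: "(k * p / q) * ((\<nu> * \<bar>W s\<bar> powr q) * w (\<sigma> s) powr - p) * \<bar>W s\<bar> powr p \<le> \<theta>' s * \<bar>W s\<bar> powr p"
        and b: "(k * p / q) * ((\<nu> * \<bar>W s\<bar> powr q) * w (\<sigma> s) powr - p) * \<bar>W s\<bar> powr p
          = (p / q) * (k * \<nu> * (\<bar>W s\<bar> powr (q + p) * w (\<sigma> s) powr - p))"
      have "H s = \<theta>' s * \<bar>W s\<bar> powr p + (p / q) * (w (\<sigma> s) powr (q - p) * \<bar>W s\<bar> powr p)"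
        unfolding H_def 1 by (simp only: mult.assoc)
      with a show ?thesis unfolding b by (simp only: distrib_left add_le_cancel_right)
    qed
    moreover have "(p / q) * (k * \<nu> * (\<bar>W s\<bar> powr (q + p) * w (\<sigma> s) powr - p) + w (\<sigma> s) powr (q - p) * \<bar>W s\<bar> powr p)
      \<ge> (p / q) * ((q / p) * (\<nu> powr (1 - p / q) * \<bar>W s\<bar> powr q))"
      using p pq \<nu> w_pos by (intro mult_left_mono weighted_am_gm) auto
    ultimately show ?thesis using p pq by simp
  qed
  have c\<Psi>: "continuous_on UNIV (\<lambda>s. \<bar>W s\<bar> powr p)"
    using p by (intro continuous_on_compose2[OF continuous_abs_powr W_cont]) auto
  have c\<Psi>': "continuous_on UNIV (\<lambda>s. \<bar>W s\<bar> powr (p - 1) * sgn (W s))"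
    using p by (intro continuous_on_compose2[OF continuous_abs_powr_sgn W_cont]) auto
  have cH: "continuous_on UNIV H" unfolding H_def by (intro continuous_intros c\<theta> c\<theta>' c\<tau> c\<Psi>)
  \<comment> \<open>The boundary term at \<open>a\<close> has the favourable sign and is dropped;
    the one at \<open>b\<close> stays, with \<open>\<theta> \<le> T powr (p - 1)\<close>.\<close>
  have strip: "\<nu> powr (1 - p / q) * (LINT s|lborel. indicator {a<..b} s * \<bar>W s\<bar> powr q) \<le> EW + T powr (p - 1) * \<bar>W b\<bar> powr p"
    if ab: "a \<le> b" for a b
  proof -
    let ?I = "\<lambda>x. indicat_real {a<..b} (l x)"
    let ?j = "\<lambda>x. \<bar>W (l x)\<bar> powr (p - 1) * sgn (W (l x))"
    define G1 where "G1 x = \<theta>' (l x) * \<bar>W (l x)\<bar> powr p + \<theta> (l x) * (p * ?j x) * K x" for x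
    have i1: "integrable M (\<lambda>x. ?I x * G1 x)" unfolding G1_def
      by (rule integrable_product_deriv[of "\<lambda>s. \<theta>' s * \<bar>W s\<bar> powr p" "\<lambda>s. \<theta> s * (p * (\<bar>W s\<bar> powr (p - 1) * sgn (W s)))"])
        (intro continuous_intros c\<theta> c\<theta>' c\<Psi> c\<Psi>')+
    have i2: "integrable M (\<lambda>x. ?I x * H (l x))"
      using integrable_product_deriv[OF cH, of "\<lambda>s. 0" a b] by simp
    have ch: "\<theta> b * \<bar>W b\<bar> powr p - \<theta> a * \<bar>W a\<bar> powr p = (LINT x|M. ?I x * G1 x)"
      unfolding G1_def using p ab
      by (intro chain_rule[OF \<theta> c\<theta>' abs_powr_has_derivative]) (auto intro!: continuous_intros continuous_abs_powr_sgn)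
    have pw: "?I x * H (l x) - ?I x * G1 x \<le> \<bar>K x - g * W (l x)\<bar> powr p" for x
    proof (cases "l x \<in> {a<..b}")
      case True
      let ?w = "W (l x)" and ?\<tau> = "\<tau> (l x)"
      let ?y = "K x - g * ?w"
      have \<tau>p: "?\<tau> powr p = \<theta> (l x) * ?\<tau>" using \<tau>(1)[of "l x"] by (simp add: \<theta>_def powr_diff)
      have "- (\<bar>?w\<bar> powr (p - 1) * sgn ?w * ?y) \<le> \<bar>?w\<bar> powr (p - 1) * \<bar>?y\<bar>"
      proof -
        have "\<bar>\<bar>?w\<bar> powr (p - 1) * sgn ?w * ?y\<bar> \<le> \<bar>?w\<bar> powr (p - 1) * \<bar>?y\<bar>"
          by (auto simp: abs_mult abs_sgn_eq)
        then show ?thesis by linarith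
      qed
      then have "p * \<theta> (l x) * - (\<bar>?w\<bar> powr (p - 1) * sgn ?w * ?y) \<le> p * \<theta> (l x) * (\<bar>?w\<bar> powr (p - 1) * \<bar>?y\<bar>)"
        using p by (intro mult_left_mono) (auto simp: \<theta>_def)
      also have "\<dots> = p * ((?\<tau> * \<bar>?w\<bar>) powr (p - 1) * \<bar>?y\<bar>)"
        using \<tau>(1)[of "l x"] by (simp add: \<theta>_def powr_mult)
      also have "\<dots> \<le> (p - 1) * (?\<tau> * \<bar>?w\<bar>) powr p + \<bar>?y\<bar> powr p"
        using p \<tau>(1)[of "l x"] by (intro young_powr) (auto simp: less_imp_le)
      also have "(?\<tau> * \<bar>?w\<bar>) powr p = \<theta> (l x) * ?\<tau> * \<bar>?w\<bar> powr p"
        using \<tau>(1)[of "l x"] by (simp add: powr_mult \<tau>p)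
      finally have Y: "p * \<theta> (l x) * - (\<bar>?w\<bar> powr (p - 1) * sgn ?w * ?y)
          - (p - 1) * (\<theta> (l x) * ?\<tau> * \<bar>?w\<bar> powr p) \<le> \<bar>?y\<bar> powr p" by simp
      have e: "\<bar>?w\<bar> powr (p - 1) * sgn ?w * ?y = ?j x * K x - g * \<bar>?w\<bar> powr p"
        using abs_powr_mult_sgn[of ?w p] by (simp add: algebra_simps)
      \<comment> \<open>The coefficient \<open>(p - 1) T - p g\<close> of the last term is 0 by
        \<open>T_eq\<close>.\<close>
      have "H (l x) - G1 x = p * \<theta> (l x) * - (\<bar>?w\<bar> powr (p - 1) * sgn ?w * ?y)
          - (p - 1) * (\<theta> (l x) * ?\<tau> * \<bar>?w\<bar> powr p) + ((p - 1) * T - p * g) * (\<theta> (l x) * \<bar>?w\<bar> powr p)"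
        unfolding e H_def G1_def by (simp add: algebra_simps)
      then have "H (l x) - G1 x \<le> \<bar>?y\<bar> powr p" using Y T_eq by simp
      then show ?thesis using True by simp
    qed simp
    have iq: "integrable lborel (\<lambda>s. indicat_real {a<..b} s * \<bar>W s\<bar> powr q)"
      using integrable_mult_indicator[of "{a<..b}" lborel, OF _ W_q] by simp
    have iH: "integrable lborel (\<lambda>s. indicat_real {a<..b} s * H s)"
      using i2 borel_measurable_continuous_onI[OF cH]
      by (subst (asm) integrable_fibration[of "\<lambda>s. indicat_real {a<..b} s * H s"]) auto
    have "\<nu> powr (1 - p / q) * (LINT s|lborel. indicator {a<..b} s * \<bar>W s\<bar> powr q)
      = (LINT s|lborel. \<nu> powr (1 - p / q) * (indicator {a<..b} s * \<bar>W s\<bar> powr q))" by simp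
    also have "\<dots> \<le> (LINT s|lborel. indicator {a<..b} s * H s)"
      using iq iH Hge by (intro integral_mono) (auto simp: indicator_def)
    also have "\<dots> = (LINT x|M. ?I x * H (l x))"
      using borel_measurable_continuous_onI[OF cH]
      by (subst integral_fibration[of "\<lambda>s. indicat_real {a<..b} s * H s"]) auto
    also have "\<dots> = (LINT x|M. ?I x * H (l x) - ?I x * G1 x) + (\<theta> b * \<bar>W b\<bar> powr p - \<theta> a * \<bar>W a\<bar> powr p)"
      unfolding ch using i1 i2 by simp
    also have "(LINT x|M. ?I x * H (l x) - ?I x * G1 x) \<le> EW"
      unfolding EW_def using i1 i2 KW_p pw by (intro integral_mono) auto
    also have "\<theta> b * \<bar>W b\<bar> powr p - \<theta> a * \<bar>W a\<bar> powr p \<le> T powr (p - 1) * \<bar>W b\<bar> powr p - 0"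
      using \<tau>[of b] p by (intro diff_mono mult_right_mono) (auto simp: \<theta>_def intro!: powr_mono2)
    finally show ?thesis by simp
  qed
  have "\<nu> powr (1 - p / q) * (LINT s|lborel. indicator {- real N<..real N} s * \<bar>W s\<bar> powr q) \<le> EW" for N :: nat
  proof (rule field_le_epsilon)
    fix e :: real assume e: "e > 0"
    \<comment> \<open>The interval is extended to the right, which only increases the integral of
      \<open>|W| powr q\<close>, up to a point where the boundary term is below
      \<open>e\<close>.\<close>
    obtain b where b: "b \<ge> real N" "\<bar>W b\<bar> powr p < e / T powr (p - 1)"
      using exists_small_value(1)[OF W_p, of "e / T powr (p - 1)" "real N"] e T_pos by auto
    have "(LINT s|lborel. indicator {- real N<..real N} s * \<bar>W s\<bar> powr q) \<le> (LINT s|lborel. indicator {- real N<..b} s * \<bar>W s\<bar> powr q)"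
      using integrable_mult_indicator[of "{- real N<..real N}" lborel, OF _ W_q]
        integrable_mult_indicator[of "{- real N<..b}" lborel, OF _ W_q] b
      by (intro integral_mono) (auto simp: indicator_def)
    then have "\<nu> powr (1 - p / q) * (LINT s|lborel. indicator {- real N<..real N} s * \<bar>W s\<bar> powr q)
      \<le> \<nu> powr (1 - p / q) * (LINT s|lborel. indicator {- real N<..b} s * \<bar>W s\<bar> powr q)"
      by (intro mult_left_mono) auto
    also have "\<dots> \<le> EW + T powr (p - 1) * \<bar>W b\<bar> powr p" using b by (intro strip) linarith
    also have "T powr (p - 1) * \<bar>W b\<bar> powr p \<le> e" using b(2) T_pos by (simp add: field_simps)
    finally show "\<nu> powr (1 - p / q) * (LINT s|lborel. indicator {- real N<..real N} s * \<bar>W s\<bar> powr q) \<le> EW + e" by simp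
  qed
  moreover have "(\<lambda>N. \<nu> powr (1 - p / q) * (LINT s|lborel. indicator {- real N<..real N} s * \<bar>W s\<bar> powr q)) \<longlonglongrightarrow> \<nu> powr (1 - p / q) * QW"
    unfolding QW_def
  proof (intro tendsto_mult tendsto_const integral_dominated_convergence[where w = "\<lambda>s. \<bar>W s\<bar> powr q"])
    show "AE s in lborel. (\<lambda>N. indicat_real {- real N<..real N} s * \<bar>W s\<bar> powr q) \<longlonglongrightarrow> \<bar>W s\<bar> powr q"
    proof (intro always_eventually allI)
      fix s
      obtain N :: nat where "\<bar>s\<bar> < real N" using reals_Archimedean2 by blast
      then have "\<forall>\<^sub>F k in sequentially. indicat_real {- real k<..real k} s * \<bar>W s\<bar> powr q = \<bar>W s\<bar> powr q"
        unfolding eventually_sequentially by (intro exI[of _ N]) (auto simp: indicator_def)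
      then show "(\<lambda>N. indicat_real {- real N<..real N} s * \<bar>W s\<bar> powr q) \<longlonglongrightarrow> \<bar>W s\<bar> powr q" by (rule tendsto_eventually)
    qed
  qed (use W_q in \<open>auto simp: indicator_def\<close>)
  ultimately show ?thesis unfolding \<nu>_def
    by (intro LIMSEQ_le_const2) auto
qed

text \<open>The limit of \<open>transported_bound\<close> as \<delta> tends to 0. By
  \<open>energy_eq\<close> the two sides agree for the profile \<open>w\<close>.\<close>

theorem bliss_inequality: "Q0 powr (1 - p / q) * QW powr (p / q) \<le> EW"
proof (cases "QW = 0")
  case True
  have "EW \<ge> 0" unfolding EW_def by (intro integral_nonneg_AE) auto
  with True show ?thesis by simp
next
  case False
  have "QW \<ge> 0" unfolding QW_def by (intro integral_nonneg_AE) auto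
  with False have QW: "QW > 0" by simp
  have lim: "((\<lambda>\<delta>. (Q0 / (QW + \<delta> * Q0)) powr (1 - p / q) * QW) \<longlongrightarrow> (Q0 / (QW + 0 * Q0)) powr (1 - p / q) * QW) (at_right 0)"
    using QW Q0_pos by (intro tendsto_intros) auto
  have ev: "\<forall>\<^sub>F \<delta> in at_right 0. (Q0 / (QW + \<delta> * Q0)) powr (1 - p / q) * QW \<le> EW"
    using transported_bound by (auto simp: eventually_at_filter)
  have "(Q0 / QW) powr (1 - p / q) * QW \<le> EW"
    using tendsto_upperbound[OF lim ev] by simp
  moreover have "(Q0 / QW) powr (1 - p / q) * QW = Q0 powr (1 - p / q) * QW powr (p / q)"
  proof -
    have "QW = QW powr (1 - p / q) * QW powr (p / q)" using QW by (simp add: powr_add[symmetric])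
    then have "(Q0 / QW) powr (1 - p / q) * QW = (Q0 powr (1 - p / q) / QW powr (1 - p / q)) * (QW powr (1 - p / q) * QW powr (p / q))"
      using QW Q0_pos by (simp add: powr_divide)
    then show ?thesis using QW by simp
  qed
  ultimately show ?thesis by simp
qed

end

section \<open>Radial functions with a weak gradient\<close>

lemma loc_integrable_off_0_measurable:
  fixes f :: "real^'n::finite \<Rightarrow> real"
  assumes "loc_integrable_off_0 f"
  shows "f \<in> borel_measurable lebesgue"
proof -
  define A where "A k = (annulus (1 / real (Suc k)) (real k) :: (real^'n) set)" for k
  have m: "(\<lambda>x. indicator (A k) x * f x) \<in> borel_measurable lebesgue" for k
  proof -
    have "compact (A k) \<and> 0 \<notin> A k" by (simp add: A_def compact_annulus zero_notin_annulus)
    then have "set_integrable lebesgue (A k) f" using assms by (simp add: loc_integrable_off_0_def)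
    then show ?thesis by (auto simp: set_integrable_def)
  qed
  have m0: "(\<lambda>x. indicator {0} x * f 0) \<in> borel_measurable (lebesgue :: (real^'n) measure)"
    by (intro borel_measurable_times borel_measurable_indicator) auto
  show ?thesis
  \<comment> \<open>The annuli miss the origin, whose value is restored by the separate second
    summand.\<close>
  proof (rule borel_measurable_LIMSEQ_real[where u = "\<lambda>k x. indicator (A k) x * f x + indicator {0} x * f 0"])
    fix x :: "real^'n"
    show "(\<lambda>k. indicator (A k) x * f x + indicator {0} x * f 0) \<longlonglongrightarrow> f x"
    proof (cases "x = 0")
      case True
      then have "x \<notin> A k" for k by (simp add: A_def zero_notin_annulus)
      then show ?thesis using True by simp
    next
      case False
      obtain k1 where k1: "1 / real (Suc k1) < norm x" using False nat_approx_posE[of "norm x"] by auto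
      obtain k2 where k2: "norm x < real k2" using reals_Archimedean2 by blast
      have "x \<in> A k" if "k \<ge> max k1 k2" for k
      proof -
        have "1 / real (Suc k) \<le> 1 / real (Suc k1)" using that by (intro divide_left_mono) auto
        then show ?thesis using k1 k2 that by (simp add: A_def annulus_def)
      qed
      then have "\<forall>\<^sub>F k in sequentially. indicator (A k) x * f x + indicator {0} x * f 0 = f x"
        using False unfolding eventually_sequentially by (intro exI[of _ "max k1 k2"]) auto
      then show ?thesis by (rule tendsto_eventually)
    qed
  qed (intro borel_measurable_add m m0)
qed

lemma loc_integrable_off_0_add:
  fixes f h :: "real^'n::finite \<Rightarrow> real"
  assumes "loc_integrable_off_0 f" "loc_integrable_off_0 h"
  shows "loc_integrable_off_0 (\<lambda>x. f x + h x)"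
  using assms unfolding loc_integrable_off_0_def by (auto intro: set_integral_add)

lemma loc_integrable_off_0_mult:
  fixes f h :: "real^'n::finite \<Rightarrow> real"
  assumes f: "loc_integrable_off_0 f" and h: "continuous_on (- {0}) h" "h \<in> borel_measurable borel"
  shows "loc_integrable_off_0 (\<lambda>x. f x * h x)"
  unfolding loc_integrable_off_0_def
proof (intro allI impI)
  fix K :: "(real^'n) set" assume K: "compact K \<and> 0 \<notin> K"
  then have "bounded (h ` K)"
    by (intro compact_imp_bounded compact_continuous_image continuous_on_subset[OF h(1)]) auto
  then obtain B where B: "\<forall>x\<in>K. \<bar>h x\<bar> \<le> B" by (auto simp: bounded_iff)
  have "integrable lebesgue (\<lambda>x. f x * (indicator K x * h x))"
  proof (rule integrable_loc_integrable_mult[OF f])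
    have "K \<in> sets lebesgue" using K by (simp add: borel_compact)
    then show "(\<lambda>x. indicator K x * h x) \<in> borel_measurable lebesgue"
      using measurable_lebesgue_if_borel[OF h(2)] by measurable
  qed (use K B in \<open>auto simp: indicator_def\<close>)
  then show "(\<lambda>x. f x * h x) absolutely_integrable_on K"
    by (simp add: set_integrable_def mult_ac)
qed

lemma loc_integrable_off_0_sum:
  fixes f :: "'i \<Rightarrow> real^'n::finite \<Rightarrow> real"
  assumes "finite I" "\<And>i. i \<in> I \<Longrightarrow> loc_integrable_off_0 (f i)"
  shows "loc_integrable_off_0 (\<lambda>x. \<Sum>i\<in>I. f i x)"
  using assms
proof (induction I rule: finite_induct)
  case empty
  then show ?case by (simp add: loc_integrable_off_0_def set_integrable_def)
next
  case (insert i I)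
  then show ?case by (simp add: loc_integrable_off_0_add)
qed

lemma loc_integrable_off_0_inner:
  fixes v :: "real^'n::finite \<Rightarrow> real^'n"
  assumes "loc_integrable_off_0 v"
  shows "loc_integrable_off_0 (\<lambda>x. v x \<bullet> x)"
  unfolding inner_vec_def inner_real_def
  by (intro loc_integrable_off_0_sum loc_integrable_off_0_mult loc_integrable_off_0_component assms)
    (auto intro!: continuous_intros)

lemma norm_in_annulus_if:
  assumes "x \<noteq> 0" "\<bar>ln (norm x)\<bar> \<le> L"
  shows "x \<in> annulus (exp (- L)) (exp L)"
  using assms ln_norm_less_if[of x L] ln_norm_greater_if[of L x]
  by (auto simp: annulus_def not_less[symmetric])

lemma integrable_cyl_measure_mult:
  fixes F :: "real^'n::finite \<Rightarrow> real"
  assumes F: "loc_integrable_off_0 F" and \<phi>: "\<phi> \<in> borel_measurable borel" "\<And>s. \<bar>\<phi> s\<bar> \<le> B" "\<And>s. \<bar>s\<bar> > L \<Longrightarrow> \<phi> s = 0"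
  shows "integrable cyl_measure (\<lambda>x. \<phi> (ln (norm x)) * F x)"
proof -
  let ?n = "real CARD('n)"
  have B: "B \<ge> 0" using \<phi>(2)[of 0] by linarith
  have Fm[measurable]: "F \<in> borel_measurable lebesgue" by (rule loc_integrable_off_0_measurable[OF F])
  have \<phi>m[measurable]: "(\<lambda>x::real^'n. \<phi> (ln (norm x))) \<in> borel_measurable lebesgue"
    using measurable_compose[OF cyl_weight_measurable(2) \<phi>(1)] .
  have "integrable lebesgue (\<lambda>x. F x * (norm x powr - ?n * \<phi> (ln (norm x))))"
  proof (rule integrable_loc_integrable_mult[OF F _ compact_annulus[of "exp (- L)" "exp L"]])
    show "\<bar>norm x powr - ?n * \<phi> (ln (norm x))\<bar> \<le> exp (- L) powr - ?n * B"
      if "x \<in> annulus (exp (- L)) (exp L)" for x :: "real^'n"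
    proof -
      have "norm x powr - ?n \<le> exp (- L) powr - ?n"
        using that by (intro powr_mono2') (auto simp: annulus_def)
      then show ?thesis using \<phi>(2) B by (auto simp: abs_mult intro!: mult_mono)
    qed
    show "norm x powr - ?n * \<phi> (ln (norm x)) = 0" if "x \<notin> annulus (exp (- L)) (exp L)" for x :: "real^'n"
      using that norm_in_annulus_if[of x L] \<phi>(3)[of "ln (norm x)"] by (cases "x = 0") force+
  qed (auto simp: zero_notin_annulus)
  then show ?thesis
    by (subst integrable_cyl_measure_iff) (auto simp: mult_ac)
qed

section \<open>Testing weak gradients with radial vector fields\<close>

definition flat_bump :: "real \<Rightarrow> real \<Rightarrow> real \<Rightarrow> real" where
  "flat_bump A B r = flat_exp 0 (r - A\<^sup>2) * flat_exp 0 (B\<^sup>2 - r)"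

definition flat_bump' :: "real \<Rightarrow> real \<Rightarrow> real \<Rightarrow> real" where
  "flat_bump' A B r = flat_exp 2 (r - A\<^sup>2) * flat_exp 0 (B\<^sup>2 - r) - flat_exp 0 (r - A\<^sup>2) * flat_exp 2 (B\<^sup>2 - r)"

lemma bump_flat_bump: "bump A B x = flat_bump A B (x \<bullet> x)"
  by (simp add: bump_def flat_bump_def)

lemma flat_exp_0_deriv: "(flat_exp 0 has_real_derivative flat_exp 2 y) (at y)"
  using flat_exp_has_derivative[of 0 y] by (simp add: numeral_2_eq_2)

lemma continuous_flat_exp: "continuous_on A (flat_exp k)"
  using flat_exp_has_derivative by (meson DERIV_isCont continuous_at_imp_continuous_on)

lemma flat_bump_deriv: "(flat_bump A B has_real_derivative flat_bump' A B r) (at r)"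
proof -
  have 1: "((\<lambda>r. flat_exp 0 (r - A\<^sup>2)) has_real_derivative flat_exp 2 (r - A\<^sup>2) * 1) (at r)"
    by (rule DERIV_chain2[OF flat_exp_0_deriv]) (auto intro!: derivative_eq_intros)
  have 2: "((\<lambda>r. flat_exp 0 (B\<^sup>2 - r)) has_real_derivative flat_exp 2 (B\<^sup>2 - r) * (-1)) (at r)"
    by (rule DERIV_chain2[OF flat_exp_0_deriv]) (auto intro!: derivative_eq_intros)
  show ?thesis unfolding flat_bump_def[abs_def] flat_bump'_def
    by (rule DERIV_cong[OF DERIV_mult[OF 1 2]]) simp
qed

lemma continuous_flat_bump: "continuous_on S (flat_bump A B)" "continuous_on S (flat_bump' A B)"
  unfolding flat_bump_def flat_bump'_def
  by (intro continuous_intros continuous_on_compose2[OF continuous_flat_exp[of UNIV]]; simp)+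

lemma flat_bump_eq_0: "r \<notin> {A\<^sup>2<..<B\<^sup>2} \<Longrightarrow> flat_bump A B r = 0 \<and> flat_bump' A B r = 0"
  by (auto simp: flat_bump_def flat_bump'_def flat_exp_def)

lemma flat_bump_pos: "r \<in> {A\<^sup>2<..<B\<^sup>2} \<Longrightarrow> flat_bump A B r > 0"
  by (auto simp: flat_bump_def flat_exp_def)

text \<open>The pairing \<open>u div F + v \<bullet> F\<close> with the field
  \<open>F x = G (x \<bullet> x) x\<close>, whose divergence is
  \<open>n G + 2 |x|\<^sup>2 G'\<close>. The variable \<open>x \<bullet> x\<close> is used instead
  of the norm because polynomials in it are polynomials in \<open>x\<close>.\<close>

definition radial_pairing :: "(real^'n::finite \<Rightarrow> real) \<Rightarrow> (real^'n \<Rightarrow> real^'n) \<Rightarrow> (real \<Rightarrow> real) \<Rightarrow> (real \<Rightarrow> real) \<Rightarrow> real^'n \<Rightarrow> real" where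
  "radial_pairing u v G G' x = u x * (real CARD('n) * G (x \<bullet> x) + 2 * (x \<bullet> x) * G' (x \<bullet> x)) + (v x \<bullet> x) * G (x \<bullet> x)"

lemma inner_self_in_iff: "0 < A \<Longrightarrow> 0 < B \<Longrightarrow> x \<in> annulus A B \<longleftrightarrow> x \<bullet> x \<in> {A\<^sup>2..B\<^sup>2}"
  by (auto simp: annulus_def power2_norm_eq_inner[symmetric] dest: power2_le_imp_le)

lemma integrable_radial_pairing:
  fixes u :: "real^'n::finite \<Rightarrow> real"
  assumes uv: "has_weak_gradient u v" and A: "0 < A" "A < B"
    and G: "continuous_on UNIV G" "continuous_on UNIV G'" and z: "\<And>r. r \<notin> {A\<^sup>2..B\<^sup>2} \<Longrightarrow> G r = 0 \<and> G' r = 0"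
  shows "integrable lebesgue (radial_pairing u v G G')"
proof -
  have loc: "loc_integrable_off_0 u" "loc_integrable_off_0 (\<lambda>x. v x \<bullet> x)"
    using uv by (auto simp: has_weak_gradient_def intro: loc_integrable_off_0_inner)
  note * = integrable_loc_integrable_continuous_mult[OF _ _ A(1), where B = B]
  have cG: "continuous_on UNIV (\<lambda>x::real^'n. G (x \<bullet> x))" "continuous_on UNIV (\<lambda>x::real^'n. G' (x \<bullet> x))"
    by (intro continuous_on_compose2[OF G(1)] continuous_on_compose2[OF G(2)] continuous_intros; simp)+
  have z': "G (x \<bullet> x) = 0 \<and> G' (x \<bullet> x) = 0" if "x \<notin> annulus A B" for x :: "real^'n"
    using that z[of "x \<bullet> x"] A inner_self_in_iff[of A B x] by simp
  show ?thesis unfolding radial_pairing_def[abs_def]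
    by (intro Bochner_Integration.integrable_add * loc continuous_intros cG) (simp_all add: z')
qed

text \<open>The components \<open>x $ i * P (x \<bullet> x) * bump A B x\<close> of the field are
  admissible test functions; adding the weak gradient identities over all \<open>i\<close> produces
  the pairing.\<close>

lemma radial_pairing_polynomial:
  fixes u :: "real^'n::finite \<Rightarrow> real"
  assumes uv: "has_weak_gradient u v" and A: "0 < A" "A < B"
    and P: "real_polynomial_function P" "\<And>r. (P has_real_derivative P' r) (at r)" and cP': "continuous_on UNIV P'"
  shows "(LINT x|lebesgue. radial_pairing u v (\<lambda>r. P r * flat_bump A B r) (\<lambda>r. P' r * flat_bump A B r + P r * flat_bump' A B r) x) = 0"
proof -
  define G where "G r = P r * flat_bump A B r" for r
  define G' where "G' r = P' r * flat_bump A B r + P r * flat_bump' A B r" for r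
  have G: "(G has_real_derivative G' r) (at r)" for r
    unfolding G_def[abs_def] G'_def by (rule DERIV_cong[OF DERIV_mult[OF P(2) flat_bump_deriv]]) simp
  have contP: "continuous_on UNIV P" using P(2) by (meson DERIV_isCont continuous_at_imp_continuous_on)
  have cG: "continuous_on UNIV G" "continuous_on UNIV G'"
    unfolding G_def G'_def by (intro continuous_intros contP cP' continuous_flat_bump)+
  have z: "G r = 0 \<and> G' r = 0" if "r \<notin> {A\<^sup>2..B\<^sup>2}" for r
    using flat_bump_eq_0[of r A B] that by (auto simp: G_def G'_def)
  define \<phi> where "\<phi> i x = (x $ i * P (x \<bullet> x)) * bump A B x" for i and x :: "real^'n"
  have "(\<lambda>x::real^'n. P (x \<bullet> x)) = P \<circ> (\<lambda>x. x \<bullet> x)" by auto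
  then have "real_polynomial_function (\<lambda>x::real^'n. P (x \<bullet> x))"
    using real_polynomial_function_compose[OF _ P(1)] real_polynomial_inner_self
    by (metis real_polynomial_function_eq)
  from real_polynomial_function.intros(4)[OF real_polynomial_function.intros(1)[OF bounded_linear_vec_nth] this]
  have test: "test_fun (\<phi> i)" for i
    unfolding \<phi>_def[abs_def] using A by (intro test_fun_bump) auto
  have pd: "partial_deriv i (\<phi> i) x = G (x \<bullet> x) + 2 * (x $ i)\<^sup>2 * G' (x \<bullet> x)" for i x
  proof -
    have 1: "((\<lambda>x::real^'n. x \<bullet> x) has_derivative (\<lambda>h. 2 * (x \<bullet> h))) (at x)"
      by (auto intro!: derivative_eq_intros simp: inner_commute)
    have 2: "((\<lambda>x::real^'n. G (x \<bullet> x)) has_derivative (\<lambda>h. G' (x \<bullet> x) * (2 * (x \<bullet> h)))) (at x)"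
      using has_derivative_compose[OF 1 G[unfolded has_field_derivative_def]] .
    have 3: "((\<lambda>x::real^'n. x $ i) has_derivative (\<lambda>h. h $ i)) (at x)"
      by (rule bounded_linear_imp_has_derivative) (rule bounded_linear_vec_nth)
    have "\<phi> i = (\<lambda>x. x $ i * G (x \<bullet> x))" by (auto simp: \<phi>_def G_def bump_flat_bump)
    then have "(\<phi> i has_derivative (\<lambda>h. x $ i * (G' (x \<bullet> x) * (2 * (x \<bullet> h))) + h $ i * G (x \<bullet> x))) (at x)"
      using has_derivative_mult[OF 3 2] by simp
    from frechet_derivative_at[OF this, symmetric] show ?thesis
      unfolding partial_deriv_def by (simp add: inner_axis power2_eq_square)
  qed
  have uloc: "loc_integrable_off_0 u" and vloc: "loc_integrable_off_0 v"
    using uv by (auto simp: has_weak_gradient_def)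
  note * = integrable_loc_integrable_continuous_mult[OF _ _ A(1), where B = B]
  have cGx: "continuous_on UNIV (\<lambda>x::real^'n. G (x \<bullet> x))" "continuous_on UNIV (\<lambda>x::real^'n. G' (x \<bullet> x))"
    by (intro continuous_on_compose2[OF cG(1)] continuous_on_compose2[OF cG(2)] continuous_intros; simp)+
  have z': "G (x \<bullet> x) = 0 \<and> G' (x \<bullet> x) = 0" if "x \<notin> annulus A B" for x :: "real^'n"
    using that z[of "x \<bullet> x"] A inner_self_in_iff[of A B x] by simp
  have i1: "integrable lebesgue (\<lambda>x. u x * partial_deriv i (\<phi> i) x)" for i
    unfolding pd by (intro * uloc continuous_intros cGx) (simp add: z')
  have \<phi>G: "\<phi> i x = x $ i * G (x \<bullet> x)" for i x by (simp add: \<phi>_def G_def bump_flat_bump)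
  have i2: "integrable lebesgue (\<lambda>x. v x $ i * \<phi> i x)" for i
    unfolding \<phi>G by (intro * loc_integrable_off_0_component[OF vloc] continuous_intros cGx) (simp add: z')
  have "0 = (\<Sum>i\<in>UNIV. (LINT x|lebesgue. u x * partial_deriv i (\<phi> i) x) + (LINT x|lebesgue. v x $ i * \<phi> i x))"
    using uv test by (simp add: has_weak_gradient_def)
  also have "\<dots> = (LINT x|lebesgue. (\<Sum>i\<in>UNIV. u x * partial_deriv i (\<phi> i) x + v x $ i * \<phi> i x))"
    using i1 i2 by (subst Bochner_Integration.integral_sum) auto
  also have "\<dots> = (LINT x|lebesgue. radial_pairing u v G G' x)"
  proof (intro Bochner_Integration.integral_cong refl)
    fix x :: "real^'n"
    have 1: "(\<Sum>i\<in>UNIV. partial_deriv i (\<phi> i) x) = real CARD('n) * G (x \<bullet> x) + 2 * (x \<bullet> x) * G' (x \<bullet> x)"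
      unfolding pd by (simp add: sum.distrib sum_distrib_right[symmetric] sum_distrib_left[symmetric] inner_vec_def power2_eq_square)
    have 2: "(\<Sum>i\<in>UNIV. v x $ i * \<phi> i x) = (v x \<bullet> x) * G (x \<bullet> x)"
      unfolding \<phi>G by (simp add: inner_vec_def sum_distrib_right mult.assoc)
    show "(\<Sum>i\<in>UNIV. u x * partial_deriv i (\<phi> i) x + v x $ i * \<phi> i x) = radial_pairing u v G G' x"
      unfolding radial_pairing_def 1[symmetric] 2[symmetric] by (simp add: sum.distrib sum_distrib_left)
  qed
  finally show ?thesis by (simp add: G_def[abs_def] G'_def[abs_def])
qed

lemma real_polynomial_antiderivative:
  assumes "real_polynomial_function (R :: real \<Rightarrow> real)"
  obtains P where "real_polynomial_function P" "\<And>r. (P has_real_derivative R r) (at r)" "P a = 0"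
proof -
  obtain c n where R: "R = (\<lambda>x. \<Sum>i\<le>n. c i * x ^ i)" using assms real_polynomial_function_iff_sum by blast
  define P0 where "P0 x = (\<Sum>i\<le>n. c i / real (Suc i) * x ^ Suc i)" for x
  have "real_polynomial_function (\<lambda>x. P0 x + - P0 a)"
    unfolding P0_def
    by (intro real_polynomial_function.intros(2,3) real_polynomial_function_sum real_polynomial_function.intros(4)
      real_polynomial_function_power real_polynomial_function.intros(1)) (auto simp: bounded_linear_ident)
  moreover have "((\<lambda>x. P0 x + - P0 a) has_real_derivative R r) (at r)" for r
  proof -
    have "((\<lambda>x. c i / real (Suc i) * x ^ Suc i) has_real_derivative c i * r ^ i) (at r)" for i
      by (rule DERIV_cong[OF DERIV_cmult[OF DERIV_pow]]) simp
    then have "(P0 has_real_derivative R r) (at r)" unfolding P0_def[abs_def] R by (intro DERIV_sum)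
    then show ?thesis by (auto intro!: derivative_eq_intros)
  qed
  ultimately show ?thesis using that by simp
qed

text \<open>
  \<open>G\<close> is approximated by \<open>P * flat_bump A B\<close> with polynomials \<open>P\<close>, in the \<open>C\<^sup>1\<close> norm.
\<close>

lemma radial_pairing_eq_0:
  fixes u :: "real^'n::finite \<Rightarrow> real"
  assumes uv: "has_weak_gradient u v" and A: "0 < A" "A < A1" "A1 < B1" "B1 < B"
    and G: "\<And>r. (G has_real_derivative G' r) (at r)" "continuous_on UNIV G'"
    and z: "\<And>r. r \<notin> {A1\<^sup>2..B1\<^sup>2} \<Longrightarrow> G r = 0 \<and> G' r = 0"
  shows "(LINT x|lebesgue. radial_pairing u v G G' x) = 0"
proof -
  have sq: "A\<^sup>2 < A1\<^sup>2" "A1\<^sup>2 < B1\<^sup>2" "B1\<^sup>2 < B\<^sup>2" using A by (auto intro: power_strict_mono)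
  let ?e = "flat_bump A B" and ?e' = "flat_bump' A B"
  have cG: "continuous_on UNIV G" using G(1) by (meson DERIV_isCont continuous_at_imp_continuous_on)
  \<comment> \<open>\<open>G\<close> vanishes near the zeros of the bump, so the quotient is
    continuously differentiable on the whole line, with value 0 where the bump vanishes. Its
    derivative is approximated first, and the polynomial is then integrated from
    \<open>A\<^sup>2\<close>, where \<open>H\<close> vanishes; this controls \<open>H\<close> and
    \<open>H'\<close> together.\<close>
  define H where "H r = G r / ?e r" for r
  define H' where "H' r = (G' r * ?e r - G r * ?e' r) / (?e r)\<^sup>2" for r
  have o: "open (- {A1\<^sup>2..B1\<^sup>2})" "open {A\<^sup>2<..<B\<^sup>2}" by (auto intro: open_Compl)
  have cov: "r \<in> {A\<^sup>2<..<B\<^sup>2} \<or> r \<in> - {A1\<^sup>2..B1\<^sup>2}" for r using sq by auto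
  have H: "(H has_real_derivative H' r) (at r)" for r
  proof (cases "r \<in> {A\<^sup>2<..<B\<^sup>2}")
    case True
    show ?thesis unfolding H_def[abs_def] H'_def power2_eq_square
      by (rule DERIV_divide[OF G(1) flat_bump_deriv]) (use flat_bump_pos[OF True] in simp)
  next
    case False
    then have r: "r \<in> - {A1\<^sup>2..B1\<^sup>2}" using cov by blast
    have "((\<lambda>r. 0) has_real_derivative H' r) (at r)" using r z by (simp add: H'_def)
    then show ?thesis
      by (rule has_field_derivative_transform_within_open[OF _ o(1) r]) (use z in \<open>auto simp: H_def\<close>)
  qed
  have cH': "continuous_on UNIV H'"
  proof -
    have "continuous_on {A\<^sup>2<..<B\<^sup>2} H'" unfolding H'_def
      by (intro continuous_intros continuous_flat_bump continuous_on_subset[OF G(2)] continuous_on_subset[OF cG])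
        (use flat_bump_pos in \<open>force+\<close>)
    moreover have "continuous_on (- {A1\<^sup>2..B1\<^sup>2}) H'"
      by (rule continuous_on_eq[OF continuous_on_const[of _ 0]]) (use z in \<open>auto simp: H'_def\<close>)
    ultimately have "continuous_on ({A\<^sup>2<..<B\<^sup>2} \<union> - {A1\<^sup>2..B1\<^sup>2}) H'" by (intro continuous_on_open_Un o)
    moreover have "{A\<^sup>2<..<B\<^sup>2} \<union> - {A1\<^sup>2..B1\<^sup>2} = UNIV" using cov by blast
    ultimately show ?thesis by simp
  qed
  have "bounded (?e ` {A\<^sup>2..B\<^sup>2})" "bounded (?e' ` {A\<^sup>2..B\<^sup>2})"
    by (intro compact_imp_bounded compact_continuous_image continuous_flat_bump compact_Icc)+
  then obtain E1 E2 where E: "\<forall>r\<in>{A\<^sup>2..B\<^sup>2}. \<bar>?e r\<bar> \<le> E1" "\<forall>r\<in>{A\<^sup>2..B\<^sup>2}. \<bar>?e' r\<bar> \<le> E2" by (auto simp: bounded_iff)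
  define d where "d = B\<^sup>2 - A\<^sup>2"
  have E0: "E1 \<ge> 0" "E2 \<ge> 0" using E sq by (meson abs_ge_zero atLeastAtMost_iff less_imp_le order_refl order_trans less_trans)+
  have d: "d > 0" using sq by (simp add: d_def)
  \<comment> \<open>Bounds the error of the factor of \<open>u\<close> up to \<epsilon>:
    \<open>E1 * d\<close> comes from \<open>G - g\<close> and \<open>E2 * d + E1\<close> from
    \<open>G' - g'\<close>, where \<open>d\<close> is the length over which the error of
    \<open>H'\<close> is integrated.\<close>
  define C where "C = real CARD('n) * (E1 * d) + 2 * B\<^sup>2 * (E2 * d + E1)"
  define C2 where "C2 = E1 * d"
  let ?Z = "annulus A B :: (real^'n) set"
  define h where "h x = C * \<bar>u x * indicator ?Z x\<bar> + C2 * \<bar>(v x \<bullet> x) * indicator ?Z x\<bar>" for x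
  have hi: "integrable lebesgue h"
  proof -
    have "integrable lebesgue (\<lambda>x. f x * indicator ?Z x)" if "loc_integrable_off_0 f" for f :: "real^'n \<Rightarrow> real"
      using that compact_annulus[of A B] zero_notin_annulus[OF A(1), of B]
      by (auto simp: loc_integrable_off_0_def set_integrable_def mult.commute)
    then show ?thesis unfolding h_def using uv
      by (intro Bochner_Integration.integrable_add integrable_mult_right integrable_abs)
        (auto simp: has_weak_gradient_def intro: loc_integrable_off_0_inner)
  qed
  have key: "\<bar>LINT x|lebesgue. radial_pairing u v G G' x\<bar> \<le> \<epsilon> * (LINT x|lebesgue. h x)" if \<epsilon>: "\<epsilon> > 0" for \<epsilon>
  proof -
    obtain R where R: "real_polynomial_function R" "\<And>r. r \<in> {A\<^sup>2..B\<^sup>2} \<Longrightarrow> \<bar>H' r - R r\<bar> < \<epsilon>"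
      using Stone_Weierstrass_real_polynomial_function[OF compact_Icc continuous_on_subset[OF cH' subset_UNIV] \<epsilon>] by blast
    obtain P where P: "real_polynomial_function P" "\<And>r. (P has_real_derivative R r) (at r)" "P (A\<^sup>2) = 0"
      using real_polynomial_antiderivative[OF R(1)] by blast
    have cR: "continuous_on UNIV R"
      using R(1) by (simp add: continuous_on_polymonial_function real_polynomial_function_eq)
    have cP: "continuous_on UNIV P" using P(2) by (meson DERIV_isCont continuous_at_imp_continuous_on)
    have HP: "\<bar>H r - P r\<bar> \<le> \<epsilon> * d" if r: "r \<in> {A\<^sup>2..B\<^sup>2}" for r
    proof (cases "r = A\<^sup>2")
      case True
      have "H (A\<^sup>2) = 0" using z[of "A\<^sup>2"] sq by (simp add: H_def)
      then show ?thesis using True P(3) \<epsilon> d by simp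
    next
      case False
      then have "A\<^sup>2 < r" using r by auto
      moreover have "((\<lambda>r. H r - P r) has_real_derivative H' r - R r) (at r)" for r
        by (auto intro!: derivative_eq_intros H P)
      ultimately obtain y where y: "A\<^sup>2 < y" "y < r" "(H r - P r) - (H (A\<^sup>2) - P (A\<^sup>2)) = (r - A\<^sup>2) * (H' y - R y)"
        using MVT2[of "A\<^sup>2" r "\<lambda>r. H r - P r" "\<lambda>r. H' r - R r"] by blast
      have "H (A\<^sup>2) = 0" using z[of "A\<^sup>2"] sq by (simp add: H_def)
      then have "\<bar>H r - P r\<bar> = (r - A\<^sup>2) * \<bar>H' y - R y\<bar>" using y P(3) by (simp add: abs_mult)
      also have "\<dots> \<le> d * \<epsilon>" using y r R(2)[of y] by (intro mult_mono) (auto simp: d_def)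
      finally show ?thesis by (simp add: mult.commute)
    qed
    define g where "g r = P r * ?e r" for r
    define g' where "g' r = R r * ?e r + P r * ?e' r" for r
    have cg: "continuous_on UNIV g" "continuous_on UNIV g'"
      unfolding g_def g'_def by (intro continuous_intros cP cR continuous_flat_bump)+
    have gz: "g r = 0 \<and> g' r = 0" if "r \<notin> {A\<^sup>2<..<B\<^sup>2}" for r using flat_bump_eq_0[OF that] by (simp add: g_def g'_def)
    have Ge: "G r = H r * ?e r" "G' r = H' r * ?e r + H r * ?e' r" for r
    proof -
      have "G r = H r * ?e r \<and> G' r = H' r * ?e r + H r * ?e' r"
      proof (cases "r \<in> {A\<^sup>2<..<B\<^sup>2}")
        case True
        from flat_bump_pos[OF this] show ?thesis by (simp add: H_def H'_def field_simps power2_eq_square)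
      next
        case False
        then have "r \<notin> {A1\<^sup>2..B1\<^sup>2}" using cov by blast
        with z[OF this] flat_bump_eq_0[OF False] show ?thesis by simp
      qed
      then show "G r = H r * ?e r" "G' r = H' r * ?e r + H r * ?e' r" by auto
    qed
    have d1: "\<bar>G r - g r\<bar> \<le> \<epsilon> * (E1 * d)" if r: "r \<in> {A\<^sup>2..B\<^sup>2}" for r
    proof -
      have "\<bar>G r - g r\<bar> = \<bar>H r - P r\<bar> * \<bar>?e r\<bar>" by (simp add: Ge g_def abs_mult[symmetric] left_diff_distrib)
      also have "\<dots> \<le> (\<epsilon> * d) * E1" using HP[OF r] E r \<epsilon> d by (intro mult_mono) auto
      finally show ?thesis by (simp add: mult_ac)
    qed
    have d2: "\<bar>G' r - g' r\<bar> \<le> \<epsilon> * (E2 * d + E1)" if r: "r \<in> {A\<^sup>2..B\<^sup>2}" for r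
    proof -
      have "G' r - g' r = (H r - P r) * ?e' r + (H' r - R r) * ?e r" by (simp add: Ge(2) g'_def algebra_simps)
      also have "\<bar>\<dots>\<bar> \<le> \<bar>H r - P r\<bar> * \<bar>?e' r\<bar> + \<bar>H' r - R r\<bar> * \<bar>?e r\<bar>"
        by (metis abs_mult abs_triangle_ineq)
      also have "\<dots> \<le> (\<epsilon> * d) * E2 + \<epsilon> * E1"
        using HP[OF r] R(2)[OF r] E r \<epsilon> d by (intro add_mono mult_mono) auto
      finally show ?thesis by (simp add: algebra_simps)
    qed
    have ig: "integrable lebesgue (radial_pairing u v g g')"
    proof (rule integrable_radial_pairing[OF uv A(1) _ cg])
      show "g r = 0 \<and> g' r = 0" if "r \<notin> {A\<^sup>2..B\<^sup>2}" for r using gz[of r] that by force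
    qed (use A in simp)
    have iG: "integrable lebesgue (radial_pairing u v G G')"
    proof (rule integrable_radial_pairing[OF uv A(1) _ cG G(2)])
      show "G r = 0 \<and> G' r = 0" if "r \<notin> {A\<^sup>2..B\<^sup>2}" for r using z[of r] that sq by force
    qed (use A in simp)
    have "(LINT x|lebesgue. radial_pairing u v g g' x) = 0"
      using radial_pairing_polynomial[OF uv A(1) _ P(1,2) cR, of B] A by (simp add: g_def[abs_def] g'_def[abs_def])
    then have "(LINT x|lebesgue. radial_pairing u v G G' x) = (LINT x|lebesgue. radial_pairing u v G G' x - radial_pairing u v g g' x)"
      using ig iG by simp
    also have "\<bar>\<dots>\<bar> \<le> (LINT x|lebesgue. \<bar>radial_pairing u v G G' x - radial_pairing u v g g' x\<bar>)"
      by (rule integral_abs_bound)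
    also have "\<dots> \<le> (LINT x|lebesgue. \<epsilon> * h x)"
    proof (rule integral_mono)
      fix x :: "real^'n"
      let ?r = "x \<bullet> x"
      have eq: "radial_pairing u v G G' x - radial_pairing u v g g' x
        = u x * (real CARD('n) * (G ?r - g ?r) + 2 * ?r * (G' ?r - g' ?r)) + (v x \<bullet> x) * (G ?r - g ?r)"
        by (simp add: radial_pairing_def algebra_simps)
      show "\<bar>radial_pairing u v G G' x - radial_pairing u v g g' x\<bar> \<le> \<epsilon> * h x"
      proof (cases "x \<in> ?Z")
        case True
        then have r: "?r \<in> {A\<^sup>2..B\<^sup>2}" using A inner_self_in_iff[of A B x] by simp
        have "\<bar>real CARD('n) * (G ?r - g ?r) + 2 * ?r * (G' ?r - g' ?r)\<bar>
          \<le> \<bar>real CARD('n) * (G ?r - g ?r)\<bar> + \<bar>2 * ?r * (G' ?r - g' ?r)\<bar>" by (rule abs_triangle_ineq)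
        also have "\<dots> = real CARD('n) * \<bar>G ?r - g ?r\<bar> + 2 * ?r * \<bar>G' ?r - g' ?r\<bar>"
          by (simp add: abs_mult)
        also have "\<dots> \<le> real CARD('n) * (\<epsilon> * (E1 * d)) + 2 * B\<^sup>2 * (\<epsilon> * (E2 * d + E1))"
          using d1[OF r] d2[OF r] r by (intro add_mono mult_mono) auto
        also have "\<dots> = \<epsilon> * C" by (simp add: C_def algebra_simps)
        finally have 1: "\<bar>u x * (real CARD('n) * (G ?r - g ?r) + 2 * ?r * (G' ?r - g' ?r))\<bar> \<le> \<bar>u x\<bar> * (\<epsilon> * C)"
          unfolding abs_mult by (rule mult_left_mono) simp
        have 2: "\<bar>(v x \<bullet> x) * (G ?r - g ?r)\<bar> \<le> \<bar>v x \<bullet> x\<bar> * (\<epsilon> * C2)"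
          unfolding abs_mult C2_def using d1[OF r] by (rule mult_left_mono) simp
        have "\<bar>u x * (real CARD('n) * (G ?r - g ?r) + 2 * ?r * (G' ?r - g' ?r)) + (v x \<bullet> x) * (G ?r - g ?r)\<bar>
          \<le> \<bar>u x\<bar> * (\<epsilon> * C) + \<bar>v x \<bullet> x\<bar> * (\<epsilon> * C2)" using 1 2 by linarith
        then show ?thesis unfolding eq using True by (simp add: h_def algebra_simps)
      next
        case False
        then have r: "?r \<notin> {A\<^sup>2..B\<^sup>2}" using A inner_self_in_iff[of A B x] by simp
        then have "G ?r = 0 \<and> G' ?r = 0" "g ?r = 0 \<and> g' ?r = 0" using z[of ?r] gz[of ?r] sq by auto
        then show ?thesis unfolding eq using False by (simp add: h_def)
      qed
    qed (use ig iG hi in auto)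
    finally show ?thesis by simp
  qed
  then have "\<bar>LINT x|lebesgue. radial_pairing u v G G' x\<bar> \<le> 0" by (rule nonpos_if_le_epsilon_mult)
  then show ?thesis by simp
qed

text \<open>In the variable \<open>s = ln |x|\<close>, and after averaging over spheres,
  \<open>|x| powr \<gamma> * u\<close> has the weak derivative
  \<open>|x| powr \<gamma> * (\<gamma> u + v \<bullet> x)\<close>.\<close>

lemma integral_radial_test:
  fixes u :: "real^'n::finite \<Rightarrow> real"
  assumes uv: "has_weak_gradient u v"
    and \<psi>: "\<And>s. (\<psi> has_real_derivative \<psi>' s) (at s)" "continuous_on UNIV \<psi>'"
    and supp: "\<And>s. \<bar>s\<bar> > L \<Longrightarrow> \<psi> s = 0 \<and> \<psi>' s = 0" and L: "L > 0"
  shows "(LINT x|cyl_measure. norm x powr \<gamma> * u x * \<psi>' (ln (norm x))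
     + norm x powr \<gamma> * (\<gamma> * u x + v x \<bullet> x) * \<psi> (ln (norm x))) = 0"
proof -
  let ?n = "real CARD('n)"
  \<comment> \<open>With \<open>r = |x|\<^sup>2\<close> one has \<open>ln r / 2 = ln |x|\<close> and
    \<open>r powr d = |x| powr (\<gamma> - n)\<close>; the exponent \<open>- n\<close> is the
    density of \<open>cyl_measure\<close>.\<close>
  define d where "d = (\<gamma> - ?n) / 2"
  have c\<psi>: "continuous_on UNIV \<psi>" using \<psi>(1) by (meson DERIV_isCont continuous_at_imp_continuous_on)
  define G where "G r = (if r \<le> 0 then 0 else r powr d * \<psi> (ln r / 2))" for r
  define G' where "G' r = (if r \<le> 0 then 0 else r powr (d - 1) * (d * \<psi> (ln r / 2) + \<psi>' (ln r / 2) / 2))" for r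
  define A1 where "A1 = exp (- L)"
  define B1 where "B1 = exp L"
  have AB: "0 < A1" "A1 < B1" using L by (auto simp: A1_def B1_def)
  have z: "G r = 0 \<and> G' r = 0" if r: "r \<notin> {A1\<^sup>2..B1\<^sup>2}" for r
  proof (cases "r \<le> 0")
    case False
    have sq: "A1\<^sup>2 = exp (- 2 * L)" "B1\<^sup>2 = exp (2 * L)" by (simp_all add: A1_def B1_def exp_double[symmetric] power2_eq_square exp_add[symmetric])
    have "r < exp (- 2 * L) \<or> r > exp (2 * L)" using r by (auto simp: sq)
    then have "ln r < - 2 * L \<or> ln r > 2 * L"
      using False by (metis exp_gt_zero ln_exp ln_less_cancel_iff not_le)
    then have "\<bar>ln r / 2\<bar> > L" by auto
    from supp[OF this] show ?thesis by (simp add: G_def G'_def)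
  qed (simp add: G_def G'_def)
  have A2: "A1\<^sup>2 > 0" using AB by simp
  have o: "open {0::real<..}" "open {..<A1\<^sup>2}" by auto
  have cov: "r \<in> {0<..} \<or> r \<in> {..<A1\<^sup>2}" for r
    using A2 unfolding greaterThan_iff lessThan_iff by linarith
  have dG: "(G has_real_derivative G' r) (at r)" for r
  proof (cases "r \<in> {0<..}")
    case True
    then have r: "r > 0" by simp
    have l: "((\<lambda>r. ln r / 2) has_real_derivative 1 / (2 * r)) (at r)"
      using r by (auto intro!: derivative_eq_intros)
    have p: "((\<lambda>r. r powr d) has_real_derivative d * r powr (d - 1)) (at r)"
      using r by (auto intro!: derivative_eq_intros)
    have "((\<lambda>r. r powr d * \<psi> (ln r / 2)) has_real_derivative G' r) (at r)"
    proof (rule DERIV_cong[OF DERIV_mult[OF p DERIV_chain2[OF \<psi>(1) l]]])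
      have "r powr d = r powr (d - 1) * r" using r by (simp add: powr_diff)
      then show "d * r powr (d - 1) * \<psi> (ln r / 2) + \<psi>' (ln r / 2) * (1 / (2 * r)) * r powr d = G' r"
        using r by (simp add: G'_def algebra_simps)
    qed
    then show ?thesis
      by (rule has_field_derivative_transform_within_open[OF _ o(1) True]) (auto simp: G_def)
  next
    case False
    then have r: "r \<in> {..<A1\<^sup>2}" using cov by blast
    have "((\<lambda>r. 0) has_real_derivative G' r) (at r)" using z[of r] r by auto
    then show ?thesis
      by (rule has_field_derivative_transform_within_open[OF _ o(2) r]) (use z in auto)
  qed
  have cG': "continuous_on UNIV G'"
  proof -
    have "continuous_on {0<..} (\<lambda>r. r powr (d - 1) * (d * \<psi> (ln r / 2) + \<psi>' (ln r / 2) / 2))"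
      by (intro continuous_intros continuous_on_compose2[OF c\<psi>] continuous_on_compose2[OF \<psi>(2)]) auto
    then have "continuous_on {0<..} G'" by (rule continuous_on_eq) (auto simp: G'_def)
    moreover have "continuous_on {..<A1\<^sup>2} G'"
      by (rule continuous_on_eq[OF continuous_on_const[of _ 0]]) (use z in auto)
    ultimately have "continuous_on ({0<..} \<union> {..<A1\<^sup>2}) G'" by (intro continuous_on_open_Un o)
    moreover have "{0<..} \<union> {..<A1\<^sup>2} = UNIV" using cov by blast
    ultimately show ?thesis by simp
  qed
  have 0: "(LINT x|lebesgue. radial_pairing u v G G' x) = 0"
    by (rule radial_pairing_eq_0[OF uv _ _ AB(2) _ dG cG' z, of "A1 / 2" "B1 + 1"]) (use AB in auto)
  have um[measurable]: "u \<in> borel_measurable lebesgue" "(\<lambda>x. v x \<bullet> x) \<in> borel_measurable lebesgue"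
    using uv by (auto simp: has_weak_gradient_def intro!: loc_integrable_off_0_measurable loc_integrable_off_0_inner)
  have "sphere_const TYPE(real^'n) * (LINT x|cyl_measure. norm x powr \<gamma> * u x * \<psi>' (ln (norm x))
     + norm x powr \<gamma> * (\<gamma> * u x + v x \<bullet> x) * \<psi> (ln (norm x)))
    = (LINT x|lebesgue. norm x powr - ?n * (norm x powr \<gamma> * u x * \<psi>' (ln (norm x))
     + norm x powr \<gamma> * (\<gamma> * u x + v x \<bullet> x) * \<psi> (ln (norm x))))"
  proof -
    have [measurable]: "(\<lambda>x::real^'n. \<psi> (ln (norm x))) \<in> borel_measurable lebesgue"
      "(\<lambda>x::real^'n. \<psi>' (ln (norm x))) \<in> borel_measurable lebesgue"
      using measurable_compose[OF cyl_weight_measurable(2) borel_measurable_continuous_onI[OF c\<psi>]]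
        measurable_compose[OF cyl_weight_measurable(2) borel_measurable_continuous_onI[OF \<psi>(2)]] by auto
    show ?thesis by (subst integral_cyl_measure[symmetric]) auto
  qed
  also have "\<dots> = (LINT x|lebesgue. radial_pairing u v G G' x)"
  proof (intro Bochner_Integration.integral_cong refl)
    fix x :: "real^'n"
    show "norm x powr - ?n * (norm x powr \<gamma> * u x * \<psi>' (ln (norm x)) + norm x powr \<gamma> * (\<gamma> * u x + v x \<bullet> x) * \<psi> (ln (norm x)))
      = radial_pairing u v G G' x"
    proof (cases "x = 0")
      case True then show ?thesis by (simp add: radial_pairing_def G_def)
    next
      case False
      define r where "r = norm x"
      have r: "r > 0" using False by (simp add: r_def)
      have xx: "x \<bullet> x = r\<^sup>2" by (simp add: r_def power2_norm_eq_inner)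
      have l: "ln (r\<^sup>2) / 2 = ln r" using r by (simp add: ln_realpow)
      have p1: "(r\<^sup>2) powr d = r powr - ?n * r powr \<gamma>"
      proof -
        have "(r\<^sup>2) powr d = (r powr 2) powr d" using r by (simp add: powr_numeral)
        also have "\<dots> = r powr (2 * d)" by (rule powr_powr)
        also have "2 * d = - ?n + \<gamma>" by (simp add: d_def)
        finally show ?thesis by (simp only: powr_add)
      qed
      have p2: "r\<^sup>2 * (r\<^sup>2) powr (d - 1) = r powr - ?n * r powr \<gamma>"
        using r p1 by (simp add: powr_diff)
      have g1: "G (x \<bullet> x) = r powr - ?n * r powr \<gamma> * \<psi> (ln r)" using r by (simp add: xx G_def l p1)
      have g2: "(x \<bullet> x) * G' (x \<bullet> x) = r powr - ?n * r powr \<gamma> * (d * \<psi> (ln r) + \<psi>' (ln r) / 2)"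
        using r by (simp add: xx G'_def l p2[symmetric])
      have "radial_pairing u v G G' x = u x * (?n * G (x \<bullet> x) + 2 * ((x \<bullet> x) * G' (x \<bullet> x))) + (v x \<bullet> x) * G (x \<bullet> x)"
        by (simp add: radial_pairing_def mult.assoc)
      also have "\<dots> = r powr - ?n * r powr \<gamma> *
          (u x * (?n * \<psi> (ln r) + 2 * (d * \<psi> (ln r) + \<psi>' (ln r) / 2)) + (v x \<bullet> x) * \<psi> (ln r))"
        unfolding g1 g2 by (simp add: algebra_simps)
      also have "?n * \<psi> (ln r) + 2 * (d * \<psi> (ln r) + \<psi>' (ln r) / 2) = \<gamma> * \<psi> (ln r) + \<psi>' (ln r)"
        by (simp add: d_def field_simps)
      finally show ?thesis by (simp add: r_def[symmetric] algebra_simps)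
    qed
  qed
  finally show ?thesis using 0 sphere_const_pos[where 'a = "real^'n"] by simp
qed

lemma line_fibration_cyl: "line_fibration (cyl_measure :: 'a::euclidean_space measure) (\<lambda>x. ln (norm x))"
proof
  show "(\<lambda>x::'a. ln (norm x)) \<in> borel_measurable cyl_measure"
    using cyl_weight_measurable(2) by (simp add: measurable_def)
  show "distr (cyl_measure :: 'a measure) borel (\<lambda>x. ln (norm x)) = lborel" by (rule distr_cyl_measure)
qed

lemma borel_measurable_cyl_iff: "f \<in> borel_measurable (cyl_measure :: 'a::euclidean_space measure) \<longleftrightarrow> f \<in> borel_measurable lebesgue"
  by (auto simp: measurable_def)

section \<open>A radial function as a primitive along the axis\<close>

locale radial_function =
  fixes u :: "real^'n::finite \<Rightarrow> real" and v :: "real^'n \<Rightarrow> real^'n" and \<gamma> :: real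
  assumes uv: "has_weak_gradient u v" and rad: "radial u"
begin

text \<open>Formally the derivative of \<open>cu\<close> with respect to
  \<open>ln |x|\<close>.\<close>

definition K where "K x = norm x powr \<gamma> * (\<gamma> * u x + v x \<bullet> x)"
definition cu where "cu x = norm x powr \<gamma> * u x"

sublocale line_fibration "cyl_measure :: (real^'n) measure" "\<lambda>x. ln (norm x)"
  by (rule line_fibration_cyl)

lemma loc: "loc_integrable_off_0 K" "loc_integrable_off_0 cu"
proof -
  have u: "loc_integrable_off_0 u" and v: "loc_integrable_off_0 (\<lambda>x. v x \<bullet> x)"
    using uv by (auto simp: has_weak_gradient_def intro: loc_integrable_off_0_inner)
  have c: "continuous_on (- {0}) (\<lambda>x::real^'n. norm x powr \<gamma>)" by (intro continuous_intros) auto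
  have m: "(\<lambda>x::real^'n. norm x powr \<gamma>) \<in> borel_measurable borel" by measurable
  have "loc_integrable_off_0 (\<lambda>x. (u x * \<gamma> + v x \<bullet> x) * norm x powr \<gamma>)"
    by (intro loc_integrable_off_0_mult[OF _ c m] loc_integrable_off_0_add loc_integrable_off_0_mult u v) auto
  then show "loc_integrable_off_0 K" by (simp add: K_def[abs_def] mult.commute)
  have "loc_integrable_off_0 (\<lambda>x. u x * norm x powr \<gamma>)" by (rule loc_integrable_off_0_mult[OF u c m])
  then show "loc_integrable_off_0 cu" by (simp add: cu_def[abs_def] mult.commute)
qed

lemma K_measurable': "K \<in> borel_measurable lebesgue" "cu \<in> borel_measurable lebesgue"
  by (intro loc_integrable_off_0_measurable loc)+

lemma K_int: "integrable cyl_measure (\<lambda>x. indicator {a<..b} (ln (norm x)) * K x)"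
  by (rule integrable_cyl_measure_mult[OF loc(1), of _ 1 "max \<bar>a\<bar> \<bar>b\<bar>"]) (auto simp: indicator_def)

text \<open>The primitive of the fibre means of \<open>K\<close> that vanishes at 0; for negative
  \<open>s\<close> the second integral supplies the sign.\<close>

definition Y where "Y s = (LINT x|cyl_measure. indicator {0<..s} (ln (norm x)) * K x)
   - (LINT x|cyl_measure. indicator {s<..0} (ln (norm x)) * K x)"

lemma Y_diff:
  assumes "a \<le> b"
  shows "Y b - Y a = (LINT x|cyl_measure. indicator {a<..b} (ln (norm x)) * K x)"
proof -
  have "Y b - Y a = (LINT x|cyl_measure. indicator {0<..b} (ln (norm x)) * K x - indicator {b<..0} (ln (norm x)) * K x
     - (indicator {0<..a} (ln (norm x)) * K x - indicator {a<..0} (ln (norm x)) * K x))"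
    unfolding Y_def using K_int by simp
  also have "\<dots> = (LINT x|cyl_measure. indicator {a<..b} (ln (norm x)) * K x)"
    using assms by (intro Bochner_Integration.integral_cong refl) (auto simp: indicator_def)
  finally show ?thesis .
qed

lemma AE_cyl_level: "AE x in (cyl_measure :: (real^'n) measure). ln (norm x) \<noteq> s"
proof -
  have "AE y in distr (cyl_measure :: (real^'n) measure) borel (\<lambda>x. ln (norm x)). y \<noteq> s"
    unfolding distr_cyl_measure by (rule AE_lborel_singleton)
  then show ?thesis by (subst (asm) AE_distr_iff) auto
qed

text \<open>Level sets of \<open>ln |x|\<close> are null sets of \<open>cyl_measure\<close>, so the
  indicators of shrinking intervals tend to 0 almost everywhere.\<close>

lemma Y_cont: "continuous_on UNIV Y"
proof (rule continuous_at_imp_continuous_on, rule ballI, unfold continuous_at_sequentially, intro allI impI)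
  fix s and X :: "nat \<Rightarrow> real" assume X: "X \<longlonglongrightarrow> s"
  obtain R where R: "\<And>j. \<bar>X j\<bar> \<le> R"
    using X by (metis Bseq_def convergent_imp_Bseq convergentI real_norm_def)
  have Rs: "\<bar>s\<bar> \<le> R" using X R by (metis LIMSEQ_le_const2 tendsto_rabs)
  let ?I = "\<lambda>j x. (indicator {s<..X j} (ln (norm x)) - indicator {X j<..s} (ln (norm x))) * K x"
  have eq: "Y (X j) - Y s = (LINT x|cyl_measure. ?I j x)" for j
  proof -
    have *: "(LINT x|cyl_measure. ?I j x) = (LINT x|cyl_measure. indicator {s<..X j} (ln (norm x)) * K x)
       - (LINT x|cyl_measure. indicator {X j<..s} (ln (norm x)) * K x)"
      using K_int by (simp add: left_diff_distrib)
    show ?thesis using Y_diff[of s "X j"] Y_diff[of "X j" s] unfolding *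
      by (cases "s \<le> X j") (auto simp: not_le)
  qed
  have "(\<lambda>j. LINT x|cyl_measure. ?I j x) \<longlonglongrightarrow> (LINT x|(cyl_measure :: (real^'n) measure). 0 :: real)"
  proof (rule integral_dominated_convergence[where w = "\<lambda>x. \<bar>indicator {- R - 1<..R} (ln (norm x)) * K x\<bar>"])
    show "AE x in cyl_measure. (\<lambda>j. ?I j x) \<longlonglongrightarrow> 0"
      using AE_cyl_level[of s]
    proof eventually_elim
      case (elim x)
      let ?l = "ln (norm x)"
      have "\<forall>\<^sub>F j in sequentially. \<bar>X j - s\<bar> < \<bar>?l - s\<bar>"
        using tendstoD[OF X, of "\<bar>?l - s\<bar>"] elim by (simp add: dist_real_def)
      then have "\<forall>\<^sub>F j in sequentially. ?I j x = 0"
        by eventually_elim (auto simp: indicator_def)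
      then show ?case by (rule tendsto_eventually)
    qed
    show "AE x in cyl_measure. norm (?I j x) \<le> \<bar>indicator {- R - 1<..R} (ln (norm x)) * K x\<bar>" for j
      using R[of j] Rs by (intro always_eventually) (auto simp: indicator_def)
    show "?I j \<in> borel_measurable cyl_measure" for j
      using K_measurable'(1) cyl_weight_measurable(2)[where 'a = "real^'n"]
      unfolding borel_measurable_cyl_iff by measurable
    show "integrable cyl_measure (\<lambda>x. \<bar>indicator {- R - 1<..R} (ln (norm x)) * K x\<bar>)"
      by (intro integrable_abs K_int)
  qed simp
  then have "(\<lambda>j. Y (X j) - Y s) \<longlonglongrightarrow> 0" unfolding eq by simp
  then show "(Y \<circ> X) \<longlonglongrightarrow> Y s" by (simp add: LIM_zero_iff comp_def)
qed

lemma fibre_primitive_Y: "fibre_primitive cyl_measure (\<lambda>x. ln (norm x)) K (\<lambda>s. Y s + C)"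
  by unfold_locales
    (use K_measurable' K_int Y_diff Y_cont in \<open>auto simp: borel_measurable_cyl_iff intro!: continuous_intros\<close>)

lemma integrable_test:
  assumes \<eta>: "continuous_on UNIV (\<eta> :: real \<Rightarrow> real)" and supp: "\<And>s. \<bar>s\<bar> > L \<Longrightarrow> \<eta> s = 0"
    and F: "loc_integrable_off_0 F"
  shows "integrable cyl_measure (\<lambda>x. F x * \<eta> (ln (norm x)))"
proof -
  obtain B where "\<And>s. \<bar>\<eta> s\<bar> \<le> B" using bounded_compact_support[OF \<eta> supp] by blast
  from integrable_cyl_measure_mult[OF F borel_measurable_continuous_onI[OF \<eta>] this supp]
  show ?thesis by (simp add: mult.commute)
qed

lemma integrable_test_fibre:
  assumes \<eta>: "continuous_on UNIV (\<eta> :: real \<Rightarrow> real)" and supp: "\<And>s. \<bar>s\<bar> > L \<Longrightarrow> \<eta> s = 0"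
  shows "integrable cyl_measure (\<lambda>x::real^'n. \<eta> (ln (norm x)))"
  using integrable_continuous_compact_support(1)[OF \<eta>, of L] supp
  by (subst integrable_fibration) (auto intro: borel_measurable_continuous_onI[OF \<eta>])

text \<open>Both functions have the derivative \<open>K\<close>: \<open>cu\<close> in the weak sense
  of \<open>integral_radial_test\<close>, and \<open>Y\<close> by \<open>chain_rule\<close>.
  Subtracting the two identities removes \<open>K\<close>.\<close>

lemma orthogonal_derivatives:
  assumes \<psi>: "\<And>s. (\<psi> has_real_derivative \<psi>' s) (at s)" "continuous_on UNIV \<psi>'"
    and supp: "\<And>s. \<bar>s\<bar> > L \<Longrightarrow> \<psi> s = 0 \<and> \<psi>' s = 0" and L: "L > 0"
  shows "(LINT x|cyl_measure. (cu x - Y (ln (norm x))) * \<psi>' (ln (norm x))) = 0"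
proof -
  interpret fibre_primitive cyl_measure "\<lambda>x::real^'n. ln (norm x)" K Y
    using fibre_primitive_Y[of 0] by simp
  have c\<psi>: "continuous_on UNIV \<psi>" using \<psi>(1) by (meson DERIV_isCont continuous_at_imp_continuous_on)
  have i1: "integrable cyl_measure (\<lambda>x. cu x * \<psi>' (ln (norm x)))" "integrable cyl_measure (\<lambda>x. K x * \<psi> (ln (norm x)))"
    using supp by (intro integrable_test[of _ L] \<psi>(2) c\<psi> loc; simp)+
  have i2: "integrable cyl_measure (\<lambda>x::real^'n. Y (ln (norm x)) * \<psi>' (ln (norm x)))"
    using supp by (intro integrable_test_fibre[of "\<lambda>s. Y s * \<psi>' s" L] continuous_intros Y_cont \<psi>(2)) simp
  have "0 = \<psi> (L + 1) * Y (L + 1) - \<psi> (- (L + 1)) * Y (- (L + 1))" using supp L by simp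
  also have "\<dots> = (LINT x|cyl_measure. indicator {- (L + 1)<..L + 1} (ln (norm x)) *
     (\<psi>' (ln (norm x)) * Y (ln (norm x)) + \<psi> (ln (norm x)) * 1 * K x))"
    using L by (intro chain_rule[OF \<psi>, of "\<lambda>y. y" "\<lambda>y. 1"]) auto
  also have "\<dots> = (LINT x|cyl_measure. Y (ln (norm x)) * \<psi>' (ln (norm x)) + K x * \<psi> (ln (norm x)))"
  proof (intro Bochner_Integration.integral_cong refl)
    fix x :: "real^'n"
    show "indicator {- (L + 1)<..L + 1} (ln (norm x)) * (\<psi>' (ln (norm x)) * Y (ln (norm x)) + \<psi> (ln (norm x)) * 1 * K x)
      = Y (ln (norm x)) * \<psi>' (ln (norm x)) + K x * \<psi> (ln (norm x))"
      using supp[of "ln (norm x)"] by (cases "\<bar>ln (norm x)\<bar> > L") (auto simp: indicator_def mult.commute)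
  qed
  also have "\<dots> = (LINT x|(cyl_measure :: (real^'n) measure). Y (ln (norm x)) * \<psi>' (ln (norm x))) + (LINT x|cyl_measure. K x * \<psi> (ln (norm x)))"
    using i1 i2 by simp
  finally have 1: "(LINT x|cyl_measure. K x * \<psi> (ln (norm x))) = - (LINT x|(cyl_measure :: (real^'n) measure). Y (ln (norm x)) * \<psi>' (ln (norm x)))" by simp
  have "(LINT x|cyl_measure. cu x * \<psi>' (ln (norm x)) + K x * \<psi> (ln (norm x))) = 0"
    using integral_radial_test[OF uv \<psi> supp L, of \<gamma>] by (simp add: cu_def K_def)
  then have "(LINT x|cyl_measure. cu x * \<psi>' (ln (norm x))) = (LINT x|(cyl_measure :: (real^'n) measure). Y (ln (norm x)) * \<psi>' (ln (norm x)))"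
    using i1 1 by simp
  then show ?thesis using i1 i2 by (simp add: left_diff_distrib)
qed

text \<open>The constant of integration, found as the mean of \<open>cu - Y\<close> with respect to
  \<open>parabola\<close>, which has integral 1.\<close>

definition C where "C = (LINT x|cyl_measure. (cu x - Y (ln (norm x))) * parabola (ln (norm x)))"
definition W where "W s = Y s + C"

text \<open>\<eta> minus its integral times \<open>parabola\<close> is the derivative of a function
  of compact support, to which \<open>orthogonal_derivatives\<close> applies; \<open>C\<close> is
  chosen so that the multiple of \<open>parabola\<close> contributes 0 as well.\<close>

lemma orthogonal_continuous:
  assumes \<eta>: "continuous_on UNIV (\<eta> :: real \<Rightarrow> real)" and supp: "\<And>s. \<bar>s\<bar> > L \<Longrightarrow> \<eta> s = 0"
  shows "(LINT x|cyl_measure. (cu x - W (ln (norm x))) * \<eta> (ln (norm x))) = 0"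
proof -
  define I where "I = (LINT s|lborel. \<eta> s)"
  define M where "M = max 1 \<bar>L\<bar>"
  have M: "M \<ge> 0" "M > 0" by (auto simp: M_def)
  define f where "f s = \<eta> s - I * parabola s" for s
  have f: "continuous_on UNIV f" unfolding f_def by (intro continuous_intros \<eta> continuous_parabola)
  have fs: "f s = 0" if "\<bar>s\<bar> > M" for s using that supp by (auto simp: f_def M_def parabola_simps)
  have i\<eta>: "integrable lborel \<eta>"
    by (rule integrable_continuous_compact_support[OF \<eta>, of L]) (use supp in auto)
  have f0: "(LINT s|lborel. f s) = 0"
    using i\<eta> integral_parabola by (simp add: f_def I_def)
  obtain \<psi> where \<psi>: "\<And>s. (\<psi> has_real_derivative f s) (at s)" "\<And>s. \<bar>s\<bar> > M \<Longrightarrow> \<psi> s = 0"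
    using compact_antiderivative[OF f fs M(1) f0] by blast
  have "(LINT x|cyl_measure. (cu x - Y (ln (norm x))) * f (ln (norm x))) = 0"
    by (rule orthogonal_derivatives[OF \<psi>(1) f _ M(2)]) (use \<psi>(2) fs in auto)
  moreover have iD: "integrable cyl_measure (\<lambda>x. (cu x - Y (ln (norm x))) * h (ln (norm x)))"
    if "continuous_on UNIV h" "\<And>s. \<bar>s\<bar> > M \<Longrightarrow> h s = 0" for h :: "real \<Rightarrow> real"
  proof -
    have "integrable cyl_measure (\<lambda>x. cu x * h (ln (norm x)))"
      using that by (intro integrable_test[of _ M] loc) auto
    moreover have "integrable cyl_measure (\<lambda>x::real^'n. Y (ln (norm x)) * h (ln (norm x)))"
      using that by (intro integrable_test_fibre[of "\<lambda>s. Y s * h s" M] continuous_intros Y_cont) auto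
    ultimately show ?thesis by (simp add: left_diff_distrib)
  qed
  moreover have s\<eta>: "\<bar>s\<bar> > M \<Longrightarrow> \<eta> s = 0" "\<bar>s\<bar> > M \<Longrightarrow> parabola s = 0" for s
    using supp by (auto simp: M_def parabola_simps)
  ultimately have "(LINT x|cyl_measure. (cu x - Y (ln (norm x))) * \<eta> (ln (norm x))) = I * C"
  proof -
    have "(LINT x|cyl_measure. (cu x - Y (ln (norm x))) * f (ln (norm x)))
      = (LINT x|cyl_measure. (cu x - Y (ln (norm x))) * \<eta> (ln (norm x)) - I * ((cu x - Y (ln (norm x))) * parabola (ln (norm x))))"
      by (simp add: f_def algebra_simps)
    also have "\<dots> = (LINT x|cyl_measure. (cu x - Y (ln (norm x))) * \<eta> (ln (norm x))) - I * C"
      unfolding C_def using iD[OF \<eta> s\<eta>(1)] iD[OF continuous_parabola s\<eta>(2)] by simp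
    finally show ?thesis
      using \<open>(LINT x|cyl_measure. (cu x - Y (ln (norm x))) * f (ln (norm x))) = 0\<close> by simp
  qed
  moreover have "(LINT x|(cyl_measure :: (real^'n) measure). \<eta> (ln (norm x))) = I"
    unfolding I_def by (rule integral_fibration) (rule borel_measurable_continuous_onI[OF \<eta>])
  moreover have "(LINT x|cyl_measure. (cu x - W (ln (norm x))) * \<eta> (ln (norm x)))
    = (LINT x|cyl_measure. (cu x - Y (ln (norm x))) * \<eta> (ln (norm x)) - C * \<eta> (ln (norm x)))"
    by (simp add: W_def algebra_simps)
  ultimately show ?thesis
    using iD[OF \<eta> s\<eta>(1)] integrable_test_fibre[OF \<eta> supp] by simp
qed

text \<open>This is the lemma of du Bois-Reymond: a radial function is the primitive of its radial weak derivative.\<close>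

lemma AE_eq_W: "AE x in lebesgue. cu x = W (ln (norm x))"
proof -
  have cW: "continuous_on UNIV W" unfolding W_def by (intro continuous_intros Y_cont)
  have *: "AE x in lebesgue. \<bar>ln (norm x)\<bar> < real m + 1 \<longrightarrow> cu x = W (ln (norm x))" for m :: nat
  proof -
    define b where "b s = parabola (s / (real m + 1))" for s
    have b: "continuous_on UNIV b" unfolding b_def
      by (intro continuous_on_compose2[OF continuous_parabola] continuous_intros) auto
    have bs: "b s = 0" if "\<bar>s\<bar> > real m + 1" for s using that by (simp add: b_def parabola_simps)
    let ?n = "real CARD('n)"
    define z where "z x = norm x powr - ?n * ((cu x - W (ln (norm x))) * b (ln (norm x)))" for x :: "real^'n"
    have mm: "(\<lambda>x. (cu x - W (ln (norm x))) * h (ln (norm x))) \<in> borel_measurable lebesgue"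
      if h: "continuous_on UNIV h" for h :: "real \<Rightarrow> real"
    proof -
      have [measurable]: "(\<lambda>x::real^'n. h (ln (norm x))) \<in> borel_measurable lebesgue"
        "(\<lambda>x::real^'n. W (ln (norm x))) \<in> borel_measurable lebesgue"
        using measurable_compose[OF cyl_weight_measurable(2) borel_measurable_continuous_onI[OF h]]
          measurable_compose[OF cyl_weight_measurable(2) borel_measurable_continuous_onI[OF cW]] by auto
      show ?thesis using K_measurable'(2) by measurable
    qed
    have iD: "integrable cyl_measure (\<lambda>x. (cu x - W (ln (norm x))) * b (ln (norm x)))"
    proof -
      have "integrable cyl_measure (\<lambda>x. cu x * b (ln (norm x)))"
        using bs by (intro integrable_test[of _ "real m + 1"] loc b) auto
      moreover have "integrable cyl_measure (\<lambda>x::real^'n. W (ln (norm x)) * b (ln (norm x)))"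
        using bs by (intro integrable_test_fibre[of "\<lambda>s. W s * b s" "real m + 1"] continuous_intros cW b) auto
      ultimately show ?thesis by (simp add: left_diff_distrib)
    qed
    have iz: "integrable lebesgue z"
      unfolding z_def using iD integrable_cyl_measure_iff[OF mm[OF b]] by simp
    obtain f where f: "AE x in lebesgue. u x = f (norm x)" using rad by (auto simp: radial_def)
    have "AE x in lebesgue. z x = 0"
    \<comment> \<open>Here the projection is the norm. Only functions of \<open>|x|\<close> have
      been tested; they suffice because radiality makes \<open>z\<close> almost everywhere a
      function of \<open>|x|\<close>, although one without known measurability.\<close>
    proof (rule AE_zero_if_orthogonal[OF iz continuous_on_norm_id,
          where f = "\<lambda>r. r powr - ?n * ((r powr \<gamma> * f r - W (ln r)) * b (ln r))"])
      show "AE x in lebesgue. z x = norm x powr - ?n * ((norm x powr \<gamma> * f (norm x) - W (ln (norm x))) * b (ln (norm x)))"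
        using f by eventually_elim (simp add: z_def cu_def)
    next
      fix \<eta> :: "real \<Rightarrow> real" assume \<eta>: "continuous_on UNIV \<eta>"
      have ce: "continuous_on UNIV (\<lambda>s. b s * \<eta> (exp s))"
        by (intro continuous_intros b continuous_on_compose2[OF \<eta>]) auto
      have "(LINT x|lebesgue. z x * \<eta> (norm x))
        = (LINT x|lebesgue. norm x powr - ?n * ((cu x - W (ln (norm x))) * (b (ln (norm x)) * \<eta> (exp (ln (norm x))))))"
      proof (rule integral_cong_AE)
        have "z \<in> borel_measurable lebesgue" using iz by auto
        moreover have "(\<lambda>x::real^'n. \<eta> (norm x)) \<in> borel_measurable lebesgue"
          by (rule measurable_lebesgue_if_borel, rule borel_measurable_continuous_onI)
            (intro continuous_on_compose2[OF \<eta>] continuous_intros, auto)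
        ultimately show "(\<lambda>x. z x * \<eta> (norm x)) \<in> borel_measurable lebesgue" by measurable
        show "(\<lambda>x. norm x powr - ?n * ((cu x - W (ln (norm x))) * (b (ln (norm x)) * \<eta> (exp (ln (norm x)))))) \<in> borel_measurable lebesgue"
          using mm[OF ce] by measurable
        show "AE x in lebesgue. z x * \<eta> (norm x) = norm x powr - ?n * ((cu x - W (ln (norm x))) * (b (ln (norm x)) * \<eta> (exp (ln (norm x)))))"
          using AE_lebesgue_neq_0 by eventually_elim (simp add: z_def)
      qed
      also have "\<dots> = sphere_const TYPE(real^'n) * (LINT x|cyl_measure. (cu x - W (ln (norm x))) * (b (ln (norm x)) * \<eta> (exp (ln (norm x)))))"
        using integral_cyl_measure[OF mm[OF ce]] by simp
      also have "\<dots> = 0"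
        using orthogonal_continuous[OF ce, of "real m + 1"] bs by simp
      finally show "(LINT x|lebesgue. z x * \<eta> (norm x)) = 0" .
    qed
    then show ?thesis
      using AE_lebesgue_neq_0
    proof eventually_elim
      case (elim x)
      have "b (ln (norm x)) > 0" if "\<bar>ln (norm x)\<bar> < real m + 1"
        unfolding b_def using that by (intro parabola_simps(3)) simp
      then show ?case using elim by (auto simp: z_def)
    qed
  qed
  have "AE x in lebesgue. \<forall>m::nat. \<bar>ln (norm x)\<bar> < real m + 1 \<longrightarrow> cu x = W (ln (norm x))"
    unfolding AE_all_countable using * by blast
  then show ?thesis
  proof eventually_elim
    case (elim x)
    obtain m :: nat where "\<bar>ln (norm x)\<bar> < real m" using reals_Archimedean2 by blast
    then show ?case using elim[rule_format, of m] by simp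
  qed
qed

end

section \<open>Non-radial trial functions\<close>

lemma loc_integrable_off_0_continuous:
  fixes f :: "real^'n::finite \<Rightarrow> 'b::euclidean_space"
  assumes "continuous_on (- {0}) f"
  shows "loc_integrable_off_0 f"
  unfolding loc_integrable_off_0_def
proof (intro allI impI)
  fix K :: "(real^'n) set" assume K: "compact K \<and> 0 \<notin> K"
  then have "integrable lborel (\<lambda>x. indicator K x *\<^sub>R f x)"
    by (intro borel_integrable_compact continuous_on_subset[OF assms]) auto
  then have "integrable lebesgue (\<lambda>x. indicator K x *\<^sub>R f x)"
    by (subst integrable_completion) (auto dest: borel_measurable_integrable)
  then show "f absolutely_integrable_on K" by (simp add: set_integrable_def)
qed

lemma test_fun_support:
  assumes "test_fun (\<phi> :: real^'n::finite \<Rightarrow> real)"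
  obtains r R where "r > 0" "\<And>x. norm x < r \<Longrightarrow> \<phi> x = 0" "\<And>x. norm x > R \<Longrightarrow> \<phi> x = 0"
    "\<And>x i. norm x < r \<Longrightarrow> partial_deriv i \<phi> x = 0" "\<And>x i. norm x > R \<Longrightarrow> partial_deriv i \<phi> x = 0"
proof -
  define S where "S = closure {x. \<phi> x \<noteq> 0}"
  have S: "compact S" "0 \<notin> S" using assms by (auto simp: test_fun_def S_def)
  have z: "\<phi> x = 0" if "x \<notin> S" for x using that closure_subset by (force simp: S_def)
  have oS: "open (- S)" using S(1) by (simp add: compact_imp_closed open_Compl)
  have z': "partial_deriv i \<phi> x = 0" if x: "x \<notin> S" for x i
  proof -
    have "((\<lambda>x. 0) has_derivative (\<lambda>h. 0)) (at x)" by simp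
    then have "(\<phi> has_derivative (\<lambda>h. 0)) (at x)"
      by (rule has_derivative_transform_within_open[OF _ oS]) (use x z in auto)
    from frechet_derivative_at[OF this] show ?thesis by (simp add: partial_deriv_def fun_eq_iff)
  qed
  obtain r where r: "r > 0" "ball 0 r \<subseteq> - S" using oS S(2) open_contains_ball by (metis ComplI)
  obtain R where R: "\<And>x. x \<in> S \<Longrightarrow> norm x \<le> R" using compact_imp_bounded[OF S(1)] by (auto simp: bounded_iff)
  have "x \<notin> S" if "norm x < r" for x using r that by auto
  moreover have "x \<notin> S" if "norm x > R" for x using R that by force
  ultimately show ?thesis using that[of r R] r z z' by blast
qed

text \<open>The product of \<open>f\<close> with a test function vanishes near the origin, so it is
  differentiable everywhere with compact support, and its partial derivatives have integral
  0.\<close>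

lemma has_weak_gradient_classical:
  fixes f :: "real^'n::finite \<Rightarrow> real"
  assumes D: "\<And>x. x \<noteq> 0 \<Longrightarrow> (f has_derivative (\<lambda>h. V x \<bullet> h)) (at x)"
    and V: "continuous_on (- {0}) V"
  shows "has_weak_gradient f V"
  unfolding has_weak_gradient_def
proof (intro conjI allI impI)
  have cf: "continuous_on (- {0}) f"
    by (intro continuous_at_imp_continuous_on ballI has_derivative_continuous[OF D]) auto
  show loc: "loc_integrable_off_0 f" "loc_integrable_off_0 V"
    by (intro loc_integrable_off_0_continuous cf V)+
  fix \<phi> :: "real^'n \<Rightarrow> real" and i assume \<phi>: "test_fun \<phi>"
  obtain r R where rR: "r > 0" "\<And>x. norm x < r \<Longrightarrow> \<phi> x = 0" "\<And>x. norm x > R \<Longrightarrow> \<phi> x = 0"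
    "\<And>x i. norm x < r \<Longrightarrow> partial_deriv i \<phi> x = 0" "\<And>x i. norm x > R \<Longrightarrow> partial_deriv i \<phi> x = 0"
    by (rule test_fun_support[OF \<phi>]) blast
  have "k_times_cont_diff (Suc 0) \<phi>" using \<phi> by (simp only: test_fun_def)
  then have d\<phi>: "\<phi> differentiable (at x)" and cp: "continuous_on UNIV (partial_deriv i \<phi>)" for x i
    by auto
  define D\<phi> where "D\<phi> x = frechet_derivative \<phi> (at x)" for x
  have d\<phi>': "(\<phi> has_derivative D\<phi> x) (at x)" for x
    using d\<phi> unfolding D\<phi>_def by (simp add: frechet_derivative_works)
  have c\<phi>: "continuous_on UNIV \<phi>"
    by (intro continuous_at_imp_continuous_on ballI has_derivative_continuous[OF d\<phi>'])
  define F where "F x = f x * \<phi> x" for x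
  define DF where "DF x h = (if x = 0 then 0 else f x * D\<phi> x h + (V x \<bullet> h) * \<phi> x)" for x h
  have dF: "(F has_derivative DF x) (at x)" for x
  proof (cases "x = 0")
    case True
    have "((\<lambda>x. 0) has_derivative DF x) (at x)" using True by (simp add: DF_def[abs_def])
    then show ?thesis
      by (rule has_derivative_transform_within_open[OF _ open_ball[of 0 r]]) (use True rR in \<open>auto simp: F_def\<close>)
  next
    case False
    show ?thesis unfolding F_def[abs_def]
      by (rule has_derivative_eq_rhs[OF has_derivative_mult[OF D[OF False] d\<phi>']]) (use False in \<open>auto simp: DF_def\<close>)
  qed
  have pe: "DF x (axis i 1) = f x * partial_deriv i \<phi> x + V x $ i * \<phi> x" if "x \<noteq> 0" for x
    using that by (simp add: DF_def D\<phi>_def partial_deriv_def inner_axis)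
  have cDF: "continuous_on UNIV (\<lambda>x. DF x (axis i 1))"
  proof (rule continuous_on_extend_by_0[OF _ rR(1)])
    have "continuous_on (- {0}) (\<lambda>x. f x * partial_deriv i \<phi> x + V x $ i * \<phi> x)"
      by (intro continuous_intros cf V continuous_on_subset[OF cp] continuous_on_subset[OF c\<phi>]) auto
    then show "continuous_on (- {0}) (\<lambda>x. DF x (axis i 1))" by (rule continuous_on_eq) (simp add: pe)
    show "DF x (axis i 1) = 0" if "norm x < r" for x
      using rR(2,4)[OF that] pe[of x] by (cases "x = 0") (auto simp: DF_def)
  qed
  have 0: "(LINT x|lebesgue. DF x (axis i 1)) = 0"
    by (rule integral_directional_derivative_eq_0[OF dF cDF, of R]) (use rR in \<open>auto simp: F_def\<close>)
  have out: "\<phi> x = 0" "partial_deriv i \<phi> x = 0" if "x \<notin> annulus r R" for x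
    using that rR by (auto simp: annulus_def not_le)
  note int = integrable_loc_integrable_continuous_mult[OF _ _ rR(1), where B = R]
  have i1: "integrable lebesgue (\<lambda>x. f x * partial_deriv i \<phi> x)"
    by (rule int[OF loc(1) cp]) (rule out)
  have i2: "integrable lebesgue (\<lambda>x. V x $ i * \<phi> x)"
    by (rule int[OF loc_integrable_off_0_component[OF loc(2)] c\<phi>]) (rule out)
  have "(LINT x|lebesgue. f x * partial_deriv i \<phi> x + V x $ i * \<phi> x) = (LINT x|lebesgue. DF x (axis i 1))"
  proof (intro Bochner_Integration.integral_cong refl)
    fix x :: "real^'n"
    show "f x * partial_deriv i \<phi> x + V x $ i * \<phi> x = DF x (axis i 1)"
      using pe[of x] rR by (cases "x = 0") (auto simp: DF_def)
  qed
  then show "(LINT x|lebesgue. f x * partial_deriv i \<phi> x) = - (LINT x|lebesgue. V x $ i * \<phi> x)"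
    using 0 i1 i2 by simp
qed

section \<open>Spherical averages by symmetry\<close>

definition swap_coords :: "'n \<Rightarrow> 'n \<Rightarrow> real^'n::finite \<Rightarrow> real^'n" where
  "swap_coords i j x = (\<chi> k. x $ (Transposition.transpose i j k))"

text \<open>Boxes determine the measure, and exchanging two coordinates only permutes the side
  lengths of a box.\<close>

lemma distr_swap_coords: "distr lborel borel (swap_coords i j) = (lborel :: (real^'n::finite) measure)"
proof (rule lborel_eqI[symmetric])
  let ?\<tau> = "Transposition.transpose i j"
  have cont: "continuous_on UNIV (swap_coords i j :: real^'n \<Rightarrow> real^'n)"
    unfolding swap_coords_def by (intro continuous_intros)
  then have [measurable]: "(swap_coords i j :: real^'n \<Rightarrow> real^'n) \<in> borel_measurable borel"
    by (rule borel_measurable_continuous_onI)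
  have prodB: "(\<Prod>b\<in>Basis. (x::real^'n) \<bullet> b) = (\<Prod>k\<in>UNIV. x $ k)" for x
  proof -
    have B: "(Basis :: (real^'n) set) = (\<lambda>k. axis k 1) ` UNIV" by (auto simp: Basis_vec_def)
    have inj: "inj (\<lambda>k. axis k 1 :: real^'n)" by (rule injI) (simp add: axis_eq_axis)
    show ?thesis unfolding B by (subst prod.reindex[OF inj]) (simp add: inner_axis)
  qed
  fix l u :: "real^'n" assume le: "\<And>b. b \<in> Basis \<Longrightarrow> l \<bullet> b \<le> u \<bullet> b"
  have lek: "l $ k \<le> u $ k" for k using le[of "axis k 1"] by (simp add: inner_axis)
  have img: "swap_coords i j -` box l u = box (swap_coords i j l) (swap_coords i j u)"
  proof -
    have "(\<forall>k. l $ k < x $ ?\<tau> k \<and> x $ ?\<tau> k < u $ k) \<longleftrightarrow> (\<forall>k. l $ ?\<tau> k < x $ k \<and> x $ k < u $ ?\<tau> k)" for x :: "real^'n"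
      by (metis transpose_involutory)
    then show ?thesis by (auto simp: mem_box_cart swap_coords_def set_eq_iff)
  qed
  have "emeasure (distr lborel borel (swap_coords i j)) (box l u) = emeasure lborel (box (swap_coords i j l) (swap_coords i j u))"
    by (subst emeasure_distr) (auto simp: img)
  also have "\<dots> = ennreal (\<Prod>b\<in>Basis. (swap_coords i j u - swap_coords i j l) \<bullet> b)"
  proof (rule emeasure_lborel_box)
    fix b :: "real^'n" assume "b \<in> Basis"
    then obtain k where "b = axis k 1" by (auto simp: Basis_vec_def)
    then show "swap_coords i j l \<bullet> b \<le> swap_coords i j u \<bullet> b" by (simp add: inner_axis swap_coords_def lek)
  qed
  also have "(\<Prod>b\<in>Basis. (swap_coords i j u - swap_coords i j l) \<bullet> b) = (\<Prod>k\<in>UNIV. (u - l) $ ?\<tau> k)"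
    unfolding prodB by (simp add: swap_coords_def)
  also have "\<dots> = (\<Prod>k\<in>UNIV. (u - l) $ k)"
    using bij_transpose[of i j] by (intro prod.reindex_bij_betw) (auto simp: bij_betw_def)
  also have "\<dots> = (\<Prod>b\<in>Basis. (u - l) \<bullet> b)" by (rule prodB[symmetric])
  finally show "emeasure (distr lborel borel (swap_coords i j)) (box l u) = (\<Prod>b\<in>Basis. (u - l) \<bullet> b)" .
qed simp

lemma norm_swap_coords: "norm (swap_coords i j x) = norm x"
proof -
  have "(\<Sum>k\<in>UNIV. (x $ Transposition.transpose i j k)\<^sup>2) = (\<Sum>k\<in>UNIV. (x $ k)\<^sup>2)"
    using bij_transpose[of i j] by (intro sum.reindex_bij_betw[of _ UNIV UNIV "\<lambda>k. (x $ k)\<^sup>2"]) (auto simp: bij_betw_def)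
  then show ?thesis by (simp add: norm_vec_def L2_set_def swap_coords_def)
qed

definition dir :: "'n::finite \<Rightarrow> real^'n \<Rightarrow> real" where "dir i x = x $ i / norm x"

lemma abs_dir_le: "\<bar>dir i x\<bar> \<le> 1"
  using component_le_norm_cart[of x i] by (cases "x = 0") (auto simp: dir_def)

lemma dir_measurable[measurable]: "dir (i::'n::finite) \<in> borel_measurable borel"
proof -
  have "(\<lambda>x::real^'n. x $ i) \<in> borel_measurable borel"
    by (intro borel_measurable_continuous_onI continuous_intros)
  then show ?thesis unfolding dir_def[abs_def] by measurable
qed

lemma integrable_cyl_dir:
  fixes F :: "real \<Rightarrow> real"
  assumes F: "F \<in> borel_measurable borel" "integrable lborel F"
    and h: "h \<in> borel_measurable borel" "\<And>x. \<bar>h x\<bar> \<le> (B::real)"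
  shows "integrable cyl_measure (\<lambda>x::real^'n::finite. F (ln (norm x)) * h x)"
proof -
  interpret line_fibration "cyl_measure :: (real^'n) measure" "\<lambda>x. ln (norm x)" by (rule line_fibration_cyl)
  have i: "integrable cyl_measure (\<lambda>x::real^'n. F (ln (norm x)))" using F by (subst integrable_fibration)
  show ?thesis
  proof (rule Bochner_Integration.integrable_bound[OF integrable_mult_left[OF i, of B]])
    have "h \<in> borel_measurable cyl_measure" unfolding borel_measurable_cyl_iff by (rule measurable_lebesgue_if_borel[OF h(1)])
    then show "(\<lambda>x. F (ln (norm x)) * h x) \<in> borel_measurable cyl_measure" using i by measurable
    show "AE x in cyl_measure. norm (F (ln (norm x)) * h x) \<le> norm (F (ln (norm x)) * B)"
    proof (intro always_eventually allI)
      fix x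
      have "\<bar>h x\<bar> \<le> \<bar>B\<bar>" using h(2)[of x] by linarith
      then show "norm (F (ln (norm x)) * h x) \<le> norm (F (ln (norm x)) * B)"
        by (simp add: abs_mult mult_left_mono)
    qed
  qed
qed

lemma integral_cyl_borel:
  fixes f :: "real^'n::finite \<Rightarrow> real"
  assumes [measurable]: "f \<in> borel_measurable borel"
  shows "sphere_const TYPE(real^'n) * (LINT x|cyl_measure. f x) = (LINT x|lborel. norm x powr - real CARD('n) * f x)"
  using integral_cyl_measure[OF measurable_lebesgue_if_borel[OF assms]]
  by (simp add: integral_completion)

text \<open>The integrand is odd under the reflection of \<open>x\<close> to \<open>- x\<close>,
  which preserves Lebesgue measure.\<close>

lemma integral_cyl_dir:
  fixes F :: "real \<Rightarrow> real"
  assumes [measurable]: "F \<in> borel_measurable borel"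
  shows "(LINT x|cyl_measure. F (ln (norm x)) * dir (i::'n::finite) x) = 0"
proof -
  let ?f = "\<lambda>x::real^'n. norm x powr - real CARD('n) * (F (ln (norm x)) * dir i x)"
  have neg: "distr lborel borel (uminus :: real^'n \<Rightarrow> real^'n) = lborel"
    using lborel_affine[of "-1" "0 :: real^'n"] by (simp add: density_1)
  have "(LINT x|lborel. ?f x) = (LINT x|distr lborel borel (uminus :: real^'n \<Rightarrow> real^'n). ?f x)" by (simp only: neg)
  also have "\<dots> = (LINT x|lborel. ?f (- x))" by (rule integral_distr) auto
  also have "\<dots> = - (LINT x|lborel. ?f x)" by (simp add: dir_def)
  finally have "(LINT x|lborel. ?f x) = 0" by simp
  then show ?thesis
    using integral_cyl_borel[of "\<lambda>x::real^'n. F (ln (norm x)) * dir i x"] sphere_const_pos[where 'a = "real^'n"] by simp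
qed

text \<open>Exchanging coordinates shows that every index gives the same value, and the squares of
  all direction cosines add up to 1 off the origin.\<close>

lemma integral_cyl_dir_square:
  fixes F :: "real \<Rightarrow> real"
  assumes [measurable]: "F \<in> borel_measurable borel" and int: "integrable lborel F"
  shows "(LINT x|cyl_measure. F (ln (norm x)) * (dir (i::'n::finite) x)\<^sup>2) = (LINT s|lborel. F s) / real CARD('n)"
proof -
  interpret line_fibration "cyl_measure :: (real^'n) measure" "\<lambda>x. ln (norm x)" by (rule line_fibration_cyl)
  let ?f = "\<lambda>i x::real^'n. F (ln (norm x)) * (dir i x)\<^sup>2"
  let ?g = "\<lambda>i x::real^'n. norm x powr - real CARD('n) * ?f i x"
  have eq: "(LINT x|cyl_measure. ?f j x) = (LINT x|cyl_measure. ?f i x)" for j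
  proof -
    have [measurable]: "(swap_coords i j :: real^'n \<Rightarrow> real^'n) \<in> borel_measurable borel"
      by (rule borel_measurable_continuous_onI) (unfold swap_coords_def, intro continuous_intros)
    have "(LINT x|lborel. ?g j x) = (LINT x|distr lborel borel (swap_coords i j). ?g j x)" by (simp only: distr_swap_coords)
    also have "\<dots> = (LINT x|lborel. ?g j (swap_coords i j x))" by (rule integral_distr) auto
    also have "\<dots> = (LINT x|lborel. ?g i x)" by (simp add: dir_def norm_swap_coords) (simp add: swap_coords_def)
    finally have "sphere_const TYPE(real^'n) * (LINT x|cyl_measure. ?f j x) = sphere_const TYPE(real^'n) * (LINT x|cyl_measure. ?f i x)"
      using integral_cyl_borel[of "?f i"] integral_cyl_borel[of "?f j"] by simp
    then show ?thesis using sphere_const_pos[where 'a = "real^'n"] by simp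
  qed
  have ii: "integrable cyl_measure (?f j)" for j
  proof (rule integrable_cyl_dir[OF _ int])
    show "\<bar>(dir j x)\<^sup>2\<bar> \<le> 1" for x using abs_dir_le[of j x] by (simp add: abs_square_le_1)
  qed auto
  have "(\<Sum>j\<in>UNIV. (LINT x|cyl_measure. ?f j x)) = (\<Sum>j\<in>(UNIV :: 'n set). (LINT x|cyl_measure. ?f i x))"
    by (intro sum.cong refl eq)
  then have "real CARD('n) * (LINT x|cyl_measure. ?f i x) = (\<Sum>j\<in>UNIV. (LINT x|cyl_measure. ?f j x))" by simp
  also have "\<dots> = (LINT x|cyl_measure. (\<Sum>j\<in>UNIV. ?f j x))" by (rule Bochner_Integration.integral_sum[symmetric]) (rule ii)
  also have "\<dots> = (LINT x|(cyl_measure :: (real^'n) measure). F (ln (norm x)))"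
  proof (rule integral_cong_AE)
    show "AE x in cyl_measure. (\<Sum>j\<in>UNIV. ?f j x) = F (ln (norm (x::real^'n)))"
      using AE_cyl_measure[OF AE_lebesgue_neq_0]
    proof eventually_elim
      case (elim x)
      have "(\<Sum>j\<in>UNIV. (dir j x)\<^sup>2) = 1"
      proof -
        have "(\<Sum>j\<in>UNIV. (dir j x)\<^sup>2) = (\<Sum>j\<in>UNIV. (x $ j)\<^sup>2) / (norm x)\<^sup>2"
          by (simp add: dir_def power_divide sum_divide_distrib)
        moreover have "(\<Sum>j\<in>UNIV. (x $ j)\<^sup>2) = (norm x)\<^sup>2" by (simp add: norm_vec_def L2_set_def sum_nonneg)
        ultimately show ?thesis using elim by simp
      qed
      then show ?case by (simp add: sum_distrib_left[symmetric])
    qed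
    show "(\<lambda>x. \<Sum>j\<in>UNIV. ?f j x) \<in> borel_measurable cyl_measure" using ii by (intro borel_measurable_sum) auto
  qed measurable
  also have "\<dots> = (LINT s|lborel. F s)" by (rule integral_fibration) simp
  finally show ?thesis by (simp add: field_simps)
qed

section \<open>Second-order expansions with uniform remainders\<close>

lemma powr_taylor_2:
  fixes r :: real
  obtains C where "C \<ge> 0" "\<And>y. \<bar>y\<bar> \<le> 1 / 2 \<Longrightarrow> \<bar>(1 + y) powr r - (1 + r * y + r * (r - 1) / 2 * y\<^sup>2)\<bar> \<le> C * \<bar>y\<bar> ^ 3"
proof -
  define diff where "diff m t = (if m = 0 then (1 + t) powr r else if m = 1 then r * (1 + t) powr (r - 1)
    else if m = 2 then r * (r - 1) * (1 + t) powr (r - 2) else r * (r - 1) * (r - 2) * (1 + t) powr (r - 3))" for m :: nat and t :: real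
  \<comment> \<open>For \<open>|t| \<le> 1 / 2\<close> the base \<open>1 + t\<close> lies between
    \<open>1 / 2\<close> and 2, so its power with exponent \<open>r - 3\<close> is at most
    \<open>2 powr |r - 3|\<close>, whatever the sign of the exponent.\<close>
  define D where "D = \<bar>r * (r - 1) * (r - 2)\<bar> * 2 powr \<bar>r - 3\<bar>"
  have "\<bar>(1 + y) powr r - (1 + r * y + r * (r - 1) / 2 * y\<^sup>2)\<bar> \<le> D / 6 * \<bar>y\<bar> ^ 3" if y: "\<bar>y\<bar> \<le> 1 / 2" for y
  proof -
    have "\<forall>m t. m < 3 \<and> \<bar>t\<bar> \<le> \<bar>y\<bar> \<longrightarrow> (diff m has_real_derivative diff (Suc m) t) (at t)"
    proof (intro allI impI)
      fix m :: nat and t :: real assume mt: "m < 3 \<and> \<bar>t\<bar> \<le> \<bar>y\<bar>"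
      then have t: "1 + t > 0" using y by linarith
      have *: "((\<lambda>t. (1 + t) powr s) has_real_derivative s * (1 + t) powr (s - 1)) (at t)" for s
        using t by (auto intro!: derivative_eq_intros)
      from mt consider "m = 0" | "m = 1" | "m = 2" by linarith
      then show "(diff m has_real_derivative diff (Suc m) t) (at t)"
      proof cases
        case 1 then show ?thesis using *[of r] by (simp add: diff_def[abs_def])
      next
        case 2 then show ?thesis using DERIV_cmult[OF *[of "r - 1"], of r] by (simp add: diff_def[abs_def] mult.assoc)
      next
        case 3 then show ?thesis using DERIV_cmult[OF *[of "r - 2"], of "r * (r - 1)"]
          by (simp add: diff_def[abs_def] mult.assoc)
      qed
    qed
    from Maclaurin_bi_le[OF refl this] obtain t where t: "\<bar>t\<bar> \<le> \<bar>y\<bar>"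
      "diff 0 y = (\<Sum>m<3. diff m 0 / fact m * y ^ m) + diff 3 t / fact 3 * y ^ 3" by blast
    have t1: "1 / 2 \<le> 1 + t" "1 + t \<le> 2" using t y by linarith+
    have "(1 + t) powr (r - 3) \<le> 2 powr \<bar>r - 3\<bar>"
    proof (cases "r \<ge> 3")
      case True then show ?thesis using t1 by (auto intro!: powr_mono2)
    next
      case False
      then have "(1 + t) powr (r - 3) \<le> (1 / 2) powr (r - 3)" using t1 by (intro powr_mono2') auto
      also have "\<dots> = 2 powr \<bar>r - 3\<bar>" using False by (simp add: powr_divide powr_minus[symmetric] field_simps) (simp add: powr_minus_divide powr_diff)
      finally show ?thesis .
    qed
    then have d3: "\<bar>diff 3 t\<bar> \<le> D" by (auto simp: diff_def D_def abs_mult intro!: mult_left_mono)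
    have e: "(1 + y) powr r - (1 + r * y + r * (r - 1) / 2 * y\<^sup>2) = diff 3 t / 6 * y ^ 3"
      using t(2) by (simp add: diff_def eval_nat_numeral)
    have "\<bar>(1 + y) powr r - (1 + r * y + r * (r - 1) / 2 * y\<^sup>2)\<bar> = \<bar>diff 3 t\<bar> / 6 * \<bar>y\<bar> ^ 3"
      unfolding e by (simp add: abs_mult power_abs)
    also have "\<dots> \<le> D / 6 * \<bar>y\<bar> ^ 3" using d3 by (intro mult_right_mono) auto
    finally show ?thesis .
  qed
  moreover have "D / 6 \<ge> 0" by (simp add: D_def)
  ultimately show ?thesis using that by blast
qed

text \<open>\<open>a\<close> and \<open>b\<close> will be the radial and angular coefficients, and
  \<open>y\<close> the direction cosine. With the base written as \<open>1 + \<xi>\<close>, the term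
  in \<open>\<xi>\<^sup>2\<close> raises the coefficient of \<open>a\<^sup>2 y\<^sup>2\<close> from
  1 to \<open>p - 1\<close>. The constant is uniform in \<open>a\<close>, \<open>b\<close> and
  \<open>y\<close>.\<close>

lemma energy_density_expansion:
  fixes p M :: real
  assumes M: "M \<ge> 0"
  obtains C where "C \<ge> 0" "\<And>a b y \<epsilon>. \<bar>a\<bar> \<le> M \<Longrightarrow> \<bar>b\<bar> \<le> M \<Longrightarrow> \<bar>y\<bar> \<le> 1 \<Longrightarrow> 0 \<le> \<epsilon> \<Longrightarrow> 8 * (M + 1)\<^sup>2 * \<epsilon> \<le> 1 \<Longrightarrow>
    ((1 + \<epsilon> * (a * y))\<^sup>2 + \<epsilon>\<^sup>2 * (b\<^sup>2 * (1 - y\<^sup>2))) powr (p / 2)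
    \<le> 1 + p * \<epsilon> * (a * y) + \<epsilon>\<^sup>2 * (p / 2) * ((p - 1) * (a\<^sup>2 * y\<^sup>2) + b\<^sup>2 * (1 - y\<^sup>2)) + C * \<epsilon> ^ 3"
proof -
  obtain C0 where C0: "C0 \<ge> 0" "\<And>y. \<bar>y\<bar> \<le> 1 / 2 \<Longrightarrow>
    \<bar>(1 + y) powr (p / 2) - (1 + p / 2 * y + p / 2 * (p / 2 - 1) / 2 * y\<^sup>2)\<bar> \<le> C0 * \<bar>y\<bar> ^ 3"
    using powr_taylor_2[of "p / 2"] by blast
  \<comment> \<open>Chosen so that \<open>|\<xi>| \<le> N \<epsilon>\<close>; the smallness
    condition on \<epsilon> then keeps \<xi> well inside the range of
    \<open>powr_taylor_2\<close>.\<close>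
  define N where "N = (M + 1)\<^sup>2"
  have N: "N \<ge> 1" "2 * M + M\<^sup>2 \<le> N" using M by (auto simp: N_def power2_sum)
  define c where "c = p / 2 * (p / 2 - 1) / 2"
  define C where "C = C0 * N ^ 3 + \<bar>c\<bar> * (4 * (M * M\<^sup>2) + (M\<^sup>2)\<^sup>2)"
  have "C \<ge> 0" using C0 N M by (simp add: C_def)
  moreover have "((1 + \<epsilon> * (a * y))\<^sup>2 + \<epsilon>\<^sup>2 * (b\<^sup>2 * (1 - y\<^sup>2))) powr (p / 2)
    \<le> 1 + p * \<epsilon> * (a * y) + \<epsilon>\<^sup>2 * (p / 2) * ((p - 1) * (a\<^sup>2 * y\<^sup>2) + b\<^sup>2 * (1 - y\<^sup>2)) + C * \<epsilon> ^ 3"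
    if h: "\<bar>a\<bar> \<le> M" "\<bar>b\<bar> \<le> M" "\<bar>y\<bar> \<le> 1" "0 \<le> \<epsilon>" "8 * (M + 1)\<^sup>2 * \<epsilon> \<le> 1" for a b y \<epsilon>
  proof -
    have e1: "8 * (N * \<epsilon>) \<le> 1" using h(5) by (simp add: N_def mult.assoc)
    have "1 * \<epsilon> \<le> N * \<epsilon>" using N h by (intro mult_right_mono) auto
    then have e2: "\<epsilon> \<le> 1" using e1 h(4) by linarith
    define \<kappa> where "\<kappa> = a\<^sup>2 * y\<^sup>2 + b\<^sup>2 * (1 - y\<^sup>2)"
    have y2: "y\<^sup>2 \<le> 1" using h(3) by (simp add: abs_square_le_1)
    have a2: "a\<^sup>2 \<le> M\<^sup>2" "b\<^sup>2 \<le> M\<^sup>2" using h M by (auto simp: abs_le_square_iff[symmetric])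
    have k0: "0 \<le> \<kappa>" using y2 by (simp add: \<kappa>_def)
    have "\<kappa> \<le> M\<^sup>2 * y\<^sup>2 + M\<^sup>2 * (1 - y\<^sup>2)" unfolding \<kappa>_def using a2 y2 by (intro add_mono mult_right_mono) auto
    then have k1: "\<kappa> \<le> M\<^sup>2" by (simp add: algebra_simps)
    have ay: "\<bar>a * y\<bar> \<le> M" using mult_mono[OF h(1,3)] M by (simp add: abs_mult)
    define \<xi> where "\<xi> = 2 * \<epsilon> * (a * y) + \<epsilon>\<^sup>2 * \<kappa>"
    have base: "(1 + \<epsilon> * (a * y))\<^sup>2 + \<epsilon>\<^sup>2 * (b\<^sup>2 * (1 - y\<^sup>2)) = 1 + \<xi>"
      by (simp add: \<xi>_def \<kappa>_def power2_eq_square algebra_simps)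
    have ee: "\<epsilon>\<^sup>2 \<le> \<epsilon>" using h(4) e2 by (simp add: power2_eq_square mult_left_le)
    have x1: "\<bar>\<xi>\<bar> \<le> N * \<epsilon>"
    proof -
      have "\<bar>\<xi>\<bar> \<le> \<bar>2 * \<epsilon> * (a * y)\<bar> + \<bar>\<epsilon>\<^sup>2 * \<kappa>\<bar>" unfolding \<xi>_def by (rule abs_triangle_ineq)
      also have "\<bar>2 * \<epsilon> * (a * y)\<bar> = 2 * \<epsilon> * \<bar>a * y\<bar>" using h(4) by (simp add: abs_mult)
      also have "\<bar>\<epsilon>\<^sup>2 * \<kappa>\<bar> = \<epsilon>\<^sup>2 * \<kappa>" using k0 by simp
      also have "2 * \<epsilon> * \<bar>a * y\<bar> + \<epsilon>\<^sup>2 * \<kappa> \<le> 2 * \<epsilon> * M + \<epsilon> * M\<^sup>2"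
        using ay k0 k1 ee h(4) by (intro add_mono mult_mono mult_left_mono) auto
      also have "\<dots> = (2 * M + M\<^sup>2) * \<epsilon>" by (simp add: algebra_simps)
      also have "\<dots> \<le> N * \<epsilon>" using N h by (intro mult_right_mono) auto
      finally show ?thesis .
    qed
    then have "\<bar>\<xi>\<bar> \<le> 1 / 2" using e1 by linarith
    from C0(2)[OF this] have "(1 + \<xi>) powr (p / 2) \<le> 1 + p / 2 * \<xi> + c * \<xi>\<^sup>2 + C0 * \<bar>\<xi>\<bar> ^ 3"
      by (simp add: c_def)
    moreover have "C0 * \<bar>\<xi>\<bar> ^ 3 \<le> C0 * (N ^ 3 * \<epsilon> ^ 3)"
      using x1 C0 by (simp add: power_mult_distrib[symmetric] mult_left_mono power_mono)
    moreover have "c * \<xi>\<^sup>2 \<le> c * (4 * \<epsilon>\<^sup>2 * (a * y)\<^sup>2) + \<bar>c\<bar> * ((4 * (M * M\<^sup>2) + (M\<^sup>2)\<^sup>2) * \<epsilon> ^ 3)"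
    proof -
      have d: "\<xi>\<^sup>2 - 4 * \<epsilon>\<^sup>2 * (a * y)\<^sup>2 = \<epsilon> ^ 3 * (4 * (a * y) * \<kappa> + \<epsilon> * \<kappa>\<^sup>2)"
        by (simp add: \<xi>_def power2_eq_square power3_eq_cube algebra_simps)
      have "\<bar>4 * (a * y) * \<kappa> + \<epsilon> * \<kappa>\<^sup>2\<bar> \<le> \<bar>4 * (a * y) * \<kappa>\<bar> + \<bar>\<epsilon> * \<kappa>\<^sup>2\<bar>" by (rule abs_triangle_ineq)
      also have "\<dots> = 4 * (\<bar>a * y\<bar> * \<kappa>) + \<epsilon> * \<kappa>\<^sup>2" using k0 h(4) by (simp add: abs_mult)
      also have "\<dots> \<le> 4 * (M * M\<^sup>2) + 1 * (M\<^sup>2)\<^sup>2"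
        using ay k0 k1 e2 h(4) M by (intro add_mono mult_left_mono mult_mono power_mono) auto
      finally have "\<bar>\<xi>\<^sup>2 - 4 * \<epsilon>\<^sup>2 * (a * y)\<^sup>2\<bar> \<le> \<epsilon> ^ 3 * (4 * (M * M\<^sup>2) + (M\<^sup>2)\<^sup>2)"
        unfolding d abs_mult using h(4) by (auto intro!: mult_left_mono)
      then have "\<bar>c * (\<xi>\<^sup>2 - 4 * \<epsilon>\<^sup>2 * (a * y)\<^sup>2)\<bar> \<le> \<bar>c\<bar> * (\<epsilon> ^ 3 * (4 * (M * M\<^sup>2) + (M\<^sup>2)\<^sup>2))"
        unfolding abs_mult by (intro mult_left_mono) auto
      moreover have "c * (\<xi>\<^sup>2 - 4 * \<epsilon>\<^sup>2 * (a * y)\<^sup>2) = c * \<xi>\<^sup>2 - c * (4 * \<epsilon>\<^sup>2 * (a * y)\<^sup>2)" by (simp only: right_diff_distrib)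
      ultimately show ?thesis by (simp add: mult.commute abs_le_iff)
    qed
    ultimately have "(1 + \<xi>) powr (p / 2) \<le> 1 + p / 2 * \<xi> + (c * (4 * \<epsilon>\<^sup>2 * (a * y)\<^sup>2) + \<bar>c\<bar> * ((4 * (M * M\<^sup>2) + (M\<^sup>2)\<^sup>2) * \<epsilon> ^ 3)) + C0 * (N ^ 3 * \<epsilon> ^ 3)"
      by linarith
    also have "\<dots> = 1 + p * \<epsilon> * (a * y) + \<epsilon>\<^sup>2 * (p / 2) * ((p - 1) * (a\<^sup>2 * y\<^sup>2) + b\<^sup>2 * (1 - y\<^sup>2)) + C * \<epsilon> ^ 3"
      by (simp add: \<xi>_def \<kappa>_def c_def C_def power_mult_distrib field_simps)
    finally show ?thesis unfolding base .
  qed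
  ultimately show ?thesis using that by blast
qed

text \<open>Only a lower bound is recorded, since the mass stands in the denominator of the
  quotient. The smallness of \<epsilon> keeps the base of the power at least
  \<open>1 / 2\<close>.\<close>

lemma mass_density_expansion:
  fixes q M :: real
  assumes M: "M \<ge> 0"
  obtains C where "C \<ge> 0" "\<And>d y \<epsilon>. \<bar>d\<bar> \<le> M \<Longrightarrow> \<bar>y\<bar> \<le> 1 \<Longrightarrow> 0 \<le> \<epsilon> \<Longrightarrow> 2 * M * \<epsilon> \<le> 1 \<Longrightarrow>
    1 + q * \<epsilon> * (d * y) + \<epsilon>\<^sup>2 * (q * (q - 1) / 2) * (d\<^sup>2 * y\<^sup>2) - C * \<epsilon> ^ 3 \<le> \<bar>1 + \<epsilon> * (d * y)\<bar> powr q"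
proof -
  obtain C0 where C0: "C0 \<ge> 0" "\<And>y. \<bar>y\<bar> \<le> 1 / 2 \<Longrightarrow>
    \<bar>(1 + y) powr q - (1 + q * y + q * (q - 1) / 2 * y\<^sup>2)\<bar> \<le> C0 * \<bar>y\<bar> ^ 3"
    using powr_taylor_2[of q] by blast
  have "1 + q * \<epsilon> * (d * y) + \<epsilon>\<^sup>2 * (q * (q - 1) / 2) * (d\<^sup>2 * y\<^sup>2) - C0 * M ^ 3 * \<epsilon> ^ 3 \<le> \<bar>1 + \<epsilon> * (d * y)\<bar> powr q"
    if h: "\<bar>d\<bar> \<le> M" "\<bar>y\<bar> \<le> 1" "0 \<le> \<epsilon>" "2 * M * \<epsilon> \<le> 1" for d y \<epsilon>
  proof -
    let ?z = "\<epsilon> * (d * y)"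
    have "\<bar>d * y\<bar> \<le> M" using mult_mono[OF h(1,2)] M by (simp add: abs_mult)
    then have z: "\<bar>?z\<bar> \<le> \<epsilon> * M" using h(3) by (simp add: abs_mult mult_left_mono)
    then have z2: "\<bar>?z\<bar> \<le> 1 / 2" using h(4) by (simp add: mult_ac)
    have "C0 * \<bar>?z\<bar> ^ 3 \<le> C0 * (\<epsilon> * M) ^ 3" using z C0 by (intro mult_left_mono power_mono) auto
    with C0(2)[OF z2] have "1 + q * ?z + q * (q - 1) / 2 * ?z\<^sup>2 - C0 * (\<epsilon> * M) ^ 3 \<le> (1 + ?z) powr q" by linarith
    moreover have "1 + ?z \<ge> 0" using z2 by linarith
    ultimately show ?thesis by (simp add: power_mult_distrib mult_ac)
  qed
  moreover have "C0 * M ^ 3 \<ge> 0" using C0 M by simp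
  ultimately show ?thesis using that by blast
qed

text \<open>To second order the right-hand side is \<open>Q + r \<epsilon>\<^sup>2 B\<close>, so
  that \<open>A < r B\<close> decides; all errors are of third order or higher. To be used with
  \<open>r = p / q\<close>.\<close>

lemma quotient_decreases:
  fixes Q r A B C1 C2 :: real
  assumes Q: "Q > 0" and AB: "A < r * B" and r: "r > 0" and C: "C1 \<ge> 0" "C2 \<ge> 0"
  shows "\<forall>\<^sub>F \<epsilon> in at_right 0. 0 < Q + \<epsilon>\<^sup>2 * B - C2 * \<epsilon> ^ 3 \<and>
    Q + \<epsilon>\<^sup>2 * A + C1 * \<epsilon> ^ 3 < Q powr (1 - r) * (Q + \<epsilon>\<^sup>2 * B - C2 * \<epsilon> ^ 3) powr r"
proof -
  obtain C0 where C0: "C0 \<ge> 0" "\<And>y. \<bar>y\<bar> \<le> 1 / 2 \<Longrightarrow>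
    \<bar>(1 + y) powr r - (1 + r * y + r * (r - 1) / 2 * y\<^sup>2)\<bar> \<le> C0 * \<bar>y\<bar> ^ 3"
    using powr_taylor_2[of r] by blast
  \<comment> \<open>\<open>K\<close> collects the Taylor terms beyond the linear one, and
    \<open>D \<epsilon>\<^sup>2\<close> bounds the relative change \<open>y\<close> of the mass for
    \<open>\<epsilon> < 1\<close>.\<close>
  define K where "K = \<bar>r * (r - 1) / 2\<bar> + C0"
  define D where "D = (\<bar>B\<bar> + C2) / Q"
  have D: "D \<ge> 0" using Q C by (simp add: D_def)
  have K: "K \<ge> 0" using C0 by (simp add: K_def)
  have "((\<lambda>\<epsilon>. \<epsilon> * (C1 + r * C2) + K * Q * D\<^sup>2 * \<epsilon>\<^sup>2) \<longlongrightarrow> 0 * (C1 + r * C2) + K * Q * D\<^sup>2 * 0\<^sup>2) (at_right 0)"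
    by (intro tendsto_intros)
  then have 1: "\<forall>\<^sub>F \<epsilon> in at_right 0. \<epsilon> * (C1 + r * C2) + K * Q * D\<^sup>2 * \<epsilon>\<^sup>2 < r * B - A"
    by (rule order_tendstoD) (use AB in simp)
  have "((\<lambda>\<epsilon>. D * \<epsilon>\<^sup>2) \<longlongrightarrow> D * 0\<^sup>2) (at_right 0)" by (intro tendsto_intros)
  then have 2: "\<forall>\<^sub>F \<epsilon> in at_right 0. D * \<epsilon>\<^sup>2 < 1 / 2" by (rule order_tendstoD) simp
  have 3: "\<forall>\<^sub>F \<epsilon> in at_right (0::real). 0 < \<epsilon> \<and> \<epsilon> < 1"
    using eventually_at_right_real[of 0 1] by (auto elim: eventually_mono)
  from 1 2 3 show ?thesis
  proof eventually_elim
    case (elim \<epsilon>)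
    define y where "y = (\<epsilon>\<^sup>2 * B - C2 * \<epsilon> ^ 3) / Q"
    have e3: "\<epsilon> ^ 3 \<le> \<epsilon>\<^sup>2" using elim by (intro power_decreasing) auto
    have "\<bar>\<epsilon>\<^sup>2 * B - C2 * \<epsilon> ^ 3\<bar> \<le> \<bar>\<epsilon>\<^sup>2 * B\<bar> + \<bar>C2 * \<epsilon> ^ 3\<bar>" by (rule abs_triangle_ineq4)
    also have "\<dots> \<le> \<epsilon>\<^sup>2 * \<bar>B\<bar> + C2 * \<epsilon>\<^sup>2" using C e3 elim by (simp add: abs_mult mult_left_mono)
    also have "\<dots> = (\<bar>B\<bar> + C2) * \<epsilon>\<^sup>2" by (simp add: algebra_simps)
    finally have yD: "\<bar>y\<bar> \<le> D * \<epsilon>\<^sup>2" using Q by (simp add: y_def D_def divide_right_mono)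
    then have y: "\<bar>y\<bar> \<le> 1 / 2" using elim by linarith
    have Qy: "Q + \<epsilon>\<^sup>2 * B - C2 * \<epsilon> ^ 3 = Q * (1 + y)" using Q by (simp add: y_def field_simps)
    have y3: "\<bar>y\<bar> ^ 3 \<le> y\<^sup>2"
      using y power_decreasing[of 2 3 "\<bar>y\<bar>"] by simp
    have yy: "y\<^sup>2 \<le> (D * \<epsilon>\<^sup>2)\<^sup>2" using yD by (metis abs_ge_zero power2_abs power_mono)
    have "- (\<bar>r * (r - 1) / 2\<bar> * y\<^sup>2) \<le> r * (r - 1) / 2 * y\<^sup>2"
      using abs_ge_minus_self[of "r * (r - 1) / 2 * y\<^sup>2"] by (simp add: abs_mult)
    moreover have "C0 * \<bar>y\<bar> ^ 3 \<le> C0 * y\<^sup>2" using y3 C0 by (intro mult_left_mono)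
    moreover have "1 + r * y + r * (r - 1) / 2 * y\<^sup>2 - C0 * \<bar>y\<bar> ^ 3 \<le> (1 + y) powr r" using C0(2)[OF y] by linarith
    ultimately have "1 + r * y - K * y\<^sup>2 \<le> (1 + y) powr r" by (simp add: K_def distrib_right)
    moreover have "K * y\<^sup>2 \<le> K * (D * \<epsilon>\<^sup>2)\<^sup>2" using yy K by (intro mult_left_mono)
    ultimately have "1 + r * y - K * (D * \<epsilon>\<^sup>2)\<^sup>2 \<le> (1 + y) powr r" by linarith
    then have "Q * (1 + r * y - K * (D * \<epsilon>\<^sup>2)\<^sup>2) \<le> Q * (1 + y) powr r" using Q by (intro mult_left_mono) auto
    also have "Q * (1 + y) powr r = Q powr (1 - r) * (Q * (1 + y)) powr r"
      using Q y by (simp add: powr_mult powr_diff)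
    finally have lower: "Q * (1 + r * y - K * (D * \<epsilon>\<^sup>2)\<^sup>2) \<le> Q powr (1 - r) * (Q * (1 + y)) powr r" .
    have "Q * (1 + r * y - K * (D * \<epsilon>\<^sup>2)\<^sup>2) = Q + r * (\<epsilon>\<^sup>2 * B - C2 * \<epsilon> ^ 3) - K * Q * D\<^sup>2 * \<epsilon> ^ 4"
    proof -
      have "Q * y = \<epsilon>\<^sup>2 * B - C2 * \<epsilon> ^ 3" using Q by (simp add: y_def)
      then have "Q * (r * y) = r * (\<epsilon>\<^sup>2 * B - C2 * \<epsilon> ^ 3)" by (metis mult.left_commute)
      then show ?thesis by (simp add: right_diff_distrib distrib_left power_mult_distrib power_mult[symmetric] mult_ac)
    qed
    moreover have "\<epsilon>\<^sup>2 * (\<epsilon> * (C1 + r * C2) + K * Q * D\<^sup>2 * \<epsilon>\<^sup>2) < \<epsilon>\<^sup>2 * (r * B - A)"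
      using elim by (intro mult_strict_left_mono) auto
    then have "Q + \<epsilon>\<^sup>2 * A + C1 * \<epsilon> ^ 3 < Q + r * (\<epsilon>\<^sup>2 * B - C2 * \<epsilon> ^ 3) - K * Q * D\<^sup>2 * \<epsilon> ^ 4"
      by (simp add: power2_eq_square power3_eq_cube power4_eq_xxxx algebra_simps)
    ultimately show ?case using lower Q y unfolding Qy by (auto simp: abs_le_iff)
  qed
qed

section \<open>The perturbed profile as a trial function\<close>

locale perturbation = bliss_profile p q g for p q g :: real +
  fixes \<mu> \<mu>' :: "real \<Rightarrow> real" and L :: real and i :: "'n::finite"
  assumes \<mu>_deriv: "\<And>s. (\<mu> has_real_derivative \<mu>' s) (at s)" and \<mu>'_cont: "continuous_on UNIV \<mu>'"
    and \<mu>_supp: "\<And>s. \<bar>s\<bar> > L \<Longrightarrow> \<mu> s = 0 \<and> \<mu>' s = 0"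
begin

text \<open>In the variable \<open>s = ln |x|\<close> the trial function is
  \<open>|x| powr (- g) * w * (1 + \<epsilon> \<mu> x\<^sub>i / |x|)\<close>. The exponent
  \<open>g + 1\<close> in \<open>R\<close> appears because \<open>R\<close> multiplies the
  coordinate and not the direction cosine.\<close>

definition P where "P s = exp (- g * s) * w s"
definition P' where "P' s = - (exp (- g * s) * (t s * w s))"
definition R where "R \<epsilon> s = \<epsilon> * (exp (- (g + 1) * s) * (w s * \<mu> s))"
definition R' where "R' \<epsilon> s = \<epsilon> * (exp (- (g + 1) * s) * (w s * (\<mu>' s - t s * \<mu> s - \<mu> s)))"
definition trial :: "real \<Rightarrow> real^'n \<Rightarrow> real" where
  "trial \<epsilon> x = P (ln (norm x)) + R \<epsilon> (ln (norm x)) * (x \<bullet> axis i 1)"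
definition trial_grad :: "real \<Rightarrow> real^'n \<Rightarrow> real^'n" where
  "trial_grad \<epsilon> x = ((P' (ln (norm x)) + R' \<epsilon> (ln (norm x)) * (x \<bullet> axis i 1)) / (norm x)\<^sup>2) *\<^sub>R x
     + R \<epsilon> (ln (norm x)) *\<^sub>R axis i 1"
text \<open>\<open>ar\<close> and \<open>br\<close> are the radial and the tangential perturbation
  of the gradient, relative to the gradient \<open>t w\<close> of the profile; they are the two
  expressions in the quadratic form of \<open>unstable_direction\<close>.\<close>

definition ar where "ar s = \<mu> s - \<mu>' s / t s"
definition br where "br s = \<mu> s / t s"
definition energy_factor where "energy_factor \<epsilon> s y = ((1 + \<epsilon> * (ar s * y))\<^sup>2 + \<epsilon>\<^sup>2 * ((br s)\<^sup>2 * (1 - y\<^sup>2))) powr (p / 2)"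
definition mass_factor where "mass_factor r \<epsilon> s y = \<bar>1 + \<epsilon> * (\<mu> s * y)\<bar> powr r"

lemma \<mu>_cont: "continuous_on A \<mu>"
  using \<mu>_deriv by (meson DERIV_isCont continuous_at_imp_continuous_on)

lemma \<mu>'_cont': "continuous_on A \<mu>'"
  using \<mu>'_cont continuous_on_subset by blast

lemma ar_cont: "continuous_on A ar" and br_cont: "continuous_on A br"
proof -
  have "t s \<noteq> 0" for s using t_pos[of s] by simp
  then show "continuous_on A ar" "continuous_on A br"
    unfolding ar_def br_def by (intro continuous_intros \<mu>_cont \<mu>'_cont' continuous_t; simp)+
qed

text \<open>Here the compact support of \<mu> pays off, because \<open>1 / t\<close> is unbounded at
  minus infinity.\<close>

lemma coefficients_bounded:
  obtains M where "M \<ge> 0" "\<And>s. \<bar>ar s\<bar> \<le> M" "\<And>s. \<bar>br s\<bar> \<le> M" "\<And>s. \<bar>\<mu> s\<bar> \<le> M"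
proof -
  obtain B1 where B1: "B1 \<ge> 0" "\<And>s. \<bar>ar s\<bar> \<le> B1"
    using bounded_compact_support[OF ar_cont, of L] \<mu>_supp by (auto simp: ar_def)
  obtain B2 where B2: "B2 \<ge> 0" "\<And>s. \<bar>br s\<bar> \<le> B2"
    using bounded_compact_support[OF br_cont, of L] \<mu>_supp by (auto simp: br_def)
  obtain B3 where B3: "B3 \<ge> 0" "\<And>s. \<bar>\<mu> s\<bar> \<le> B3"
    using bounded_compact_support[OF \<mu>_cont, of L] \<mu>_supp by auto
  show ?thesis
  proof (rule that[of "B1 + B2 + B3"])
    show "\<bar>ar s\<bar> \<le> B1 + B2 + B3" for s using B1 B2 B3 B1(2)[of s] by linarith
    show "\<bar>br s\<bar> \<le> B1 + B2 + B3" for s using B1 B2 B3 B2(2)[of s] by linarith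
    show "\<bar>\<mu> s\<bar> \<le> B1 + B2 + B3" for s using B1 B2 B3 B3(2)[of s] by linarith
  qed (use B1 B2 B3 in auto)
qed

lemma P_deriv: "(P has_real_derivative P' s) (at s)"
  unfolding P_def[abs_def] P'_def by (auto intro!: derivative_eq_intros w_deriv simp: algebra_simps)

lemma R_deriv: "(R \<epsilon> has_real_derivative R' \<epsilon> s) (at s)"
  unfolding R_def[abs_def] R'_def by (auto intro!: derivative_eq_intros w_deriv \<mu>_deriv simp: algebra_simps)

lemma has_weak_gradient_trial: "has_weak_gradient (trial \<epsilon>) (trial_grad \<epsilon>)"
proof (rule has_weak_gradient_classical)
  fix x :: "real^'n" assume "x \<noteq> 0"
  from has_derivative_log_radial[OF P_deriv R_deriv this, of \<epsilon> "axis i 1"]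
  show "(trial \<epsilon> has_derivative (\<lambda>h. trial_grad \<epsilon> x \<bullet> h)) (at x)"
    by (simp add: trial_def[abs_def] trial_grad_def inner_add_left)
next
  have c: "continuous_on UNIV P'" "continuous_on UNIV (R \<epsilon>)" "continuous_on UNIV (R' \<epsilon>)"
    unfolding P'_def R_def R'_def by (intro continuous_intros continuous_w continuous_t \<mu>_cont \<mu>'_cont')+
  show "continuous_on (- {0}) (trial_grad \<epsilon>)" unfolding trial_grad_def
    by (intro continuous_intros continuous_on_compose2[OF c(1)] continuous_on_compose2[OF c(2)] continuous_on_compose2[OF c(3)]) auto
qed

lemma trial_eq:
  assumes "x \<noteq> 0"
  shows "norm x powr g * trial \<epsilon> x = w (ln (norm x)) * (1 + \<epsilon> * (\<mu> (ln (norm x)) * dir i x))"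
proof -
  have r: "norm x > 0" using assms by simp
  have e1: "exp (- g * ln (norm x)) = norm x powr - g" using r by (simp add: powr_def)
  have e2: "exp (- (g + 1) * ln (norm x)) = norm x powr - g / norm x"
    using r by (simp add: powr_def left_diff_distrib exp_diff)
  have "norm x powr g * norm x powr - g = 1" using r by (simp add: powr_add[symmetric])
  then have "norm x powr g * (norm x powr - g * A) = A" for A by (simp add: mult.assoc[symmetric])
  moreover have "trial \<epsilon> x = norm x powr - g * (w (ln (norm x)) * (1 + \<epsilon> * (\<mu> (ln (norm x)) * dir i x)))"
    unfolding trial_def P_def R_def e1 e2 dir_def by (simp add: inner_axis algebra_simps)
  ultimately show ?thesis by simp
qed

lemma trial_powr:
  assumes "x \<noteq> 0"
  shows "norm x powr (r * g - d) * \<bar>trial \<epsilon> x\<bar> powr r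
    = norm x powr - d * (w (ln (norm x)) powr r * mass_factor r \<epsilon> (ln (norm x)) (dir i x))"
proof -
  have r: "norm x > 0" using assms by simp
  have "norm x powr (r * g - d) * \<bar>trial \<epsilon> x\<bar> powr r = norm x powr - d * (norm x powr (g * r) * \<bar>trial \<epsilon> x\<bar> powr r)"
    using r by (simp add: powr_diff powr_minus_divide mult.commute)
  also have "norm x powr (g * r) * \<bar>trial \<epsilon> x\<bar> powr r = (norm x powr g * \<bar>trial \<epsilon> x\<bar>) powr r"
    using r by (simp add: powr_mult powr_powr)
  also have "norm x powr g * \<bar>trial \<epsilon> x\<bar> = \<bar>norm x powr g * trial \<epsilon> x\<bar>" by (simp add: abs_mult)
  also have "\<dots> = w (ln (norm x)) * \<bar>1 + \<epsilon> * (\<mu> (ln (norm x)) * dir i x)\<bar>"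
    unfolding trial_eq[OF assms] using w_pos[of "ln (norm x)"] by (simp add: abs_mult)
  also have "\<dots> powr r = w (ln (norm x)) powr r * mass_factor r \<epsilon> (ln (norm x)) (dir i x)"
    unfolding mass_factor_def using w_pos[of "ln (norm x)"] by (simp add: powr_mult)
  finally show ?thesis .
qed

text \<open>Up to a common factor the gradient is \<open>c1 X + c2 e\<close> with the unit vectors
  \<open>X = x / |x|\<close> and \<open>e\<close> along the axis. Its radial component is
  \<open>c1 + c2 y\<close>, and the squared length of the tangential part is
  \<open>c2\<^sup>2 (1 - y\<^sup>2)\<close>.\<close>

lemma trial_grad_powr:
  assumes "x \<noteq> 0"
  shows "norm x powr (p * g + p - d) * norm (trial_grad \<epsilon> x) powr p
    = norm x powr - d * ((t (ln (norm x)) * w (ln (norm x))) powr p * energy_factor \<epsilon> (ln (norm x)) (dir i x))"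
proof -
  define r where "r = norm x"
  define s where "s = ln r"
  define y where "y = dir i x"
  have r: "r > 0" using assms by (simp add: r_def)
  have ts: "t s > 0" "w s > 0" by (rule t_pos, rule w_pos)
  define c1 where "c1 = - t s + \<epsilon> * (\<mu>' s - t s * \<mu> s - \<mu> s) * y"
  define c2 where "c2 = \<epsilon> * \<mu> s"
  define X where "X = (1 / r) *\<^sub>R x"
  have XX: "X \<bullet> X = 1" using r by (simp add: X_def power2_norm_eq_inner[symmetric] r_def[symmetric] power2_eq_square)
  have Xe: "X \<bullet> axis i 1 = y" by (simp add: X_def y_def dir_def r_def inner_axis)
  have e1: "exp (- g * s) = r powr - g" using r by (simp add: powr_def s_def)
  have e2: "exp (- (g + 1) * s) = r powr - g / r" using r by (simp add: powr_def left_diff_distrib exp_diff s_def)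
  have xe: "x \<bullet> axis i 1 = r * y" using r by (simp add: y_def dir_def r_def inner_axis)
  have "trial_grad \<epsilon> x = (r powr - g / r * w s) *\<^sub>R (c1 *\<^sub>R X + c2 *\<^sub>R axis i 1)"
  proof -
    have "(P' s + R' \<epsilon> s * (r * y)) / r\<^sup>2 = r powr - g / r * w s * c1 * (1 / r)"
      unfolding P'_def R'_def e1 e2 c1_def using r by (simp add: field_simps power2_eq_square)
    moreover have "R \<epsilon> s = r powr - g / r * w s * c2" unfolding R_def e2 c2_def by simp
    ultimately show ?thesis
      unfolding trial_grad_def r_def[symmetric] s_def[symmetric] xe by (simp add: X_def scaleR_add_right)
  qed
  then have "norm (trial_grad \<epsilon> x) = r powr - g / r * w s * norm (c1 *\<^sub>R X + c2 *\<^sub>R axis i 1)"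
    using r ts by simp
  moreover have "norm (c1 *\<^sub>R X + c2 *\<^sub>R axis i (1::real)) = t s * sqrt ((1 + \<epsilon> * (ar s * y))\<^sup>2 + \<epsilon>\<^sup>2 * ((br s)\<^sup>2 * (1 - y\<^sup>2)))"
  proof -
    have ee: "axis i (1::real) \<bullet> axis i 1 = 1" by (simp add: inner_axis)
    have "(norm (c1 *\<^sub>R X + c2 *\<^sub>R axis i (1::real)))\<^sup>2 = c1\<^sup>2 * (X \<bullet> X) + 2 * c1 * c2 * (X \<bullet> axis i 1) + c2\<^sup>2 * (axis i (1::real) \<bullet> axis i 1)"
      unfolding power2_norm_eq_inner by (simp add: inner_add_left inner_add_right inner_commute power2_eq_square algebra_simps)
    also have "\<dots> = (c1 + c2 * y)\<^sup>2 + c2\<^sup>2 * (1 - y\<^sup>2)"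
      unfolding XX Xe ee by (simp add: power2_eq_square algebra_simps)
    also have "c1 + c2 * y = - (t s * (1 + \<epsilon> * (ar s * y)))"
      using ts by (simp add: c1_def c2_def ar_def field_simps)
    also have "c2\<^sup>2 = (t s)\<^sup>2 * (\<epsilon>\<^sup>2 * (br s)\<^sup>2)"
      using ts by (simp add: c2_def br_def power_mult_distrib power_divide)
    also have "(- (t s * (1 + \<epsilon> * (ar s * y))))\<^sup>2 + (t s)\<^sup>2 * (\<epsilon>\<^sup>2 * (br s)\<^sup>2) * (1 - y\<^sup>2)
      = (t s)\<^sup>2 * ((1 + \<epsilon> * (ar s * y))\<^sup>2 + \<epsilon>\<^sup>2 * ((br s)\<^sup>2 * (1 - y\<^sup>2)))"
      by (simp only: power2_minus power_mult_distrib) (simp only: distrib_left mult.assoc)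
    finally have "norm (c1 *\<^sub>R X + c2 *\<^sub>R axis i (1::real)) = sqrt ((t s)\<^sup>2 * ((1 + \<epsilon> * (ar s * y))\<^sup>2 + \<epsilon>\<^sup>2 * ((br s)\<^sup>2 * (1 - y\<^sup>2))))"
      by (metis norm_ge_zero real_sqrt_unique)
    then show ?thesis using ts by (simp add: real_sqrt_mult)
  qed
  ultimately have n: "norm (trial_grad \<epsilon> x) = r powr (- g - 1) * (t s * w s) * sqrt ((1 + \<epsilon> * (ar s * y))\<^sup>2 + \<epsilon>\<^sup>2 * ((br s)\<^sup>2 * (1 - y\<^sup>2)))"
    using r by (simp add: powr_diff)
  have y1: "y\<^sup>2 \<le> 1" using abs_dir_le[of i x] by (simp add: y_def abs_square_le_1)
  have Z: "(1 + \<epsilon> * (ar s * y))\<^sup>2 + \<epsilon>\<^sup>2 * ((br s)\<^sup>2 * (1 - y\<^sup>2)) \<ge> 0" using y1 by simp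
  have "norm (trial_grad \<epsilon> x) powr p = r powr ((- g - 1) * p) * (t s * w s) powr p * energy_factor \<epsilon> s y"
    unfolding n energy_factor_def using r ts Z
    by (simp add: powr_mult powr_powr powr_half_sqrt[symmetric])
  moreover have "r powr (p * g + p - d) * r powr ((- g - 1) * p) = r powr - d"
    by (simp add: powr_add[symmetric] algebra_simps)
  ultimately show ?thesis unfolding r_def[symmetric] s_def[symmetric] y_def[symmetric]
    by (simp add: mult.assoc[symmetric])
qed

lemma factor_measurable:
  "(\<lambda>x::real^'n. mass_factor r \<epsilon> (ln (norm x)) (dir i x)) \<in> borel_measurable borel"
  "(\<lambda>x::real^'n. energy_factor \<epsilon> (ln (norm x)) (dir i x)) \<in> borel_measurable borel"
proof -
  have [measurable]: "\<mu> \<in> borel_measurable borel" "ar \<in> borel_measurable borel" "br \<in> borel_measurable borel"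
    by (intro borel_measurable_continuous_onI \<mu>_cont ar_cont br_cont)+
  show "(\<lambda>x::real^'n. mass_factor r \<epsilon> (ln (norm x)) (dir i x)) \<in> borel_measurable borel"
    "(\<lambda>x::real^'n. energy_factor \<epsilon> (ln (norm x)) (dir i x)) \<in> borel_measurable borel"
    unfolding mass_factor_def energy_factor_def by measurable
qed

lemma factor_bounded:
  assumes "r > 0"
  shows "\<exists>B. \<forall>s y. \<bar>y\<bar> \<le> 1 \<longrightarrow> \<bar>mass_factor r \<epsilon> s y\<bar> \<le> B \<and> \<bar>energy_factor \<epsilon> s y\<bar> \<le> B"
proof -
  obtain M where M: "M \<ge> 0" "\<And>s. \<bar>ar s\<bar> \<le> M" "\<And>s. \<bar>br s\<bar> \<le> M" "\<And>s. \<bar>\<mu> s\<bar> \<le> M"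
    by (rule coefficients_bounded) blast
  define B1 where "B1 = (1 + \<bar>\<epsilon>\<bar> * M) powr r"
  define B2 where "B2 = ((1 + \<bar>\<epsilon>\<bar> * M)\<^sup>2 + \<epsilon>\<^sup>2 * M\<^sup>2) powr (p / 2)"
  have lin: "\<bar>1 + \<epsilon> * (c * y)\<bar> \<le> 1 + \<bar>\<epsilon>\<bar> * M" if "\<bar>c\<bar> \<le> M" "\<bar>y\<bar> \<le> 1" for c y
  proof -
    have "\<bar>c * y\<bar> \<le> M" using mult_mono[OF that] M by (simp add: abs_mult)
    then have "\<bar>\<epsilon> * (c * y)\<bar> \<le> \<bar>\<epsilon>\<bar> * M" unfolding abs_mult[of \<epsilon>] by (intro mult_left_mono) auto
    then show ?thesis by linarith
  qed
  have "\<bar>mass_factor r \<epsilon> s y\<bar> \<le> B1 \<and> \<bar>energy_factor \<epsilon> s y\<bar> \<le> B2" if y: "\<bar>y\<bar> \<le> 1" for s y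
  proof
    show "\<bar>mass_factor r \<epsilon> s y\<bar> \<le> B1"
      unfolding mass_factor_def B1_def using lin[OF M(4) y] assms by (simp add: powr_mono2)
    have y2: "0 \<le> 1 - y\<^sup>2" "1 - y\<^sup>2 \<le> 1" using y by (auto simp: abs_square_le_1)
    have "(1 + \<epsilon> * (ar s * y))\<^sup>2 \<le> (1 + \<bar>\<epsilon>\<bar> * M)\<^sup>2"
      using lin[OF M(2) y] by (metis abs_ge_zero power2_abs power_mono)
    moreover have "(br s)\<^sup>2 * (1 - y\<^sup>2) \<le> M\<^sup>2 * 1"
    proof (intro mult_mono y2)
      show "(br s)\<^sup>2 \<le> M\<^sup>2" using M(1) M(3)[of s] by (simp add: abs_le_square_iff[symmetric])
    qed simp
    then have "\<epsilon>\<^sup>2 * ((br s)\<^sup>2 * (1 - y\<^sup>2)) \<le> \<epsilon>\<^sup>2 * M\<^sup>2" by (intro mult_left_mono) auto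
    ultimately have "(1 + \<epsilon> * (ar s * y))\<^sup>2 + \<epsilon>\<^sup>2 * ((br s)\<^sup>2 * (1 - y\<^sup>2)) \<le> (1 + \<bar>\<epsilon>\<bar> * M)\<^sup>2 + \<epsilon>\<^sup>2 * M\<^sup>2" by linarith
    moreover have "0 \<le> (1 + \<epsilon> * (ar s * y))\<^sup>2 + \<epsilon>\<^sup>2 * ((br s)\<^sup>2 * (1 - y\<^sup>2))" using y2 by simp
    ultimately show "\<bar>energy_factor \<epsilon> s y\<bar> \<le> B2"
      unfolding energy_factor_def B2_def using p by (simp add: powr_mono2)
  qed
  then have "\<bar>mass_factor r \<epsilon> s y\<bar> \<le> max B1 B2 \<and> \<bar>energy_factor \<epsilon> s y\<bar> \<le> max B1 B2" if "\<bar>y\<bar> \<le> 1" for s y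
    using that by (meson max.coboundedI1 max.coboundedI2)
  then show ?thesis by blast
qed

lemma integrable_tw: "integrable lborel (\<lambda>s. (t s * w s) powr p)"
proof -
  have "(\<lambda>s. (t s * w s) powr p) = (\<lambda>s. w s powr p * t s powr p)"
    using t_pos w_pos by (auto simp: powr_mult fun_eq_iff less_imp_le)
  then show ?thesis using p t_powr_bounded
    by (simp only:) (intro integrable_w_powr_mult[where B = "T powr p"] continuous_t_powr; simp)
qed

lemma continuous_tw: "continuous_on A (\<lambda>s. (t s * w s) powr p)"
proof -
  have "t s * w s \<noteq> 0" for s using t_pos[of s] w_pos[of s] by simp
  then show ?thesis by (intro continuous_intros continuous_t continuous_w) blast
qed

lemma trial_integrable:
  shows "r > 0 \<Longrightarrow> integrable cyl_measure (\<lambda>x::real^'n. w (ln (norm x)) powr r * mass_factor r \<epsilon> (ln (norm x)) (dir i x))"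
    and "integrable cyl_measure (\<lambda>x::real^'n. (t (ln (norm x)) * w (ln (norm x))) powr p * energy_factor \<epsilon> (ln (norm x)) (dir i x))"
proof -
  show "integrable cyl_measure (\<lambda>x::real^'n. w (ln (norm x)) powr r * mass_factor r \<epsilon> (ln (norm x)) (dir i x))" if r: "r > 0"
  proof -
    obtain B where B: "\<And>s y. \<bar>y\<bar> \<le> 1 \<Longrightarrow> \<bar>mass_factor r \<epsilon> s y\<bar> \<le> B" using factor_bounded[OF r] by blast
    show ?thesis
      by (rule integrable_cyl_dir[where F = "\<lambda>s. w s powr r", OF _ integrable_w_powr[OF r] factor_measurable(1) B[OF abs_dir_le]])
        (rule borel_measurable_continuous_onI[OF continuous_w_powr])
  qed
  obtain B where B: "\<And>s y. \<bar>y\<bar> \<le> 1 \<Longrightarrow> \<bar>energy_factor \<epsilon> s y\<bar> \<le> B"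
    using factor_bounded[OF zero_less_one, of \<epsilon>] by blast
  show "integrable cyl_measure (\<lambda>x::real^'n. (t (ln (norm x)) * w (ln (norm x))) powr p * energy_factor \<epsilon> (ln (norm x)) (dir i x))"
    by (rule integrable_cyl_dir[where F = "\<lambda>s. (t s * w s) powr p", OF _ integrable_tw factor_measurable(2) B[OF abs_dir_le]])
      (rule borel_measurable_continuous_onI[OF continuous_tw])
qed

definition cyl_energy where
  "cyl_energy \<epsilon> = (LINT x|(cyl_measure :: (real^'n) measure). (t (ln (norm x)) * w (ln (norm x))) powr p * energy_factor \<epsilon> (ln (norm x)) (dir i x))"
definition cyl_mass where
  "cyl_mass \<epsilon> = (LINT x|(cyl_measure :: (real^'n) measure). w (ln (norm x)) powr q * mass_factor q \<epsilon> (ln (norm x)) (dir i x))"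

text \<open>Averaging over spheres: the linear term in the direction cosine drops out, and its
  square becomes \<open>1 / n\<close>.\<close>

lemma quadratic_integral:
  fixes F c0 c1 c2 :: "real \<Rightarrow> real" and M :: real
  assumes F: "continuous_on UNIV F" "integrable lborel F"
    and c: "continuous_on UNIV c1" "continuous_on UNIV c2" "continuous_on UNIV c0"
    and bd: "\<And>s. \<bar>c0 s\<bar> \<le> M" "\<And>s. \<bar>c1 s\<bar> \<le> M" "\<And>s. \<bar>c2 s\<bar> \<le> M"
  shows "integrable cyl_measure (\<lambda>x::real^'n. F (ln (norm x)) * (c0 (ln (norm x)) + c1 (ln (norm x)) * dir i x + c2 (ln (norm x)) * (dir i x)\<^sup>2))"
    and "(LINT x|(cyl_measure :: (real^'n) measure). F (ln (norm x)) * (c0 (ln (norm x)) + c1 (ln (norm x)) * dir i x + c2 (ln (norm x)) * (dir i x)\<^sup>2))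
      = (LINT s|lborel. F s * c0 s) + (LINT s|lborel. F s * c2 s) / real CARD('n)"
    and "integrable lborel (\<lambda>s. F s * c0 s)" "integrable lborel (\<lambda>s. F s * c2 s)"
proof -
  interpret line_fibration "cyl_measure :: (real^'n) measure" "\<lambda>x. ln (norm x)" by (rule line_fibration_cyl)
  have i: "integrable lborel (\<lambda>s. F s * c s)" if "continuous_on UNIV c" "\<And>s. \<bar>c s\<bar> \<le> M" for c
  proof (rule Bochner_Integration.integrable_bound[OF integrable_mult_left[OF F(2), of M]])
    show "(\<lambda>s. F s * c s) \<in> borel_measurable lborel"
      using borel_measurable_continuous_onI[OF continuous_on_mult[OF F(1) that(1)]] by simp
    show "AE s in lborel. norm (F s * c s) \<le> norm (F s * M)"
    proof (intro always_eventually allI)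
      fix s
      have "\<bar>c s\<bar> \<le> \<bar>M\<bar>" using that(2)[of s] by linarith
      then show "norm (F s * c s) \<le> norm (F s * M)" by (simp add: abs_mult mult_left_mono)
    qed
  qed
  have m: "(\<lambda>s. F s * c s) \<in> borel_measurable borel" if "continuous_on UNIV c" for c
    by (rule borel_measurable_continuous_onI[OF continuous_on_mult[OF F(1) that]])
  note i0 = i[OF c(3) bd(1)] and i1 = i[OF c(1) bd(2)] and i2 = i[OF c(2) bd(3)]
  show "integrable lborel (\<lambda>s. F s * c0 s)" "integrable lborel (\<lambda>s. F s * c2 s)" by (rule i0, rule i2)
  have d2: "\<bar>(dir i x)\<^sup>2\<bar> \<le> 1" for x using abs_dir_le[of i x] by (simp add: abs_square_le_1)
  have j0: "integrable cyl_measure (\<lambda>x::real^'n. F (ln (norm x)) * c0 (ln (norm x)))"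
    using i0 by (subst integrable_fibration[OF m[OF c(3)]])
  have j1: "integrable cyl_measure (\<lambda>x::real^'n. F (ln (norm x)) * c1 (ln (norm x)) * dir i x)"
    by (rule integrable_cyl_dir[OF m[OF c(1)] i1 dir_measurable abs_dir_le])
  have j2: "integrable cyl_measure (\<lambda>x::real^'n. F (ln (norm x)) * c2 (ln (norm x)) * (dir i x)\<^sup>2)"
    by (rule integrable_cyl_dir[OF m[OF c(2)] i2 _ d2]) measurable
  have eq: "F (ln (norm x)) * (c0 (ln (norm x)) + c1 (ln (norm x)) * dir i x + c2 (ln (norm x)) * (dir i x)\<^sup>2)
    = F (ln (norm x)) * c0 (ln (norm x)) + F (ln (norm x)) * c1 (ln (norm x)) * dir i x + F (ln (norm x)) * c2 (ln (norm x)) * (dir i x)\<^sup>2"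
    for x :: "real^'n" by (simp add: distrib_left mult.assoc)
  show "integrable cyl_measure (\<lambda>x::real^'n. F (ln (norm x)) * (c0 (ln (norm x)) + c1 (ln (norm x)) * dir i x + c2 (ln (norm x)) * (dir i x)\<^sup>2))"
    unfolding eq by (intro Bochner_Integration.integrable_add j0 j1 j2)
  show "(LINT x|(cyl_measure :: (real^'n) measure). F (ln (norm x)) * (c0 (ln (norm x)) + c1 (ln (norm x)) * dir i x + c2 (ln (norm x)) * (dir i x)\<^sup>2))
      = (LINT s|lborel. F s * c0 s) + (LINT s|lborel. F s * c2 s) / real CARD('n)"
    unfolding eq using j0 j1 j2 integral_fibration[OF m[OF c(3)]]
      integral_cyl_dir[OF m[OF c(1)], of i] integral_cyl_dir_square[OF m[OF c(2)] i2, of i]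
    by simp
qed

text \<open>The constant term is \<open>Q0\<close> by \<open>energy_eq\<close>, and the first order
  disappears on averaging. In second order \<open>1 - y\<^sup>2\<close> averages to
  \<open>(n - 1) / n\<close>, the source of the weight \<open>n - 1\<close>.\<close>

lemma energy_upper:
  defines "A \<equiv> (p / (2 * real CARD('n))) * (LINT s|lborel. (t s * w s) powr p * ((p - 1) * (ar s)\<^sup>2 + (real CARD('n) - 1) * (br s)\<^sup>2))"
  shows "\<exists>C\<ge>0. \<exists>e0>0. \<forall>\<epsilon>. 0 \<le> \<epsilon> \<longrightarrow> \<epsilon> \<le> e0 \<longrightarrow> cyl_energy \<epsilon> \<le> Q0 + \<epsilon>\<^sup>2 * A + C * \<epsilon> ^ 3"
proof -
  let ?n = "real CARD('n)"
  let ?F = "\<lambda>s. (t s * w s) powr p"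
  obtain M where M: "M \<ge> 0" "\<And>s. \<bar>ar s\<bar> \<le> M" "\<And>s. \<bar>br s\<bar> \<le> M" "\<And>s. \<bar>\<mu> s\<bar> \<le> M"
    by (rule coefficients_bounded) blast
  obtain C where C: "C \<ge> 0" "\<And>a b y \<epsilon>. \<bar>a\<bar> \<le> M \<Longrightarrow> \<bar>b\<bar> \<le> M \<Longrightarrow> \<bar>y\<bar> \<le> 1 \<Longrightarrow> 0 \<le> \<epsilon> \<Longrightarrow> 8 * (M + 1)\<^sup>2 * \<epsilon> \<le> 1 \<Longrightarrow>
    ((1 + \<epsilon> * (a * y))\<^sup>2 + \<epsilon>\<^sup>2 * (b\<^sup>2 * (1 - y\<^sup>2))) powr (p / 2)
    \<le> 1 + p * \<epsilon> * (a * y) + \<epsilon>\<^sup>2 * (p / 2) * ((p - 1) * (a\<^sup>2 * y\<^sup>2) + b\<^sup>2 * (1 - y\<^sup>2)) + C * \<epsilon> ^ 3"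
    using energy_density_expansion[OF M(1), of p] by blast
  have sq: "(ar s)\<^sup>2 \<le> M\<^sup>2" "(br s)\<^sup>2 \<le> M\<^sup>2" for s
    using M(1) M(2)[of s] M(3)[of s] by (simp_all add: abs_le_square_iff[symmetric])
  have "cyl_energy \<epsilon> \<le> Q0 + \<epsilon>\<^sup>2 * A + (C * Q0) * \<epsilon> ^ 3" if \<epsilon>: "0 \<le> \<epsilon>" "\<epsilon> \<le> 1 / (8 * (M + 1)\<^sup>2)" for \<epsilon>
  proof -
    have \<epsilon>': "8 * (M + 1)\<^sup>2 * \<epsilon> \<le> 1" using \<epsilon> M(1) by (simp add: field_simps)
    \<comment> \<open>Coefficients of the powers of the direction cosine. Expanding
      \<open>1 - y\<^sup>2\<close> splits the angular term between \<open>c0\<close> and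
      \<open>c2\<close>; the cubic remainder is put into \<open>c0\<close>.\<close>
    define c0 where "c0 s = 1 + \<epsilon>\<^sup>2 * (p / 2) * (br s)\<^sup>2 + C * \<epsilon> ^ 3" for s
    define c1 where "c1 s = p * \<epsilon> * ar s" for s
    define c2 where "c2 s = \<epsilon>\<^sup>2 * (p / 2) * ((p - 1) * (ar s)\<^sup>2 - (br s)\<^sup>2)" for s
    define B where "B = 1 + \<epsilon>\<^sup>2 * (p / 2) * M\<^sup>2 + C * \<epsilon> ^ 3 + p * \<epsilon> * M + \<epsilon>\<^sup>2 * (p / 2) * ((p - 1) * M\<^sup>2 + M\<^sup>2)"
    have cc: "continuous_on UNIV c0" "continuous_on UNIV c1" "continuous_on UNIV c2"
      unfolding c0_def c1_def c2_def by (intro continuous_intros ar_cont br_cont)+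
    have parts: "\<bar>c0 s\<bar> \<le> 1 + \<epsilon>\<^sup>2 * (p / 2) * M\<^sup>2 + C * \<epsilon> ^ 3" "\<bar>c1 s\<bar> \<le> p * \<epsilon> * M" "\<bar>c2 s\<bar> \<le> \<epsilon>\<^sup>2 * (p / 2) * ((p - 1) * M\<^sup>2 + M\<^sup>2)" for s
    proof -
      have "c0 s \<ge> 0" using C(1) \<epsilon>(1) p by (simp add: c0_def)
      moreover have "\<epsilon>\<^sup>2 * (p / 2) * (br s)\<^sup>2 \<le> \<epsilon>\<^sup>2 * (p / 2) * M\<^sup>2" using sq(2) p by (intro mult_left_mono) auto
      ultimately show "\<bar>c0 s\<bar> \<le> 1 + \<epsilon>\<^sup>2 * (p / 2) * M\<^sup>2 + C * \<epsilon> ^ 3" by (simp add: c0_def)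
      show "\<bar>c1 s\<bar> \<le> p * \<epsilon> * M" using M(2) \<epsilon>(1) p by (simp add: c1_def abs_mult mult_left_mono)
      have "\<bar>(p - 1) * (ar s)\<^sup>2 - (br s)\<^sup>2\<bar> \<le> \<bar>(p - 1) * (ar s)\<^sup>2\<bar> + \<bar>(br s)\<^sup>2\<bar>" by (rule abs_triangle_ineq4)
      also have "\<dots> = (p - 1) * (ar s)\<^sup>2 + (br s)\<^sup>2" using p by (simp add: abs_mult)
      also have "\<dots> \<le> (p - 1) * M\<^sup>2 + M\<^sup>2" using sq p by (intro add_mono mult_left_mono) auto
      finally show "\<bar>c2 s\<bar> \<le> \<epsilon>\<^sup>2 * (p / 2) * ((p - 1) * M\<^sup>2 + M\<^sup>2)"
        unfolding c2_def abs_mult using p by (auto intro!: mult_left_mono)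
    qed
    have nn: "0 \<le> \<epsilon>\<^sup>2 * (p / 2) * M\<^sup>2" "0 \<le> C * \<epsilon> ^ 3" "0 \<le> p * \<epsilon> * M" "0 \<le> \<epsilon>\<^sup>2 * (p / 2) * ((p - 1) * M\<^sup>2 + M\<^sup>2)"
      using C(1) \<epsilon>(1) p M(1) by auto
    have bd: "\<bar>c0 s\<bar> \<le> B" "\<bar>c1 s\<bar> \<le> B" "\<bar>c2 s\<bar> \<le> B" for s
      using parts[of s] nn unfolding B_def by linarith+
    note QI = quadratic_integral[OF continuous_tw integrable_tw cc(2,3,1) bd]
    have "cyl_energy \<epsilon> \<le> (LINT x|(cyl_measure :: (real^'n) measure). ?F (ln (norm x)) * (c0 (ln (norm x)) + c1 (ln (norm x)) * dir i x + c2 (ln (norm x)) * (dir i x)\<^sup>2))"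
      unfolding cyl_energy_def
    proof (rule integral_mono[OF trial_integrable(2) QI(1)])
      fix x :: "real^'n"
      have "energy_factor \<epsilon> (ln (norm x)) (dir i x) \<le> c0 (ln (norm x)) + c1 (ln (norm x)) * dir i x + c2 (ln (norm x)) * (dir i x)\<^sup>2"
        using C(2)[OF M(2)[of "ln (norm x)"] M(3)[of "ln (norm x)"] abs_dir_le[of i x] \<epsilon>(1) \<epsilon>']
        unfolding energy_factor_def c0_def c1_def c2_def by (simp add: algebra_simps)
      then show "?F (ln (norm x)) * energy_factor \<epsilon> (ln (norm x)) (dir i x)
        \<le> ?F (ln (norm x)) * (c0 (ln (norm x)) + c1 (ln (norm x)) * dir i x + c2 (ln (norm x)) * (dir i x)\<^sup>2)"
        by (rule mult_left_mono) simp
    qed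
    also have "\<dots> = (LINT s|lborel. ?F s * c0 s) + (LINT s|lborel. ?F s * c2 s) / ?n" by (rule QI(2))
    also have "\<dots> = Q0 + \<epsilon>\<^sup>2 * A + (C * Q0) * \<epsilon> ^ 3"
    proof -
      have sqb: "\<bar>(ar s)\<^sup>2\<bar> \<le> M\<^sup>2" "\<bar>(br s)\<^sup>2\<bar> \<le> M\<^sup>2" for s using sq by auto
      have cs: "continuous_on UNIV (\<lambda>s. (ar s)\<^sup>2)" "continuous_on UNIV (\<lambda>s. (br s)\<^sup>2)"
        by (intro continuous_intros ar_cont br_cont)+
      note ab = quadratic_integral(3,4)[OF continuous_tw integrable_tw cs(1) cs(2) cs(1) sqb(1) sqb(1) sqb(2)]
      define Ia where "Ia = (LINT s|lborel. ?F s * (ar s)\<^sup>2)"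
      define Ib where "Ib = (LINT s|lborel. ?F s * (br s)\<^sup>2)"
      have 0: "(LINT s|lborel. ?F s * c0 s) = (1 + C * \<epsilon> ^ 3) * Q0 + \<epsilon>\<^sup>2 * (p / 2) * Ib"
      proof -
        have "(LINT s|lborel. ?F s * c0 s) = (LINT s|lborel. (1 + C * \<epsilon> ^ 3) * ?F s + \<epsilon>\<^sup>2 * (p / 2) * (?F s * (br s)\<^sup>2))"
          by (intro Bochner_Integration.integral_cong) (auto simp: c0_def algebra_simps)
        also have "\<dots> = (1 + C * \<epsilon> ^ 3) * (LINT s|lborel. ?F s) + \<epsilon>\<^sup>2 * (p / 2) * Ib"
          unfolding Ib_def by (subst Bochner_Integration.integral_add) (auto intro!: integrable_mult_right integrable_tw ab)
        finally show ?thesis by (simp only: energy_eq)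
      qed
      have 2: "(LINT s|lborel. ?F s * c2 s) = \<epsilon>\<^sup>2 * (p / 2) * ((p - 1) * Ia - Ib)"
      proof -
        have "(LINT s|lborel. ?F s * c2 s) = (LINT s|lborel. \<epsilon>\<^sup>2 * (p / 2) * ((p - 1) * (?F s * (ar s)\<^sup>2) - ?F s * (br s)\<^sup>2))"
          by (intro Bochner_Integration.integral_cong) (auto simp: c2_def algebra_simps)
        also have "\<dots> = \<epsilon>\<^sup>2 * (p / 2) * (LINT s|lborel. (p - 1) * (?F s * (ar s)\<^sup>2) - ?F s * (br s)\<^sup>2)" by simp
        also have "(LINT s|lborel. (p - 1) * (?F s * (ar s)\<^sup>2) - ?F s * (br s)\<^sup>2) = (p - 1) * Ia - Ib"
          unfolding Ia_def Ib_def by (subst Bochner_Integration.integral_diff) (auto intro!: integrable_mult_right ab)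
        finally show ?thesis .
      qed
      have "(LINT s|lborel. ?F s * ((p - 1) * (ar s)\<^sup>2 + (?n - 1) * (br s)\<^sup>2)) = (p - 1) * Ia + (?n - 1) * Ib"
      proof -
        have "(LINT s|lborel. ?F s * ((p - 1) * (ar s)\<^sup>2 + (?n - 1) * (br s)\<^sup>2)) = (LINT s|lborel. (p - 1) * (?F s * (ar s)\<^sup>2) + (?n - 1) * (?F s * (br s)\<^sup>2))"
          by (intro Bochner_Integration.integral_cong) (auto simp: algebra_simps)
        also have "\<dots> = (p - 1) * Ia + (?n - 1) * Ib"
          unfolding Ia_def Ib_def by (subst Bochner_Integration.integral_add) (auto intro!: integrable_mult_right ab)
        finally show ?thesis .
      qed
      then have A: "A = (p / (2 * ?n)) * ((p - 1) * Ia + (?n - 1) * Ib)" by (simp only: A_def)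
      have n: "?n > 0" by simp
      show ?thesis unfolding 0 2 A using n by (simp add: field_simps)
    qed
    finally show ?thesis .
  qed
  moreover have "1 / (8 * (M + 1)\<^sup>2) > 0" using M(1) by simp
  moreover have "C * Q0 \<ge> 0" using C(1) Q0_pos by simp
  ultimately show ?thesis by blast
qed

text \<open>The same averaging for the mass; the square of the direction cosine contributes the
  factor \<open>1 / n\<close> in \<open>Bm\<close>.\<close>

lemma mass_lower:
  defines "Bm \<equiv> (q * (q - 1) / (2 * real CARD('n))) * (LINT s|lborel. w s powr q * (\<mu> s)\<^sup>2)"
  shows "\<exists>C\<ge>0. \<exists>e0>0. \<forall>\<epsilon>. 0 \<le> \<epsilon> \<longrightarrow> \<epsilon> \<le> e0 \<longrightarrow> Q0 + \<epsilon>\<^sup>2 * Bm - C * \<epsilon> ^ 3 \<le> cyl_mass \<epsilon>"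
proof -
  let ?n = "real CARD('n)"
  let ?F = "\<lambda>s. w s powr q"
  have q: "q > 0" using p pq by simp
  obtain M where M: "M \<ge> 0" "\<And>s. \<bar>ar s\<bar> \<le> M" "\<And>s. \<bar>br s\<bar> \<le> M" "\<And>s. \<bar>\<mu> s\<bar> \<le> M"
    by (rule coefficients_bounded) blast
  obtain C where C: "C \<ge> 0" "\<And>d y \<epsilon>. \<bar>d\<bar> \<le> M \<Longrightarrow> \<bar>y\<bar> \<le> 1 \<Longrightarrow> 0 \<le> \<epsilon> \<Longrightarrow> 2 * M * \<epsilon> \<le> 1 \<Longrightarrow>
    1 + q * \<epsilon> * (d * y) + \<epsilon>\<^sup>2 * (q * (q - 1) / 2) * (d\<^sup>2 * y\<^sup>2) - C * \<epsilon> ^ 3 \<le> \<bar>1 + \<epsilon> * (d * y)\<bar> powr q"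
    using mass_density_expansion[OF M(1), of q] by blast
  have sq: "\<bar>(\<mu> s)\<^sup>2\<bar> \<le> M\<^sup>2" for s
    using M(1) M(4)[of s] by (simp add: abs_le_square_iff[symmetric])
  have "Q0 + \<epsilon>\<^sup>2 * Bm - (C * Q0) * \<epsilon> ^ 3 \<le> cyl_mass \<epsilon>" if \<epsilon>: "0 \<le> \<epsilon>" "\<epsilon> \<le> 1 / (2 * (M + 1))" for \<epsilon>
  proof -
    have "2 * (M + 1) * \<epsilon> \<le> 1" using \<epsilon> M(1) by (simp add: field_simps)
    moreover have "2 * M * \<epsilon> \<le> 2 * (M + 1) * \<epsilon>" using \<epsilon> by (intro mult_right_mono) auto
    ultimately have \<epsilon>': "2 * M * \<epsilon> \<le> 1" by linarith
    define c0 where "c0 s = 1 - C * \<epsilon> ^ 3" for s :: real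
    define c1 where "c1 s = q * \<epsilon> * \<mu> s" for s
    define c2 where "c2 s = \<epsilon>\<^sup>2 * (q * (q - 1) / 2) * (\<mu> s)\<^sup>2" for s
    define K where "K = 1 + C * \<epsilon> ^ 3 + q * \<epsilon> * M + \<epsilon>\<^sup>2 * (q * (q - 1) / 2) * M\<^sup>2"
    have cc: "continuous_on UNIV c0" "continuous_on UNIV c1" "continuous_on UNIV c2"
      unfolding c0_def c1_def c2_def by (intro continuous_intros \<mu>_cont)+
    have nn: "0 \<le> C * \<epsilon> ^ 3" "0 \<le> q * \<epsilon> * M" "0 \<le> \<epsilon>\<^sup>2 * (q * (q - 1) / 2) * M\<^sup>2"
      using C(1) \<epsilon>(1) p pq M(1) by auto
    have parts: "\<bar>c0 s\<bar> \<le> 1 + C * \<epsilon> ^ 3" "\<bar>c1 s\<bar> \<le> q * \<epsilon> * M" "\<bar>c2 s\<bar> \<le> \<epsilon>\<^sup>2 * (q * (q - 1) / 2) * M\<^sup>2" for s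
    proof -
      show "\<bar>c0 s\<bar> \<le> 1 + C * \<epsilon> ^ 3" using nn(1) by (simp add: c0_def)
      show "\<bar>c1 s\<bar> \<le> q * \<epsilon> * M" using M(4) \<epsilon>(1) q by (simp add: c1_def abs_mult mult_left_mono)
      have "0 \<le> \<epsilon>\<^sup>2 * (q * (q - 1) / 2)" using p pq by simp
      then show "\<bar>c2 s\<bar> \<le> \<epsilon>\<^sup>2 * (q * (q - 1) / 2) * M\<^sup>2"
        unfolding c2_def abs_mult[of "\<epsilon>\<^sup>2 * (q * (q - 1) / 2)"] using sq by (simp only: abs_of_nonneg) (rule mult_left_mono)
    qed
    have bd: "\<bar>c0 s\<bar> \<le> K" "\<bar>c1 s\<bar> \<le> K" "\<bar>c2 s\<bar> \<le> K" for s
      using parts[of s] nn unfolding K_def by linarith+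
    note QI = quadratic_integral[OF continuous_w_powr integrable_w_powr[OF q] cc(2,3,1) bd]
    have "Q0 + \<epsilon>\<^sup>2 * Bm - (C * Q0) * \<epsilon> ^ 3 = (LINT s|lborel. ?F s * c0 s) + (LINT s|lborel. ?F s * c2 s) / ?n"
    proof -
      have 0: "(LINT s|lborel. ?F s * c0 s) = Q0 * (1 - C * \<epsilon> ^ 3)" by (simp add: c0_def Q0_def)
      have "(LINT s|lborel. ?F s * c2 s) = (LINT s|lborel. \<epsilon>\<^sup>2 * (q * (q - 1) / 2) * (?F s * (\<mu> s)\<^sup>2))"
        by (intro Bochner_Integration.integral_cong) (auto simp: c2_def)
      then have 2: "(LINT s|lborel. ?F s * c2 s) = \<epsilon>\<^sup>2 * (q * (q - 1) / 2) * (LINT s|lborel. ?F s * (\<mu> s)\<^sup>2)" by simp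
      show ?thesis unfolding 0 2 Bm_def by (simp add: field_simps)
    qed
    also have "\<dots> = (LINT x|(cyl_measure :: (real^'n) measure). ?F (ln (norm x)) * (c0 (ln (norm x)) + c1 (ln (norm x)) * dir i x + c2 (ln (norm x)) * (dir i x)\<^sup>2))"
      by (rule QI(2)[symmetric])
    also have "\<dots> \<le> cyl_mass \<epsilon>"
      unfolding cyl_mass_def
    proof (rule integral_mono[OF QI(1) trial_integrable(1)[OF q]])
      fix x :: "real^'n"
      have "c0 (ln (norm x)) + c1 (ln (norm x)) * dir i x + c2 (ln (norm x)) * (dir i x)\<^sup>2 \<le> mass_factor q \<epsilon> (ln (norm x)) (dir i x)"
        using C(2)[OF M(4)[of "ln (norm x)"] abs_dir_le[of i x] \<epsilon>(1) \<epsilon>']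
        unfolding mass_factor_def c0_def c1_def c2_def by (simp add: algebra_simps)
      then show "?F (ln (norm x)) * (c0 (ln (norm x)) + c1 (ln (norm x)) * dir i x + c2 (ln (norm x)) * (dir i x)\<^sup>2)
        \<le> ?F (ln (norm x)) * mass_factor q \<epsilon> (ln (norm x)) (dir i x)"
        by (rule mult_left_mono) simp
    qed
    finally show ?thesis .
  qed
  moreover have "1 / (2 * (M + 1)) > 0" using M(1) by simp
  moreover have "C * Q0 \<ge> 0" using C(1) Q0_pos by simp
  ultimately show ?thesis by blast
qed

text \<open>Multiplied by \<open>p / (2 n)\<close>, the negativity of the second variation is the
  condition \<open>A < (p / q) B\<close> of \<open>quotient_decreases\<close>; \<epsilon> is taken
  small enough for both expansions.\<close>

lemma exists_better_trial:
  assumes unstable: "(LINT s|lborel. (t s * w s) powr p * ((p - 1) * (\<mu> s - \<mu>' s / t s)\<^sup>2 + (real CARD('n) - 1) * (\<mu> s / t s)\<^sup>2))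
      < (q - 1) * (LINT s|lborel. w s powr q * (\<mu> s)\<^sup>2)"
  obtains \<epsilon> where "0 < cyl_mass \<epsilon>" "cyl_energy \<epsilon> < Q0 powr (1 - p / q) * cyl_mass \<epsilon> powr (p / q)"
proof -
  define IA where "IA = (LINT s|lborel. (t s * w s) powr p * ((p - 1) * (ar s)\<^sup>2 + (real CARD('n) - 1) * (br s)\<^sup>2))"
  define IB where "IB = (LINT s|lborel. w s powr q * (\<mu> s)\<^sup>2)"
  define A where "A = (p / (2 * real CARD('n))) * IA"
  define B where "B = (q * (q - 1) / (2 * real CARD('n))) * IB"
  have AB: "A < (p / q) * B"
  proof -
    have "IA < (q - 1) * IB" using unstable by (simp add: IA_def IB_def ar_def br_def)
    then have "(p / (2 * real CARD('n))) * IA < (p / (2 * real CARD('n))) * ((q - 1) * IB)"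
      using p by (intro mult_strict_left_mono) auto
    moreover have "(p / q) * B = (p / (2 * real CARD('n))) * ((q - 1) * IB)"
      unfolding B_def using p pq by simp
    ultimately show ?thesis unfolding A_def by simp
  qed
  obtain C1 e1 where E: "C1 \<ge> 0" "e1 > 0" "\<And>\<epsilon>. 0 \<le> \<epsilon> \<Longrightarrow> \<epsilon> \<le> e1 \<Longrightarrow> cyl_energy \<epsilon> \<le> Q0 + \<epsilon>\<^sup>2 * A + C1 * \<epsilon> ^ 3"
    using energy_upper unfolding A_def IA_def by blast
  obtain C2 e2 where M: "C2 \<ge> 0" "e2 > 0" "\<And>\<epsilon>. 0 \<le> \<epsilon> \<Longrightarrow> \<epsilon> \<le> e2 \<Longrightarrow> Q0 + \<epsilon>\<^sup>2 * B - C2 * \<epsilon> ^ 3 \<le> cyl_mass \<epsilon>"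
    using mass_lower unfolding B_def IB_def by blast
  have "\<forall>\<^sub>F \<epsilon> in at_right 0. 0 < Q0 + \<epsilon>\<^sup>2 * B - C2 * \<epsilon> ^ 3 \<and>
    Q0 + \<epsilon>\<^sup>2 * A + C1 * \<epsilon> ^ 3 < Q0 powr (1 - p / q) * (Q0 + \<epsilon>\<^sup>2 * B - C2 * \<epsilon> ^ 3) powr (p / q)"
    using p pq by (intro quotient_decreases[OF Q0_pos AB _ E(1) M(1)]) auto
  moreover have "\<forall>\<^sub>F \<epsilon> in at_right 0. 0 < \<epsilon> \<and> \<epsilon> < min e1 e2"
    using eventually_at_right_real[of 0 "min e1 e2"] E(2) M(2) by (auto elim: eventually_mono)
  ultimately have "\<forall>\<^sub>F \<epsilon> in at_right 0. 0 < cyl_mass \<epsilon> \<and> cyl_energy \<epsilon> < Q0 powr (1 - p / q) * cyl_mass \<epsilon> powr (p / q)"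
  proof eventually_elim
    case (elim \<epsilon>)
    have m: "Q0 + \<epsilon>\<^sup>2 * B - C2 * \<epsilon> ^ 3 \<le> cyl_mass \<epsilon>" using elim by (intro M(3)) auto
    have "cyl_energy \<epsilon> \<le> Q0 + \<epsilon>\<^sup>2 * A + C1 * \<epsilon> ^ 3" using elim by (intro E(3)) auto
    also have "\<dots> < Q0 powr (1 - p / q) * (Q0 + \<epsilon>\<^sup>2 * B - C2 * \<epsilon> ^ 3) powr (p / q)" using elim by simp
    also have "\<dots> \<le> Q0 powr (1 - p / q) * cyl_mass \<epsilon> powr (p / q)"
      using m elim p pq by (intro mult_left_mono powr_mono2) auto
    finally show ?case using m elim by auto
  qed
  then obtain \<epsilon> where "0 < cyl_mass \<epsilon> \<and> cyl_energy \<epsilon> < Q0 powr (1 - p / q) * cyl_mass \<epsilon> powr (p / q)"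
    using eventually_happens'[OF trivial_limit_at_right_real] by blast
  then show ?thesis using that by blast
qed

end

section \<open>Transfer to weighted integrals on the space, and the contradiction\<close>

lemma has_weak_gradient_weak_gradient:
  "has_weak_gradient u V \<Longrightarrow> has_weak_gradient u (weak_gradient u)"
  unfolding weak_gradient_def by (rule someI[where P = "has_weak_gradient u"])

lemma weak_gradient_AE_eq:
  assumes "has_weak_gradient u V"
  shows "AE x in lebesgue. weak_gradient u x = V x"
  using has_weak_gradient_weak_gradient[OF assms] assms by (rule weak_gradient_unique)

text \<open>The exponents add up to 1, so the area of the sphere scales both sides of the comparison
  alike.\<close>

lemma powr_homogeneous:
  fixes c x y r :: real
  assumes "c > 0" "x \<ge> 0" "y \<ge> 0"
  shows "(c * x) powr (1 - r) * (c * y) powr r = c * (x powr (1 - r) * y powr r)"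
proof -
  have "(c * x) powr (1 - r) * (c * y) powr r = (c powr (1 - r) * c powr r) * (x powr (1 - r) * y powr r)"
    using assms by (simp add: powr_mult)
  also have "c powr (1 - r) * c powr r = c" using assms(1) by (simp add: powr_add[symmetric])
  finally show ?thesis .
qed

text \<open>The factor \<open>sphere_const\<close> undoes the normalization of
  \<open>cyl_measure\<close>; identities off a null set are enough.\<close>

lemma integral_cyl_transfer:
  fixes F :: "real^'n::finite \<Rightarrow> real"
  assumes G: "integrable cyl_measure G" and Fm: "F \<in> borel_measurable lebesgue"
    and eq: "AE x in lebesgue. F x = norm x powr - real CARD('n) * G x"
  shows "integrable lebesgue F" "(LINT x|lebesgue. F x) = sphere_const TYPE(real^'n) * (LINT x|cyl_measure. G x)"
proof -
  have Gm: "G \<in> borel_measurable lebesgue" using G borel_measurable_cyl_iff by blast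
  then have i: "integrable lebesgue (\<lambda>x. norm x powr - real CARD('n) * G x)"
    using G integrable_cyl_measure_iff[OF Gm] by simp
  then show "integrable lebesgue F" using eq Fm
    by (subst integrable_cong_AE[of F _ "\<lambda>x. norm x powr - real CARD('n) * G x"]) auto
  have "(LINT x|lebesgue. F x) = (LINT x|lebesgue. norm x powr - real CARD('n) * G x)"
    using i eq Fm by (intro integral_cong_AE) auto
  then show "(LINT x|lebesgue. F x) = sphere_const TYPE(real^'n) * (LINT x|cyl_measure. G x)"
    using integral_cyl_measure[OF Gm] by simp
qed

lemma loc_integrable_off_0_measurable_vec:
  fixes V :: "real^'n::finite \<Rightarrow> real^'n"
  assumes "loc_integrable_off_0 V"
  shows "V \<in> borel_measurable lebesgue"
proof (rule borel_measurable_euclidean_space[THEN iffD2], rule ballI)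
  fix b :: "real^'n" assume "b \<in> Basis"
  then obtain k where b: "b = axis k 1" by (auto simp: Basis_vec_def)
  show "(\<lambda>x. V x \<bullet> b) \<in> borel_measurable lebesgue"
    using loc_integrable_off_0_measurable[OF loc_integrable_off_0_component[OF assms, of k]]
    by (simp add: b inner_axis)
qed

context perturbation
begin

lemma trial_measurable: "trial \<epsilon> \<in> borel_measurable lebesgue"
  using has_weak_gradient_trial[of \<epsilon>] by (auto simp: has_weak_gradient_def intro: loc_integrable_off_0_measurable)

text \<open>The relation for \<open>a\<close> is the definition of \<open>g\<close> solved for
  \<open>a\<close>. With it, the powers of \<open>|x|\<close> contributed by the trial function
  reduce each of the three weights to \<open>|x| powr (- n)\<close>.\<close>

lemma trial_properties:
  fixes a :: real
  assumes a: "a = p * g + p - real CARD('n)"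
  shows "trial \<epsilon> \<in> D1p p a"
    and "grad_energy p a (trial \<epsilon>) = sphere_const TYPE(real^'n) * cyl_energy \<epsilon>"
    and "q_integral p a q (trial \<epsilon>) = sphere_const TYPE(real^'n) * cyl_mass \<epsilon>"
proof -
  let ?n = "real CARD('n)"
  have q: "q > 0" using p pq by simp
  note um[measurable] = trial_measurable[of \<epsilon>]
  have wg: "has_weak_gradient (trial \<epsilon>) (weak_gradient (trial \<epsilon>))"
    using has_weak_gradient_trial by (rule has_weak_gradient_weak_gradient)
  have wm[measurable]: "weak_gradient (trial \<epsilon>) \<in> borel_measurable lebesgue"
    using wg by (auto simp: has_weak_gradient_def intro: loc_integrable_off_0_measurable_vec)
  have 1: "AE x in lebesgue. norm x powr (a - p) * \<bar>trial \<epsilon> x\<bar> powr p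
    = norm x powr - ?n * (w (ln (norm x)) powr p * mass_factor p \<epsilon> (ln (norm x)) (dir i x))"
    using AE_lebesgue_neq_0
  proof eventually_elim
    case (elim x)
    have "a - p = p * g - ?n" by (simp add: a)
    then show ?case using trial_powr[OF elim, of p ?n \<epsilon>] by simp
  qed
  have b: "- b_exponent ?n p a q = q * g - ?n"
    using p by (simp add: b_exponent_def a field_simps)
  have 2: "AE x in lebesgue. norm x powr - b_exponent ?n p a q * \<bar>trial \<epsilon> x\<bar> powr q
    = norm x powr - ?n * (w (ln (norm x)) powr q * mass_factor q \<epsilon> (ln (norm x)) (dir i x))"
    using AE_lebesgue_neq_0
  proof eventually_elim
    case (elim x)
    show ?case using trial_powr[OF elim, of q ?n \<epsilon>] by (simp only: b)
  qed
  have 3: "AE x in lebesgue. norm x powr a * norm (weak_gradient (trial \<epsilon>) x) powr p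
    = norm x powr - ?n * ((t (ln (norm x)) * w (ln (norm x))) powr p * energy_factor \<epsilon> (ln (norm x)) (dir i x))"
    using AE_lebesgue_neq_0 weak_gradient_AE_eq[OF has_weak_gradient_trial[of \<epsilon>]]
  proof eventually_elim
    case (elim x)
    show ?case using trial_grad_powr[OF elim(1), of ?n \<epsilon>] by (simp only: elim(2) a)
  qed
  note T1 = integral_cyl_transfer[OF trial_integrable(1)[of p \<epsilon>] _ 1]
  note T2 = integral_cyl_transfer[OF trial_integrable(1)[OF q, of \<epsilon>] _ 2]
  note T3 = integral_cyl_transfer[OF trial_integrable(2)[of \<epsilon>] _ 3]
  have i1: "integrable lebesgue (\<lambda>x. norm x powr (a - p) * \<bar>trial \<epsilon> x\<bar> powr p)"
    by (rule T1(1)) (use p in \<open>auto intro!: borel_measurable_times\<close>)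
  have m3: "(\<lambda>x. norm x powr a * norm (weak_gradient (trial \<epsilon>) x) powr p) \<in> borel_measurable lebesgue"
    by measurable
  show "trial \<epsilon> \<in> D1p p a"
    unfolding D1p_def using um i1 has_weak_gradient_trial T3(1)[OF m3] by blast
  show "grad_energy p a (trial \<epsilon>) = sphere_const TYPE(real^'n) * cyl_energy \<epsilon>"
    unfolding grad_energy_def cyl_energy_def by (rule T3(2)[OF m3])
  show "q_integral p a q (trial \<epsilon>) = sphere_const TYPE(real^'n) * cyl_mass \<epsilon>"
    unfolding q_integral_def cyl_mass_def by (rule T2(2)) (auto intro!: borel_measurable_times)
qed

end

context bliss_profile
begin

text \<open>With \<open>\<gamma> = g\<close> one has
  \<open>K - g W = |x| powr g * (v \<bullet> x)\<close> almost everywhere, so Cauchy-Schwarz bounds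
  the one-dimensional energy by the full one. Positivity of the mass comes from continuity of
  \<open>W\<close>, which cannot vanish identically.\<close>

lemma radial_lower_bound:
  fixes u :: "real^'n::finite \<Rightarrow> real" and a :: real
  assumes u: "u \<in> D1p p a" and rad: "radial u" and nz: "\<not> ae_zero u"
    and a: "a = p * g + p - real CARD('n)"
  defines "c \<equiv> sphere_const TYPE(real^'n)"
  shows "0 < q_integral p a q u"
    and "(c * Q0) powr (1 - p / q) * q_integral p a q u powr (p / q) \<le> grad_energy p a u"
proof -
  let ?n = "real CARD('n)"
  have c: "c > 0" unfolding c_def by (rule sphere_const_pos)
  define v where "v = weak_gradient u"
  have uv: "has_weak_gradient u v"
    using u unfolding v_def D1p_def by (blast intro: has_weak_gradient_weak_gradient)
  interpret rf: radial_function u v g by unfold_locales (rule uv, rule rad)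
  have um[measurable]: "u \<in> borel_measurable lebesgue" using u by (simp add: D1p_def)
  have vm[measurable]: "v \<in> borel_measurable lebesgue"
    using uv by (auto simp: has_weak_gradient_def intro: loc_integrable_off_0_measurable_vec)
  have cWm: "rf.W \<in> borel_measurable borel"
    using fibre_primitive.W_cont[OF rf.fibre_primitive_Y[of rf.C]]
    by (intro borel_measurable_continuous_onI) (simp add: rf.W_def[abs_def])
  have Wm[measurable]: "(\<lambda>x::real^'n. rf.W (ln (norm x))) \<in> borel_measurable lebesgue"
    using measurable_compose[OF cyl_weight_measurable(2) cWm] .
  have pow: "norm x powr (r * g - d) * \<bar>u x\<bar> powr r = norm x powr - d * \<bar>rf.cu x\<bar> powr r" if "x \<noteq> 0" for x r d
  proof -
    have "\<bar>rf.cu x\<bar> powr r = norm x powr (g * r) * \<bar>u x\<bar> powr r"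
      by (simp add: rf.cu_def abs_mult powr_mult powr_powr)
    then show ?thesis using that by (simp add: powr_diff powr_minus_divide mult.commute)
  qed
  have e1: "AE x in lebesgue. norm x powr (a - p) * \<bar>u x\<bar> powr p = norm x powr - ?n * \<bar>rf.W (ln (norm x))\<bar> powr p"
    using rf.AE_eq_W AE_lebesgue_neq_0
  proof eventually_elim
    case (elim x)
    have "a - p = p * g - ?n" by (simp add: a)
    then show ?case using pow[OF elim(2), of p ?n] elim(1) by simp
  qed
  have "integrable lebesgue (\<lambda>x::real^'n. norm x powr - ?n * \<bar>rf.W (ln (norm x))\<bar> powr p)"
  proof (rule integrable_cong_AE_imp[OF _ _ e1])
    show "integrable lebesgue (\<lambda>x. norm x powr (a - p) * \<bar>u x\<bar> powr p)" using u by (simp add: D1p_def)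
  qed measurable
  then have "integrable cyl_measure (\<lambda>x::real^'n. \<bar>rf.W (ln (norm x))\<bar> powr p)"
    by (subst integrable_cyl_measure_iff) auto
  then have Wp: "integrable lborel (\<lambda>s. \<bar>rf.W s\<bar> powr p)"
    using cWm by (subst (asm) rf.integrable_fibration[of "\<lambda>s. \<bar>rf.W s\<bar> powr p"]) auto
  have KW: "AE x in lebesgue. norm x powr - ?n * \<bar>rf.K x - g * rf.W (ln (norm x))\<bar> powr p \<le> norm x powr a * norm (v x) powr p"
    using rf.AE_eq_W AE_lebesgue_neq_0
  proof eventually_elim
    case (elim x)
    have r: "norm x > 0" using elim by simp
    have "rf.K x - g * rf.W (ln (norm x)) = norm x powr g * (v x \<bullet> x)"
      unfolding elim(1)[symmetric] rf.K_def rf.cu_def by (simp add: algebra_simps)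
    then have "\<bar>rf.K x - g * rf.W (ln (norm x))\<bar> = norm x powr g * \<bar>v x \<bullet> x\<bar>" by (simp add: abs_mult)
    also have "\<dots> \<le> norm x powr g * (norm (v x) * norm x)"
      by (intro mult_left_mono Cauchy_Schwarz_ineq2) auto
    finally have "\<bar>rf.K x - g * rf.W (ln (norm x))\<bar> powr p \<le> (norm x powr g * (norm (v x) * norm x)) powr p"
      using p by (intro powr_mono2) auto
    also have "\<dots> = norm x powr (g * p) * (norm (v x) powr p * norm x powr p)"
      by (simp add: powr_mult powr_powr)
    finally have "norm x powr - ?n * \<bar>rf.K x - g * rf.W (ln (norm x))\<bar> powr p
      \<le> norm x powr - ?n * (norm x powr (g * p) * (norm (v x) powr p * norm x powr p))"
      by (rule mult_left_mono) simp
    also have "\<dots> = norm x powr a * norm (v x) powr p"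
      using r by (simp add: a powr_add powr_diff powr_minus_divide mult_ac)
    finally show ?case .
  qed
  have Km[measurable]: "rf.K \<in> borel_measurable lebesgue" by (rule rf.K_measurable')
  have iE: "integrable lebesgue (\<lambda>x. norm x powr a * norm (v x) powr p)" using u by (simp add: D1p_def v_def)
  have iKW': "integrable lebesgue (\<lambda>x. norm x powr - ?n * \<bar>rf.K x - g * rf.W (ln (norm x))\<bar> powr p)"
    by (rule Bochner_Integration.integrable_bound[OF iE])
      (use KW in \<open>auto elim: eventually_mono\<close>)
  have KWm: "(\<lambda>x. \<bar>rf.K x - g * rf.W (ln (norm x))\<bar> powr p) \<in> borel_measurable lebesgue" by measurable
  have iKW: "integrable cyl_measure (\<lambda>x. \<bar>rf.K x - g * rf.W (ln (norm x))\<bar> powr p)"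
    using iKW' integrable_cyl_measure_iff[OF KWm] by simp
  interpret fp: fibre_primitive "cyl_measure :: (real^'n) measure" "\<lambda>x. ln (norm x)" rf.K rf.W
    using rf.fibre_primitive_Y[of rf.C] by (simp add: rf.W_def[abs_def])
  interpret bs: bliss_setting p q g "cyl_measure :: (real^'n) measure" "\<lambda>x. ln (norm x)" rf.K rf.W
    by unfold_locales (rule Wp, rule iKW)
  have E: "c * bs.EW \<le> grad_energy p a u"
  proof -
    have "c * bs.EW = (LINT x|lebesgue. norm x powr - ?n * \<bar>rf.K x - g * rf.W (ln (norm x))\<bar> powr p)"
      unfolding c_def bs.EW_def using integral_cyl_measure[OF KWm] by simp
    also have "\<dots> \<le> (LINT x|lebesgue. norm x powr a * norm (v x) powr p)"
      by (rule integral_mono_AE[OF iKW' iE KW])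
    finally show ?thesis by (simp add: grad_energy_def v_def)
  qed
  have b: "- b_exponent ?n p a q = q * g - ?n"
    using p by (simp add: b_exponent_def a field_simps)
  have e2: "AE x in lebesgue. norm x powr - b_exponent ?n p a q * \<bar>u x\<bar> powr q = norm x powr - ?n * \<bar>rf.W (ln (norm x))\<bar> powr q"
    using rf.AE_eq_W AE_lebesgue_neq_0
  proof eventually_elim
    case (elim x)
    show ?case using pow[OF elim(2), of q ?n] elim(1) by (simp only: b)
  qed
  have WqM: "integrable cyl_measure (\<lambda>x::real^'n. \<bar>rf.W (ln (norm x))\<bar> powr q)"
    using bs.W_q cWm by (subst rf.integrable_fibration[of "\<lambda>s. \<bar>rf.W s\<bar> powr q"]) auto
  have Q: "q_integral p a q u = c * bs.QW"
  proof -
    have "q_integral p a q u = c * (LINT x|(cyl_measure :: (real^'n) measure). \<bar>rf.W (ln (norm x))\<bar> powr q)"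
      unfolding q_integral_def c_def by (rule integral_cyl_transfer(2)[OF WqM _ e2]) measurable
    also have "(LINT x|(cyl_measure :: (real^'n) measure). \<bar>rf.W (ln (norm x))\<bar> powr q) = bs.QW"
      unfolding bs.QW_def using cWm by (intro rf.integral_fibration) auto
    finally show ?thesis .
  qed
  have QW: "bs.QW > 0"
  proof -
    have "\<exists>s. rf.W s \<noteq> 0"
    proof (rule ccontr)
      assume "\<nexists>s. rf.W s \<noteq> 0"
      then have W0: "rf.W s = 0" for s by blast
      have "AE x in lebesgue. u x = 0"
        using rf.AE_eq_W AE_lebesgue_neq_0 by eventually_elim (use W0 in \<open>auto simp: rf.cu_def\<close>)
      then show False using nz by (simp add: ae_zero_def)
    qed
    then obtain s where s: "rf.W s \<noteq> 0" by blast
    have "continuous_on UNIV (\<lambda>s. \<bar>rf.W s\<bar> powr q)"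
      using p pq by (intro continuous_on_compose2[OF continuous_abs_powr fp.W_cont]) auto
    then show ?thesis unfolding bs.QW_def
      by (rule integral_pos_continuous[OF _ bs.W_q, of s]) (use s in auto)
  qed
  show "0 < q_integral p a q u" using c QW by (simp add: Q)
  have "(c * Q0) powr (1 - p / q) * (c * bs.QW) powr (p / q) = c * (Q0 powr (1 - p / q) * bs.QW powr (p / q))"
    using c QW Q0_pos by (intro powr_homogeneous) auto
  also have "\<dots> \<le> c * bs.EW" using bs.bliss_inequality c by (intro mult_left_mono) auto
  also have "\<dots> \<le> grad_energy p a u" by (rule E)
  finally show "(c * Q0) powr (1 - p / q) * q_integral p a q u powr (p / q) \<le> grad_energy p a u" by (simp only: Q)
qed

end

lemma CKN_const_le:
  fixes u :: "real^'n::finite \<Rightarrow> real"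
  assumes "u \<in> D1p p a" "\<not> ae_zero u"
  shows "CKN_const TYPE('n) p a q \<le> grad_energy p a u / q_integral p a q u powr (p / q)"
  unfolding CKN_const_def
proof (rule cINF_lower)
  show "bdd_below ((\<lambda>u::real^'n \<Rightarrow> real. grad_energy p a u / q_integral p a q u powr (p / q)) ` {u. u \<in> D1p p a \<and> \<not> ae_zero u})"
    by (rule bdd_belowI2[of _ 0]) (auto simp: grad_energy_def intro!: divide_nonneg_nonneg integral_nonneg_AE)
qed (use assms in auto)

theorem theorem1p1:
  fixes p q a p' :: real
  assumes "CARD('n::finite) \<ge> 2"
    and "1 < p" and "p < q" and "ereal q < critical_exponent (real CARD('n)) p"
    and "a > p - real CARD('n)"
    and "p' = p / (p - 1)"
    and "1 / (real CARD('n) - 1) * ((real CARD('n) - p + a) / p)\<^sup>2 > 1 / (q - p) - 1 / (q + p')"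
  shows "\<not> (\<exists>u :: real ^ 'n \<Rightarrow> real. CKN_minimizer p a q u \<and> radial u)"
proof
  assume "\<exists>u :: real ^ 'n \<Rightarrow> real. CKN_minimizer p a q u \<and> radial u"
  then obtain u :: "real^'n \<Rightarrow> real" where u: "u \<in> D1p p a" "\<not> ae_zero u" "radial u"
    and min: "grad_energy p a u = CKN_const TYPE('n) p a q * q_integral p a q u powr (p / q)"
    by (auto simp: CKN_minimizer_def)
  let ?n = "real CARD('n)"
  define g where "g = (?n - p + a) / p"
  have g: "g > 0" using assms by (simp add: g_def)
  have a: "a = p * g + p - ?n" using assms by (simp add: g_def)
  interpret bliss_profile p q g by unfold_locales (use assms g in auto)
  have N: "?n - 1 < threshold"
  proof -
    have n1: "?n - 1 > 0" using assms(1) by simp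
    have "p' > 0" using assms by simp
    then have qp: "q - p > 0" "q + p' > 0" using assms(2,3) by linarith+
    \<comment> \<open>The right side of the hypothesis over a common denominator. The relation
      \<open>(p - 1) (p + p') = p\<^sup>2\<close> of conjugate exponents then turns it into the
      bound by \<open>threshold\<close>.\<close>
    have "1 / (q - p) - 1 / (q + p') = (p + p') / ((q - p) * (q + p'))"
      using qp by (simp add: field_simps)
    then have "(p + p') / ((q - p) * (q + p')) < g\<^sup>2 / (?n - 1)"
      using assms(7) by (simp add: g_def)
    then have "(?n - 1) * (p + p') < g\<^sup>2 * ((q - p) * (q + p'))"
      using n1 qp by (simp add: divide_simps mult_ac)
    moreover have "g\<^sup>2 * ((q - p) * (q + p')) = (p + p') * threshold"
    proof -
      have p1: "p - 1 > 0" using assms by simp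
      have 1: "q - p = p * k" using p by (simp add: k_def)
      have 2: "(p - 1) * (q + p') = p * ((k + 1) * (p - 1) + 1)"
        using p1 by (simp add: assms(6) k_def field_simps)
      have 3: "(p - 1) * (p + p') = p * p" using p1 by (simp add: assms(6) field_simps)
      have "(p - 1) * (g\<^sup>2 * ((q - p) * (q + p'))) = g\<^sup>2 * ((q - p) * ((p - 1) * (q + p')))"
        by (simp only: mult_ac)
      also have "\<dots> = (p * p) * threshold" unfolding 1 2 threshold_def by (simp only: mult_ac)
      also have "\<dots> = (p - 1) * ((p + p') * threshold)" unfolding 3[symmetric] by (simp only: mult_ac)
      finally show ?thesis using p1 by simp
    qed
    ultimately have "(p + p') * (?n - 1) < (p + p') * threshold" by (simp only: mult_ac)
    moreover have "p + p' > 0" using \<open>p' > 0\<close> p by simp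
    ultimately show ?thesis by simp
  qed
  obtain \<mu> \<mu>' L where \<mu>: "\<And>s. (\<mu> has_real_derivative \<mu>' s) (at s)" "continuous_on UNIV \<mu>'"
    "\<And>s. \<bar>s\<bar> > L \<Longrightarrow> \<mu> s = 0 \<and> \<mu>' s = 0"
    and unstable: "(LINT s|lborel. (t s * w s) powr p * ((p - 1) * (\<mu> s - \<mu>' s / t s)\<^sup>2 + (?n - 1) * (\<mu> s / t s)\<^sup>2))
      < (q - 1) * (LINT s|lborel. w s powr q * (\<mu> s)\<^sup>2)"
    by (rule unstable_direction[OF N]) blast
  \<comment> \<open>Any fixed coordinate serves as the direction of the perturbation.\<close>
  define i :: 'n where "i = undefined"
  interpret pt: perturbation p q g \<mu> \<mu>' L i by unfold_locales (fact \<mu>)+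
  obtain \<epsilon> where \<epsilon>: "0 < pt.cyl_mass \<epsilon>" "pt.cyl_energy \<epsilon> < Q0 powr (1 - p / q) * pt.cyl_mass \<epsilon> powr (p / q)"
    by (rule pt.exists_better_trial[OF unstable]) blast
  define c where "c = sphere_const TYPE(real^'n)"
  have c: "c > 0" unfolding c_def by (rule sphere_const_pos)
  note trial = pt.trial_properties[OF a, of \<epsilon>, folded c_def]
  have qpos: "q_integral p a q (pt.trial \<epsilon>) > 0" unfolding trial(3) using c \<epsilon>(1) by simp
  have nz: "\<not> ae_zero (pt.trial \<epsilon>)"
  proof
    assume "ae_zero (pt.trial \<epsilon>)"
    then have "AE x in lebesgue. norm x powr - b_exponent ?n p a q * \<bar>pt.trial \<epsilon> x\<bar> powr q = 0"
      unfolding ae_zero_def by eventually_elim simp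
    then have "q_integral p a q (pt.trial \<epsilon>) = 0" unfolding q_integral_def by (rule integral_eq_zero_AE)
    then show False using qpos by simp
  qed
  have "CKN_const TYPE('n) p a q \<le> grad_energy p a (pt.trial \<epsilon>) / q_integral p a q (pt.trial \<epsilon>) powr (p / q)"
    by (rule CKN_const_le[OF trial(1) nz])
  also have "\<dots> < (c * Q0) powr (1 - p / q)"
  proof -
    have "c * pt.cyl_energy \<epsilon> < c * (Q0 powr (1 - p / q) * pt.cyl_mass \<epsilon> powr (p / q))"
      using \<epsilon>(2) c by simp
    also have "\<dots> = (c * Q0) powr (1 - p / q) * (c * pt.cyl_mass \<epsilon>) powr (p / q)"
      using c \<epsilon>(1) Q0_pos by (intro powr_homogeneous[symmetric]) auto
    finally show ?thesis using c \<epsilon>(1) unfolding trial(2,3) by (simp add: divide_less_eq)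
  qed
  finally have "CKN_const TYPE('n) p a q < (c * Q0) powr (1 - p / q)" .
  moreover note lower = radial_lower_bound[OF u(1) u(3) u(2) a, folded c_def]
  \<comment> \<open>The strict inequality survives the multiplication because the mass of
    \<open>u\<close> is positive.\<close>
  ultimately have "CKN_const TYPE('n) p a q * q_integral p a q u powr (p / q)
    < (c * Q0) powr (1 - p / q) * q_integral p a q u powr (p / q)"
    by (intro mult_strict_right_mono) auto
  also have "\<dots> \<le> grad_energy p a u" by (rule lower(2))
  finally show False using min by simp
qed

end
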